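(* Let $n\ge1$ be an integer, $Q=2n+2$, $q^*=\frac{Q+2}{Q-2}$, and let $1<q<q^*$. There is a constant $C>0$ depending only on $n$ and $q$ such that every positive smooth solution $u$ of $$-\triangle_{\mathbb{H}^n}u=2n^2u^{q}\quad\text{in }B_1(0)\setminus\{0\}$$ satisfies $$u(\xi)\le C|\xi|^{-\frac{2}{q-1}}\quad\text{for }\xi\text{ near }0,$$ i.e. for all $\xi\neq0$ in some neighbourhood of $0$.
   Context: The Heisenberg group $\mathbb{H}^n$ is the set $\mathbb{C}^n\times\mathbb{R}$ with coordinates $(z,t)$, $z=(z^1,\dots,z^n)$. Put $Z_\alpha=\frac{\partial}{\partial z^\alpha}+\sqrt{-1}\,\overline{z}^{\alpha}\frac{\partial}{\partial t}$ for $\alpha=1,\dots,n$, and $Z_{\overline{\alpha}}=\overline{Z_\alpha}=\frac{\partial}{\partial\overline{z}^\alpha}-\sqrt{-1}\,z^{\alpha}\frac{\partial}{\partial t}$. The Heisenberg Laplacian of a smooth real function $u$ is $\triangle_{\mathbb{H}^n}u=\sum_{\alpha=1}^n\big(u_{\alpha\overline{\alpha}}+u_{\overline{\alpha}\alpha}\big)=\sum_{\alpha=1}^n\big(Z_{\overline{\alpha}}Z_\alpha u+Z_\alpha Z_{\overline{\alpha}}u\big)$. The number $Q=2n+2$ is the homogeneous dimension of $\mathbb{H}^n$. For $\xi=(z,t)$, $|\xi|=(|z|^4+t^2)^{1/4}$ is the homogeneous norm, where $|z|^2=\sum_\alpha|z^\alpha|^2$, and $B_1(0)=\{\xi\in\mathbb{H}^n:|\xi|<1\}$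 is the unit ball. *)

theory Defs
  imports "HOL-Analysis.Analysis"
begin

text \<open>
  Smoothness, intended for open sets: \<open>Ck_on k f S\<close> says that all iterated directional
  derivatives of \<open>f\<close> up to order \<open>k\<close> exist and are continuous on \<open>S\<close>. The derivatives are
  taken in the full space, so on an open \<open>S\<close> the values of \<open>f\<close> outside \<open>S\<close> are irrelevant.
\<close>

fun Ck_on ::
  "nat \<Rightarrow> ('a::euclidean_space \<Rightarrow> 'b::real_normed_vector) \<Rightarrow> 'a set \<Rightarrow> bool" where
  "Ck_on 0 f S \<longleftrightarrow> continuous_on S f"
| "Ck_on (Suc k) f S \<longleftrightarrow>
     (\<forall>x\<in>S. f differentiable (at x)) \<and>
     (\<forall>v. Ck_on k (\<lambda>x. frechet_derivative f (at x) v) S)"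

definition smooth_on ::
  "('a::euclidean_space \<Rightarrow> 'b::real_normed_vector) \<Rightarrow> 'a set \<Rightarrow> bool" where
  "smooth_on f S \<longleftrightarrow> (\<forall>k. Ck_on k f S)"

type_synonym 'n heis = "(complex ^ 'n) \<times> real"

definition heis_norm :: "'n::finite heis \<Rightarrow> real" where
  "heis_norm \<xi> = ((\<Sum>\<alpha>\<in>UNIV. (cmod (fst \<xi> $ \<alpha>))\<^sup>2)\<^sup>2 + (snd \<xi>)\<^sup>2) powr (1/4)"

definition heis_unit_ball :: "'n::finite heis set" where
  "heis_unit_ball = {\<xi>. heis_norm \<xi> < 1}"

text \<open>
  Coordinate derivatives, with \<open>z\<^sup>\<alpha> = x\<^sup>\<alpha> + \<i> y\<^sup>\<alpha>\<close>; \<open>dz\<close> and \<open>dzbar\<close> are the Wirtinger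
  derivatives in \<open>z\<^sup>\<alpha>\<close>.
\<close>

definition dx :: "'n::finite \<Rightarrow> ('n heis \<Rightarrow> complex) \<Rightarrow> 'n heis \<Rightarrow> complex" where
  "dx \<alpha> f \<xi> = frechet_derivative f (at \<xi>) (axis \<alpha> 1, 0)"

definition dy :: "'n::finite \<Rightarrow> ('n heis \<Rightarrow> complex) \<Rightarrow> 'n heis \<Rightarrow> complex" where
  "dy \<alpha> f \<xi> = frechet_derivative f (at \<xi>) (axis \<alpha> \<i>, 0)"

definition dt :: "('n::finite heis \<Rightarrow> complex) \<Rightarrow> 'n heis \<Rightarrow> complex" where
  "dt f \<xi> = frechet_derivative f (at \<xi>) (0, 1)"

definition dz :: "'n::finite \<Rightarrow> ('n heis \<Rightarrow> complex) \<Rightarrow> 'n heis \<Rightarrow> complex" where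
  "dz \<alpha> f \<xi> = (dx \<alpha> f \<xi> - \<i> * dy \<alpha> f \<xi>) / 2"

definition dzbar :: "'n::finite \<Rightarrow> ('n heis \<Rightarrow> complex) \<Rightarrow> 'n heis \<Rightarrow> complex" where
  "dzbar \<alpha> f \<xi> = (dx \<alpha> f \<xi> + \<i> * dy \<alpha> f \<xi>) / 2"

definition Z :: "'n::finite \<Rightarrow> ('n heis \<Rightarrow> complex) \<Rightarrow> 'n heis \<Rightarrow> complex" where
  "Z \<alpha> f \<xi> = dz \<alpha> f \<xi> + \<i> * cnj (fst \<xi> $ \<alpha>) * dt f \<xi>"

definition Zbar :: "'n::finite \<Rightarrow> ('n heis \<Rightarrow> complex) \<Rightarrow> 'n heis \<Rightarrow> complex" where
  "Zbar \<alpha> f \<xi> = dzbar \<alpha> f \<xi> - \<i> * (fst \<xi> $ \<alpha>) * dt f \<xi>"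

text \<open>Complex-valued, since the intermediate functions \<open>Z \<alpha> u\<close> are complex even for real \<open>u\<close>.\<close>

definition heis_laplacian :: "('n::finite heis \<Rightarrow> real) \<Rightarrow> 'n heis \<Rightarrow> complex" where
  "heis_laplacian u \<xi> =
     (\<Sum>\<alpha>\<in>UNIV. Zbar \<alpha> (Z \<alpha> (\<lambda>\<eta>. complex_of_real (u \<eta>))) \<xi>
              + Z \<alpha> (Zbar \<alpha> (\<lambda>\<eta>. complex_of_real (u \<eta>))) \<xi>)"

end

theory Submission
  imports Defs
begin

text \<open>
  With \<open>f = ln u / n\<close> the equation becomes a trace condition on the Hessian of \<open>f\<close>, whose
  trace-free parts \<open>D\<close>, \<open>E\<close> and \<open>G\<close> are the tensors of Jerison and Lee. A suitable combination \<open>V\<close>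
  of them has, in the subcritical range, a divergence that is a sum of nonnegative terms. Adding
  multiples of two further divergences controls \<open>u powr (3 (q - 1))\<close> against a cutoff, and integration
  gives \<open>\<integral> \<eta>\<^sup>s u powr (3q - 1 - 2/n) \<le> C R powr (Q - \<tau>)\<close> with \<open>\<tau> > Q\<close> on balls of radius \<open>R\<close>.

  If \<open>u(\<xi>) |\<xi>| powr (2/(q-1))\<close> were too large, then rescaling \<open>u\<close> around a maximum point of
  \<open>(|\<xi>|/2 - |\<eta>|) powr (2/(q-1)) * u(\<xi> \<circ> \<eta>)\<close> would give a solution on a ball of large radius \<open>R\<close>
  which is bounded near the origin and has a prescribed value there. By a mean value inequality it
  has a definite mass near the origin, which the integral estimate forbids once \<open>R\<close> is large.
\<close>

section \<open>Smooth functions\<close>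

text \<open>For \<open>p = 0\<close> the divergence of \<open>V\<close> is a sum of terms that all
  vanish on the Jerison-Lee extremals, so nothing in it can dominate a power of \<open>A\<close>,
  \<open>w\<close> or \<open>h\<close>. For \<open>p < 0\<close> it contains in addition positive
  multiples of \<open>w * A^2\<close> and \<open>w^2 * A\<close>, and on these the estimate rests.
  The obstacle is the cutoff: its gradient, of size \<open>\<kappa>\<close>, produces
  \<open>\<kappa>^2\<close> times \<open>A^2\<close>, \<open>w^2\<close> and \<open>h^2\<close>. The
  field \<open>A^2 * a\<close>, added to \<open>V\<close> with a small factor, supplies
  \<open>A^3\<close>; the imaginary part of the divergence of \<open>h * a\<close> supplies
  \<open>h^2\<close>; and the field \<open>w^2 * a\<close> trades \<open>w^2 * A\<close> for
  \<open>w^3\<close>. All inequalities are homogeneous when \<open>A\<close>, \<open>w\<close> and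
  \<open>h\<close> count as inverse squared lengths, so the only possible remainder is
  \<open>\<kappa>^6\<close>. The bounds on \<open>q\<close> enter as \<open>-2 < p < 0\<close>. The
  radius of the blow-up ball is fixed in advance from \<open>n\<close> and \<open>q\<close>, so a
  single rescaled solution gives the contradiction and the constant depends on nothing else.\<close>

definition ddir :: "'a \<Rightarrow> ('a::euclidean_space \<Rightarrow> 'b::real_normed_vector) \<Rightarrow> 'a \<Rightarrow> 'b" where
  "ddir v f x = frechet_derivative f (at x) v"

lemma ddir_eqI: "(f has_derivative f') (at x) \<Longrightarrow> ddir v f x = f' v"
  unfolding ddir_def using frechet_derivative_at by metis

lemma has_derivative_ddir: "f differentiable (at x) \<Longrightarrow> (f has_derivative (\<lambda>v. ddir v f x)) (at x)"
  unfolding ddir_def using frechet_derivative_works by auto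

lemma ddir_const [simp]: "ddir v (\<lambda>x. c) x = 0"
  by (simp add: ddir_def)

lemma ddir_transform:
  assumes "f differentiable (at x)" "open S" "x \<in> S" "\<And>y. y \<in> S \<Longrightarrow> f y = g y"
  shows "ddir v g x = ddir v f x"
  unfolding ddir_def using frechet_derivative_transform_within_open[OF assms] by simp

lemma differentiable_transform_open:
  assumes "f differentiable (at x)" "open S" "x \<in> S" "\<And>y. y \<in> S \<Longrightarrow> f y = g y"
  shows "g differentiable (at x)"
  using assms has_derivative_transform_within_open unfolding differentiable_def by blast

text \<open>On an open set the two functions have the same germ at the point, hence the same
  derivatives; points without any derivative are covered too.\<close>

lemma ddir_cong:
  assumes "open S" "x \<in> S" "\<And>y. y \<in> S \<Longrightarrow> f y = g y"
  shows "ddir v f x = ddir v g x"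
proof (cases "f differentiable (at x)")
  case True
  then show ?thesis using ddir_transform[OF True assms] by simp
next
  case False
  then have "\<not> g differentiable (at x)"
    using differentiable_transform_open[of g x S f] assms by metis
  \<comment> \<open>\<open>frechet_derivative\<close> is a choice among all derivatives; if there
    are none, both sides choose from the same empty predicate.\<close>
  then have "\<And>D. \<not> (f has_derivative D) (at x)" "\<And>D. \<not> (g has_derivative D) (at x)"
    using False unfolding differentiable_def by auto
  then show ?thesis unfolding ddir_def frechet_derivative_def by simp
qed

lemma ddir_add:
  assumes "f differentiable (at x)" "g differentiable (at x)"
  shows "ddir v (\<lambda>y. f y + g y) x = ddir v f x + ddir v g x"
  by (rule ddir_eqI) (intro has_derivative_add has_derivative_ddir assms)

lemma ddir_mult:
  fixes f g :: "'a::euclidean_space \<Rightarrow> 'b::real_normed_algebra"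
  assumes "f differentiable (at x)" "g differentiable (at x)"
  shows "ddir v (\<lambda>y. f y * g y) x = f x * ddir v g x + ddir v f x * g x"
  by (rule ddir_eqI) (intro has_derivative_mult has_derivative_ddir assms)

lemma ddir_bounded_linear:
  assumes "bounded_linear h" "f differentiable (at x)"
  shows "ddir v (\<lambda>y. h (f y)) x = h (ddir v f x)"
  by (rule ddir_eqI) (intro bounded_linear.has_derivative[OF assms(1)] has_derivative_ddir assms)

lemma has_derivative_exp_comp:
  fixes f :: "'a::euclidean_space \<Rightarrow> 'b::{real_normed_field,banach}"
  assumes "f differentiable (at x)"
  shows "((\<lambda>y. exp (f y)) has_derivative (\<lambda>v. exp (f x) * ddir v f x)) (at x)"
  using has_derivative_compose[OF has_derivative_ddir[OF assms] DERIV_exp[unfolded has_field_derivative_def]]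
  by simp

lemma has_derivative_ln_comp:
  fixes f :: "'a::euclidean_space \<Rightarrow> real"
  assumes "f differentiable (at x)" "f x > 0"
  shows "((\<lambda>y. ln (f y)) has_derivative (\<lambda>v. inverse (f x) * ddir v f x)) (at x)"
  using has_derivative_compose[OF has_derivative_ddir[OF assms(1)] DERIV_ln[OF assms(2), unfolded has_field_derivative_def]]
  by simp

lemma has_derivative_inverse_comp:
  fixes f :: "'a::euclidean_space \<Rightarrow> real"
  assumes "f differentiable (at x)" "f x \<noteq> 0"
  shows "((\<lambda>y. inverse (f y)) has_derivative (\<lambda>v. (-1) * (inverse (f x) * inverse (f x) * ddir v f x))) (at x)"
  using has_derivative_compose[OF has_derivative_ddir[OF assms(1)]
      DERIV_inverse[OF assms(2), unfolded has_field_derivative_def]]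
  by (simp add: power2_eq_square numeral_2_eq_2 mult_ac)

text \<open>The closure proofs below replace the derivative of a composite by its formula, which is
  valid only on \<open>S\<close>; this makes the replacement legitimate under further
  derivatives.\<close>

lemma Ck_on_cong:
  assumes "open S" "\<And>x. x \<in> S \<Longrightarrow> f x = g x"
  shows "Ck_on k f S \<longleftrightarrow> Ck_on k g S"
  using assms(2)
proof (induction k arbitrary: f g)
  case 0 then show ?case using continuous_on_cong by force
next
  case (Suc k)
  have "f differentiable (at x) \<longleftrightarrow> g differentiable (at x)" if "x \<in> S" for x
    using differentiable_transform_open[of f x S g] differentiable_transform_open[of g x S f]
      that assms(1) Suc.prems by metis
  moreover have "Ck_on k (ddir v f) S = Ck_on k (ddir v g) S" for v
    by (rule Suc.IH) (use ddir_cong[OF assms(1)] Suc.prems in metis)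
  ultimately show ?case by (simp add: ddir_def[abs_def])
qed

lemma Ck_on_Suc:
  "Ck_on (Suc k) f S \<longleftrightarrow> (\<forall>x\<in>S. f differentiable (at x)) \<and> (\<forall>v. Ck_on k (ddir v f) S)"
  by (simp add: ddir_def[abs_def])

declare Ck_on.simps(2) [simp del]

lemma Ck_on_SucD: "Ck_on (Suc k) f S \<Longrightarrow> Ck_on k f S"
proof (induction k arbitrary: f)
  case 0
  then show ?case
    by (auto simp: Ck_on_Suc intro!: continuous_at_imp_continuous_on differentiable_imp_continuous_within)
next
  case (Suc k)
  then show ?case by (auto simp: Ck_on_Suc[of "Suc k"] Ck_on_Suc[of k])
qed

lemma Ck_on_const: "Ck_on k (\<lambda>x. c) S"
proof (induction k arbitrary: c)
  case (Suc k)
  have "ddir v (\<lambda>x. c) = (\<lambda>x. 0)" for v :: 'a by (auto simp: fun_eq_iff)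
  then show ?case by (simp add: Ck_on_Suc Suc)
qed simp

lemma Ck_on_bounded_linear:
  assumes "open S" "bounded_linear h" "Ck_on k f S"
  shows "Ck_on k (\<lambda>x. h (f x)) S"
  using assms(3)
proof (induction k arbitrary: f)
  case 0 then show ?case
    by (simp add: bounded_linear.continuous_on[OF assms(2)])
next
  case (Suc k)
  have "Ck_on k (ddir v (\<lambda>x. h (f x))) S" for v
  proof -
    have "Ck_on k (\<lambda>x. h (ddir v f x)) S" using Suc by (simp add: Ck_on_Suc)
    then show ?thesis
      by (rule Ck_on_cong[THEN iffD1, OF assms(1), rotated])
         (use Suc.prems  in \<open>auto simp: Ck_on_Suc ddir_bounded_linear[OF assms(2)]\<close>)
  qed
  moreover have "(\<lambda>x. h (f x)) differentiable (at x)" if "x \<in> S" for x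
    using bounded_linear.has_derivative[OF assms(2) has_derivative_ddir] Suc.prems that
    unfolding Ck_on_Suc differentiable_def by blast
  ultimately show ?case by (simp add: Ck_on_Suc)
qed

lemma Ck_on_add:
  assumes "open S" "Ck_on k f S" "Ck_on k g S"
  shows "Ck_on k (\<lambda>x. f x + g x) S"
  using assms(2,3)
proof (induction k arbitrary: f g)
  case 0 then show ?case by (simp add: continuous_on_add)
next
  case (Suc k)
  have "Ck_on k (ddir v (\<lambda>x. f x + g x)) S" for v
  proof -
    have "Ck_on k (\<lambda>x. ddir v f x + ddir v g x) S" using Suc by (simp add: Ck_on_Suc)
    then show ?thesis
      by (rule Ck_on_cong[THEN iffD1, OF assms(1), rotated])
         (use Suc.prems  in \<open>auto simp: Ck_on_Suc ddir_add\<close>)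
  qed
  then show ?case using Suc.prems by (auto simp: Ck_on_Suc)
qed

lemma Ck_on_mult:
  fixes f g :: "'a::euclidean_space \<Rightarrow> 'b::real_normed_algebra"
  assumes "open S" "Ck_on k f S" "Ck_on k g S"
  shows "Ck_on k (\<lambda>x. f x * g x) S"
  using assms(2,3)
proof (induction k arbitrary: f g)
  case 0 then show ?case by (simp add: continuous_on_mult)
next
  case (Suc k)
  have "Ck_on k (ddir v (\<lambda>x. f x * g x)) S" for v
  proof -
    have "Ck_on k (\<lambda>x. f x * ddir v g x + ddir v f x * g x) S"
    proof -
      have c: "Ck_on k f S" "Ck_on k g S" "Ck_on k (ddir v f) S" "Ck_on k (ddir v g) S"
        using Suc.prems Ck_on_SucD by (auto simp: Ck_on_Suc)
      show ?thesis by (rule Ck_on_add[OF assms(1) Suc.IH Suc.IH]; rule c)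
    qed
    then show ?thesis
      by (rule Ck_on_cong[THEN iffD1, OF assms(1), rotated])
         (use Suc.prems  in \<open>auto simp: Ck_on_Suc ddir_mult\<close>)
  qed
  then show ?case using Suc.prems by (auto simp: Ck_on_Suc)
qed

text \<open>The derivative reproduces the exponential itself, one order lower, so the induction runs
  with \<open>f\<close> fixed. Reciprocals are treated in the same way.\<close>

lemma Ck_on_exp:
  fixes f :: "'a::euclidean_space \<Rightarrow> 'b::{real_normed_field,banach}"
  assumes "open S" "Ck_on k f S"
  shows "Ck_on k (\<lambda>x. exp (f x)) S"
  using assms(2)
proof (induction k)
  case 0 then show ?case by (simp add: continuous_on_exp)
next
  case (Suc k)
  have "Ck_on k (ddir v (\<lambda>x. exp (f x))) S" for v
  proof -
    have "Ck_on k (\<lambda>x. exp (f x) * ddir v f x) S"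
    proof -
      have c: "Ck_on k f S" "Ck_on k (ddir v f) S"
        using Suc.prems Ck_on_SucD by (auto simp: Ck_on_Suc)
      show ?thesis by (rule Ck_on_mult[OF assms(1) Suc.IH[OF c(1)] c(2)])
    qed
    then show ?thesis
      by (rule Ck_on_cong[THEN iffD1, OF assms(1), rotated])
         (use Suc.prems  in \<open>auto simp: Ck_on_Suc ddir_eqI[OF has_derivative_exp_comp]\<close>)
  qed
  then show ?case using Suc.prems by (auto simp: Ck_on_Suc intro!: differentiableI[OF has_derivative_exp_comp])
qed

lemma Ck_on_inverse:
  fixes f :: "'a::euclidean_space \<Rightarrow> real"
  assumes "open S" "Ck_on k f S" "\<And>x. x \<in> S \<Longrightarrow> f x \<noteq> 0"
  shows "Ck_on k (\<lambda>x. inverse (f x)) S"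
  using assms(2)
proof (induction k)
  case 0 then show ?case using assms by (simp add: continuous_on_inverse)
next
  case (Suc k)
  have "Ck_on k (ddir v (\<lambda>x. inverse (f x))) S" for v
  proof -
    have "Ck_on k (\<lambda>x. (-1) * (inverse (f x) * inverse (f x) * ddir v f x)) S"
    proof -
      have c: "Ck_on k f S" "Ck_on k (ddir v f) S"
        using Suc.prems Ck_on_SucD by (auto simp: Ck_on_Suc)
      show ?thesis
        by (rule Ck_on_mult[OF assms(1) Ck_on_const
              Ck_on_mult[OF assms(1) Ck_on_mult[OF assms(1) Suc.IH[OF c(1)] Suc.IH[OF c(1)]] c(2)]])
    qed
    then show ?thesis
      by (rule Ck_on_cong[THEN iffD1, OF assms(1), rotated])
         (use Suc.prems assms(3)  in \<open>auto simp: Ck_on_Suc ddir_eqI[OF has_derivative_inverse_comp]\<close>)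
  qed
  then show ?case using Suc.prems assms(3) by (auto simp: Ck_on_Suc intro!: differentiableI[OF has_derivative_inverse_comp])
qed

text \<open>The first derivative no longer contains a logarithm, so a case split on the order and
  the result for reciprocals take the place of an induction.\<close>

lemma Ck_on_ln:
  fixes f :: "'a::euclidean_space \<Rightarrow> real"
  assumes "open S" "Ck_on k f S" "\<And>x. x \<in> S \<Longrightarrow> f x > 0"
  shows "Ck_on k (\<lambda>x. ln (f x)) S"
proof (cases k)
  case 0 then show ?thesis using assms by (force intro!: continuous_on_ln)
next
  case (Suc m)
  have c: "Ck_on (Suc m) f S" using Suc assms by simp
  have "Ck_on m (ddir v (\<lambda>x. ln (f x))) S" for v
  proof -
    have "Ck_on m (\<lambda>x. inverse (f x) * ddir v f x) S"
    proof -
      have d: "Ck_on m f S" "Ck_on m (ddir v f) S"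
        using c Ck_on_SucD by (auto simp: Ck_on_Suc)
      have "f x \<noteq> 0" if "x \<in> S" for x using assms(3)[OF that] by simp
      then show ?thesis using Ck_on_mult[OF assms(1) Ck_on_inverse[OF assms(1) d(1)] d(2)] by blast
    qed
    then show ?thesis
      by (rule Ck_on_cong[THEN iffD1, OF assms(1), rotated])
         (use c assms(3)  in \<open>auto simp: Ck_on_Suc ddir_eqI[OF has_derivative_ln_comp]\<close>)
  qed
  then show ?thesis using Suc c assms(3) by (auto simp: Ck_on_Suc intro!: differentiableI[OF has_derivative_ln_comp])
qed

lemma ddir_compose_affine:
  assumes "bounded_linear L" "f differentiable (at (c + L x))"
  shows "(\<lambda>y. f (c + L y)) differentiable (at x)"
    and "ddir v (\<lambda>y. f (c + L y)) x = ddir (L v) f (c + L x)"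
proof -
  have *: "((\<lambda>y. c + L y) has_derivative L) (at x)"
    using bounded_linear_imp_has_derivative[OF assms(1)] by (auto intro!: derivative_eq_intros)
  have "((\<lambda>y. f (c + L y)) has_derivative (\<lambda>v. ddir (L v) f (c + L x))) (at x)"
    using has_derivative_compose[OF * has_derivative_ddir[OF assms(2)]] .
  then show "(\<lambda>y. f (c + L y)) differentiable (at x)"
    and "ddir v (\<lambda>y. f (c + L y)) x = ddir (L v) f (c + L x)"
    by (auto simp: differentiable_def ddir_eqI)
qed

lemma Ck_on_compose_affine:
  assumes "open S" "bounded_linear L" "\<And>x. x \<in> S \<Longrightarrow> c + L x \<in> T" "Ck_on k f T"
  shows "Ck_on k (\<lambda>x. f (c + L x)) S"
  using assms(4)
proof (induction k arbitrary: f)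
  case 0
  have "continuous_on S (\<lambda>x. c + L x)"
    by (intro continuous_intros bounded_linear.continuous_on[OF assms(2)])
  then show ?case using 0 assms(3) by (auto intro!: continuous_on_compose2[of T f])
next
  case (Suc k)
  have "Ck_on k (ddir v (\<lambda>x. f (c + L x))) S" for v
  proof -
    have "Ck_on k (\<lambda>x. ddir (L v) f (c + L x)) S" using Suc by (simp add: Ck_on_Suc)
    then show ?thesis
      by (rule Ck_on_cong[THEN iffD1, OF assms(1), rotated])
         (use Suc.prems assms(3)  in \<open>auto simp: Ck_on_Suc ddir_compose_affine(2)[OF assms(2)]\<close>)
  qed
  then show ?case using Suc.prems assms(3) by (auto simp: Ck_on_Suc intro!: ddir_compose_affine(1)[OF assms(2)])
qed

lemma smooth_on_iff:
  "smooth_on f S \<longleftrightarrow> (\<forall>x\<in>S. f differentiable (at x)) \<and> (\<forall>v. smooth_on (ddir v f) S)"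
proof
  assume "smooth_on f S"
  then show "(\<forall>x\<in>S. f differentiable (at x)) \<and> (\<forall>v. smooth_on (ddir v f) S)"
    unfolding smooth_on_def by (metis Ck_on_Suc)
next
  assume *: "(\<forall>x\<in>S. f differentiable (at x)) \<and> (\<forall>v. smooth_on (ddir v f) S)"
  then have "Ck_on (Suc k) f S" for k by (simp add: smooth_on_def Ck_on_Suc)
  then show "smooth_on f S" unfolding smooth_on_def using Ck_on_SucD by blast
qed

lemma smooth_on_differentiable: "smooth_on f S \<Longrightarrow> x \<in> S \<Longrightarrow> f differentiable (at x)"
  using smooth_on_iff by blast

lemma smooth_on_ddir: "smooth_on f S \<Longrightarrow> smooth_on (ddir v f) S"
  using smooth_on_iff by blast

lemma smooth_on_continuous: "smooth_on f S \<Longrightarrow> continuous_on S f"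
  by (metis Ck_on.simps(1) smooth_on_def)

lemma smooth_on_const: "smooth_on (\<lambda>x. c) S"
  by (simp add: smooth_on_def Ck_on_const)

lemma smooth_on_bounded_linear:
  "open S \<Longrightarrow> bounded_linear h \<Longrightarrow> smooth_on f S \<Longrightarrow> smooth_on (\<lambda>x. h (f x)) S"
  by (simp add: smooth_on_def Ck_on_bounded_linear)

lemma smooth_on_linear: "open S \<Longrightarrow> bounded_linear h \<Longrightarrow> smooth_on h S"
proof -
  assume a: "open S" "bounded_linear h"
  have "ddir v h = (\<lambda>x. h v)" for v
    using ddir_eqI[OF bounded_linear_imp_has_derivative[OF a(2)]] by (auto simp: fun_eq_iff)
  then show ?thesis
    by (subst smooth_on_iff) (simp add: smooth_on_const bounded_linear_imp_differentiable[OF a(2)])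
qed

lemma smooth_on_add: "open S \<Longrightarrow> smooth_on f S \<Longrightarrow> smooth_on g S \<Longrightarrow> smooth_on (\<lambda>x. f x + g x) S"
  by (simp add: smooth_on_def Ck_on_add)

lemma smooth_on_mult:
  fixes f g :: "'a::euclidean_space \<Rightarrow> 'b::real_normed_algebra"
  shows "open S \<Longrightarrow> smooth_on f S \<Longrightarrow> smooth_on g S \<Longrightarrow> smooth_on (\<lambda>x. f x * g x) S"
  by (simp add: smooth_on_def Ck_on_mult)

lemma smooth_on_exp:
  fixes f :: "'a::euclidean_space \<Rightarrow> 'b::{real_normed_field,banach}"
  shows "open S \<Longrightarrow> smooth_on f S \<Longrightarrow> smooth_on (\<lambda>x. exp (f x)) S"
  by (simp add: smooth_on_def Ck_on_exp)

lemma smooth_on_ln: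
  fixes f :: "'a::euclidean_space \<Rightarrow> real"
  shows "open S \<Longrightarrow> smooth_on f S \<Longrightarrow> (\<And>x. x \<in> S \<Longrightarrow> f x > 0) \<Longrightarrow> smooth_on (\<lambda>x. ln (f x)) S"
  by (simp add: smooth_on_def Ck_on_ln)

lemma smooth_on_minus: "open S \<Longrightarrow> smooth_on f S \<Longrightarrow> smooth_on (\<lambda>x. - f x) S"
  using smooth_on_bounded_linear[OF _ bounded_linear_minus[OF bounded_linear_ident]] by blast

lemma smooth_on_diff: "open S \<Longrightarrow> smooth_on f S \<Longrightarrow> smooth_on g S \<Longrightarrow> smooth_on (\<lambda>x. f x - g x) S"
  using smooth_on_add[of S f "\<lambda>x. - g x"] smooth_on_minus by force

lemma smooth_on_power:
  fixes f :: "'a::euclidean_space \<Rightarrow> 'b::real_normed_algebra_1"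
  shows "open S \<Longrightarrow> smooth_on f S \<Longrightarrow> smooth_on (\<lambda>x. f x ^ m) S"
  by (induction m) (auto intro: smooth_on_const smooth_on_mult)

lemma smooth_on_sum:
  "open S \<Longrightarrow> (\<And>i. i \<in> I \<Longrightarrow> smooth_on (f i) S) \<Longrightarrow> smooth_on (\<lambda>x. \<Sum>i\<in>I. f i x) S"
  by (induction I rule: infinite_finite_induct) (auto intro: smooth_on_const smooth_on_add)

lemma smooth_on_subset: "smooth_on f T \<Longrightarrow> S \<subseteq> T \<Longrightarrow> smooth_on f S"
proof -
  have "Ck_on k f T \<Longrightarrow> S \<subseteq> T \<Longrightarrow> Ck_on k f S" for k
    by (induction k arbitrary: f) (auto simp: Ck_on_Suc intro: continuous_on_subset)
  then show "smooth_on f T \<Longrightarrow> S \<subseteq> T \<Longrightarrow> smooth_on f S" by (simp add: smooth_on_def)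
qed

lemma smooth_on_compose_affine:
  assumes "open S" "bounded_linear L" "\<And>x. x \<in> S \<Longrightarrow> c + L x \<in> T" "smooth_on f T"
  shows "smooth_on (\<lambda>x. f (c + L x)) S"
  using assms(4) Ck_on_compose_affine[OF assms(1,2,3)] unfolding smooth_on_def by auto

lemma smooth_on_cnj: "open S \<Longrightarrow> smooth_on f S \<Longrightarrow> smooth_on (\<lambda>x. cnj (f x)) S"
  by (rule smooth_on_bounded_linear[OF _ bounded_linear_cnj])

lemma smooth_on_of_real:
  "open S \<Longrightarrow> smooth_on f S \<Longrightarrow> smooth_on (\<lambda>x. complex_of_real (f x)) S"
  by (rule smooth_on_bounded_linear[OF _ bounded_linear_of_real])

lemmas smooth_intros = smooth_on_const smooth_on_add smooth_on_mult smooth_on_exp smooth_on_minus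
  smooth_on_diff smooth_on_power smooth_on_sum smooth_on_cnj smooth_on_of_real smooth_on_ddir

section \<open>Symmetry of second derivatives\<close>

lemma mvt_ddir:
  fixes g :: "'a::euclidean_space \<Rightarrow> real"
  assumes "h > 0" "\<And>s. 0 \<le> s \<Longrightarrow> s \<le> h \<Longrightarrow> g differentiable (at (x + s *\<^sub>R v))"
  shows "\<exists>s. 0 < s \<and> s < h \<and> g (x + h *\<^sub>R v) - g x = h * ddir v g (x + s *\<^sub>R v)"
proof -
  have "((\<lambda>s. g (x + s *\<^sub>R v)) has_real_derivative ddir v g (x + s *\<^sub>R v)) (at s)"
    if "0 \<le> s" "s \<le> h" for s
  proof -
    have "((\<lambda>s. x + s *\<^sub>R v) has_derivative (\<lambda>s. s *\<^sub>R v)) (at s)"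
      by (auto intro!: derivative_eq_intros)
    from has_derivative_compose[OF this has_derivative_ddir[OF assms(2)[OF that]]]
    have "((\<lambda>s. g (x + s *\<^sub>R v)) has_derivative (\<lambda>r. ddir (r *\<^sub>R v) g (x + s *\<^sub>R v))) (at s)" .
    moreover have "ddir (r *\<^sub>R v) g (x + s *\<^sub>R v) = ddir v g (x + s *\<^sub>R v) * r" for r
      unfolding ddir_def
      using linear_cmul[OF linear_frechet_derivative[OF assms(2)[OF that]]] by simp
    ultimately show ?thesis by (simp add: has_field_derivative_def)
  qed
  from MVT2[OF assms(1) this] show ?thesis by force
qed

text \<open>The mean value theorem is used twice: in direction \<open>v\<close> for the increment of
  \<open>g\<close> in direction \<open>w\<close>, then in direction \<open>w\<close> for the
  derivative so obtained.\<close>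

lemma mixed_difference:
  fixes g :: "'a::euclidean_space \<Rightarrow> real"
  assumes "smooth_on g S" "h > 0" "\<And>s t. 0 \<le> s \<Longrightarrow> s \<le> h \<Longrightarrow> 0 \<le> t \<Longrightarrow> t \<le> h \<Longrightarrow> x + s *\<^sub>R v + t *\<^sub>R w \<in> S"
  shows "\<exists>s t. 0 \<le> s \<and> s \<le> h \<and> 0 \<le> t \<and> t \<le> h \<and>
     g (x + h *\<^sub>R v + h *\<^sub>R w) - g (x + h *\<^sub>R v) - g (x + h *\<^sub>R w) + g x
     = h * h * ddir w (ddir v g) (x + s *\<^sub>R v + t *\<^sub>R w)"
proof -
  have d1: "(\<lambda>y. g (y + h *\<^sub>R w)) differentiable (at (x + s *\<^sub>R v))"
      "ddir v (\<lambda>y. g (y + h *\<^sub>R w)) (x + s *\<^sub>R v) = ddir v g (x + s *\<^sub>R v + h *\<^sub>R w)"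
    if "0 \<le> s" "s \<le> h" for s
  proof -
    have "g differentiable (at (h *\<^sub>R w + (x + s *\<^sub>R v)))"
      using smooth_on_differentiable[OF assms(1) assms(3)[OF that, of h]] assms(2) by (simp add: add_ac)
    from ddir_compose_affine[OF bounded_linear_ident this]
    show "(\<lambda>y. g (y + h *\<^sub>R w)) differentiable (at (x + s *\<^sub>R v))"
      "ddir v (\<lambda>y. g (y + h *\<^sub>R w)) (x + s *\<^sub>R v) = ddir v g (x + s *\<^sub>R v + h *\<^sub>R w)"
      by (simp_all add: add_ac)
  qed
  have d2: "g differentiable (at (x + s *\<^sub>R v))" if "0 \<le> s" "s \<le> h" for s
    using smooth_on_differentiable[OF assms(1) assms(3)[OF that, of 0]] assms(2) by simp
  have d3: "(\<lambda>y. - g y) differentiable (at (x + s *\<^sub>R v))"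
    "ddir v (\<lambda>y. - g y) (x + s *\<^sub>R v) = - ddir v g (x + s *\<^sub>R v)" if "0 \<le> s" "s \<le> h" for s
    using d2[OF that] ddir_bounded_linear[OF bounded_linear_minus[OF bounded_linear_ident] d2[OF that]] by auto
  have d4: "(\<lambda>y. g (y + h *\<^sub>R w) + - g y) differentiable (at (x + s *\<^sub>R v))" if "0 \<le> s" "s \<le> h" for s
    using d1(1)[OF that] d3(1)[OF that] by (rule differentiable_add)
  obtain s where s: "0 < s" "s < h" and
    e1: "(g (x + h *\<^sub>R v + h *\<^sub>R w) + - g (x + h *\<^sub>R v)) - (g (x + h *\<^sub>R w) + - g x)
      = h * ddir v (\<lambda>y. g (y + h *\<^sub>R w) + - g y) (x + s *\<^sub>R v)"
    using mvt_ddir[OF assms(2), of "\<lambda>y. g (y + h *\<^sub>R w) + - g y" x v] d4 by blast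
  have e2: "ddir v (\<lambda>y. g (y + h *\<^sub>R w) + - g y) (x + s *\<^sub>R v)
      = ddir v g (x + s *\<^sub>R v + h *\<^sub>R w) - ddir v g (x + s *\<^sub>R v)"
    using ddir_add[OF d1(1)[of s] d3(1)[of s]] d1(2)[of s] d3(2)[of s] s by simp
  obtain t where t: "0 < t" "t < h" and
    e3: "ddir v g (x + s *\<^sub>R v + h *\<^sub>R w) - ddir v g (x + s *\<^sub>R v)
      = h * ddir w (ddir v g) (x + s *\<^sub>R v + t *\<^sub>R w)"
    using mvt_ddir[OF assms(2), of "ddir v g" "x + s *\<^sub>R v" w] assms(3) s
      smooth_on_differentiable[OF smooth_on_ddir[OF assms(1)]] by force
  show ?thesis
    apply (rule exI[of _ s], rule exI[of _ t])
    using s t e1 e2 e3 by simp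
qed

text \<open>The second difference is symmetric in \<open>v\<close> and \<open>w\<close>, so it
  equals \<open>h * h\<close> times either mixed derivative, each at some nearby point; continuity
  then forces the two to agree.\<close>

lemma ddir_commute_real:
  fixes g :: "'a::euclidean_space \<Rightarrow> real"
  assumes "open S" "smooth_on g S" "x \<in> S"
  shows "ddir v (ddir w g) x = ddir w (ddir v g) x"
proof (rule ccontr)
  define P where "P = ddir w (ddir v g)"
  define Q where "Q = ddir v (ddir w g)"
  assume "ddir v (ddir w g) x \<noteq> ddir w (ddir v g) x"
  then have ne: "P x \<noteq> Q x" by (simp add: P_def Q_def)
  \<comment> \<open>Half the gap: a value within \<open>e\<close> of \<open>P x\<close> cannot equal
    a value within \<open>e\<close> of \<open>Q x\<close>.\<close>
  define e where "e = \<bar>P x - Q x\<bar> / 2"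
  have e: "e > 0" using ne by (simp add: e_def)
  have "continuous_on S P" "continuous_on S Q"
    unfolding P_def Q_def by (intro smooth_on_continuous smooth_on_ddir assms)+
  then have "isCont P x" "isCont Q x" using assms(1,3) continuous_on_eq_continuous_at by blast+
  then obtain d1 d2 where d: "d1 > 0" "\<And>y. dist y x < d1 \<Longrightarrow> \<bar>P y - P x\<bar> < e"
     "d2 > 0" "\<And>y. dist y x < d2 \<Longrightarrow> \<bar>Q y - Q x\<bar> < e"
    unfolding continuous_at_eps_delta using e by (metis dist_real_def)
  obtain d0 where d0: "d0 > 0" "ball x d0 \<subseteq> S" using assms(1,3) openE by blast
  define d where "d = min d0 (min d1 d2)"
  have dp: "d > 0" using d d0 by (simp add: d_def)
  \<comment> \<open>Keeps the whole parallelogram within distance \<open>d / 2\<close> of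
    \<open>x\<close>; the summand 1 covers the case \<open>v = w = 0\<close>.\<close>
  define h where "h = d / (2 * (norm v + norm w + 1))"
  have h: "h > 0" using dp by (simp add: h_def add_nonneg_pos)
  have near: "dist (x + s *\<^sub>R v + t *\<^sub>R w) x < d" if "0 \<le> s" "s \<le> h" "0 \<le> t" "t \<le> h" for s t
  proof -
    have "dist (x + s *\<^sub>R v + t *\<^sub>R w) x = norm (s *\<^sub>R v + t *\<^sub>R w)" by (simp add: dist_norm)
    also have "\<dots> \<le> s * norm v + t * norm w" using norm_triangle_ineq[of "s *\<^sub>R v" "t *\<^sub>R w"] that by simp
    also have "\<dots> \<le> h * norm v + h * norm w" using that by (intro add_mono mult_right_mono) auto
    also have "\<dots> \<le> h * (norm v + norm w + 1)" using h by (simp add: algebra_simps)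
    also have "\<dots> = d / 2"
    proof -
      have "norm v + norm w + 1 > 0" by (simp add: add_nonneg_pos)
      then show ?thesis unfolding h_def by (simp add: field_simps)
    qed
    finally show ?thesis using dp by simp
  qed
  have inS: "x + s *\<^sub>R v + t *\<^sub>R w \<in> S" if "0 \<le> s" "s \<le> h" "0 \<le> t" "t \<le> h" for s t
    using near[OF that] d0(2) by (auto simp: d_def mem_ball dist_commute)
  obtain s t where st: "0 \<le> s" "s \<le> h" "0 \<le> t" "t \<le> h"
    "g (x + h *\<^sub>R v + h *\<^sub>R w) - g (x + h *\<^sub>R v) - g (x + h *\<^sub>R w) + g x
     = h * h * P (x + s *\<^sub>R v + t *\<^sub>R w)"
    using mixed_difference[OF assms(2) h inS] unfolding P_def by blast
  have inS': "x + s *\<^sub>R w + t *\<^sub>R v \<in> S" if "0 \<le> s" "s \<le> h" "0 \<le> t" "t \<le> h" for s t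
    using inS[of t s] that by (simp add: add_ac)
  obtain s' t' where st': "0 \<le> s'" "s' \<le> h" "0 \<le> t'" "t' \<le> h"
    "g (x + h *\<^sub>R w + h *\<^sub>R v) - g (x + h *\<^sub>R w) - g (x + h *\<^sub>R v) + g x
     = h * h * Q (x + s' *\<^sub>R w + t' *\<^sub>R v)"
    using mixed_difference[OF assms(2) h inS'] unfolding Q_def by blast
  have "h * h * P (x + s *\<^sub>R v + t *\<^sub>R w) = h * h * Q (x + s' *\<^sub>R w + t' *\<^sub>R v)"
  proof -
    have eq: "x + h *\<^sub>R w + h *\<^sub>R v = x + h *\<^sub>R v + h *\<^sub>R w" by (simp add: add_ac)
    show ?thesis using st(5) st'(5) unfolding eq by linarith
  qed
  then have "P (x + s *\<^sub>R v + t *\<^sub>R w) = Q (x + t' *\<^sub>R v + s' *\<^sub>R w)" using h by (simp add: add_ac)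
  moreover have "\<bar>P (x + s *\<^sub>R v + t *\<^sub>R w) - P x\<bar> < e"
    using d(2) near[OF st(1-4)] by (auto simp: d_def)
  moreover have "\<bar>Q (x + t' *\<^sub>R v + s' *\<^sub>R w) - Q x\<bar> < e"
    using d(4) near[OF st'(3,4) st'(1,2)] by (auto simp: d_def)
  ultimately show False unfolding e_def by argo
qed

lemma ddir_commute:
  fixes f :: "'a::euclidean_space \<Rightarrow> complex"
  assumes "open S" "smooth_on f S" "x \<in> S"
  shows "ddir v (ddir w f) x = ddir w (ddir v f) x"
proof -
  have *: "L (ddir v (ddir w f) x) = ddir v (ddir w (\<lambda>y. L (f y))) x"
    if L: "bounded_linear L" for L :: "complex \<Rightarrow> real" and v w
  proof -
    have "ddir v (ddir w (\<lambda>y. L (f y))) x = ddir v (\<lambda>y. L (ddir w f y)) x"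
      by (rule ddir_cong[OF assms(1,3)])
         (use ddir_bounded_linear[OF L] smooth_on_differentiable[OF assms(2)] in auto)
    also have "\<dots> = L (ddir v (ddir w f) x)"
      by (rule ddir_bounded_linear[OF L])
         (use smooth_on_differentiable[OF smooth_on_ddir[OF assms(2)] assms(3)] in auto)
    finally show ?thesis by simp
  qed
  have "L (ddir v (ddir w f) x) = L (ddir w (ddir v f) x)"
    if L: "bounded_linear L" for L :: "complex \<Rightarrow> real"
    unfolding *[OF L] by (rule ddir_commute_real[OF assms(1) smooth_on_bounded_linear[OF assms(1) L assms(2)] assms(3)])
  from this[OF bounded_linear_Re] this[OF bounded_linear_Im] show ?thesis
    by (simp add: complex_eq_iff)
qed

section \<open>The complex vector fields\<close>

lemma Z_ddir: "Z \<alpha> f \<xi> = (ddir (axis \<alpha> 1, 0) f \<xi> - \<i> * ddir (axis \<alpha> \<i>, 0) f \<xi>) / 2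
    + \<i> * cnj (fst \<xi> $ \<alpha>) * ddir (0, 1) f \<xi>"
  by (simp add: Z_def dz_def dx_def dy_def dt_def ddir_def)

lemma Zbar_ddir: "Zbar \<alpha> f \<xi> = (ddir (axis \<alpha> 1, 0) f \<xi> + \<i> * ddir (axis \<alpha> \<i>, 0) f \<xi>) / 2
    - \<i> * (fst \<xi> $ \<alpha>) * ddir (0, 1) f \<xi>"
  by (simp add: Zbar_def dzbar_def dx_def dy_def dt_def ddir_def)

lemma dt_ddir: "dt f = ddir (0, 1) f"
  by (simp add: dt_def ddir_def fun_eq_iff)

lemma Z_const [simp]: "Z \<alpha> (\<lambda>x. c) \<xi> = 0" "Zbar \<alpha> (\<lambda>x. c) \<xi> = 0" "dt (\<lambda>x. c) \<xi> = 0"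
  by (simp_all add: Z_ddir Zbar_ddir dt_ddir)

lemma Z_cong:
  assumes "open S" "\<xi> \<in> S" "\<And>y. y \<in> S \<Longrightarrow> f y = g y"
  shows "Z \<alpha> f \<xi> = Z \<alpha> g \<xi>" "Zbar \<alpha> f \<xi> = Zbar \<alpha> g \<xi>" "dt f \<xi> = dt g \<xi>"
  using ddir_cong[OF assms] by (simp_all add: Z_ddir Zbar_ddir dt_ddir)

lemma Z_add:
  assumes "f differentiable (at \<xi>)" "g differentiable (at \<xi>)"
  shows "Z \<alpha> (\<lambda>x. f x + g x) \<xi> = Z \<alpha> f \<xi> + Z \<alpha> g \<xi>"
    "Zbar \<alpha> (\<lambda>x. f x + g x) \<xi> = Zbar \<alpha> f \<xi> + Zbar \<alpha> g \<xi>"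
    "dt (\<lambda>x. f x + g x) \<xi> = dt f \<xi> + dt g \<xi>"
  by (simp_all add: Z_ddir Zbar_ddir dt_ddir ddir_add[OF assms] algebra_simps add_divide_distrib diff_divide_distrib)

lemma Z_mult:
  assumes "f differentiable (at \<xi>)" "g differentiable (at \<xi>)"
  shows "Z \<alpha> (\<lambda>x. f x * g x) \<xi> = f \<xi> * Z \<alpha> g \<xi> + Z \<alpha> f \<xi> * g \<xi>"
    "Zbar \<alpha> (\<lambda>x. f x * g x) \<xi> = f \<xi> * Zbar \<alpha> g \<xi> + Zbar \<alpha> f \<xi> * g \<xi>"
    "dt (\<lambda>x. f x * g x) \<xi> = f \<xi> * dt g \<xi> + dt f \<xi> * g \<xi>"
  by (simp_all add: Z_ddir Zbar_ddir dt_ddir ddir_mult[OF assms] algebra_simps add_divide_distrib diff_divide_distrib)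

lemma Z_cmult:
  assumes "f differentiable (at \<xi>)"
  shows "Z \<alpha> (\<lambda>x. c * f x) \<xi> = c * Z \<alpha> f \<xi>"
    "Zbar \<alpha> (\<lambda>x. c * f x) \<xi> = c * Zbar \<alpha> f \<xi>"
    "dt (\<lambda>x. c * f x) \<xi> = c * dt f \<xi>"
  using Z_mult[of "\<lambda>x. c", OF _ assms] by simp_all

lemma Z_minus:
  assumes "f differentiable (at \<xi>)"
  shows "Z \<alpha> (\<lambda>x. - f x) \<xi> = - Z \<alpha> f \<xi>"
    "Zbar \<alpha> (\<lambda>x. - f x) \<xi> = - Zbar \<alpha> f \<xi>"
    "dt (\<lambda>x. - f x) \<xi> = - dt f \<xi>"
  using Z_cmult[OF assms, where c="-1"] by simp_all

lemma Z_diff: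
  assumes "f differentiable (at \<xi>)" "g differentiable (at \<xi>)"
  shows "Z \<alpha> (\<lambda>x. f x - g x) \<xi> = Z \<alpha> f \<xi> - Z \<alpha> g \<xi>"
    "Zbar \<alpha> (\<lambda>x. f x - g x) \<xi> = Zbar \<alpha> f \<xi> - Zbar \<alpha> g \<xi>"
    "dt (\<lambda>x. f x - g x) \<xi> = dt f \<xi> - dt g \<xi>"
  using Z_add[of f \<xi> "\<lambda>x. - g x"] Z_minus[OF assms(2)] assms by simp_all

lemma Z_sum:
  assumes "finite I" "\<And>i. i \<in> I \<Longrightarrow> f i differentiable (at \<xi>)"
  shows "Z \<alpha> (\<lambda>x. \<Sum>i\<in>I. f i x) \<xi> = (\<Sum>i\<in>I. Z \<alpha> (f i) \<xi>)"
    "Zbar \<alpha> (\<lambda>x. \<Sum>i\<in>I. f i x) \<xi> = (\<Sum>i\<in>I. Zbar \<alpha> (f i) \<xi>)"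
    "dt (\<lambda>x. \<Sum>i\<in>I. f i x) \<xi> = (\<Sum>i\<in>I. dt (f i) \<xi>)"
  using assms by (induction I rule: finite_induct) (simp_all add: Z_add)

lemma Z_exp:
  assumes "f differentiable (at \<xi>)"
  shows "Z \<alpha> (\<lambda>x. exp (f x)) \<xi> = exp (f \<xi>) * Z \<alpha> f \<xi>"
    "Zbar \<alpha> (\<lambda>x. exp (f x)) \<xi> = exp (f \<xi>) * Zbar \<alpha> f \<xi>"
    "dt (\<lambda>x. exp (f x)) \<xi> = exp (f \<xi>) * dt f \<xi>"
  by (simp_all add: Z_ddir Zbar_ddir dt_ddir ddir_eqI[OF has_derivative_exp_comp[OF assms]] algebra_simps add_divide_distrib diff_divide_distrib)

lemma Z_power:
  assumes "f differentiable (at \<xi>)"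
  shows "Z \<alpha> (\<lambda>x. f x ^ m) \<xi> = of_nat m * f \<xi> ^ (m - 1) * Z \<alpha> f \<xi>"
    "Zbar \<alpha> (\<lambda>x. f x ^ m) \<xi> = of_nat m * f \<xi> ^ (m - 1) * Zbar \<alpha> f \<xi>"
    "dt (\<lambda>x. f x ^ m) \<xi> = of_nat m * f \<xi> ^ (m - 1) * dt f \<xi>"
proof -
  have "((\<lambda>x. f x ^ m) has_derivative (\<lambda>v. of_nat m * f \<xi> ^ (m - 1) * ddir v f \<xi>)) (at \<xi>)"
    using has_derivative_power[OF has_derivative_ddir[OF assms], of m] by (simp add: mult_ac)
  from ddir_eqI[OF this]
  show "Z \<alpha> (\<lambda>x. f x ^ m) \<xi> = of_nat m * f \<xi> ^ (m - 1) * Z \<alpha> f \<xi>"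
    "Zbar \<alpha> (\<lambda>x. f x ^ m) \<xi> = of_nat m * f \<xi> ^ (m - 1) * Zbar \<alpha> f \<xi>"
    "dt (\<lambda>x. f x ^ m) \<xi> = of_nat m * f \<xi> ^ (m - 1) * dt f \<xi>"
    by (simp_all add: Z_ddir Zbar_ddir dt_ddir algebra_simps add_divide_distrib diff_divide_distrib)
qed

lemma Z_cnj:
  assumes "f differentiable (at \<xi>)"
  shows "Z \<alpha> (\<lambda>x. cnj (f x)) \<xi> = cnj (Zbar \<alpha> f \<xi>)"
    "Zbar \<alpha> (\<lambda>x. cnj (f x)) \<xi> = cnj (Z \<alpha> f \<xi>)"
    "dt (\<lambda>x. cnj (f x)) \<xi> = cnj (dt f \<xi>)"
  by (simp_all add: Z_ddir Zbar_ddir dt_ddir ddir_bounded_linear[OF bounded_linear_cnj assms])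

lemma bounded_linear_coord: "bounded_linear (\<lambda>\<xi>::'n::finite heis. fst \<xi> $ \<alpha>)"
  using bounded_linear_compose[OF bounded_linear_vec_nth[of \<alpha>] bounded_linear_fst] by (simp add: comp_def)

lemma bounded_linear_snd_of_real: "bounded_linear (\<lambda>\<xi>::'n::finite heis. complex_of_real (snd \<xi>))"
  using bounded_linear_compose[OF bounded_linear_of_real bounded_linear_snd] by (simp add: comp_def)

lemma ddir_linear: "bounded_linear h \<Longrightarrow> ddir v h x = h v"
  by (rule ddir_eqI[OF bounded_linear_imp_has_derivative])

lemma Z_coord:
  fixes \<xi> :: "'n::finite heis"
  shows "Z \<alpha> (\<lambda>x. fst x $ \<beta>) \<xi> = (if \<alpha> = \<beta> then 1 else 0)"
    "Zbar \<alpha> (\<lambda>x. fst x $ \<beta>) \<xi> = 0"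
    "dt (\<lambda>x. fst x $ \<beta>) \<xi> = 0"
    "Z \<alpha> (\<lambda>x. complex_of_real (snd x)) \<xi> = \<i> * cnj (fst \<xi> $ \<alpha>)"
    "Zbar \<alpha> (\<lambda>x. complex_of_real (snd x)) \<xi> = - \<i> * fst \<xi> $ \<alpha>"
    "dt (\<lambda>x. complex_of_real (snd x)) \<xi> = 1"
  by (auto simp: Z_ddir Zbar_ddir dt_ddir ddir_linear[OF bounded_linear_coord] axis_def
      ddir_linear[OF bounded_linear_snd_of_real])

lemma smooth_on_coord:
  "open S \<Longrightarrow> smooth_on (\<lambda>\<xi>::'n::finite heis. fst \<xi> $ \<alpha>) S"
  "open S \<Longrightarrow> smooth_on (\<lambda>\<xi>::'n::finite heis. snd \<xi>) S"
  by (intro smooth_on_linear bounded_linear_coord bounded_linear_snd; assumption)+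

lemma smooth_on_Z:
  fixes f :: "'n::finite heis \<Rightarrow> complex"
  assumes "open S" "smooth_on f S"
  shows "smooth_on (Z \<alpha> f) S" "smooth_on (Zbar \<alpha> f) S" "smooth_on (dt f) S"
proof -
  have "Z \<alpha> f = (\<lambda>\<xi>. (1/2) * (ddir (axis \<alpha> 1, 0) f \<xi> - \<i> * ddir (axis \<alpha> \<i>, 0) f \<xi>)
    + \<i> * cnj (fst \<xi> $ \<alpha>) * ddir (0, 1) f \<xi>)" by (simp add: Z_ddir fun_eq_iff)
  then show "smooth_on (Z \<alpha> f) S" by (simp only:) (intro smooth_intros smooth_on_coord assms)
  have "Zbar \<alpha> f = (\<lambda>\<xi>. (1/2) * (ddir (axis \<alpha> 1, 0) f \<xi> + \<i> * ddir (axis \<alpha> \<i>, 0) f \<xi>)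
    - \<i> * (fst \<xi> $ \<alpha>) * ddir (0, 1) f \<xi>)" by (simp add: Zbar_ddir fun_eq_iff)
  then show "smooth_on (Zbar \<alpha> f) S" by (simp only:) (intro smooth_intros smooth_on_coord assms)
  show "smooth_on (dt f) S" unfolding dt_ddir by (intro smooth_intros assms)
qed

text \<open>The last summand is the derivative of the variable coefficient of \<open>dt\<close>; it
  is the source of the commutator below.\<close>

lemma ddir_Z:
  assumes "open S" "smooth_on f S" "\<xi> \<in> S"
  shows "ddir v (Z \<beta> f) \<xi> = (ddir v (ddir (axis \<beta> 1, 0) f) \<xi> - \<i> * ddir v (ddir (axis \<beta> \<i>, 0) f) \<xi>) / 2
    + \<i> * cnj (fst \<xi> $ \<beta>) * ddir v (ddir (0, 1) f) \<xi> + \<i> * cnj (fst v $ \<beta>) * ddir (0, 1) f \<xi>" (is ?A)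
    and "ddir v (Zbar \<beta> f) \<xi> = (ddir v (ddir (axis \<beta> 1, 0) f) \<xi> + \<i> * ddir v (ddir (axis \<beta> \<i>, 0) f) \<xi>) / 2
    - \<i> * (fst \<xi> $ \<beta>) * ddir v (ddir (0, 1) f) \<xi> - \<i> * (fst v $ \<beta>) * ddir (0, 1) f \<xi>" (is ?B)
proof -
  have d: "(ddir w f has_derivative (\<lambda>v. ddir v (ddir w f) \<xi>)) (at \<xi>)" for w
    using has_derivative_ddir smooth_on_differentiable[OF smooth_on_ddir[OF assms(2)] assms(3)] by blast
  note c = bounded_linear_imp_has_derivative[OF bounded_linear_coord, of \<beta> "at \<xi>"]
  note cc = has_derivative_cnj[OF c]
  have "((\<lambda>\<xi>. (1/2) * (ddir (axis \<beta> 1, 0) f \<xi> - \<i> * ddir (axis \<beta> \<i>, 0) f \<xi>)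
    + \<i> * cnj (fst \<xi> $ \<beta>) * ddir (0, 1) f \<xi>) has_derivative
    (\<lambda>v. (1/2) * (ddir v (ddir (axis \<beta> 1, 0) f) \<xi> - \<i> * ddir v (ddir (axis \<beta> \<i>, 0) f) \<xi>)
    + (\<i> * cnj (fst \<xi> $ \<beta>) * ddir v (ddir (0, 1) f) \<xi> + (\<i> * cnj (fst v $ \<beta>)) * ddir (0, 1) f \<xi>))) (at \<xi>)"
    by (intro has_derivative_add has_derivative_mult_right has_derivative_diff has_derivative_mult d cc)
  then have "(Z \<beta> f has_derivative
    (\<lambda>v. (1/2) * (ddir v (ddir (axis \<beta> 1, 0) f) \<xi> - \<i> * ddir v (ddir (axis \<beta> \<i>, 0) f) \<xi>)
    + (\<i> * cnj (fst \<xi> $ \<beta>) * ddir v (ddir (0, 1) f) \<xi> + (\<i> * cnj (fst v $ \<beta>)) * ddir (0, 1) f \<xi>))) (at \<xi>)"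
    by (rule has_derivative_transform[rotated -1]) (simp_all add: Z_ddir)
  from ddir_eqI[OF this] show ?A by (simp add: field_simps)
  have "((\<lambda>\<xi>. (1/2) * (ddir (axis \<beta> 1, 0) f \<xi> + \<i> * ddir (axis \<beta> \<i>, 0) f \<xi>)
    - \<i> * (fst \<xi> $ \<beta>) * ddir (0, 1) f \<xi>) has_derivative
    (\<lambda>v. (1/2) * (ddir v (ddir (axis \<beta> 1, 0) f) \<xi> + \<i> * ddir v (ddir (axis \<beta> \<i>, 0) f) \<xi>)
    - (\<i> * (fst \<xi> $ \<beta>) * ddir v (ddir (0, 1) f) \<xi> + (\<i> * (fst v $ \<beta>)) * ddir (0, 1) f \<xi>))) (at \<xi>)"
    by (intro has_derivative_add has_derivative_mult_right has_derivative_diff has_derivative_mult d c)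
  then have "(Zbar \<beta> f has_derivative
    (\<lambda>v. (1/2) * (ddir v (ddir (axis \<beta> 1, 0) f) \<xi> + \<i> * ddir v (ddir (axis \<beta> \<i>, 0) f) \<xi>)
    - (\<i> * (fst \<xi> $ \<beta>) * ddir v (ddir (0, 1) f) \<xi> + (\<i> * (fst v $ \<beta>)) * ddir (0, 1) f \<xi>))) (at \<xi>)"
    by (rule has_derivative_transform[rotated -1]) (simp_all add: Zbar_ddir)
  from ddir_eqI[OF this] show ?B by (simp add: field_simps)
qed

text \<open>Second derivatives cancel by symmetry, which leaves the derivatives of the coefficients.
  They cancel as well, except for \<open>Zbar \<alpha>\<close> against \<open>Z \<alpha>\<close>,
  where the two contributions \<open>\<i> * dt f\<close> add up: the Heisenberg commutation
  relation.\<close>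

lemma Z_commute:
  assumes "open S" "smooth_on f S" "\<xi> \<in> S"
  shows "Z \<alpha> (Z \<beta> f) \<xi> = Z \<beta> (Z \<alpha> f) \<xi>"
    "Zbar \<alpha> (Zbar \<beta> f) \<xi> = Zbar \<beta> (Zbar \<alpha> f) \<xi>"
    "Zbar \<alpha> (Z \<beta> f) \<xi> = Z \<beta> (Zbar \<alpha> f) \<xi> + (if \<alpha> = \<beta> then 2 * \<i> * dt f \<xi> else 0)"
    "dt (Z \<alpha> f) \<xi> = Z \<alpha> (dt f) \<xi>"
    "dt (Zbar \<alpha> f) \<xi> = Zbar \<alpha> (dt f) \<xi>"
proof -
  note c = ddir_commute[OF assms]
  note d = ddir_Z[OF assms]
  show "Z \<alpha> (Z \<beta> f) \<xi> = Z \<beta> (Z \<alpha> f) \<xi>"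
    unfolding Z_ddir[of _ "Z _ f"] d
    unfolding c[of "(axis \<beta> _, _)" "(axis \<alpha> _, _)"] c[of "(axis _ _, _)" "(0, 1)"]
    by (auto simp: axis_def field_simps)
  show "Zbar \<alpha> (Zbar \<beta> f) \<xi> = Zbar \<beta> (Zbar \<alpha> f) \<xi>"
    unfolding Zbar_ddir[of _ "Zbar _ f"] d
    unfolding c[of "(axis \<beta> _, _)" "(axis \<alpha> _, _)"] c[of "(axis _ _, _)" "(0, 1)"]
    by (auto simp: axis_def field_simps)
  show "Zbar \<alpha> (Z \<beta> f) \<xi> = Z \<beta> (Zbar \<alpha> f) \<xi> + (if \<alpha> = \<beta> then 2 * \<i> * dt f \<xi> else 0)"
    unfolding Zbar_ddir[of _ "Z _ f"] Z_ddir[of _ "Zbar _ f"] d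
    unfolding c[of "(axis \<beta> _, _)" "(axis \<alpha> _, _)"] c[of "(axis _ _, _)" "(0, 1)"]
    by (auto simp: axis_def field_simps dt_ddir)
  show "dt (Z \<alpha> f) \<xi> = Z \<alpha> (dt f) \<xi>" "dt (Zbar \<alpha> f) \<xi> = Zbar \<alpha> (dt f) \<xi>"
    unfolding dt_ddir d Z_ddir Zbar_ddir c[of "(axis _ _, _)" "(0, 1)"] by simp_all
qed

text \<open>Serves the Kronecker delta in the tensor \<open>E\<close>.\<close>

lemma smooth_on_if: "smooth_on f S \<Longrightarrow> smooth_on (\<lambda>x. if b then f x else 0) S"
  by (cases b) (auto intro: smooth_on_const)

section \<open>The Jerison--Lee tensors\<close>

text \<open>
  Here \<open>f = ln u / n\<close>, \<open>p = n (q - 1) - 2\<close> and hence \<open>w = u powr (q - 1)\<close>; the functions \<open>ab\<close> and \<open>gb\<close>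
  are the conjugates of \<open>a\<close> and \<open>g\<close>. The critical exponent corresponds to \<open>p = 0\<close>.
\<close>

locale log_solution =
  fixes S :: "'n::finite heis set" and f :: "'n heis \<Rightarrow> real" and p :: real
    and F h w A g gb :: "'n heis \<Rightarrow> complex" and a ab :: "'n \<Rightarrow> 'n heis \<Rightarrow> complex"
    and nn :: complex
  defines F_def: "F \<equiv> (\<lambda>\<xi>. complex_of_real (f \<xi>))"
    and a_def: "a \<equiv> (\<lambda>\<alpha>. Z \<alpha> F)"
    and ab_def: "ab \<equiv> (\<lambda>\<alpha>. Zbar \<alpha> F)"
    and h_def: "h \<equiv> dt F"
    and w_def: "w \<equiv> (\<lambda>\<xi>. exp ((2 + complex_of_real p) * F \<xi>))"
    and A_def: "A \<equiv> (\<lambda>\<xi>. \<Sum>\<alpha>\<in>UNIV. a \<alpha> \<xi> * ab \<alpha> \<xi>)"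
    and g_def: "g \<equiv> (\<lambda>\<xi>. A \<xi> + w \<xi> - \<i> * h \<xi>)"
    and gb_def: "gb \<equiv> (\<lambda>\<xi>. A \<xi> + w \<xi> + \<i> * h \<xi>)"
    and nn_def: "nn \<equiv> of_nat CARD('n)"
  assumes S_open: "open S"
    and f_smooth: "smooth_on f S"
    and pde: "\<And>\<xi>. \<xi> \<in> S \<Longrightarrow> (\<Sum>\<alpha>\<in>UNIV. Zbar \<alpha> (Z \<alpha> F) \<xi>) = - nn * g \<xi>"
begin

text \<open>For \<open>p = 0\<close> the three tensors \<open>E\<close>, \<open>D\<close> and
  \<open>G\<close> vanish on the Jerison-Lee extremals, for instance if \<open>f\<close> is, up to a
  suitable additive constant, minus the logarithm of the modulus of
  \<open>t + \<i> * |z|^2 + c\<close> with \<open>Im c > 0\<close>. This fixes the factor 2 in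
  \<open>D\<close> and the choice of \<open>g\<close>.\<close>

definition E where "E \<alpha> \<beta> \<xi> = Zbar \<beta> (a \<alpha>) \<xi> + (if \<alpha> = \<beta> then g \<xi> else 0)"
definition D where "D \<alpha> \<beta> \<xi> = Z \<beta> (a \<alpha>) \<xi> - 2 * a \<alpha> \<xi> * a \<beta> \<xi>"
definition Dv where "Dv \<alpha> \<xi> = (\<Sum>\<beta>\<in>UNIV. D \<alpha> \<beta> \<xi> * ab \<beta> \<xi>)"
definition Ev where "Ev \<alpha> \<xi> = (\<Sum>\<beta>\<in>UNIV. E \<alpha> \<beta> \<xi> * a \<beta> \<xi>)"
definition G where "G \<alpha> \<xi> = \<i> * dt (a \<alpha>) \<xi> + g \<xi> * a \<alpha> \<xi>"
definition d where "d \<xi> = (\<Sum>\<alpha>\<in>UNIV. Dv \<alpha> \<xi> * ab \<alpha> \<xi>)"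
definition e where "e \<xi> = (\<Sum>\<alpha>\<in>UNIV. Ev \<alpha> \<xi> * ab \<alpha> \<xi>)"
definition c where "c \<xi> = (\<Sum>\<alpha>\<in>UNIV. G \<alpha> \<xi> * ab \<alpha> \<xi>)"

lemma sF: "smooth_on F S" unfolding F_def by (intro smooth_intros S_open f_smooth)
lemma sa: "smooth_on (a \<alpha>) S" unfolding a_def by (intro smooth_on_Z S_open sF)
lemma sab: "smooth_on (ab \<alpha>) S" unfolding ab_def by (intro smooth_on_Z S_open sF)
lemma sh: "smooth_on h S" unfolding h_def by (intro smooth_on_Z S_open sF)
lemma sw: "smooth_on w S" unfolding w_def by (intro smooth_intros S_open sF)
lemma sA: "smooth_on A S" unfolding A_def by (intro smooth_intros S_open sa sab)
lemma sg: "smooth_on g S" unfolding g_def by (intro smooth_intros S_open sA sw sh)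
lemma sgb: "smooth_on gb S" unfolding gb_def by (intro smooth_intros S_open sA sw sh)
lemma sE: "smooth_on (E \<alpha> \<beta>) S" unfolding E_def[abs_def] by (intro smooth_intros smooth_on_if smooth_on_Z S_open sa sg)
lemma sD: "smooth_on (D \<alpha> \<beta>) S" unfolding D_def[abs_def] by (intro smooth_intros smooth_on_Z S_open sa sg)
lemma sDv: "smooth_on (Dv \<alpha>) S" unfolding Dv_def[abs_def] by (intro smooth_intros S_open sD sab)
lemma sEv: "smooth_on (Ev \<alpha>) S" unfolding Ev_def[abs_def] by (intro smooth_intros S_open sE sa)
lemma sG: "smooth_on (G \<alpha>) S" unfolding G_def[abs_def] by (intro smooth_intros smooth_on_Z S_open sa sg)

lemma cnj_F: "cnj (F x) = F x" by (simp add: F_def)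

lemma cnj_w: "cnj (w x) = w x"
  by (simp add: w_def cnj_F exp_cnj)

lemmas smooths = sF sa sab sh sw sA sg sgb sE sD sDv sEv sG

context
  fixes \<xi> assumes xi: "\<xi> \<in> S"
begin

lemma differentiable_fields [simp]:
  "F differentiable (at \<xi>)" "a \<alpha> differentiable (at \<xi>)" "ab \<alpha> differentiable (at \<xi>)"
  "h differentiable (at \<xi>)" "w differentiable (at \<xi>)" "A differentiable (at \<xi>)"
  "g differentiable (at \<xi>)" "gb differentiable (at \<xi>)" "E \<alpha> \<beta> differentiable (at \<xi>)"
  "D \<alpha> \<beta> differentiable (at \<xi>)" "Dv \<alpha> differentiable (at \<xi>)" "Ev \<alpha> differentiable (at \<xi>)"
  "G \<alpha> differentiable (at \<xi>)" "dt F differentiable (at \<xi>)"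
  "Z \<beta> (a \<alpha>) differentiable (at \<xi>)" "Zbar \<beta> (a \<alpha>) differentiable (at \<xi>)" "dt (a \<alpha>) differentiable (at \<xi>)"
  "dt h differentiable (at \<xi>)"
  using smooths smooth_on_Z[OF S_open sa] smooth_on_Z[OF S_open sF] smooth_on_Z[OF S_open sh] smooth_on_differentiable[OF _ xi] by blast+

lemma cnj_a: "cnj (a \<alpha> \<xi>) = ab \<alpha> \<xi>" "cnj (ab \<alpha> \<xi>) = a \<alpha> \<xi>"
  using Z_cnj(1,2)[of F \<xi> \<alpha>] by (simp_all add: cnj_F a_def ab_def)

lemma cnj_h: "cnj (h \<xi>) = h \<xi>"
  using Z_cnj(3)[of F \<xi>] by (simp add: cnj_F h_def)

lemma cnj_A: "cnj (A \<xi>) = A \<xi>"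
  by (simp add: A_def cnj_a mult.commute)

lemma cnj_g: "cnj (g \<xi>) = gb \<xi>" "cnj (gb \<xi>) = g \<xi>"
  by (simp_all add: g_def gb_def cnj_A cnj_w cnj_h)

end

section \<open>Symmetries of the tensors and first derivatives of the scalars\<close>

lemma Zbar_real_cnj:
  assumes "\<xi> \<in> S" "smooth_on k S" "\<And>x. x \<in> S \<Longrightarrow> cnj (k x) = l x"
  shows "Zbar \<alpha> l \<xi> = cnj (Z \<alpha> k \<xi>)" "Z \<alpha> l \<xi> = cnj (Zbar \<alpha> k \<xi>)" "dt l \<xi> = cnj (dt k \<xi>)"
  using Z_cnj[OF smooth_on_differentiable[OF assms(2,1)]] Z_cong[OF S_open assms(1,3)]
  by simp_all

context
  fixes \<xi> assumes xi: "\<xi> \<in> S"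
begin

text \<open>Conjugation exchanges \<open>Zbar\<close> and \<open>Z\<close>; restoring their order
  costs \<open>2 * \<i> * h\<close> on the diagonal, and this is exactly \<open>gb - g\<close>. The
  imaginary part of \<open>g\<close> is there to make \<open>E\<close> Hermitian.\<close>

lemma cnj_E: "cnj (E \<alpha> \<beta> \<xi>) = E \<beta> \<alpha> \<xi>"
proof -
  have "cnj (Zbar \<beta> (a \<alpha>) \<xi>) = Z \<beta> (ab \<alpha>) \<xi>"
    using Zbar_real_cnj(2)[OF xi sa cnj_a(1)] by simp
  also have "\<dots> = Zbar \<alpha> (a \<beta>) \<xi> - (if \<alpha> = \<beta> then 2 * \<i> * h \<xi> else 0)"
    using Z_commute(3)[OF S_open sF xi, of \<alpha> \<beta>] by (simp add: a_def ab_def h_def)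
  finally show ?thesis by (simp add: E_def cnj_g[OF xi]) (auto simp: g_def gb_def)
qed

lemma D_sym: "D \<alpha> \<beta> \<xi> = D \<beta> \<alpha> \<xi>"
  using Z_commute(1)[OF S_open sF xi, of \<alpha> \<beta>] by (simp add: D_def a_def)

lemma Z_a: "Z \<beta> (a \<alpha>) \<xi> = D \<alpha> \<beta> \<xi> + 2 * a \<alpha> \<xi> * a \<beta> \<xi>"
  by (simp add: D_def)

lemma Zbar_a: "Zbar \<beta> (a \<alpha>) \<xi> = E \<alpha> \<beta> \<xi> - (if \<alpha> = \<beta> then g \<xi> else 0)"
  by (simp add: E_def)

lemma Z_ab: "Z \<beta> (ab \<alpha>) \<xi> = E \<beta> \<alpha> \<xi> - (if \<alpha> = \<beta> then gb \<xi> else 0)"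
proof -
  have "Z \<beta> (ab \<alpha>) \<xi> = cnj (Zbar \<beta> (a \<alpha>) \<xi>)"
    using Zbar_real_cnj(2)[OF xi sa cnj_a(1)] by simp
  then show ?thesis by (simp add: Zbar_a cnj_E cnj_g[OF xi])
qed

lemma Zbar_ab: "Zbar \<beta> (ab \<alpha>) \<xi> = cnj (D \<alpha> \<beta> \<xi>) + 2 * ab \<alpha> \<xi> * ab \<beta> \<xi>"
proof -
  have "Zbar \<beta> (ab \<alpha>) \<xi> = cnj (Z \<beta> (a \<alpha>) \<xi>)"
    using Zbar_real_cnj(1)[OF xi sa cnj_a(1)] by simp
  then show ?thesis by (simp add: Z_a cnj_a[OF xi])
qed

text \<open>This is the differential equation rewritten; in \<open>div_Ev\<close> it removes the
  term with \<open>g\<close>.\<close>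

lemma trace_E: "(\<Sum>\<alpha>\<in>UNIV. E \<alpha> \<alpha> \<xi>) = 0"
  using pde[OF xi] by (simp add: E_def sum.distrib nn_def a_def)

lemma dt_a: "dt (a \<alpha>) \<xi> = Z \<alpha> h \<xi>"
  using Z_commute(4)[OF S_open sF xi] by (simp add: a_def h_def)

lemma Z_h: "\<i> * Z \<alpha> h \<xi> = G \<alpha> \<xi> - g \<xi> * a \<alpha> \<xi>"
  by (simp add: G_def dt_a)

lemma Zbar_h: "\<i> * Zbar \<alpha> h \<xi> = gb \<xi> * ab \<alpha> \<xi> - cnj (G \<alpha> \<xi>)"
proof -
  have "Zbar \<alpha> h \<xi> = cnj (Z \<alpha> h \<xi>)"
    using Zbar_real_cnj(1)[OF xi sh cnj_h] by simp
  then have "\<i> * Zbar \<alpha> h \<xi> = - cnj (\<i> * Z \<alpha> h \<xi>)" by simp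
  also have "\<dots> = gb \<xi> * ab \<alpha> \<xi> - cnj (G \<alpha> \<xi>)"
    unfolding Z_h by (simp add: cnj_g[OF xi] cnj_a[OF xi])
  finally show ?thesis .
qed

lemma Z_w: "Z \<alpha> w \<xi> = (2 + p) * w \<xi> * a \<alpha> \<xi>" "dt w \<xi> = (2 + p) * w \<xi> * h \<xi>"
  unfolding w_def using differentiable_fields(1)[OF xi] by (simp_all add: Z_exp Z_cmult a_def h_def)

lemma Z_A: "Z \<alpha> A \<xi> = Dv \<alpha> \<xi> + Ev \<alpha> \<xi> + (2 * A \<xi> - gb \<xi>) * a \<alpha> \<xi>"
proof -
  have "Z \<alpha> A \<xi> = (\<Sum>\<beta>\<in>UNIV. a \<beta> \<xi> * Z \<alpha> (ab \<beta>) \<xi> + Z \<alpha> (a \<beta>) \<xi> * ab \<beta> \<xi>)"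
    unfolding A_def using differentiable_fields[OF xi] by (simp add: Z_sum Z_mult)
  also have "\<dots> = (\<Sum>\<beta>\<in>UNIV. E \<alpha> \<beta> \<xi> * a \<beta> \<xi> + D \<alpha> \<beta> \<xi> * ab \<beta> \<xi>
      + 2 * a \<alpha> \<xi> * (a \<beta> \<xi> * ab \<beta> \<xi>) - (if \<beta> = \<alpha> then gb \<xi> * a \<beta> \<xi> else 0))"
    by (intro sum.cong refl) (auto simp: Z_ab Z_a D_sym[of _ \<alpha>] algebra_simps)
  also have "\<dots> = Dv \<alpha> \<xi> + Ev \<alpha> \<xi> + (2 * A \<xi> - gb \<xi>) * a \<alpha> \<xi>"
    by (simp add: sum.distrib sum_subtractf Dv_def Ev_def A_def sum_distrib_left algebra_simps)
  finally show ?thesis .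
qed

lemma Z_g: "Z \<alpha> g \<xi> = Dv \<alpha> \<xi> + Ev \<alpha> \<xi> - G \<alpha> \<xi> + 2 * g \<xi> * a \<alpha> \<xi> + p * w \<xi> * a \<alpha> \<xi>"
proof -
  have "Z \<alpha> g \<xi> = Z \<alpha> A \<xi> + Z \<alpha> w \<xi> - \<i> * Z \<alpha> h \<xi>"
    unfolding g_def using differentiable_fields[OF xi] by (simp add: Z_diff Z_add Z_cmult)
  then show ?thesis unfolding Z_A Z_w Z_h by (simp add: g_def gb_def algebra_simps)
qed

text \<open>Since \<open>2 * A + 2 * w = g + gb\<close>, all multiples of \<open>a \<alpha>\<close>
  cancel except \<open>p * w * a \<alpha>\<close>, the only trace of the subcritical
  exponent.\<close>

lemma Z_gb: "Z \<alpha> gb \<xi> = Dv \<alpha> \<xi> + Ev \<alpha> \<xi> + G \<alpha> \<xi> + p * w \<xi> * a \<alpha> \<xi>"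
proof -
  have "Z \<alpha> gb \<xi> = Z \<alpha> A \<xi> + Z \<alpha> w \<xi> + \<i> * Z \<alpha> h \<xi>"
    unfolding gb_def using differentiable_fields[OF xi] by (simp add: Z_diff Z_add Z_cmult)
  then show ?thesis unfolding Z_A Z_w Z_h by (simp add: g_def gb_def algebra_simps)
qed

lemma Zbar_g: "Zbar \<alpha> g \<xi> = cnj (Dv \<alpha> \<xi> + Ev \<alpha> \<xi> + G \<alpha> \<xi> + p * w \<xi> * a \<alpha> \<xi>)"
  using Zbar_real_cnj(1)[OF xi sgb cnj_g(2)] Z_gb by simp

lemma Zbar_A: "Zbar \<alpha> A \<xi> = cnj (Dv \<alpha> \<xi> + Ev \<alpha> \<xi> + (2 * A \<xi> - gb \<xi>) * a \<alpha> \<xi>)"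
  using Zbar_real_cnj(1)[OF xi sA cnj_A] Z_A by simp

lemma Zbar_w: "Zbar \<alpha> w \<xi> = (2 + p) * w \<xi> * ab \<alpha> \<xi>"
  using Zbar_real_cnj(1)[OF xi sw, of w] Z_w by (simp add: cnj_w cnj_a[OF xi])

lemma dt_g: "\<i> * dt g \<xi> = c \<xi> - cnj (c \<xi>) + 2 * \<i> * A \<xi> * h \<xi> + (2 + p) * \<i> * w \<xi> * h \<xi> + dt h \<xi>"
proof -
  have "dt A \<xi> = (\<Sum>\<beta>\<in>UNIV. a \<beta> \<xi> * dt (ab \<beta>) \<xi> + dt (a \<beta>) \<xi> * ab \<beta> \<xi>)"
    unfolding A_def using differentiable_fields[OF xi] by (simp add: Z_sum Z_mult)
  moreover have "dt (ab \<beta>) \<xi> = Zbar \<beta> h \<xi>" for \<beta>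
    using Z_commute(5)[OF S_open sF xi] by (simp add: ab_def h_def)
  ultimately have "\<i> * dt A \<xi> = (\<Sum>\<beta>\<in>UNIV. a \<beta> \<xi> * (\<i> * Zbar \<beta> h \<xi>) + (\<i> * Z \<beta> h \<xi>) * ab \<beta> \<xi>)"
    by (simp add: sum_distrib_left dt_a algebra_simps)
  also have "\<dots> = (\<Sum>\<beta>\<in>UNIV. gb \<xi> * (a \<beta> \<xi> * ab \<beta> \<xi>) - cnj (G \<beta> \<xi> * ab \<beta> \<xi>) + (G \<beta> \<xi> * ab \<beta> \<xi>) - g \<xi> * (a \<beta> \<xi> * ab \<beta> \<xi>))"
    unfolding Z_h Zbar_h by (intro sum.cong refl) (simp add: algebra_simps cnj_a[OF xi])
  also have "\<dots> = (gb \<xi> - g \<xi>) * A \<xi> + c \<xi> - cnj (c \<xi>)"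
    by (simp add: sum.distrib sum_subtractf A_def c_def sum_distrib_left[symmetric] algebra_simps)
  finally have 1: "\<i> * dt A \<xi> = (gb \<xi> - g \<xi>) * A \<xi> + c \<xi> - cnj (c \<xi>)" .
  have "dt g \<xi> = dt A \<xi> + dt w \<xi> - \<i> * dt h \<xi>"
    unfolding g_def using differentiable_fields[OF xi] by (simp add: Z_diff Z_add Z_cmult)
  then have "\<i> * dt g \<xi> = \<i> * (dt A \<xi> + dt w \<xi> - \<i> * dt h \<xi>)" by (simp only:)
  then have "\<i> * dt g \<xi> = \<i> * dt A \<xi> + \<i> * dt w \<xi> + dt h \<xi>" by (simp add: algebra_simps del: mult_left_cancel mult_cancel_left)
  then show ?thesis unfolding 1 Z_w by (simp add: g_def gb_def algebra_simps)
qed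

lemma div_a: "(\<Sum>\<alpha>\<in>UNIV. Zbar \<alpha> (a \<alpha>) \<xi>) = - nn * g \<xi>"
  using pde[OF xi] by (simp add: a_def)

end

section \<open>Divergences of the tensors\<close>

context
  fixes \<xi> assumes xi: "\<xi> \<in> S"
begin

text \<open>Moving \<open>Zbar \<alpha>\<close> past \<open>Z \<beta>\<close> yields the divergence
  of \<open>a\<close>, known from the equation, and the commutator
  \<open>2 * \<i> * dt (a \<beta>)\<close>, which joins \<open>2 * g * a \<beta>\<close> to form
  \<open>2 * G \<beta>\<close>.\<close>

lemma div_D: "(\<Sum>\<alpha>\<in>UNIV. Zbar \<alpha> (D \<alpha> \<beta>) \<xi>)
   = - nn * Dv \<beta> \<xi> - (nn + 2) * (Ev \<beta> \<xi> - G \<beta> \<xi>) - nn * p * w \<xi> * a \<beta> \<xi>"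
proof -
  have "Zbar \<alpha> (D \<alpha> \<beta>) \<xi> = Zbar \<alpha> (Z \<beta> (a \<alpha>)) \<xi>
      - (2 * a \<alpha> \<xi> * Zbar \<alpha> (a \<beta>) \<xi> + 2 * Zbar \<alpha> (a \<alpha>) \<xi> * a \<beta> \<xi>)" for \<alpha>
    unfolding D_def[abs_def] using differentiable_fields[OF xi] by (simp add: Z_diff Z_mult Z_cmult)
  also have "\<dots> \<alpha> = Z \<beta> (Zbar \<alpha> (a \<alpha>)) \<xi> + (if \<alpha> = \<beta> then 2 * \<i> * dt (a \<alpha>) \<xi> else 0)
      - 2 * (E \<beta> \<alpha> \<xi> * a \<alpha> \<xi>) + (if \<alpha> = \<beta> then 2 * g \<xi> * a \<alpha> \<xi> else 0)
      - 2 * a \<beta> \<xi> * Zbar \<alpha> (a \<alpha>) \<xi>" for \<alpha>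
    using Z_commute(3)[OF S_open sa xi, of \<alpha> \<beta> \<alpha>] by (auto simp: Zbar_a[OF xi] algebra_simps)
  finally have "(\<Sum>\<alpha>\<in>UNIV. Zbar \<alpha> (D \<alpha> \<beta>) \<xi>) = (\<Sum>\<alpha>\<in>UNIV. Z \<beta> (Zbar \<alpha> (a \<alpha>)) \<xi>)
      + 2 * \<i> * dt (a \<beta>) \<xi> - 2 * Ev \<beta> \<xi> + 2 * g \<xi> * a \<beta> \<xi>
      - 2 * a \<beta> \<xi> * (- nn * g \<xi>)"
    unfolding div_a[OF xi, symmetric]
    by (simp add: sum.distrib sum_subtractf Ev_def sum_distrib_left)
  also have "(\<Sum>\<alpha>\<in>UNIV. Z \<beta> (Zbar \<alpha> (a \<alpha>)) \<xi>) = Z \<beta> (\<lambda>\<xi>. \<Sum>\<alpha>\<in>UNIV. Zbar \<alpha> (a \<alpha>) \<xi>) \<xi>"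
    using differentiable_fields[OF xi] by (simp add: Z_sum)
  also have "\<dots> = Z \<beta> (\<lambda>\<xi>. - nn * g \<xi>) \<xi>"
    by (rule Z_cong[OF S_open xi]) (use div_a in auto)
  also have "\<dots> = - nn * Z \<beta> g \<xi>" using differentiable_fields[OF xi] by (simp add: Z_minus Z_cmult)
  finally show ?thesis unfolding Z_g[OF xi]
    by (simp add: G_def algebra_simps)
qed

text \<open>The fields \<open>Zbar\<close> commute among themselves, so the derivative
  \<open>Zbar \<beta>\<close> falls on the divergence of \<open>a\<close> and the equation gives
  \<open>- nn * Zbar \<beta> g\<close>; the diagonal part of \<open>E\<close> adds one more
  \<open>Zbar \<beta> g\<close>.\<close>

lemma div_E: "(\<Sum>\<alpha>\<in>UNIV. Zbar \<alpha> (E \<alpha> \<beta>) \<xi>)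
   = (1 - nn) * cnj (Dv \<beta> \<xi> + Ev \<beta> \<xi> + G \<beta> \<xi> + p * w \<xi> * a \<beta> \<xi>)"
proof -
  have "Zbar \<alpha> (E \<alpha> \<beta>) \<xi> = Zbar \<beta> (Zbar \<alpha> (a \<alpha>)) \<xi> + (if \<alpha> = \<beta> then Zbar \<alpha> g \<xi> else 0)" for \<alpha>
    unfolding E_def[abs_def] using differentiable_fields[OF xi] Z_commute(2)[OF S_open sa xi, of \<alpha> \<beta> \<alpha>] by (simp add: Z_add)
  then have "(\<Sum>\<alpha>\<in>UNIV. Zbar \<alpha> (E \<alpha> \<beta>) \<xi>) = (\<Sum>\<alpha>\<in>UNIV. Zbar \<beta> (Zbar \<alpha> (a \<alpha>)) \<xi>) + Zbar \<beta> g \<xi>"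
    by (simp add: sum.distrib)
  also have "(\<Sum>\<alpha>\<in>UNIV. Zbar \<beta> (Zbar \<alpha> (a \<alpha>)) \<xi>) = Zbar \<beta> (\<lambda>\<xi>. \<Sum>\<alpha>\<in>UNIV. Zbar \<alpha> (a \<alpha>) \<xi>) \<xi>"
    using differentiable_fields[OF xi] by (simp add: Z_sum)
  also have "\<dots> = Zbar \<beta> (\<lambda>\<xi>. - nn * g \<xi>) \<xi>"
    by (rule Z_cong[OF S_open xi]) (use div_a in auto)
  also have "\<dots> = - nn * Zbar \<beta> g \<xi>" using differentiable_fields[OF xi] by (simp add: Z_minus Z_cmult)
  finally show ?thesis unfolding Zbar_g[OF xi] by (simp add: algebra_simps)
qed

text \<open>\<open>Zbar \<alpha>\<close> commutes with \<open>dt\<close>, so the equation can be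
  inserted under \<open>dt\<close>, and \<open>dt_g\<close> and \<open>Zbar_g\<close> express the
  result by the contractions \<open>c\<close>, \<open>d\<close> and \<open>e\<close>.\<close>

lemma div_G: "(\<Sum>\<alpha>\<in>UNIV. Zbar \<alpha> (G \<alpha>) \<xi>)
   = - nn * (c \<xi> - cnj (c \<xi>)) - 2 * \<i> * nn * A \<xi> * h \<xi> - (2 + p) * \<i> * nn * w \<xi> * h \<xi> - nn * dt h \<xi>
     + cnj (d \<xi>) + cnj (e \<xi>) + cnj (c \<xi>) + p * w \<xi> * A \<xi> - nn * g \<xi> ^ 2"
proof -
  have "Zbar \<alpha> (G \<alpha>) \<xi> = \<i> * Zbar \<alpha> (dt (a \<alpha>)) \<xi> + (g \<xi> * Zbar \<alpha> (a \<alpha>) \<xi> + Zbar \<alpha> g \<xi> * a \<alpha> \<xi>)" for \<alpha>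
    unfolding G_def[abs_def] using differentiable_fields[OF xi] by (simp add: Z_add Z_mult Z_cmult)
  also have "\<dots> \<alpha> = \<i> * dt (Zbar \<alpha> (a \<alpha>)) \<xi> + g \<xi> * Zbar \<alpha> (a \<alpha>) \<xi>
     + (cnj (Dv \<alpha> \<xi> * ab \<alpha> \<xi>) + cnj (Ev \<alpha> \<xi> * ab \<alpha> \<xi>) + cnj (G \<alpha> \<xi> * ab \<alpha> \<xi>) + p * w \<xi> * (a \<alpha> \<xi> * ab \<alpha> \<xi>))" for \<alpha>
    using Z_commute(5)[OF S_open sa xi, of \<alpha> \<alpha>] cnj_w by (simp add: Zbar_g[OF xi] cnj_a[OF xi] algebra_simps)
  finally have "(\<Sum>\<alpha>\<in>UNIV. Zbar \<alpha> (G \<alpha>) \<xi>) = \<i> * (\<Sum>\<alpha>\<in>UNIV. dt (Zbar \<alpha> (a \<alpha>)) \<xi>)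
    + g \<xi> * (- nn * g \<xi>) + (cnj (d \<xi>) + cnj (e \<xi>) + cnj (c \<xi>) + p * w \<xi> * A \<xi>)"
    unfolding div_a[OF xi, symmetric] d_def e_def c_def A_def
    by (simp add: sum.distrib sum_distrib_left)
  also have "(\<Sum>\<alpha>\<in>UNIV. dt (Zbar \<alpha> (a \<alpha>)) \<xi>) = dt (\<lambda>\<xi>. \<Sum>\<alpha>\<in>UNIV. Zbar \<alpha> (a \<alpha>) \<xi>) \<xi>"
    using differentiable_fields[OF xi] by (simp add: Z_sum)
  also have "\<dots> = dt (\<lambda>\<xi>. - nn * g \<xi>) \<xi>"
    by (rule Z_cong[OF S_open xi]) (use div_a in auto)
  also have "\<dots> = - nn * dt g \<xi>" using differentiable_fields[OF xi] by (simp add: Z_minus Z_cmult)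
  also have "\<i> * (- nn * dt g \<xi>) = - nn * (\<i> * dt g \<xi>)" by simp
  finally show ?thesis unfolding dt_g[OF xi]
    by (simp add: algebra_simps power2_eq_square)
qed

end

end

section \<open>The divergence of the field \<open>V\<close>\<close>

lemma cnj_mult_of_real: "cnj z * z = complex_of_real ((cmod z)\<^sup>2)" "z * cnj z = complex_of_real ((cmod z)\<^sup>2)"
  by (metis complex_norm_square mult.commute)+

lemma div_Zbar_mult:
  assumes "k differentiable (at \<xi>)" "\<And>\<alpha>. X \<alpha> differentiable (at \<xi>)"
  shows "(\<Sum>\<alpha>\<in>UNIV. Zbar \<alpha> (\<lambda>x. k x * X \<alpha> x) \<xi>)
    = k \<xi> * (\<Sum>\<alpha>\<in>UNIV. Zbar \<alpha> (X \<alpha>) \<xi>) + (\<Sum>\<alpha>\<in>UNIV. Zbar \<alpha> k \<xi> * X \<alpha> \<xi>)"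
  using assms by (simp add: Z_mult sum.distrib sum_distrib_left)

lemma sum_split_factor:
  fixes q :: complex
  shows "(\<Sum>\<alpha>\<in>I. (P \<alpha> + q * r \<alpha>) * X \<alpha>) = (\<Sum>\<alpha>\<in>I. P \<alpha> * X \<alpha>) + q * (\<Sum>\<alpha>\<in>I. X \<alpha> * r \<alpha>)"
  by (simp add: sum_distrib_left sum.distrib algebra_simps)

text \<open>
  The part of the divergence of \<open>V\<close> that involves only scalars; \<open>nE\<close> and \<open>nD\<close> stand for the squared
  norms of \<open>E\<close> and \<open>D\<close>, and \<open>h0\<close> for \<open>dt h\<close>, which drops out of the real part.
\<close>

lemma divergence_scalar_part:
  fixes d c A w h e h0 g gb nn :: complex and rA rw rh re nE nD n p rh0 :: real
  assumes "g = A + w - \<i> * h" "gb = A + w + \<i> * h" "A = of_real rA" "w = of_real rw" "h = of_real rh"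
    "e = of_real re" "nn = of_real n" "h0 = of_real rh0"
  shows "Re ((3 * gb + of_real p * w) * e + (of_real p * w - gb) * d - 3 * gb * c
   + (g + 3 * \<i> * h) * (of_real nE + (1 - nn) * (cnj d + e + cnj c + of_real p * w * A))
   + (g - \<i> * h) * (of_real nD + 2 * d - nn * d - (nn + 2) * (e - c) - nn * of_real p * w * A)
   - 3 * \<i> * h * (- nn * (c - cnj c) - 2 * \<i> * nn * A * h - of_real (2 + p) * \<i> * nn * w * h - nn * h0
     + cnj d + e + cnj c + of_real p * w * A - nn * g ^ 2)
   + 2 * (nn - 1) * ((g + 3 * \<i> * h) * e + (g - \<i> * h) * d - 3 * \<i> * h * c))
   = (rA + rw) * (nE + nD) + p * rw * (re + Re d) - (2 * n - 1) * p * rw * rA * (rA + rw) - 3 * n * p * rw * rh\<^sup>2"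
  unfolding assms by (simp add: power2_eq_square algebra_simps)

text \<open>The part of \<open>div_V\<close> quadratic in the contracted tensors falls into the
  squares summed in \<open>SG\<close>, \<open>SX\<close> and \<open>SY\<close>; the leftover
  \<open>2 * Re (D * cnj E)\<close> has no sign and is left to \<open>pos_DE\<close>.\<close>

lemma Re_quadratic_cross_terms:
  "Re (cnj (D + E - 2 * G) * E + cnj (D + E + 2 * G) * D + 3 * cnj G * G)
    = (cmod G)\<^sup>2 + (cmod (G + D))\<^sup>2 + (cmod (G - E))\<^sup>2 + 2 * Re (D * cnj E)"
  unfolding cmod_power2 by (simp add: power2_eq_square algebra_simps)

lemma cmod_sq_expand:
  "(cmod (D * cnj c + E * b))\<^sup>2 = (cmod D)\<^sup>2 * (cmod c)\<^sup>2 + (cmod b)\<^sup>2 * (cmod E)\<^sup>2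
    + 2 * Re (D * cnj b * cnj (E * c))"
  "(cmod (D + of_real (p / 2) * b * c))\<^sup>2 = (cmod D)\<^sup>2 + p * Re (D * cnj c * cnj b) + p\<^sup>2 / 4 * ((cmod b)\<^sup>2 * (cmod c)\<^sup>2)"
  unfolding cmod_power2 by (simp_all add: power2_eq_square field_simps)

context log_solution begin

text \<open>
  The coefficients of \<open>V\<close> are chosen so that the cross terms in its divergence, weighted by
  \<open>weight = u powr (2 (n - 1) / n)\<close>, combine into the squares collected in \<open>SG\<close>, \<open>SX\<close>, \<open>SY\<close>
  and in \<open>pos_DE\<close>.
\<close>

definition V where "V \<alpha> \<xi> = (g \<xi> + 3 * \<i> * h \<xi>) * Ev \<alpha> \<xi> + (g \<xi> - \<i> * h \<xi>) * Dv \<alpha> \<xi> - 3 * \<i> * h \<xi> * G \<alpha> \<xi>"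
definition weight where "weight \<xi> = exp (2 * (nn - 1) * F \<xi>)"
definition nE where "nE \<xi> = (\<Sum>\<alpha>\<in>UNIV. \<Sum>\<beta>\<in>UNIV. (cmod (E \<alpha> \<beta> \<xi>))\<^sup>2)"
definition nD where "nD \<xi> = (\<Sum>\<alpha>\<in>UNIV. \<Sum>\<beta>\<in>UNIV. (cmod (D \<alpha> \<beta> \<xi>))\<^sup>2)"

definition rA where "rA x = Re (A x)"
definition rw where "rw x = Re (w x)"
definition rh where "rh x = Re (h x)"
definition SG where "SG x = (\<Sum>\<alpha>\<in>UNIV. (cmod (G \<alpha> x))\<^sup>2)"
definition SX where "SX x = (\<Sum>\<alpha>\<in>UNIV. (cmod (G \<alpha> x + Dv \<alpha> x))\<^sup>2)"
definition SY where "SY x = (\<Sum>\<alpha>\<in>UNIV. (cmod (G \<alpha> x - Ev \<alpha> x))\<^sup>2)"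

lemma rw_pos: "rw x > 0" and w_real: "w x = of_real (rw x)"
proof -
  have "w x = of_real (exp ((2 + p) * f x))"
    unfolding w_def F_def by (simp flip: exp_of_real)
  then show "rw x > 0" "w x = of_real (rw x)" by (auto simp: rw_def)
qed

lemma sV: "smooth_on (V \<alpha>) S" unfolding V_def[abs_def] by (intro smooth_intros S_open sg sh sEv sDv sG)
lemma s_weight: "smooth_on weight S" unfolding weight_def[abs_def] by (intro smooth_intros S_open sF)

context
  fixes \<xi> assumes xi: "\<xi> \<in> S"
begin

lemma differentiable_V_weight [simp]: "V \<alpha> differentiable (at \<xi>)" "weight differentiable (at \<xi>)"
  using smooth_on_differentiable[OF _ xi] sV s_weight by blast+

lemma cnj_e: "cnj (e \<xi>) = e \<xi>"
proof -
  have "e \<xi> = (\<Sum>\<alpha>\<in>UNIV. \<Sum>\<beta>\<in>UNIV. E \<alpha> \<beta> \<xi> * a \<beta> \<xi> * ab \<alpha> \<xi>)"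
    by (simp add: e_def Ev_def sum_distrib_right)
  also have "\<dots> = (\<Sum>\<beta>\<in>UNIV. \<Sum>\<alpha>\<in>UNIV. E \<alpha> \<beta> \<xi> * a \<beta> \<xi> * ab \<alpha> \<xi>)" by (rule sum.swap)
  also have "\<dots> = cnj (e \<xi>)"
    by (simp add: e_def Ev_def sum_distrib_right sum_distrib_left cnj_E[OF xi] cnj_a[OF xi] mult_ac)
  finally show ?thesis by simp
qed

text \<open>\<open>Zbar \<alpha> (a \<beta>)\<close> is \<open>E \<beta> \<alpha>\<close> up to a
  multiple of the identity. By Hermitian symmetry the first part contracts with \<open>E\<close> to
  its squared norm; the second meets the trace of \<open>E\<close> and vanishes.\<close>

lemma div_Ev: "(\<Sum>\<alpha>\<in>UNIV. Zbar \<alpha> (Ev \<alpha>) \<xi>)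
  = of_real (nE \<xi>) + (1 - nn) * (cnj (d \<xi>) + e \<xi> + cnj (c \<xi>) + p * w \<xi> * A \<xi>)"
proof -
  have "(\<Sum>\<alpha>\<in>UNIV. Zbar \<alpha> (Ev \<alpha>) \<xi>)
    = (\<Sum>\<alpha>\<in>UNIV. \<Sum>\<beta>\<in>UNIV. E \<alpha> \<beta> \<xi> * Zbar \<alpha> (a \<beta>) \<xi>) + (\<Sum>\<alpha>\<in>UNIV. \<Sum>\<beta>\<in>UNIV. Zbar \<alpha> (E \<alpha> \<beta>) \<xi> * a \<beta> \<xi>)"
    unfolding Ev_def[abs_def] using differentiable_fields[OF xi] by (simp add: Z_sum Z_mult sum.distrib)
  also have "(\<Sum>\<alpha>\<in>UNIV. \<Sum>\<beta>\<in>UNIV. E \<alpha> \<beta> \<xi> * Zbar \<alpha> (a \<beta>) \<xi>) =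
     (\<Sum>\<alpha>\<in>UNIV. (\<Sum>\<beta>\<in>UNIV. E \<alpha> \<beta> \<xi> * E \<beta> \<alpha> \<xi>) - g \<xi> * E \<alpha> \<alpha> \<xi>)"
    unfolding Zbar_a[OF xi] by (simp add: right_diff_distrib sum_subtractf if_distrib[of "\<lambda>x. _ * x"] mult.commute cong: if_cong)
  also have "\<dots> = of_real (nE \<xi>)"
  proof -
    have "E \<alpha> \<beta> \<xi> * E \<beta> \<alpha> \<xi> = of_real ((cmod (E \<alpha> \<beta> \<xi>))\<^sup>2)" for \<alpha> \<beta>
      using cnj_mult_of_real(2)[of "E \<alpha> \<beta> \<xi>"] unfolding cnj_E[OF xi] .
    then show ?thesis
      unfolding sum_subtractf sum_distrib_left[symmetric] trace_E[OF xi] by (simp add: nE_def)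
  qed
  also have "(\<Sum>\<alpha>\<in>UNIV. \<Sum>\<beta>\<in>UNIV. Zbar \<alpha> (E \<alpha> \<beta>) \<xi> * a \<beta> \<xi>) = (\<Sum>\<beta>\<in>UNIV. (\<Sum>\<alpha>\<in>UNIV. Zbar \<alpha> (E \<alpha> \<beta>) \<xi>) * a \<beta> \<xi>)"
    by (subst sum.swap) (simp add: sum_distrib_right)
  also have "\<dots> = (\<Sum>\<beta>\<in>UNIV. (1 - nn) * (cnj (Dv \<beta> \<xi> * ab \<beta> \<xi>) + cnj (Ev \<beta> \<xi> * ab \<beta> \<xi>) + cnj (G \<beta> \<xi> * ab \<beta> \<xi>) + p * w \<xi> * (a \<beta> \<xi> * ab \<beta> \<xi>)))"
    unfolding div_E[OF xi] by (intro sum.cong refl) (simp add: cnj_a[OF xi] cnj_w algebra_simps)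
  also have "\<dots> = (1 - nn) * (cnj (d \<xi>) + cnj (e \<xi>) + cnj (c \<xi>) + p * w \<xi> * A \<xi>)"
    by (simp add: sum_distrib_left[symmetric] sum.distrib d_def e_def c_def A_def)
  finally show ?thesis by (simp add: cnj_e)
qed

text \<open>\<open>Zbar \<alpha> (ab \<beta>)\<close> is the conjugate of \<open>D\<close> plus a
  quadratic term: the former contracts with \<open>D\<close> to its squared norm, the latter gives
  \<open>2 * d\<close>.\<close>

lemma div_Dv: "(\<Sum>\<alpha>\<in>UNIV. Zbar \<alpha> (Dv \<alpha>) \<xi>)
  = of_real (nD \<xi>) + 2 * d \<xi> - nn * d \<xi> - (nn + 2) * (e \<xi> - c \<xi>) - nn * p * w \<xi> * A \<xi>"
proof -
  have "(\<Sum>\<alpha>\<in>UNIV. Zbar \<alpha> (Dv \<alpha>) \<xi>)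
    = (\<Sum>\<alpha>\<in>UNIV. \<Sum>\<beta>\<in>UNIV. D \<alpha> \<beta> \<xi> * Zbar \<alpha> (ab \<beta>) \<xi>) + (\<Sum>\<alpha>\<in>UNIV. \<Sum>\<beta>\<in>UNIV. Zbar \<alpha> (D \<alpha> \<beta>) \<xi> * ab \<beta> \<xi>)"
    unfolding Dv_def[abs_def] using differentiable_fields[OF xi] by (simp add: Z_sum Z_mult sum.distrib)
  also have "(\<Sum>\<alpha>\<in>UNIV. \<Sum>\<beta>\<in>UNIV. D \<alpha> \<beta> \<xi> * Zbar \<alpha> (ab \<beta>) \<xi>) =
     (\<Sum>\<alpha>\<in>UNIV. \<Sum>\<beta>\<in>UNIV. of_real ((cmod (D \<alpha> \<beta> \<xi>))\<^sup>2) + 2 * (D \<alpha> \<beta> \<xi> * ab \<beta> \<xi> * ab \<alpha> \<xi>))"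
    unfolding Zbar_ab[OF xi] cnj_mult_of_real[symmetric]
    by (intro sum.cong refl) (simp add: algebra_simps D_sym[OF xi])
  also have "\<dots> = of_real (nD \<xi>) + 2 * d \<xi>"
    by (simp add: sum.distrib nD_def d_def Dv_def sum_distrib_right sum_distrib_left)
  also have "(\<Sum>\<alpha>\<in>UNIV. \<Sum>\<beta>\<in>UNIV. Zbar \<alpha> (D \<alpha> \<beta>) \<xi> * ab \<beta> \<xi>) = (\<Sum>\<beta>\<in>UNIV. (\<Sum>\<alpha>\<in>UNIV. Zbar \<alpha> (D \<alpha> \<beta>) \<xi>) * ab \<beta> \<xi>)"
    by (subst sum.swap) (simp add: sum_distrib_right)
  also have "\<dots> = (\<Sum>\<beta>\<in>UNIV. - nn * (Dv \<beta> \<xi> * ab \<beta> \<xi>) - (nn + 2) * (Ev \<beta> \<xi> * ab \<beta> \<xi> - G \<beta> \<xi> * ab \<beta> \<xi>) - nn * p * w \<xi> * (a \<beta> \<xi> * ab \<beta> \<xi>))"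
    unfolding div_D[OF xi] by (intro sum.cong refl) (simp add: algebra_simps)
  also have "\<dots> = - nn * d \<xi> - (nn + 2) * (e \<xi> - c \<xi>) - nn * p * w \<xi> * A \<xi>"
    unfolding d_def e_def c_def A_def by (simp only: sum_distrib_left[symmetric] sum_subtractf)
  finally show ?thesis by simp
qed

text \<open>The summands are grouped for use: first the sum quadratic in the tensors, for
  \<open>Re_quadratic_cross_terms\<close>, then the scalar expression treated by
  \<open>divergence_scalar_part\<close>.\<close>

lemma div_V: "(\<Sum>\<alpha>\<in>UNIV. Zbar \<alpha> (V \<alpha>) \<xi>) =
   (\<Sum>\<alpha>\<in>UNIV. cnj (Dv \<alpha> \<xi> + Ev \<alpha> \<xi> - 2 * G \<alpha> \<xi>) * Ev \<alpha> \<xi> + cnj (Dv \<alpha> \<xi> + Ev \<alpha> \<xi> + 2 * G \<alpha> \<xi>) * Dv \<alpha> \<xi>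
      + 3 * cnj (G \<alpha> \<xi>) * G \<alpha> \<xi>)
   + (3 * gb \<xi> + p * w \<xi>) * e \<xi> + (p * w \<xi> - gb \<xi>) * d \<xi> - 3 * gb \<xi> * c \<xi>
   + (g \<xi> + 3 * \<i> * h \<xi>) * (of_real (nE \<xi>) + (1 - nn) * (cnj (d \<xi>) + e \<xi> + cnj (c \<xi>) + p * w \<xi> * A \<xi>))
   + (g \<xi> - \<i> * h \<xi>) * (of_real (nD \<xi>) + 2 * d \<xi> - nn * d \<xi> - (nn + 2) * (e \<xi> - c \<xi>) - nn * p * w \<xi> * A \<xi>)
   - 3 * \<i> * h \<xi> * (- nn * (c \<xi> - cnj (c \<xi>)) - 2 * \<i> * nn * A \<xi> * h \<xi> - (2 + p) * \<i> * nn * w \<xi> * h \<xi> - nn * dt h \<xi>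
     + cnj (d \<xi>) + e \<xi> + cnj (c \<xi>) + p * w \<xi> * A \<xi> - nn * g \<xi> ^ 2)"
proof -
  \<comment> \<open>The scalar coefficients of \<open>V\<close> differentiate to conjugated tensors
    plus multiples of \<open>ab \<alpha>\<close>; the latter contract with the tensors to
    \<open>e\<close>, \<open>d\<close> and \<open>c\<close>.\<close>
  have 1: "Zbar \<alpha> (\<lambda>\<xi>. g \<xi> + 3 * \<i> * h \<xi>) \<xi> = cnj (Dv \<alpha> \<xi> + Ev \<alpha> \<xi> - 2 * G \<alpha> \<xi>) + (3 * gb \<xi> + p * w \<xi>) * ab \<alpha> \<xi>" for \<alpha>
  proof -
    have "Zbar \<alpha> (\<lambda>\<xi>. g \<xi> + 3 * \<i> * h \<xi>) \<xi> = Zbar \<alpha> g \<xi> + 3 * (\<i> * Zbar \<alpha> h \<xi>)"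
      using differentiable_fields[OF xi] by (simp add: Z_add Z_cmult)
    then show ?thesis unfolding Zbar_g[OF xi] Zbar_h[OF xi] by (simp add: cnj_a[OF xi] cnj_w algebra_simps)
  qed
  have 2: "Zbar \<alpha> (\<lambda>\<xi>. g \<xi> - \<i> * h \<xi>) \<xi> = cnj (Dv \<alpha> \<xi> + Ev \<alpha> \<xi> + 2 * G \<alpha> \<xi>) + (p * w \<xi> - gb \<xi>) * ab \<alpha> \<xi>" for \<alpha>
  proof -
    have "Zbar \<alpha> (\<lambda>\<xi>. g \<xi> - \<i> * h \<xi>) \<xi> = Zbar \<alpha> g \<xi> - (\<i> * Zbar \<alpha> h \<xi>)"
      using differentiable_fields[OF xi] by (simp add: Z_diff Z_cmult)
    then show ?thesis unfolding Zbar_g[OF xi] Zbar_h[OF xi] by (simp add: cnj_a[OF xi] cnj_w algebra_simps)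
  qed
  have 3: "Zbar \<alpha> (\<lambda>\<xi>. 3 * \<i> * h \<xi>) \<xi> = 3 * gb \<xi> * ab \<alpha> \<xi> - 3 * cnj (G \<alpha> \<xi>)" for \<alpha>
  proof -
    have "Zbar \<alpha> (\<lambda>\<xi>. 3 * \<i> * h \<xi>) \<xi> = 3 * (\<i> * Zbar \<alpha> h \<xi>)"
      using differentiable_fields[OF xi] by (simp add: Z_cmult)
    then show ?thesis unfolding Zbar_h[OF xi] by (simp add: algebra_simps)
  qed
  have "(\<Sum>\<alpha>\<in>UNIV. Zbar \<alpha> (V \<alpha>) \<xi>) =
     (\<Sum>\<alpha>\<in>UNIV. Zbar \<alpha> (\<lambda>\<xi>. (g \<xi> + 3 * \<i> * h \<xi>) * Ev \<alpha> \<xi>) \<xi>)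
     + (\<Sum>\<alpha>\<in>UNIV. Zbar \<alpha> (\<lambda>\<xi>. (g \<xi> - \<i> * h \<xi>) * Dv \<alpha> \<xi>) \<xi>)
     - (\<Sum>\<alpha>\<in>UNIV. Zbar \<alpha> (\<lambda>\<xi>. (3 * \<i> * h \<xi>) * G \<alpha> \<xi>) \<xi>)"
    unfolding V_def[abs_def] using differentiable_fields[OF xi] by (simp add: Z_diff Z_add sum.distrib sum_subtractf)
  also have "(\<Sum>\<alpha>\<in>UNIV. Zbar \<alpha> (\<lambda>\<xi>. (g \<xi> + 3 * \<i> * h \<xi>) * Ev \<alpha> \<xi>) \<xi>)
     = (g \<xi> + 3 * \<i> * h \<xi>) * (\<Sum>\<alpha>\<in>UNIV. Zbar \<alpha> (Ev \<alpha>) \<xi>)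
      + ((\<Sum>\<alpha>\<in>UNIV. cnj (Dv \<alpha> \<xi> + Ev \<alpha> \<xi> - 2 * G \<alpha> \<xi>) * Ev \<alpha> \<xi>) + (3 * gb \<xi> + p * w \<xi>) * e \<xi>)"
    using differentiable_fields[OF xi] by (subst div_Zbar_mult) (simp_all only: 1 e_def sum_split_factor, simp_all)
  also have "(\<Sum>\<alpha>\<in>UNIV. Zbar \<alpha> (\<lambda>\<xi>. (g \<xi> - \<i> * h \<xi>) * Dv \<alpha> \<xi>) \<xi>)
     = (g \<xi> - \<i> * h \<xi>) * (\<Sum>\<alpha>\<in>UNIV. Zbar \<alpha> (Dv \<alpha>) \<xi>)
      + ((\<Sum>\<alpha>\<in>UNIV. cnj (Dv \<alpha> \<xi> + Ev \<alpha> \<xi> + 2 * G \<alpha> \<xi>) * Dv \<alpha> \<xi>) + (p * w \<xi> - gb \<xi>) * d \<xi>)"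
    using differentiable_fields[OF xi] by (subst div_Zbar_mult) (simp_all only: 2 d_def sum_split_factor, simp_all)
  also have "(\<Sum>\<alpha>\<in>UNIV. Zbar \<alpha> (\<lambda>\<xi>. (3 * \<i> * h \<xi>) * G \<alpha> \<xi>) \<xi>)
     = (3 * \<i> * h \<xi>) * (\<Sum>\<alpha>\<in>UNIV. Zbar \<alpha> (G \<alpha>) \<xi>)
      + (3 * gb \<xi> * c \<xi> - (\<Sum>\<alpha>\<in>UNIV. 3 * cnj (G \<alpha> \<xi>) * G \<alpha> \<xi>))"
  proof -
    have "(\<Sum>\<alpha>\<in>UNIV. (3 * gb \<xi> * ab \<alpha> \<xi> - 3 * cnj (G \<alpha> \<xi>)) * G \<alpha> \<xi>)
      = 3 * gb \<xi> * c \<xi> - (\<Sum>\<alpha>\<in>UNIV. 3 * cnj (G \<alpha> \<xi>) * G \<alpha> \<xi>)"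
      by (simp only: c_def left_diff_distrib sum_subtractf sum_distrib_left) (simp add: mult_ac)
    then show ?thesis using differentiable_fields[OF xi] by (subst div_Zbar_mult) (simp_all only: 3, simp_all)
  qed
  finally have *: "(\<Sum>\<alpha>\<in>UNIV. Zbar \<alpha> (V \<alpha>) \<xi>) =
      (g \<xi> + 3 * \<i> * h \<xi>) * (\<Sum>\<alpha>\<in>UNIV. Zbar \<alpha> (Ev \<alpha>) \<xi>)
      + ((\<Sum>\<alpha>\<in>UNIV. cnj (Dv \<alpha> \<xi> + Ev \<alpha> \<xi> - 2 * G \<alpha> \<xi>) * Ev \<alpha> \<xi>) + (3 * gb \<xi> + p * w \<xi>) * e \<xi>)
     + ((g \<xi> - \<i> * h \<xi>) * (\<Sum>\<alpha>\<in>UNIV. Zbar \<alpha> (Dv \<alpha>) \<xi>)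
      + ((\<Sum>\<alpha>\<in>UNIV. cnj (Dv \<alpha> \<xi> + Ev \<alpha> \<xi> + 2 * G \<alpha> \<xi>) * Dv \<alpha> \<xi>) + (p * w \<xi> - gb \<xi>) * d \<xi>))
     - ((3 * \<i> * h \<xi>) * (\<Sum>\<alpha>\<in>UNIV. Zbar \<alpha> (G \<alpha>) \<xi>)
      + (3 * gb \<xi> * c \<xi> - (\<Sum>\<alpha>\<in>UNIV. 3 * cnj (G \<alpha> \<xi>) * G \<alpha> \<xi>)))" .
  have aux: "(K1 + (S1 + u1)) + (K2 + (S2 + u2)) - (K3 + (u3 - S3)) = (S1 + S2 + S3) + u1 + u2 - u3 + K1 + K2 - K3"
    for K1 K2 K3 S1 S2 S3 u1 u2 u3 :: complex by simp
  show ?thesis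
    unfolding * div_Ev div_Dv div_G[OF xi] cnj_e sum.distrib by (rule aux)
qed

lemma A_real: "A \<xi> = of_real (rA \<xi>)" and h_real: "h \<xi> = of_real (rh \<xi>)" and e_real: "e \<xi> = of_real (Re (e \<xi>))"
  using cnj_A[OF xi] cnj_h[OF xi] cnj_e by (simp_all add: rA_def rh_def complex_eq_iff)

lemma rA_sum: "rA \<xi> = (\<Sum>\<alpha>\<in>UNIV. (cmod (a \<alpha> \<xi>))\<^sup>2)"
  unfolding rA_def A_def Re_sum by (simp flip: cnj_a(1)[OF xi] add: cnj_mult_of_real)

lemma rA_nonneg: "rA \<xi> \<ge> 0"
  unfolding rA_sum by (intro sum_nonneg) auto

lemma dt_h_real: "dt h \<xi> = of_real (Re (dt h \<xi>))"
  using Zbar_real_cnj(3)[OF xi sh cnj_h] by (simp add: complex_eq_iff)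

text \<open>Summing \<open>|D \<alpha> \<beta> * ab \<gamma> + E \<alpha> \<gamma> * a
  \<beta>|^2\<close> over three indices gives exactly this expression: the free index of a pure
  square contributes the factor \<open>rA\<close>, and the mixed terms contract to \<open>Dv\<close>
  and \<open>Ev\<close>.\<close>

lemma pos_DE: "rA \<xi> * (nD \<xi> + nE \<xi>) + 2 * (\<Sum>\<alpha>\<in>UNIV. Re (Dv \<alpha> \<xi> * cnj (Ev \<alpha> \<xi>))) \<ge> 0"
proof -
  have "0 \<le> (\<Sum>\<alpha>\<in>UNIV. \<Sum>\<beta>\<in>UNIV. \<Sum>\<gamma>\<in>UNIV. (cmod (D \<alpha> \<beta> \<xi> * ab \<gamma> \<xi> + E \<alpha> \<gamma> \<xi> * a \<beta> \<xi>))\<^sup>2)"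
    by (intro sum_nonneg) auto
  also have "\<dots> = (\<Sum>\<alpha>\<in>UNIV. \<Sum>\<beta>\<in>UNIV. \<Sum>\<gamma>\<in>UNIV. (cmod (D \<alpha> \<beta> \<xi>))\<^sup>2 * (cmod (a \<gamma> \<xi>))\<^sup>2)
     + (\<Sum>\<alpha>\<in>UNIV. \<Sum>\<beta>\<in>UNIV. \<Sum>\<gamma>\<in>UNIV. (cmod (a \<beta> \<xi>))\<^sup>2 * (cmod (E \<alpha> \<gamma> \<xi>))\<^sup>2)
     + 2 * (\<Sum>\<alpha>\<in>UNIV. \<Sum>\<beta>\<in>UNIV. \<Sum>\<gamma>\<in>UNIV. Re (D \<alpha> \<beta> \<xi> * ab \<beta> \<xi> * cnj (E \<alpha> \<gamma> \<xi> * a \<gamma> \<xi>)))"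
    unfolding sum_distrib_left sum.distrib[symmetric]
    by (intro sum.cong refl) (simp only: cnj_a(1)[OF xi, symmetric] cmod_sq_expand)
  also have "(\<Sum>\<alpha>\<in>UNIV. \<Sum>\<beta>\<in>UNIV. \<Sum>\<gamma>\<in>UNIV. (cmod (D \<alpha> \<beta> \<xi>))\<^sup>2 * (cmod (a \<gamma> \<xi>))\<^sup>2) = nD \<xi> * rA \<xi>"
    unfolding rA_sum nD_def by (simp only: sum_distrib_right) (simp only: sum_distrib_left)
  also have "(\<Sum>\<alpha>\<in>UNIV. \<Sum>\<beta>\<in>UNIV. \<Sum>\<gamma>\<in>UNIV. (cmod (a \<beta> \<xi>))\<^sup>2 * (cmod (E \<alpha> \<gamma> \<xi>))\<^sup>2) = rA \<xi> * nE \<xi>"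
  proof -
    have "rA \<xi> * nE \<xi> = (\<Sum>\<alpha>\<in>UNIV. rA \<xi> * (\<Sum>\<gamma>\<in>UNIV. (cmod (E \<alpha> \<gamma> \<xi>))\<^sup>2))"
      unfolding nE_def by (rule sum_distrib_left)
    then show ?thesis unfolding rA_sum sum_product by simp
  qed
  also have "(\<Sum>\<alpha>\<in>UNIV. \<Sum>\<beta>\<in>UNIV. \<Sum>\<gamma>\<in>UNIV. Re (D \<alpha> \<beta> \<xi> * ab \<beta> \<xi> * cnj (E \<alpha> \<gamma> \<xi> * a \<gamma> \<xi>)))
    = (\<Sum>\<alpha>\<in>UNIV. Re (Dv \<alpha> \<xi> * cnj (Ev \<alpha> \<xi>)))"
    unfolding Dv_def Ev_def cnj_sum sum_product Re_sum by simp
  finally show ?thesis by (simp add: algebra_simps)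
qed

text \<open>Completing the square, here and in \<open>pos_E\<close>, removes the terms
  \<open>p * d\<close> and \<open>p * e\<close>, which have no sign, at a price quadratic in
  \<open>p\<close>.\<close>

lemma pos_D: "nD \<xi> + p * Re (d \<xi>) + p\<^sup>2 / 4 * (rA \<xi>)\<^sup>2 \<ge> 0"
proof -
  have "0 \<le> (\<Sum>\<alpha>\<in>UNIV. \<Sum>\<beta>\<in>UNIV. (cmod (D \<alpha> \<beta> \<xi> + of_real (p/2) * a \<alpha> \<xi> * a \<beta> \<xi>))\<^sup>2)"
    by (intro sum_nonneg) auto
  also have "\<dots> = (\<Sum>\<alpha>\<in>UNIV. \<Sum>\<beta>\<in>UNIV. (cmod (D \<alpha> \<beta> \<xi>))\<^sup>2)
     + p * (\<Sum>\<alpha>\<in>UNIV. \<Sum>\<beta>\<in>UNIV. Re (D \<alpha> \<beta> \<xi> * ab \<beta> \<xi> * ab \<alpha> \<xi>))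
     + p\<^sup>2 / 4 * (\<Sum>\<alpha>\<in>UNIV. \<Sum>\<beta>\<in>UNIV. (cmod (a \<alpha> \<xi>))\<^sup>2 * (cmod (a \<beta> \<xi>))\<^sup>2)"
    unfolding sum_distrib_left sum.distrib[symmetric]
    by (intro sum.cong refl) (simp only: cnj_a(1)[OF xi, symmetric] cmod_sq_expand complex_cnj_cnj complex_mod_cnj)
  also have "(\<Sum>\<alpha>\<in>UNIV. \<Sum>\<beta>\<in>UNIV. (cmod (a \<alpha> \<xi>))\<^sup>2 * (cmod (a \<beta> \<xi>))\<^sup>2) = (rA \<xi>)\<^sup>2"
    unfolding rA_sum power2_eq_square[of "sum _ _"] sum_product by simp
  also have "(\<Sum>\<alpha>\<in>UNIV. \<Sum>\<beta>\<in>UNIV. Re (D \<alpha> \<beta> \<xi> * ab \<beta> \<xi> * ab \<alpha> \<xi>)) = Re (d \<xi>)"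
    unfolding d_def Dv_def sum_distrib_right Re_sum ..
  finally show ?thesis by (simp add: nD_def)
qed

lemma pos_E: "nE \<xi> + p * Re (e \<xi>) + p\<^sup>2 / 4 * (rA \<xi>)\<^sup>2 \<ge> 0"
proof -
  have "0 \<le> (\<Sum>\<alpha>\<in>UNIV. \<Sum>\<beta>\<in>UNIV. (cmod (E \<alpha> \<beta> \<xi> + of_real (p/2) * a \<alpha> \<xi> * ab \<beta> \<xi>))\<^sup>2)"
    by (intro sum_nonneg) auto
  also have "\<dots> = (\<Sum>\<alpha>\<in>UNIV. \<Sum>\<beta>\<in>UNIV. (cmod (E \<alpha> \<beta> \<xi>))\<^sup>2)
     + p * (\<Sum>\<alpha>\<in>UNIV. \<Sum>\<beta>\<in>UNIV. Re (E \<alpha> \<beta> \<xi> * a \<beta> \<xi> * ab \<alpha> \<xi>))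
     + p\<^sup>2 / 4 * (\<Sum>\<alpha>\<in>UNIV. \<Sum>\<beta>\<in>UNIV. (cmod (a \<alpha> \<xi>))\<^sup>2 * (cmod (a \<beta> \<xi>))\<^sup>2)"
    unfolding sum_distrib_left sum.distrib[symmetric]
    by (intro sum.cong refl) (simp only: cnj_a(1)[OF xi, symmetric] cmod_sq_expand complex_cnj_cnj complex_mod_cnj)
  also have "(\<Sum>\<alpha>\<in>UNIV. \<Sum>\<beta>\<in>UNIV. (cmod (a \<alpha> \<xi>))\<^sup>2 * (cmod (a \<beta> \<xi>))\<^sup>2) = (rA \<xi>)\<^sup>2"
    unfolding rA_sum power2_eq_square[of "sum _ _"] sum_product by simp
  also have "(\<Sum>\<alpha>\<in>UNIV. \<Sum>\<beta>\<in>UNIV. Re (E \<alpha> \<beta> \<xi> * a \<beta> \<xi> * ab \<alpha> \<xi>)) = Re (e \<xi>)"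
    unfolding e_def Ev_def sum_distrib_right Re_sum ..
  finally show ?thesis by (simp add: nE_def)
qed

lemma sum_ab_V: "(\<Sum>\<alpha>\<in>UNIV. ab \<alpha> \<xi> * V \<alpha> \<xi>) = (g \<xi> + 3 * \<i> * h \<xi>) * e \<xi> + (g \<xi> - \<i> * h \<xi>) * d \<xi> - 3 * \<i> * h \<xi> * c \<xi>"
  unfolding e_def d_def c_def sum_distrib_left sum.distrib[symmetric] sum_subtractf[symmetric] V_def
  by (intro sum.cong refl) (simp add: algebra_simps)

text \<open>The factor \<open>2 * (nn - 1) * ab\<close> is the logarithmic derivative of
  \<open>weight\<close>. \<open>pos_DE\<close> absorbs the cross term; \<open>rw\<close> times
  \<open>pos_D\<close> and \<open>pos_E\<close> absorbs \<open>d\<close> and \<open>e\<close>, and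
  the price of these two is the summand \<open>p^2 / 2\<close>.\<close>

lemma div_V_lower:
  "Re ((\<Sum>\<alpha>\<in>UNIV. Zbar \<alpha> (V \<alpha>) \<xi>) + 2 * (nn - 1) * (\<Sum>\<alpha>\<in>UNIV. ab \<alpha> \<xi> * V \<alpha> \<xi>))
   \<ge> SG \<xi> + SX \<xi> + SY \<xi> + (- p * (2 * real CARD('n) - 1) - p\<^sup>2 / 2) * (rw \<xi> * (rA \<xi>)\<^sup>2)
      - p * (2 * real CARD('n) - 1) * ((rw \<xi>)\<^sup>2 * rA \<xi>) - 3 * real CARD('n) * p * (rw \<xi> * (rh \<xi>)\<^sup>2)"
proof -
  let ?S = "\<Sum>\<alpha>\<in>UNIV. cnj (Dv \<alpha> \<xi> + Ev \<alpha> \<xi> - 2 * G \<alpha> \<xi>) * Ev \<alpha> \<xi> + cnj (Dv \<alpha> \<xi> + Ev \<alpha> \<xi> + 2 * G \<alpha> \<xi>) * Dv \<alpha> \<xi>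
      + 3 * cnj (G \<alpha> \<xi>) * G \<alpha> \<xi>"
  have S: "Re ?S = SG \<xi> + SX \<xi> + SY \<xi> + 2 * (\<Sum>\<alpha>\<in>UNIV. Re (Dv \<alpha> \<xi> * cnj (Ev \<alpha> \<xi>)))"
    unfolding Re_sum Re_quadratic_cross_terms by (simp add: SG_def SX_def SY_def sum.distrib sum_distrib_left)
  have n: "nn = of_real (real CARD('n))" by (simp add: nn_def)
  have aux: "Re ((S + u1 + u2 - u3 + u4 + u5 - u6) + u7) = Re S + Re (u1 + u2 - u3 + u4 + u5 - u6 + u7)"
    for S u1 u2 u3 u4 u5 u6 u7 :: complex by simp
  have eq: "Re ((\<Sum>\<alpha>\<in>UNIV. Zbar \<alpha> (V \<alpha>) \<xi>) + 2 * (nn - 1) * (\<Sum>\<alpha>\<in>UNIV. ab \<alpha> \<xi> * V \<alpha> \<xi>))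
    = Re ?S + ((rA \<xi> + rw \<xi>) * (nE \<xi> + nD \<xi>) + p * rw \<xi> * (Re (e \<xi>) + Re (d \<xi>))
      - (2 * real CARD('n) - 1) * p * rw \<xi> * rA \<xi> * (rA \<xi> + rw \<xi>) - 3 * real CARD('n) * p * rw \<xi> * (rh \<xi>)\<^sup>2)"
    unfolding div_V sum_ab_V aux
    by (intro arg_cong2[of _ _ _ _ "(+)"] refl divergence_scalar_part g_def[THEN meta_eq_to_obj_eq, THEN fun_cong] gb_def[THEN meta_eq_to_obj_eq, THEN fun_cong]
        A_real w_real h_real e_real n) (rule dt_h_real)
  have "0 \<le> rw \<xi> * (nD \<xi> + p * Re (d \<xi>) + p\<^sup>2 / 4 * (rA \<xi>)\<^sup>2)"
    "0 \<le> rw \<xi> * (nE \<xi> + p * Re (e \<xi>) + p\<^sup>2 / 4 * (rA \<xi>)\<^sup>2)"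
    using pos_D pos_E rw_pos[of \<xi>] by (simp_all add: mult_nonneg_nonneg)
  then show ?thesis
    unfolding eq S using pos_DE by (simp add: algebra_simps power2_eq_square)
qed

end

end

section \<open>Absorption of the error terms\<close>

text \<open>If \<open>t\<close> is counted like \<open>k^2\<close>, all terms have the same degree,
  so only the comparison of \<open>k^2\<close> with \<open>\<delta> * t\<close> matters.\<close>

lemma young_cubic:
  fixes t k \<delta> :: real
  assumes "t \<ge> 0" "k \<ge> 0" "0 < \<delta>" "\<delta> \<le> 1"
  shows "k\<^sup>2 * t\<^sup>2 \<le> \<delta> * t ^ 3 + k ^ 6 / \<delta>\<^sup>2" "k ^ 4 * t \<le> \<delta> * t ^ 3 + k ^ 6 / \<delta>\<^sup>2"
proof -
  have "k\<^sup>2 * t\<^sup>2 \<le> \<delta> * t ^ 3 + k ^ 6 / \<delta>\<^sup>2 \<and> k ^ 4 * t \<le> \<delta> * t ^ 3 + k ^ 6 / \<delta>\<^sup>2"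
  proof (cases "k\<^sup>2 \<le> \<delta> * t")
    case True
    have "k\<^sup>2 * t\<^sup>2 \<le> \<delta> * t * t\<^sup>2" using True by (intro mult_right_mono) auto
    also have "\<dots> = \<delta> * t ^ 3" by (simp add: power2_eq_square power3_eq_cube)
    finally have "k\<^sup>2 * t\<^sup>2 \<le> \<delta> * t ^ 3" .
    moreover have "k ^ 4 * t \<le> \<delta> * t ^ 3"
    proof -
      have "k ^ 4 = k\<^sup>2 * k\<^sup>2" by (simp add: power_add[symmetric])
      also have "\<dots> \<le> (\<delta> * t) * (\<delta> * t)" using True assms by (intro mult_mono) auto
      also have "\<dots> \<le> (\<delta> * t) * (1 * t)" using assms by (intro mult_left_mono mult_right_mono) auto
      also have "\<dots> = \<delta> * t\<^sup>2" by (simp add: power2_eq_square)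
      finally have "k ^ 4 * t \<le> \<delta> * t\<^sup>2 * t" using assms by (intro mult_right_mono) auto
      then show ?thesis by (simp add: power2_eq_square power3_eq_cube)
    qed
    moreover have "k ^ 6 / \<delta>\<^sup>2 \<ge> 0" using assms by simp
    ultimately show ?thesis by linarith
  next
    case False
    then have t: "t \<le> k\<^sup>2 / \<delta>" using assms by (simp add: field_simps)
    have "k\<^sup>2 * t\<^sup>2 \<le> k\<^sup>2 * (k\<^sup>2 / \<delta>)\<^sup>2" using t assms by (intro mult_left_mono power_mono) auto
    also have "\<dots> = k ^ 6 / \<delta>\<^sup>2" by (simp add: power_divide flip: power_mult power_add)
    finally have 1: "k\<^sup>2 * t\<^sup>2 \<le> k ^ 6 / \<delta>\<^sup>2" .
    have "k ^ 4 * t \<le> k ^ 4 * (k\<^sup>2 / \<delta>)" using t assms by (intro mult_left_mono) auto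
    also have "\<dots> = k ^ 6 / \<delta>" by (simp flip: power_add)
    also have "\<dots> \<le> k ^ 6 / \<delta>\<^sup>2"
      using assms by (intro divide_left_mono) (auto simp: power2_eq_square mult_left_le)
    finally have 2: "k ^ 4 * t \<le> k ^ 6 / \<delta>\<^sup>2" .
    have "\<delta> * t ^ 3 \<ge> 0" using assms by simp
    then show ?thesis using 1 2 by linarith
  qed
  then show "k\<^sup>2 * t\<^sup>2 \<le> \<delta> * t ^ 3 + k ^ 6 / \<delta>\<^sup>2" "k ^ 4 * t \<le> \<delta> * t ^ 3 + k ^ 6 / \<delta>\<^sup>2" by auto
qed

text \<open>
  \<open>Q1\<close>, \<open>Q2\<close>, \<open>Q3\<close> stand for the weighted divergences bounded below in \<open>weighted_div_V_lower\<close>,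
  \<open>weighted_div_h_lower\<close> and above in \<open>weighted_div_w_upper\<close>, and \<open>\<kappa>\<close> for the inverse of cutoff times
  radius. Taking \<open>200 s\<^sup>2\<close> copies of the second inequality cancels the term \<open>100 s\<^sup>2 \<kappa>\<^sup>2 h\<^sup>2\<close> of the
  first; the weight \<open>1 / (800 s\<^sup>2)\<close> of \<open>G2\<close> then costs only a quarter of \<open>G2\<close>.
\<close>

definition absorbs :: "real \<Rightarrow> real \<Rightarrow> real \<Rightarrow> real \<Rightarrow> real \<Rightarrow> real \<Rightarrow> real \<Rightarrow> real \<Rightarrow> real \<Rightarrow> real \<Rightarrow> bool" where
  "absorbs n s \<epsilon> c1 c2 C1 C2 K1 K2 C \<longleftrightarrow> (\<forall>G2 X2 Y2 A w h \<kappa> Q1 Q2 Q3.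
    G2 \<ge> 0 \<longrightarrow> X2 \<ge> 0 \<longrightarrow> Y2 \<ge> 0 \<longrightarrow> A \<ge> 0 \<longrightarrow> w \<ge> 0 \<longrightarrow> \<kappa> \<ge> 0 \<longrightarrow>
    Q1 \<ge> (G2 + X2 + Y2) / 2 + c1 * (w * A\<^sup>2) + c2 * (w\<^sup>2 * A) + \<epsilon> * A ^ 3 - C1 * (\<kappa>\<^sup>2 * A\<^sup>2)
       - 24 * s\<^sup>2 * (\<kappa>\<^sup>2 * w\<^sup>2) - 100 * s\<^sup>2 * (\<kappa>\<^sup>2 * h\<^sup>2) \<longrightarrow>
    \<kappa>\<^sup>2 * Q2 \<ge> \<kappa>\<^sup>2 * h\<^sup>2 / 2 - \<kappa>\<^sup>2 * A\<^sup>2 - \<kappa>\<^sup>2 * (w * A) - G2 / (800 * s\<^sup>2) - C2 * (\<kappa> ^ 4 * A) \<longrightarrow>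
    Q3 \<le> - n * w ^ 3 + (n + 2 + s) * (w\<^sup>2 * A) + 2 * s * (\<kappa>\<^sup>2 * w\<^sup>2) \<longrightarrow>
    w ^ 3 \<le> K1 * Q1 + K2 * (\<kappa>\<^sup>2 * Q2) - 2 * Q3 + C * \<kappa> ^ 6)"

lemma absorption:
  fixes n s \<epsilon> c1 c2 C1 C2 :: real
  assumes "n \<ge> 1" "s > 0" "\<epsilon> > 0" "c1 \<ge> 0" "c2 > 0" "C1 \<ge> 0" "C2 \<ge> 0"
  shows "\<exists>K1 K2 C. C > 0 \<and> absorbs n s \<epsilon> c1 c2 C1 C2 K1 K2 C"
proof -
  \<comment> \<open>Total coefficient of \<open>\<kappa>^2 * A^2\<close> and
    \<open>\<kappa>^4 * A\<close> after \<open>200 * s^2\<close> copies of the second inequality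
    have been added; in 300, the share 200 comes from that inequality and 100 from splitting
    \<open>w * A\<close>. The next constant makes this total absorbable by
    \<open>\<epsilon> * A^3\<close>.\<close>
  define Ca where "Ca = C1 + 300 * s\<^sup>2 + 200 * s\<^sup>2 * C2"
  define \<delta>1 where "\<delta>1 = min 1 (\<epsilon> / (Ca + 1))"
  \<comment> \<open>With this factor the term \<open>c2 * (w^2 * A)\<close> of the first inequality
    pays for the \<open>w^2 * A\<close> in the third.\<close>
  define K where "K = (n + 2 + s) / c2"
  define Cb where "Cb = K * (124 * s\<^sup>2) + 2 * s"
  \<comment> \<open>Small enough that the \<open>\<kappa>^2 * w^2\<close> terms cost at most half of
    \<open>w^3\<close>; moving that half to the left is the origin of the factor 2 in the
    witnesses.\<close>
  define \<delta>2 where "\<delta>2 = min 1 (1 / (2 * (Cb + 1)))"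
  have Ca: "Ca \<ge> 0" using assms by (simp add: Ca_def)
  have d1: "0 < \<delta>1" "\<delta>1 \<le> 1" "Ca * \<delta>1 \<le> \<epsilon>"
  proof -
    show "0 < \<delta>1" "\<delta>1 \<le> 1" using Ca assms by (simp_all add: \<delta>1_def)
    have "Ca * \<delta>1 \<le> Ca * (\<epsilon> / (Ca + 1))" using Ca by (intro mult_left_mono) (auto simp: \<delta>1_def)
    also have "\<dots> \<le> \<epsilon>" using Ca assms by (simp add: field_simps)
    finally show "Ca * \<delta>1 \<le> \<epsilon>" .
  qed
  have K: "K > 0" using assms by (simp add: K_def)
  have Cb: "Cb \<ge> 0" using K assms by (simp add: Cb_def)
  have d2: "0 < \<delta>2" "\<delta>2 \<le> 1" "Cb * \<delta>2 \<le> 1 / 2"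
  proof -
    show "0 < \<delta>2" "\<delta>2 \<le> 1" using Cb by (simp_all add: \<delta>2_def)
    have "Cb * \<delta>2 \<le> Cb * (1 / (2 * (Cb + 1)))" using Cb by (intro mult_left_mono) (auto simp: \<delta>2_def)
    also have "\<dots> \<le> 1 / 2" using Cb by (simp add: field_simps)
    finally show "Cb * \<delta>2 \<le> 1 / 2" .
  qed
  show ?thesis
    unfolding absorbs_def
  proof (rule exI[of _ "2 * K"], rule exI[of _ "2 * K * (200 * s\<^sup>2)"],
      rule exI[of _ "2 * (K * (Ca / \<delta>1\<^sup>2) + Cb / \<delta>2\<^sup>2)"], intro conjI allI impI)
    have "Ca > 0" using assms by (simp add: Ca_def add_nonneg_pos add_pos_nonneg)
    then show "0 < 2 * (K * (Ca / \<delta>1\<^sup>2) + Cb / \<delta>2\<^sup>2)"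
      using K Cb d1 by (simp add: add_pos_nonneg)
  next
    fix G2 X2 Y2 A w h \<kappa> Q1 Q2 Q3 :: real
    assume nn: "G2 \<ge> 0" "X2 \<ge> 0" "Y2 \<ge> 0" "A \<ge> 0" "w \<ge> 0" "\<kappa> \<ge> 0"
    assume q1: "Q1 \<ge> (G2 + X2 + Y2) / 2 + c1 * (w * A\<^sup>2) + c2 * (w\<^sup>2 * A) + \<epsilon> * A ^ 3 - C1 * (\<kappa>\<^sup>2 * A\<^sup>2)
       - 24 * s\<^sup>2 * (\<kappa>\<^sup>2 * w\<^sup>2) - 100 * s\<^sup>2 * (\<kappa>\<^sup>2 * h\<^sup>2)"
    assume q2: "\<kappa>\<^sup>2 * Q2 \<ge> \<kappa>\<^sup>2 * h\<^sup>2 / 2 - \<kappa>\<^sup>2 * A\<^sup>2 - \<kappa>\<^sup>2 * (w * A) - G2 / (800 * s\<^sup>2) - C2 * (\<kappa> ^ 4 * A)"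
    assume q3: "Q3 \<le> - n * w ^ 3 + (n + 2 + s) * (w\<^sup>2 * A) + 2 * s * (\<kappa>\<^sup>2 * w\<^sup>2)"
    have "200 * s\<^sup>2 * (\<kappa>\<^sup>2 * Q2) \<ge> 200 * s\<^sup>2 * (\<kappa>\<^sup>2 * h\<^sup>2 / 2 - \<kappa>\<^sup>2 * A\<^sup>2 - \<kappa>\<^sup>2 * (w * A) - G2 / (800 * s\<^sup>2) - C2 * (\<kappa> ^ 4 * A))"
      using q2 by (intro mult_left_mono) auto
    moreover have "200 * s\<^sup>2 * (G2 / (800 * s\<^sup>2)) = G2 / 4" using assms by (simp add: field_simps)
    ultimately have q2': "200 * s\<^sup>2 * (\<kappa>\<^sup>2 * Q2) \<ge> 100 * s\<^sup>2 * (\<kappa>\<^sup>2 * h\<^sup>2) - 200 * s\<^sup>2 * (\<kappa>\<^sup>2 * A\<^sup>2)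
       - 200 * s\<^sup>2 * (\<kappa>\<^sup>2 * (w * A)) - G2 / 4 - 200 * s\<^sup>2 * C2 * (\<kappa> ^ 4 * A)"
      by (simp add: algebra_simps)
    have "0 \<le> (A - w)\<^sup>2" by simp
    then have "w * A \<le> A\<^sup>2 / 2 + w\<^sup>2 / 2" by (simp add: power2_eq_square algebra_simps)
    then have "200 * s\<^sup>2 * (\<kappa>\<^sup>2 * (w * A)) \<le> 200 * s\<^sup>2 * (\<kappa>\<^sup>2 * (A\<^sup>2 / 2 + w\<^sup>2 / 2))"
      by (intro mult_left_mono) auto
    then have wA: "200 * s\<^sup>2 * (\<kappa>\<^sup>2 * (w * A)) \<le> 100 * s\<^sup>2 * (\<kappa>\<^sup>2 * A\<^sup>2) + 100 * s\<^sup>2 * (\<kappa>\<^sup>2 * w\<^sup>2)"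
      by (simp add: algebra_simps)
    have "c1 * (w * A\<^sup>2) \<ge> 0" using assms nn by simp
    then have "c2 * (w\<^sup>2 * A) + \<epsilon> * A ^ 3 \<le> Q1 + 200 * s\<^sup>2 * (\<kappa>\<^sup>2 * Q2) + (C1 + 300 * s\<^sup>2) * (\<kappa>\<^sup>2 * A\<^sup>2)
        + 200 * s\<^sup>2 * C2 * (\<kappa> ^ 4 * A) + 124 * s\<^sup>2 * (\<kappa>\<^sup>2 * w\<^sup>2)"
    proof -
      define u1 u2 u3 u4 u5 where "u1 = s\<^sup>2 * (\<kappa>\<^sup>2 * A\<^sup>2)" "u2 = s\<^sup>2 * (\<kappa>\<^sup>2 * w\<^sup>2)" "u3 = s\<^sup>2 * (\<kappa>\<^sup>2 * h\<^sup>2)"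
        "u4 = s\<^sup>2 * (\<kappa>\<^sup>2 * (w * A))" "u5 = s\<^sup>2 * (\<kappa>\<^sup>2 * Q2)"
      note u = this
      have 1: "Q1 \<ge> (G2 + X2 + Y2) / 2 + c1 * (w * A\<^sup>2) + c2 * (w\<^sup>2 * A) + \<epsilon> * A ^ 3 - C1 * (\<kappa>\<^sup>2 * A\<^sup>2) - 24 * u2 - 100 * u3"
        using q1 by (simp add: u mult.assoc)
      have 2: "200 * u5 \<ge> 100 * u3 - 200 * u1 - 200 * u4 - G2 / 4 - 200 * s\<^sup>2 * C2 * (\<kappa> ^ 4 * A)"
        using q2' by (simp add: u mult.assoc)
      have 3: "200 * u4 \<le> 100 * u1 + 100 * u2" using wA by (simp add: u mult.assoc)
      have 4: "(C1 + 300 * s\<^sup>2) * (\<kappa>\<^sup>2 * A\<^sup>2) = C1 * (\<kappa>\<^sup>2 * A\<^sup>2) + 300 * u1"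
        "124 * s\<^sup>2 * (\<kappa>\<^sup>2 * w\<^sup>2) = 124 * u2" "200 * s\<^sup>2 * (\<kappa>\<^sup>2 * Q2) = 200 * u5"
        by (simp_all add: u algebra_simps)
      have aux: "b + e \<le> Q1 + 200 * u5 + (c + 300 * u1) + v + 124 * u2"
        if "(G2 + X2 + Y2) / 2 + a + b + e - c - 24 * u2 - 100 * u3 \<le> Q1"
          "100 * u3 - 200 * u1 - 200 * u4 - G2 / 4 - v \<le> 200 * u5" "0 \<le> a" for a b c e v :: real
      proof -
        have "100 * u3 \<le> 200 * u5 + 300 * u1 + 100 * u2 + G2 / 4 + v" using that(2) 3 by linarith
        moreover have "(G2 + X2 + Y2) / 2 \<ge> G2 / 4" using nn(1-3) by (simp add: field_simps)
        ultimately show ?thesis using that(1,3) by linarith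
      qed
      show ?thesis unfolding 4 by (rule aux[OF 1 2 \<open>c1 * (w * A\<^sup>2) \<ge> 0\<close>])
    qed
    also have "(C1 + 300 * s\<^sup>2) * (\<kappa>\<^sup>2 * A\<^sup>2) \<le> (C1 + 300 * s\<^sup>2) * (\<delta>1 * A ^ 3 + \<kappa> ^ 6 / \<delta>1\<^sup>2)"
      using young_cubic(1)[OF nn(4,6) d1(1,2)] assms by (intro mult_left_mono) auto
    also have "200 * s\<^sup>2 * C2 * (\<kappa> ^ 4 * A) \<le> 200 * s\<^sup>2 * C2 * (\<delta>1 * A ^ 3 + \<kappa> ^ 6 / \<delta>1\<^sup>2)"
      using young_cubic(2)[OF nn(4,6) d1(1,2)] assms by (intro mult_left_mono) auto
    finally have "c2 * (w\<^sup>2 * A) + \<epsilon> * A ^ 3 \<le> Q1 + 200 * s\<^sup>2 * (\<kappa>\<^sup>2 * Q2) + (Ca * \<delta>1) * A ^ 3 + Ca / \<delta>1\<^sup>2 * \<kappa> ^ 6 + 124 * s\<^sup>2 * (\<kappa>\<^sup>2 * w\<^sup>2)"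
      by (simp add: Ca_def algebra_simps add_divide_distrib)
    moreover have "(Ca * \<delta>1) * A ^ 3 \<le> \<epsilon> * A ^ 3" using d1 nn by (intro mult_right_mono) auto
    ultimately have "c2 * (w\<^sup>2 * A) \<le> Q1 + 200 * s\<^sup>2 * (\<kappa>\<^sup>2 * Q2) + Ca / \<delta>1\<^sup>2 * \<kappa> ^ 6 + 124 * s\<^sup>2 * (\<kappa>\<^sup>2 * w\<^sup>2)" by linarith
    then have "K * (c2 * (w\<^sup>2 * A)) \<le> K * (Q1 + 200 * s\<^sup>2 * (\<kappa>\<^sup>2 * Q2) + Ca / \<delta>1\<^sup>2 * \<kappa> ^ 6 + 124 * s\<^sup>2 * (\<kappa>\<^sup>2 * w\<^sup>2))"
      using K by (intro mult_left_mono) auto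
    moreover have "K * (c2 * (w\<^sup>2 * A)) = (n + 2 + s) * (w\<^sup>2 * A)" using assms by (simp add: K_def)
    moreover have "w ^ 3 \<le> n * w ^ 3" using assms nn by (simp add: mult_le_cancel_right1)
    ultimately have "w ^ 3 \<le> K * Q1 + K * (200 * s\<^sup>2) * (\<kappa>\<^sup>2 * Q2) - Q3 + K * (Ca / \<delta>1\<^sup>2) * \<kappa> ^ 6 + Cb * (\<kappa>\<^sup>2 * w\<^sup>2)"
      using q3 by (simp add: Cb_def algebra_simps)
    moreover have "Cb * (\<kappa>\<^sup>2 * w\<^sup>2) \<le> (Cb * \<delta>2) * w ^ 3 + Cb / \<delta>2\<^sup>2 * \<kappa> ^ 6"
      using mult_left_mono[OF young_cubic(1)[OF nn(5,6) d2(1,2)] Cb] by (simp add: algebra_simps)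
    moreover have "(Cb * \<delta>2) * w ^ 3 \<le> 1 / 2 * w ^ 3" using d2 nn by (intro mult_right_mono) auto
    ultimately have "w ^ 3 \<le> 2 * (K * Q1 + K * (200 * s\<^sup>2) * (\<kappa>\<^sup>2 * Q2) - Q3 + K * (Ca / \<delta>1\<^sup>2) * \<kappa> ^ 6 + Cb / \<delta>2\<^sup>2 * \<kappa> ^ 6)"
      unfolding distrib_left right_diff_distrib by linarith
    then show "w ^ 3 \<le> 2 * K * Q1 + 2 * K * (200 * s\<^sup>2) * (\<kappa>\<^sup>2 * Q2) - 2 * Q3 + 2 * (K * (Ca / \<delta>1\<^sup>2) + Cb / \<delta>2\<^sup>2) * \<kappa> ^ 6"
      by (simp add: algebra_simps)
  qed
qed

lemma weighted_young:
  fixes x y l :: real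
  assumes "l > 0" shows "x * y \<le> l * x\<^sup>2 + y\<^sup>2 / (4 * l)"
proof -
  have "0 \<le> (2 * l * x - y)\<^sup>2 / (4 * l)" using assms by simp
  also have "\<dots> = l * x\<^sup>2 + y\<^sup>2 / (4 * l) - x * y" using assms by (simp add: field_simps power2_eq_square)
  finally show ?thesis by simp
qed

text \<open>By \<open>V_alt\<close> the field is a combination of \<open>G\<close>,
  \<open>X = G + Dv\<close> and \<open>Y = G - Ev\<close>, whose squares all occur in
  \<open>div_V_lower\<close>; a quarter of them pays for the cutoff term. In 25 and 6 the bound
  \<open>m^2 \<le> 3 * A^2 + 3 * w^2 + 12 * h^2\<close> is counted twice, plus one
  \<open>h^2\<close> from \<open>G\<close>.\<close>

lemma boundary_V:
  fixes \<beta> G X Y :: complex and s h B A w :: real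
  assumes "s \<ge> 0" "B = A + w"
  shows "s * \<bar>Re (\<beta> * (\<i> * h * G - (B + 2 * \<i> * h) * Y + (B - 2 * \<i> * h) * X))\<bar>
    \<le> ((cmod G)\<^sup>2 + (cmod X)\<^sup>2 + (cmod Y)\<^sup>2) / 4 + s\<^sup>2 * (cmod \<beta>)\<^sup>2 * (25 * h\<^sup>2 + 6 * A\<^sup>2 + 6 * w\<^sup>2)"
proof -
  define m where "m = \<bar>B\<bar> + 2 * \<bar>h\<bar>"
  have m1: "cmod (of_real B + 2 * \<i> * of_real h) \<le> m"
    using norm_triangle_ineq[of "of_real B" "2 * \<i> * of_real h"] by (simp add: m_def norm_mult)
  have m2: "cmod (of_real B - 2 * \<i> * of_real h) \<le> m"
    using norm_triangle_ineq4[of "of_real B" "2 * \<i> * of_real h"] by (simp add: m_def norm_mult)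
  have "cmod (\<beta> * (\<i> * h * G - (B + 2 * \<i> * h) * Y + (B - 2 * \<i> * h) * X))
    \<le> cmod \<beta> * (\<bar>h\<bar> * cmod G + cmod (of_real B + 2 * \<i> * of_real h) * cmod Y + cmod (of_real B - 2 * \<i> * of_real h) * cmod X)"
    unfolding norm_mult
    by (intro mult_left_mono order_trans[OF norm_triangle_ineq] order_trans[OF norm_triangle_ineq4] add_mono)
       (auto simp: norm_mult)
  also have "\<dots> \<le> cmod \<beta> * (\<bar>h\<bar> * cmod G + m * cmod Y + m * cmod X)"
    using m1 m2 by (intro mult_left_mono add_mono mult_right_mono) auto
  finally have "\<bar>Re (\<beta> * (\<i> * h * G - (B + 2 * \<i> * h) * Y + (B - 2 * \<i> * h) * X))\<bar>
     \<le> cmod \<beta> * (\<bar>h\<bar> * cmod G + m * cmod Y + m * cmod X)"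
    using abs_Re_le_cmod order_trans by blast
  then have "s * \<bar>Re (\<beta> * (\<i> * h * G - (B + 2 * \<i> * h) * Y + (B - 2 * \<i> * h) * X))\<bar>
     \<le> s * (cmod \<beta> * (\<bar>h\<bar> * cmod G + m * cmod Y + m * cmod X))"
    using assms(1) by (rule mult_left_mono)
  also have "\<dots> = cmod G * (s * cmod \<beta> * \<bar>h\<bar>) + cmod Y * (s * cmod \<beta> * m) + cmod X * (s * cmod \<beta> * m)"
    by (simp add: algebra_simps)
  also have "\<dots> \<le> (1/4 * (cmod G)\<^sup>2 + (s * cmod \<beta> * \<bar>h\<bar>)\<^sup>2 / (4 * (1/4))) + (1/4 * (cmod Y)\<^sup>2 + (s * cmod \<beta> * m)\<^sup>2 / (4 * (1/4)))
      + (1/4 * (cmod X)\<^sup>2 + (s * cmod \<beta> * m)\<^sup>2 / (4 * (1/4)))"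
    by (intro add_mono weighted_young) auto
  also have "\<dots> = ((cmod G)\<^sup>2 + (cmod X)\<^sup>2 + (cmod Y)\<^sup>2) / 4 + s\<^sup>2 * (cmod \<beta>)\<^sup>2 * (h\<^sup>2 + 2 * m\<^sup>2)"
    by (simp add: power_mult_distrib algebra_simps)
  also have "\<dots> \<le> ((cmod G)\<^sup>2 + (cmod X)\<^sup>2 + (cmod Y)\<^sup>2) / 4 + s\<^sup>2 * (cmod \<beta>)\<^sup>2 * (25 * h\<^sup>2 + 6 * A\<^sup>2 + 6 * w\<^sup>2)"
  proof -
    have "m\<^sup>2 \<le> 3 * A\<^sup>2 + 3 * w\<^sup>2 + 12 * h\<^sup>2"
    proof -
      have "m \<le> \<bar>A\<bar> + \<bar>w\<bar> + 2 * \<bar>h\<bar>" "m \<ge> 0" unfolding m_def assms(2) by auto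
      then have "m\<^sup>2 \<le> (\<bar>A\<bar> + \<bar>w\<bar> + 2 * \<bar>h\<bar>)\<^sup>2" by (rule power_mono)
      also have "\<dots> \<le> 3 * \<bar>A\<bar>\<^sup>2 + 3 * \<bar>w\<bar>\<^sup>2 + 12 * \<bar>h\<bar>\<^sup>2"
      proof -
        have "(a + b + 2 * c)\<^sup>2 \<le> 3 * a\<^sup>2 + 3 * b\<^sup>2 + 12 * c\<^sup>2" for a b c :: real
        proof -
          have "0 \<le> (a - b)\<^sup>2 + (a - 2 * c)\<^sup>2 + (b - 2 * c)\<^sup>2" by simp
          then show ?thesis by (simp add: power2_eq_square algebra_simps)
        qed
        then show ?thesis .
      qed
      finally show ?thesis by simp
    qed
    then have "s\<^sup>2 * (cmod \<beta>)\<^sup>2 * (h\<^sup>2 + 2 * m\<^sup>2) \<le> s\<^sup>2 * (cmod \<beta>)\<^sup>2 * (25 * h\<^sup>2 + 6 * A\<^sup>2 + 6 * w\<^sup>2)"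
      by (intro mult_left_mono) auto
    then show ?thesis by simp
  qed
  finally show ?thesis .
qed

section \<open>Weighted divergences in the presence of a cutoff\<close>

context log_solution begin

text \<open>By \<open>div_weighted\<close> this is the divergence of
  \<open>eta ^ s * weight * X\<close> divided by \<open>eta ^ s * weight\<close>, with
  \<open>\<beta>\<close> the logarithmic derivative of the cutoff \<open>eta\<close>.\<close>

definition weighted_div where
  "weighted_div \<xi> s \<beta> X = (\<Sum>\<alpha>\<in>UNIV. Zbar \<alpha> (X \<alpha>) \<xi>) + 2 * (nn - 1) * (\<Sum>\<alpha>\<in>UNIV. ab \<alpha> \<xi> * X \<alpha> \<xi>)
     + of_nat s * (\<Sum>\<alpha>\<in>UNIV. \<beta> \<alpha> * X \<alpha> \<xi>)"

context
  fixes \<xi> assumes xi: "\<xi> \<in> S"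
begin

text \<open>Expressed by the three quantities whose squares are available; the coefficients of
  \<open>G \<alpha>\<close> add up to \<open>- 3 * \<i> * h\<close>.\<close>

lemma V_alt: "V \<alpha> \<xi> = \<i> * rh \<xi> * G \<alpha> \<xi> - ((rA \<xi> + rw \<xi>) + 2 * \<i> * rh \<xi>) * (G \<alpha> \<xi> - Ev \<alpha> \<xi>)
    + ((rA \<xi> + rw \<xi>) - 2 * \<i> * rh \<xi>) * (G \<alpha> \<xi> + Dv \<alpha> \<xi>)"
  by (simp add: V_def g_def A_real[OF xi, symmetric] w_real[symmetric] h_real[OF xi, symmetric] algebra_simps)

text \<open>\<open>G\<close> cancels in \<open>Dv + Ev = (G + Dv) - (G - Ev)\<close>, so
  \<open>d + e\<close> is controlled by the squares in \<open>SX\<close> and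
  \<open>SY\<close>.\<close>

lemma Re_de_lower:
  assumes "\<epsilon> \<ge> 0"
  shows "2 * \<epsilon> * (rA \<xi> * (Re (d \<xi>) + Re (e \<xi>))) \<ge> - (SX \<xi> + SY \<xi>) / 4 - 8 * \<epsilon>\<^sup>2 * (rA \<xi>) ^ 3"
proof -
  let ?X = "\<lambda>\<alpha>. G \<alpha> \<xi> + Dv \<alpha> \<xi>" and ?Y = "\<lambda>\<alpha>. G \<alpha> \<xi> - Ev \<alpha> \<xi>"
  have "Re (d \<xi>) + Re (e \<xi>) = (\<Sum>\<alpha>\<in>UNIV. Re (?X \<alpha> * ab \<alpha> \<xi>) - Re (?Y \<alpha> * ab \<alpha> \<xi>))"
    unfolding d_def e_def Re_sum sum.distrib[symmetric] by (intro sum.cong refl) (simp add: algebra_simps)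
  then have "- (2 * \<epsilon> * (rA \<xi> * (Re (d \<xi>) + Re (e \<xi>)))) =
     (\<Sum>\<alpha>\<in>UNIV. 2 * \<epsilon> * rA \<xi> * (Re (?Y \<alpha> * ab \<alpha> \<xi>) - Re (?X \<alpha> * ab \<alpha> \<xi>)))"
    unfolding sum_distrib_left sum_negf[symmetric] by (simp only:) (simp add: sum_distrib_left algebra_simps flip: sum_negf)
  also have "\<dots> \<le> (\<Sum>\<alpha>\<in>UNIV. (cmod (?X \<alpha>))\<^sup>2 / 4 + (cmod (?Y \<alpha>))\<^sup>2 / 4 + 8 * \<epsilon>\<^sup>2 * (rA \<xi>)\<^sup>2 * (cmod (a \<alpha> \<xi>))\<^sup>2)"
  proof (rule sum_mono)
    fix \<alpha>
    have r: "Re (?Y \<alpha> * ab \<alpha> \<xi>) - Re (?X \<alpha> * ab \<alpha> \<xi>) \<le> cmod (?Y \<alpha>) * cmod (a \<alpha> \<xi>) + cmod (?X \<alpha>) * cmod (a \<alpha> \<xi>)"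
      using abs_Re_le_cmod[of "?Y \<alpha> * ab \<alpha> \<xi>"] abs_Re_le_cmod[of "?X \<alpha> * ab \<alpha> \<xi>"]
      unfolding norm_mult cnj_a(1)[OF xi, symmetric] complex_mod_cnj by linarith
    have "2 * \<epsilon> * rA \<xi> * (Re (?Y \<alpha> * ab \<alpha> \<xi>) - Re (?X \<alpha> * ab \<alpha> \<xi>))
      \<le> 2 * \<epsilon> * rA \<xi> * (cmod (?Y \<alpha>) * cmod (a \<alpha> \<xi>) + cmod (?X \<alpha>) * cmod (a \<alpha> \<xi>))"
      using r assms rA_nonneg[OF xi] by (intro mult_left_mono) auto
    also have "\<dots> = cmod (?Y \<alpha>) * (2 * \<epsilon> * rA \<xi> * cmod (a \<alpha> \<xi>)) + cmod (?X \<alpha>) * (2 * \<epsilon> * rA \<xi> * cmod (a \<alpha> \<xi>))"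
      by (simp add: algebra_simps)
    also have "\<dots> \<le> (1/4 * (cmod (?Y \<alpha>))\<^sup>2 + (2 * \<epsilon> * rA \<xi> * cmod (a \<alpha> \<xi>))\<^sup>2 / (4 * (1/4)))
       + (1/4 * (cmod (?X \<alpha>))\<^sup>2 + (2 * \<epsilon> * rA \<xi> * cmod (a \<alpha> \<xi>))\<^sup>2 / (4 * (1/4)))"
      by (intro add_mono weighted_young) auto
    also have "\<dots> = (cmod (?X \<alpha>))\<^sup>2 / 4 + (cmod (?Y \<alpha>))\<^sup>2 / 4 + 8 * \<epsilon>\<^sup>2 * (rA \<xi>)\<^sup>2 * (cmod (a \<alpha> \<xi>))\<^sup>2"
      by (simp add: power_mult_distrib)
    finally show "2 * \<epsilon> * rA \<xi> * (Re (?Y \<alpha> * ab \<alpha> \<xi>) - Re (?X \<alpha> * ab \<alpha> \<xi>))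
      \<le> (cmod (?X \<alpha>))\<^sup>2 / 4 + (cmod (?Y \<alpha>))\<^sup>2 / 4 + 8 * \<epsilon>\<^sup>2 * (rA \<xi>)\<^sup>2 * (cmod (a \<alpha> \<xi>))\<^sup>2" .
  qed
  also have "\<dots> = SX \<xi> / 4 + SY \<xi> / 4 + 8 * \<epsilon>\<^sup>2 * (rA \<xi>)\<^sup>2 * rA \<xi>"
    by (simp only: sum.distrib SX_def SY_def rA_sum[OF xi] sum_distrib_left sum_divide_distrib)
  finally show ?thesis by (simp add: power2_eq_square power3_eq_cube algebra_simps add_divide_distrib)
qed

lemma div_weighted:
  assumes "eta differentiable (at \<xi>)" "eta \<xi> \<noteq> 0" "\<And>\<alpha>. X \<alpha> differentiable (at \<xi>)"
  shows "(\<Sum>\<alpha>\<in>UNIV. Zbar \<alpha> (\<lambda>x. eta x ^ s * (weight x * X \<alpha> x)) \<xi>)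
    = eta \<xi> ^ s * (weight \<xi> * weighted_div \<xi> s (\<lambda>\<alpha>. Zbar \<alpha> eta \<xi> / eta \<xi>) X)"
proof -
  have weight: "Zbar \<alpha> weight \<xi> = weight \<xi> * (2 * (nn - 1)) * ab \<alpha> \<xi>" for \<alpha>
    unfolding weight_def[abs_def] ab_def using differentiable_fields(1)[OF xi] by (simp add: Z_exp Z_cmult)
  have "(\<Sum>\<alpha>\<in>UNIV. Zbar \<alpha> (\<lambda>x. (eta x ^ s * weight x) * X \<alpha> x) \<xi>)
    = eta \<xi> ^ s * weight \<xi> * (\<Sum>\<alpha>\<in>UNIV. Zbar \<alpha> (X \<alpha>) \<xi>)
     + (\<Sum>\<alpha>\<in>UNIV. Zbar \<alpha> (\<lambda>x. eta x ^ s * weight x) \<xi> * X \<alpha> \<xi>)"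
    by (rule div_Zbar_mult) (use assms differentiable_V_weight[OF xi] in auto)
  also have "(\<Sum>\<alpha>\<in>UNIV. Zbar \<alpha> (\<lambda>x. eta x ^ s * weight x) \<xi> * X \<alpha> \<xi>)
     = (\<Sum>\<alpha>\<in>UNIV. eta \<xi> ^ s * weight \<xi> * (2 * (nn - 1) * (ab \<alpha> \<xi> * X \<alpha> \<xi>) + of_nat s * (Zbar \<alpha> eta \<xi> / eta \<xi> * X \<alpha> \<xi>)))"
  proof (intro sum.cong refl)
    fix \<alpha>
    \<comment> \<open>For \<open>s = 0\<close> both sides vanish, so the truncated
      \<open>s - 1\<close> does no harm.\<close>
    have "of_nat s * eta \<xi> ^ (s - 1) = eta \<xi> ^ s * (of_nat s / eta \<xi>)"
      using assms(2) by (cases s) auto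
    then have "Zbar \<alpha> (\<lambda>x. eta x ^ s * weight x) \<xi> = eta \<xi> ^ s * weight \<xi> * (2 * (nn - 1)) * ab \<alpha> \<xi>
      + eta \<xi> ^ s * (of_nat s / eta \<xi>) * Zbar \<alpha> eta \<xi> * weight \<xi>"
      using assms differentiable_V_weight[OF xi] by (simp add: Z_mult Z_power weight)
    then show "Zbar \<alpha> (\<lambda>x. eta x ^ s * weight x) \<xi> * X \<alpha> \<xi> =
      eta \<xi> ^ s * weight \<xi> * (2 * (nn - 1) * (ab \<alpha> \<xi> * X \<alpha> \<xi>) + of_nat s * (Zbar \<alpha> eta \<xi> / eta \<xi> * X \<alpha> \<xi>))"
      by (simp only:) (simp add: algebra_simps)
  qed
  also have "\<dots> = eta \<xi> ^ s * weight \<xi> * (2 * (nn - 1) * (\<Sum>\<alpha>\<in>UNIV. ab \<alpha> \<xi> * X \<alpha> \<xi>) + of_nat s * (\<Sum>\<alpha>\<in>UNIV. Zbar \<alpha> eta \<xi> / eta \<xi> * X \<alpha> \<xi>))"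
    by (simp only: sum_distrib_left[symmetric] sum.distrib)
  finally show ?thesis
    unfolding weighted_div_def mult.assoc distrib_left add.assoc .
qed

lemma Re_mult_real: "x = of_real r \<Longrightarrow> Re (x * y) = r * Re y" "x = of_real r \<Longrightarrow> Im (x * y) = r * Im y"
  by auto

lemma sum_sq_bound:
  assumes "(\<Sum>\<alpha>\<in>UNIV. (cmod (\<beta> \<alpha>))\<^sup>2) \<le> 4 * \<kappa>\<^sup>2" "l > 0"
  shows "\<bar>Re (\<Sum>\<alpha>\<in>UNIV. \<beta> \<alpha> * a \<alpha> \<xi>)\<bar> \<le> l * rA \<xi> + \<kappa>\<^sup>2 / l"
proof -
  have "\<bar>Re (\<Sum>\<alpha>\<in>UNIV. \<beta> \<alpha> * a \<alpha> \<xi>)\<bar> \<le> (\<Sum>\<alpha>\<in>UNIV. cmod (\<beta> \<alpha> * a \<alpha> \<xi>))"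
    using abs_Re_le_cmod norm_sum order_trans by blast
  also have "\<dots> \<le> (\<Sum>\<alpha>\<in>UNIV. l * (cmod (a \<alpha> \<xi>))\<^sup>2 + (cmod (\<beta> \<alpha>))\<^sup>2 / (4 * l))"
    unfolding norm_mult by (intro sum_mono) (subst mult.commute, rule weighted_young[OF assms(2)])
  also have "\<dots> = l * rA \<xi> + (\<Sum>\<alpha>\<in>UNIV. (cmod (\<beta> \<alpha>))\<^sup>2) / (4 * l)"
    by (simp only: sum.distrib sum_distrib_left sum_divide_distrib rA_sum[OF xi])
  also have "\<dots> \<le> l * rA \<xi> + (4 * \<kappa>\<^sup>2) / (4 * l)"
    using assms by (intro add_left_mono divide_right_mono) auto
  finally show ?thesis by simp
qed

text \<open>The field \<open>A^2 * a\<close> is added because its divergence contains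
  \<open>n * A^3\<close>. Of its other terms, \<open>w * A^2\<close> is charged to the positive
  coefficient that \<open>p < 0\<close> provides, and \<open>A * (d + e)\<close> to
  \<open>SX\<close> and \<open>SY\<close>.\<close>

lemma weighted_div_V_lower:
  assumes \<beta>: "(\<Sum>\<alpha>\<in>UNIV. (cmod (\<beta> \<alpha>))\<^sup>2) \<le> 4 * \<kappa>\<^sup>2" and s: "s > 0" and eps: "0 < \<epsilon>" "\<epsilon> \<le> 1 / 16"
  shows "Re (weighted_div \<xi> s \<beta> (\<lambda>\<alpha> x. V \<alpha> x + of_real \<epsilon> * ((A x)\<^sup>2 * a \<alpha> x)))
    \<ge> (SG \<xi> + SX \<xi> + SY \<xi>) / 2 + (- p * (2 * real CARD('n) - 1) - p\<^sup>2 / 2 - \<epsilon> * (real CARD('n) + 2)) * (rw \<xi> * (rA \<xi>)\<^sup>2)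
      - p * (2 * real CARD('n) - 1) * ((rw \<xi>)\<^sup>2 * rA \<xi>) - 3 * real CARD('n) * p * (rw \<xi> * (rh \<xi>)\<^sup>2)
      + \<epsilon> / 4 * (rA \<xi>) ^ 3 - 28 * (real s)\<^sup>2 * (\<kappa>\<^sup>2 * (rA \<xi>)\<^sup>2) - 24 * (real s)\<^sup>2 * (\<kappa>\<^sup>2 * (rw \<xi>)\<^sup>2)
      - 100 * (real s)\<^sup>2 * (\<kappa>\<^sup>2 * (rh \<xi>)\<^sup>2)"
proof -
  let ?X = "\<lambda>\<alpha> x. V \<alpha> x + of_real \<epsilon> * ((A x)\<^sup>2 * a \<alpha> x)"
  let ?n = "real CARD('n)"
  have split: "weighted_div \<xi> s \<beta> ?X = ((\<Sum>\<alpha>\<in>UNIV. Zbar \<alpha> (V \<alpha>) \<xi>) + 2 * (nn - 1) * (\<Sum>\<alpha>\<in>UNIV. ab \<alpha> \<xi> * V \<alpha> \<xi>))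
     + of_real \<epsilon> * ((\<Sum>\<alpha>\<in>UNIV. Zbar \<alpha> (\<lambda>x. (A x)\<^sup>2 * a \<alpha> x) \<xi>) + 2 * (nn - 1) * ((A \<xi>)\<^sup>2 * A \<xi>))
     + of_nat s * (\<Sum>\<alpha>\<in>UNIV. \<beta> \<alpha> * V \<alpha> \<xi>) + of_nat s * of_real \<epsilon> * ((A \<xi>)\<^sup>2 * (\<Sum>\<alpha>\<in>UNIV. \<beta> \<alpha> * a \<alpha> \<xi>))"
  proof -
    have 1: "(\<Sum>\<alpha>\<in>UNIV. Zbar \<alpha> (?X \<alpha>) \<xi>) = (\<Sum>\<alpha>\<in>UNIV. Zbar \<alpha> (V \<alpha>) \<xi>) + of_real \<epsilon> * (\<Sum>\<alpha>\<in>UNIV. Zbar \<alpha> (\<lambda>x. (A x)\<^sup>2 * a \<alpha> x) \<xi>)"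
      using differentiable_fields[OF xi] differentiable_V_weight[OF xi] by (simp add: Z_add Z_cmult sum.distrib sum_distrib_left)
    have 2: "(\<Sum>\<alpha>\<in>UNIV. ab \<alpha> \<xi> * ?X \<alpha> \<xi>) = (\<Sum>\<alpha>\<in>UNIV. ab \<alpha> \<xi> * V \<alpha> \<xi>) + of_real \<epsilon> * ((A \<xi>)\<^sup>2 * A \<xi>)"
    proof -
      have "(\<Sum>\<alpha>\<in>UNIV. ab \<alpha> \<xi> * ?X \<alpha> \<xi>) = (\<Sum>\<alpha>\<in>UNIV. ab \<alpha> \<xi> * V \<alpha> \<xi> + of_real \<epsilon> * (A \<xi>)\<^sup>2 * (a \<alpha> \<xi> * ab \<alpha> \<xi>))"
        by (simp add: algebra_simps)
      also have "\<dots> = (\<Sum>\<alpha>\<in>UNIV. ab \<alpha> \<xi> * V \<alpha> \<xi>) + of_real \<epsilon> * (A \<xi>)\<^sup>2 * A \<xi>"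
        unfolding sum.distrib sum_distrib_left[symmetric] by (simp add: A_def)
      finally show ?thesis by simp
    qed
    have 3: "(\<Sum>\<alpha>\<in>UNIV. \<beta> \<alpha> * ?X \<alpha> \<xi>) = (\<Sum>\<alpha>\<in>UNIV. \<beta> \<alpha> * V \<alpha> \<xi>) + of_real \<epsilon> * ((A \<xi>)\<^sup>2 * (\<Sum>\<alpha>\<in>UNIV. \<beta> \<alpha> * a \<alpha> \<xi>))"
      by (simp add: sum.distrib sum_distrib_left algebra_simps)
    show ?thesis unfolding weighted_div_def 1 2 3 by (simp add: algebra_simps)
  qed
  have A2: "Re ((\<Sum>\<alpha>\<in>UNIV. Zbar \<alpha> (\<lambda>x. (A x)\<^sup>2 * a \<alpha> x) \<xi>) + 2 * (nn - 1) * ((A \<xi>)\<^sup>2 * A \<xi>))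
     = ?n * (rA \<xi>) ^ 3 - (?n + 2) * (rw \<xi> * (rA \<xi>)\<^sup>2) + 2 * (rA \<xi> * (Re (d \<xi>) + Re (e \<xi>)))"
  proof -
    have "(\<Sum>\<alpha>\<in>UNIV. Zbar \<alpha> (\<lambda>x. (A x)\<^sup>2 * a \<alpha> x) \<xi>) = (A \<xi>)\<^sup>2 * (- nn * g \<xi>)
       + (\<Sum>\<alpha>\<in>UNIV. 2 * A \<xi> * (cnj (Dv \<alpha> \<xi> * ab \<alpha> \<xi>) + cnj (Ev \<alpha> \<xi> * ab \<alpha> \<xi>) + (2 * A \<xi> - g \<xi>) * (a \<alpha> \<xi> * ab \<alpha> \<xi>)))"
      using differentiable_fields[OF xi]
      by (subst div_Zbar_mult) (simp_all add: Z_power div_a[OF xi] Zbar_A[OF xi] cnj_a[OF xi] cnj_A[OF xi] cnj_g[OF xi] algebra_simps)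
    also have "\<dots> = (A \<xi>)\<^sup>2 * (- nn * g \<xi>) + 2 * A \<xi> * (cnj (d \<xi>) + cnj (e \<xi>) + (2 * A \<xi> - g \<xi>) * A \<xi>)"
      unfolding sum_distrib_left[symmetric] sum.distrib d_def e_def A_def cnj_sum ..
    finally have *: "(\<Sum>\<alpha>\<in>UNIV. Zbar \<alpha> (\<lambda>x. (A x)\<^sup>2 * a \<alpha> x) \<xi>)
       = (A \<xi>)\<^sup>2 * (- nn * g \<xi>) + 2 * A \<xi> * (cnj (d \<xi>) + cnj (e \<xi>) + (2 * A \<xi> - g \<xi>) * A \<xi>)" .
    show ?thesis
      unfolding * g_def A_real[OF xi] w_real h_real[OF xi] nn_def
      by (simp add: power2_eq_square power3_eq_cube algebra_simps)
  qed
  \<comment> \<open>The gradient bound \<open>4 * \<kappa>^2\<close> turns the constants 25 and 6 of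
    \<open>boundary_V\<close> into 100 and 24.\<close>
  have bV: "real s * Re (\<Sum>\<alpha>\<in>UNIV. \<beta> \<alpha> * V \<alpha> \<xi>) \<ge> - ((SG \<xi> + SX \<xi> + SY \<xi>) / 4)
      - (real s)\<^sup>2 * (4 * \<kappa>\<^sup>2) * (25 * (rh \<xi>)\<^sup>2 + 6 * (rA \<xi>)\<^sup>2 + 6 * (rw \<xi>)\<^sup>2)"
  proof -
    let ?q = "25 * (rh \<xi>)\<^sup>2 + 6 * (rA \<xi>)\<^sup>2 + 6 * (rw \<xi>)\<^sup>2"
    have "- (real s * Re (\<Sum>\<alpha>\<in>UNIV. \<beta> \<alpha> * V \<alpha> \<xi>)) \<le> (\<Sum>\<alpha>\<in>UNIV. real s * \<bar>Re (\<beta> \<alpha> * V \<alpha> \<xi>)\<bar>)"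
      unfolding Re_sum sum_distrib_left sum_negf[symmetric] by (intro sum_mono) (simp add: abs_mult flip: mult_minus_right add: mult_left_mono)
    also have "\<dots> \<le> (\<Sum>\<alpha>\<in>UNIV. ((cmod (G \<alpha> \<xi>))\<^sup>2 + (cmod (G \<alpha> \<xi> + Dv \<alpha> \<xi>))\<^sup>2 + (cmod (G \<alpha> \<xi> - Ev \<alpha> \<xi>))\<^sup>2) / 4
         + (real s)\<^sup>2 * (cmod (\<beta> \<alpha>))\<^sup>2 * ?q)"
      unfolding V_alt by (intro sum_mono) (rule boundary_V, simp_all)
    also have "\<dots> = (SG \<xi> + SX \<xi> + SY \<xi>) / 4 + (real s)\<^sup>2 * (\<Sum>\<alpha>\<in>UNIV. (cmod (\<beta> \<alpha>))\<^sup>2) * ?q"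
      by (simp only: sum.distrib sum_divide_distrib[symmetric] sum_distrib_left sum_distrib_right SG_def SX_def SY_def)
    also have "\<dots> \<le> (SG \<xi> + SX \<xi> + SY \<xi>) / 4 + (real s)\<^sup>2 * (4 * \<kappa>\<^sup>2) * ?q"
      using \<beta> by (intro add_left_mono mult_right_mono mult_left_mono) auto
    finally show ?thesis by linarith
  qed
  have bA: "real s * \<epsilon> * ((rA \<xi>)\<^sup>2 * Re (\<Sum>\<alpha>\<in>UNIV. \<beta> \<alpha> * a \<alpha> \<xi>)) \<ge> - \<epsilon> / 4 * (rA \<xi>) ^ 3 - 4 * (real s)\<^sup>2 * (\<kappa>\<^sup>2 * (rA \<xi>)\<^sup>2)"
  proof -
    \<comment> \<open>The parameter \<open>1 / (4 * s)\<close> makes the cubic part cost exactly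
      \<open>\<epsilon> / 4\<close>.\<close>
    have "- Re (\<Sum>\<alpha>\<in>UNIV. \<beta> \<alpha> * a \<alpha> \<xi>) \<le> 1 / (4 * real s) * rA \<xi> + \<kappa>\<^sup>2 / (1 / (4 * real s))"
      using sum_sq_bound[OF \<beta>, of "1 / (4 * real s)"] s by auto
    then have "real s * \<epsilon> * (rA \<xi>)\<^sup>2 * (- Re (\<Sum>\<alpha>\<in>UNIV. \<beta> \<alpha> * a \<alpha> \<xi>)) \<le> real s * \<epsilon> * (rA \<xi>)\<^sup>2 * (1 / (4 * real s) * rA \<xi> + \<kappa>\<^sup>2 / (1 / (4 * real s)))"
      using eps by (intro mult_left_mono) auto
    also have "\<dots> = \<epsilon> / 4 * (rA \<xi>) ^ 3 + \<epsilon> * (4 * (real s)\<^sup>2 * (\<kappa>\<^sup>2 * (rA \<xi>)\<^sup>2))"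
      using s by (simp add: field_simps power2_eq_square power3_eq_cube)
    also have "\<epsilon> * (4 * (real s)\<^sup>2 * (\<kappa>\<^sup>2 * (rA \<xi>)\<^sup>2)) \<le> 1 * (4 * (real s)\<^sup>2 * (\<kappa>\<^sup>2 * (rA \<xi>)\<^sup>2))"
      using eps by (intro mult_right_mono) auto
    finally show ?thesis by (simp add: algebra_simps)
  qed
  \<comment> \<open>Here \<open>\<epsilon> \<le> 1 / 16\<close> enters:
    \<open>8 * \<epsilon>^2 \<le> \<epsilon> / 2\<close>, and since the dimension is at least 1, a
    quarter of \<open>\<epsilon> * A^3\<close> survives.\<close>
  have A3: "\<epsilon> * (?n * (rA \<xi>) ^ 3) - 8 * \<epsilon>\<^sup>2 * (rA \<xi>) ^ 3 - \<epsilon> / 4 * (rA \<xi>) ^ 3 \<ge> \<epsilon> / 4 * (rA \<xi>) ^ 3"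
  proof -
    have "8 * \<epsilon>\<^sup>2 \<le> \<epsilon> / 2" using eps by (simp add: power2_eq_square)
    moreover have "\<epsilon> \<le> \<epsilon> * ?n" using eps by simp
    ultimately have "\<epsilon> / 4 \<le> \<epsilon> * ?n - 8 * \<epsilon>\<^sup>2 - \<epsilon> / 4" by linarith
    then have "\<epsilon> / 4 * (rA \<xi>) ^ 3 \<le> (\<epsilon> * ?n - 8 * \<epsilon>\<^sup>2 - \<epsilon> / 4) * (rA \<xi>) ^ 3"
      using rA_nonneg[OF xi] by (intro mult_right_mono) auto
    then show ?thesis by (simp add: algebra_simps)
  qed
  have Req: "Re (weighted_div \<xi> s \<beta> ?X) = Re ((\<Sum>\<alpha>\<in>UNIV. Zbar \<alpha> (V \<alpha>) \<xi>) + 2 * (nn - 1) * (\<Sum>\<alpha>\<in>UNIV. ab \<alpha> \<xi> * V \<alpha> \<xi>))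
     + \<epsilon> * (?n * (rA \<xi>) ^ 3 - (?n + 2) * (rw \<xi> * (rA \<xi>)\<^sup>2) + 2 * (rA \<xi> * (Re (d \<xi>) + Re (e \<xi>))))
     + real s * Re (\<Sum>\<alpha>\<in>UNIV. \<beta> \<alpha> * V \<alpha> \<xi>) + real s * \<epsilon> * ((rA \<xi>)\<^sup>2 * Re (\<Sum>\<alpha>\<in>UNIV. \<beta> \<alpha> * a \<alpha> \<xi>))"
  proof -
    have 1: "Re (x + of_real \<epsilon> * y + of_nat s * z + of_nat s * of_real \<epsilon> * u)
        = Re x + \<epsilon> * Re y + real s * Re z + real s * \<epsilon> * Re u" for x y z u
    proof -
      have "of_nat s * of_real \<epsilon> = complex_of_real (real s * \<epsilon>)" by simp
      then show ?thesis by (simp only: Re_mult_real(1)[OF refl] plus_complex.sel) simp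
    qed
    have 2: "Re ((A \<xi>)\<^sup>2 * z) = (rA \<xi>)\<^sup>2 * Re z" for z
      unfolding A_real[OF xi] by (simp flip: of_real_power)
    show ?thesis unfolding split 1 A2 2 ..
  qed
  have de: "\<epsilon> * (2 * (rA \<xi> * (Re (d \<xi>) + Re (e \<xi>)))) \<ge> - (SX \<xi> + SY \<xi>) / 4 - 8 * \<epsilon>\<^sup>2 * (rA \<xi>) ^ 3"
    using Re_de_lower[of \<epsilon>] eps by (simp add: algebra_simps)
  have nonneg: "SG \<xi> \<ge> 0" "SX \<xi> \<ge> 0" "SY \<xi> \<ge> 0"
    unfolding SG_def SX_def SY_def by (auto intro: sum_nonneg)
  have aux: "Q + e * (N * r - N2 * u + z) + x4 + x5 \<ge> (g + x + y) / 2 + (c - e * N2) * u - b2 - b3 + e / 4 * r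
      - 28 * S * (K * aa) - 24 * S * (K * ww) - 100 * S * (K * hh)"
    if "Q \<ge> g + x + y + c * u - b2 - b3" "e * z \<ge> - (x + y) / 4 - E8"
      "x4 \<ge> - ((g + x + y) / 4) - S * (4 * K) * (25 * hh + 6 * aa + 6 * ww)" "x5 \<ge> - e / 4 * r - 4 * S * (K * aa)"
      "e * (N * r) - E8 - e / 4 * r \<ge> e / 4 * r" "g \<ge> 0"
    for Q e N r N2 u z x4 x5 g x y c b2 b3 S K aa ww hh E8 :: real
  proof -
    have 1: "S * (4 * K) * (25 * hh + 6 * aa + 6 * ww) = 100 * (S * (K * hh)) + 24 * (S * (K * aa)) + 24 * (S * (K * ww))"
      "e * (N * r - N2 * u + z) = e * (N * r) - e * N2 * u + e * z" "(c - e * N2) * u = c * u - e * N2 * u"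
      by (simp_all add: algebra_simps)
    have 2: "e / 4 * r = (e * r) / 4" "- e / 4 * r = - ((e * r) / 4)" by simp_all
    show ?thesis
      using that unfolding 1 2 mult.assoc[of _ S] add_divide_distrib minus_add_distrib minus_divide_left[symmetric] by linarith
  qed
  show ?thesis unfolding Req by (rule aux[OF div_V_lower[OF xi] de bV bA A3 nonneg(1)])
qed

end

end

context log_solution begin

context
  fixes \<xi> assumes xi: "\<xi> \<in> S"
begin

text \<open>The divergence of \<open>a\<close> is \<open>- nn * g\<close>, whose imaginary part is
  \<open>nn * h\<close>; the field \<open>h * a\<close> therefore produces the \<open>h^2\<close>
  that offsets the cutoff terms of \<open>weighted_div_V_lower\<close>. The contraction
  \<open>c\<close> with \<open>G\<close> is split with a weight \<open>l\<close>, so that only a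
  small part of \<open>SG\<close> is spent.\<close>

lemma weighted_div_h_lower:
  assumes \<beta>: "(\<Sum>\<alpha>\<in>UNIV. (cmod (\<beta> \<alpha>))\<^sup>2) \<le> 4 * \<kappa>\<^sup>2" and l: "l > 0"
  shows "\<kappa>\<^sup>2 * Im (weighted_div \<xi> s \<beta> (\<lambda>\<alpha> x. h x * a \<alpha> x))
    \<ge> \<kappa>\<^sup>2 * (rh \<xi>)\<^sup>2 / 2 - \<kappa>\<^sup>2 * (rA \<xi>)\<^sup>2 - \<kappa>\<^sup>2 * (rw \<xi> * rA \<xi>) - l * SG \<xi> - (1 / (4 * l) + 2 * (real s)\<^sup>2) * (\<kappa> ^ 4 * rA \<xi>)"
proof -
  let ?n = "real CARD('n)"
  have "\<i> * (\<Sum>\<alpha>\<in>UNIV. Zbar \<alpha> h \<xi> * a \<alpha> \<xi>) = (\<Sum>\<alpha>\<in>UNIV. gb \<xi> * (a \<alpha> \<xi> * ab \<alpha> \<xi>) - cnj (G \<alpha> \<xi> * ab \<alpha> \<xi>))"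
    unfolding sum_distrib_left
  proof (intro sum.cong refl)
    fix \<alpha>
    have "\<i> * (Zbar \<alpha> h \<xi> * a \<alpha> \<xi>) = (\<i> * Zbar \<alpha> h \<xi>) * a \<alpha> \<xi>" by simp
    then show "\<i> * (Zbar \<alpha> h \<xi> * a \<alpha> \<xi>) = gb \<xi> * (a \<alpha> \<xi> * ab \<alpha> \<xi>) - cnj (G \<alpha> \<xi> * ab \<alpha> \<xi>)"
      unfolding Zbar_h[OF xi] by (simp add: cnj_a[OF xi] algebra_simps)
  qed
  also have "\<dots> = gb \<xi> * A \<xi> - cnj (c \<xi>)"
    unfolding sum_subtractf sum_distrib_left[symmetric] c_def cnj_sum by (simp add: A_def)
  finally have "\<i> * (\<Sum>\<alpha>\<in>UNIV. Zbar \<alpha> h \<xi> * a \<alpha> \<xi>) = gb \<xi> * A \<xi> - cnj (c \<xi>)" .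
  then have "Re (\<i> * (\<Sum>\<alpha>\<in>UNIV. Zbar \<alpha> h \<xi> * a \<alpha> \<xi>)) = Re (gb \<xi> * A \<xi> - cnj (c \<xi>))" by simp
  then have 1: "Im (\<Sum>\<alpha>\<in>UNIV. Zbar \<alpha> h \<xi> * a \<alpha> \<xi>) = - (rA \<xi> * (rA \<xi> + rw \<xi>)) + Re (c \<xi>)"
    unfolding gb_def A_real[OF xi] w_real h_real[OF xi] by (simp add: algebra_simps)
  have X: "(\<Sum>\<alpha>\<in>UNIV. Zbar \<alpha> (\<lambda>x. h x * a \<alpha> x) \<xi>) = h \<xi> * (- nn * g \<xi>) + (\<Sum>\<alpha>\<in>UNIV. Zbar \<alpha> h \<xi> * a \<alpha> \<xi>)"
    using differentiable_fields[OF xi] by (subst div_Zbar_mult) (simp_all add: div_a[OF xi])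
  have Y: "(\<Sum>\<alpha>\<in>UNIV. ab \<alpha> \<xi> * (h \<xi> * a \<alpha> \<xi>)) = h \<xi> * A \<xi>"
    by (simp add: A_def sum_distrib_left mult_ac)
  have W: "(\<Sum>\<alpha>\<in>UNIV. \<beta> \<alpha> * (h \<xi> * a \<alpha> \<xi>)) = h \<xi> * (\<Sum>\<alpha>\<in>UNIV. \<beta> \<alpha> * a \<alpha> \<xi>)"
    by (simp add: sum_distrib_left mult_ac)
  have 2: "Im (h \<xi> * (- nn * g \<xi>)) = ?n * (rh \<xi>)\<^sup>2" "Im (2 * (nn - 1) * (h \<xi> * A \<xi>)) = 0"
    "Im (of_nat s * (h \<xi> * z)) = real s * rh \<xi> * Im z" for z
    unfolding g_def A_real[OF xi] w_real h_real[OF xi] nn_def by (simp_all add: power2_eq_square algebra_simps)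
  have eq: "Im (weighted_div \<xi> s \<beta> (\<lambda>\<alpha> x. h x * a \<alpha> x)) = ?n * (rh \<xi>)\<^sup>2 - rA \<xi> * (rA \<xi> + rw \<xi>) + Re (c \<xi>)
      + real s * rh \<xi> * Im (\<Sum>\<alpha>\<in>UNIV. \<beta> \<alpha> * a \<alpha> \<xi>)"
    unfolding weighted_div_def X Y W plus_complex.sel 1 2 by simp
  have c: "- (\<kappa>\<^sup>2 * Re (c \<xi>)) \<le> l * SG \<xi> + 1 / (4 * l) * (\<kappa> ^ 4 * rA \<xi>)"
  proof -
    have "- (\<kappa>\<^sup>2 * Re (c \<xi>)) \<le> (\<Sum>\<alpha>\<in>UNIV. l * (cmod (G \<alpha> \<xi>))\<^sup>2 + 1 / (4 * l) * (\<kappa> ^ 4 * (cmod (a \<alpha> \<xi>))\<^sup>2))"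
      unfolding c_def Re_sum sum_distrib_left sum_negf[symmetric]
    proof (rule sum_mono)
      fix \<alpha>
      have "- Re (G \<alpha> \<xi> * ab \<alpha> \<xi>) \<le> cmod (G \<alpha> \<xi>) * cmod (a \<alpha> \<xi>)"
        using abs_Re_le_cmod[of "G \<alpha> \<xi> * ab \<alpha> \<xi>"] unfolding norm_mult cnj_a(1)[OF xi, symmetric] complex_mod_cnj by linarith
      then have "\<kappa>\<^sup>2 * - Re (G \<alpha> \<xi> * ab \<alpha> \<xi>) \<le> \<kappa>\<^sup>2 * (cmod (G \<alpha> \<xi>) * cmod (a \<alpha> \<xi>))"
        by (intro mult_left_mono) auto
      also have "\<dots> = cmod (G \<alpha> \<xi>) * (\<kappa>\<^sup>2 * cmod (a \<alpha> \<xi>))" by simp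
      also have "\<dots> \<le> l * (cmod (G \<alpha> \<xi>))\<^sup>2 + (\<kappa>\<^sup>2 * cmod (a \<alpha> \<xi>))\<^sup>2 / (4 * l)" by (rule weighted_young[OF l])
      also have "\<dots> = l * (cmod (G \<alpha> \<xi>))\<^sup>2 + 1 / (4 * l) * (\<kappa> ^ 4 * (cmod (a \<alpha> \<xi>))\<^sup>2)"
        by (simp add: power_mult_distrib flip: power_mult)
      finally show "- (\<kappa>\<^sup>2 * Re (G \<alpha> \<xi> * ab \<alpha> \<xi>)) \<le> l * (cmod (G \<alpha> \<xi>))\<^sup>2 + 1 / (4 * l) * (\<kappa> ^ 4 * (cmod (a \<alpha> \<xi>))\<^sup>2)"
        by (simp only: mult_minus_right)
    qed
    then show ?thesis by (simp only: sum.distrib sum_distrib_left[symmetric] SG_def rA_sum[OF xi])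
  qed
  \<comment> \<open>One share \<open>h^2 / 2\<close> for each index uses up half of
    \<open>n * h^2\<close>; the other half is kept.\<close>
  have b: "- (real s * rh \<xi> * Im (\<Sum>\<alpha>\<in>UNIV. \<beta> \<alpha> * a \<alpha> \<xi>)) \<le> ?n * ((rh \<xi>)\<^sup>2 / 2) + 2 * (real s)\<^sup>2 * \<kappa>\<^sup>2 * rA \<xi>"
  proof -
    have "- (real s * rh \<xi> * Im (\<Sum>\<alpha>\<in>UNIV. \<beta> \<alpha> * a \<alpha> \<xi>)) \<le> (\<Sum>\<alpha>\<in>(UNIV :: 'n set). (rh \<xi>)\<^sup>2 / 2 + 2 * (real s)\<^sup>2 * \<kappa>\<^sup>2 * (cmod (a \<alpha> \<xi>))\<^sup>2)"
      unfolding Im_sum sum_distrib_left sum_negf[symmetric]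
    proof (rule sum_mono)
      fix \<alpha>
      have b1: "(cmod (\<beta> \<alpha>))\<^sup>2 \<le> 4 * \<kappa>\<^sup>2"
        using \<beta> member_le_sum[of \<alpha> UNIV "\<lambda>\<alpha>. (cmod (\<beta> \<alpha>))\<^sup>2"] by simp
      have "- (real s * rh \<xi> * Im (\<beta> \<alpha> * a \<alpha> \<xi>)) \<le> \<bar>real s * rh \<xi> * Im (\<beta> \<alpha> * a \<alpha> \<xi>)\<bar>" by simp
      also have "\<dots> = \<bar>rh \<xi>\<bar> * (real s * \<bar>Im (\<beta> \<alpha> * a \<alpha> \<xi>)\<bar>)" by (simp add: abs_mult)
      also have "\<dots> \<le> 1 / 2 * \<bar>rh \<xi>\<bar>\<^sup>2 + (real s * \<bar>Im (\<beta> \<alpha> * a \<alpha> \<xi>)\<bar>)\<^sup>2 / (4 * (1 / 2))" by (rule weighted_young) simp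
      also have "\<dots> = (rh \<xi>)\<^sup>2 / 2 + (real s)\<^sup>2 / 2 * (Im (\<beta> \<alpha> * a \<alpha> \<xi>))\<^sup>2" by (simp add: power_mult_distrib)
      also have "(real s)\<^sup>2 / 2 * (Im (\<beta> \<alpha> * a \<alpha> \<xi>))\<^sup>2 \<le> (real s)\<^sup>2 / 2 * ((4 * \<kappa>\<^sup>2) * (cmod (a \<alpha> \<xi>))\<^sup>2)"
      proof (rule mult_left_mono)
        have "(Im (\<beta> \<alpha> * a \<alpha> \<xi>))\<^sup>2 \<le> (cmod (\<beta> \<alpha>))\<^sup>2 * (cmod (a \<alpha> \<xi>))\<^sup>2"
          unfolding power_mult_distrib[symmetric] norm_mult[symmetric] by (simp add: cmod_power2)
        also have "\<dots> \<le> (4 * \<kappa>\<^sup>2) * (cmod (a \<alpha> \<xi>))\<^sup>2" using b1 by (intro mult_right_mono) auto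
        finally show "(Im (\<beta> \<alpha> * a \<alpha> \<xi>))\<^sup>2 \<le> (4 * \<kappa>\<^sup>2) * (cmod (a \<alpha> \<xi>))\<^sup>2" .
      qed simp
      finally show "- (real s * rh \<xi> * Im (\<beta> \<alpha> * a \<alpha> \<xi>)) \<le> (rh \<xi>)\<^sup>2 / 2 + 2 * (real s)\<^sup>2 * \<kappa>\<^sup>2 * (cmod (a \<alpha> \<xi>))\<^sup>2"
        by (simp add: mult_ac)
    qed
    also have "\<dots> = ?n * ((rh \<xi>)\<^sup>2 / 2) + 2 * (real s)\<^sup>2 * \<kappa>\<^sup>2 * rA \<xi>"
      unfolding sum.distrib sum_distrib_left[symmetric] rA_sum[OF xi] by simp
    finally show ?thesis .
  qed
  have b': "- (\<kappa>\<^sup>2 * (real s * rh \<xi> * Im (\<Sum>\<alpha>\<in>UNIV. \<beta> \<alpha> * a \<alpha> \<xi>))) \<le> \<kappa>\<^sup>2 * (?n * ((rh \<xi>)\<^sup>2 / 2)) + 2 * (real s)\<^sup>2 * (\<kappa> ^ 4 * rA \<xi>)"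
  proof -
    have "\<kappa>\<^sup>2 * - (real s * rh \<xi> * Im (\<Sum>\<alpha>\<in>UNIV. \<beta> \<alpha> * a \<alpha> \<xi>)) \<le> \<kappa>\<^sup>2 * (?n * ((rh \<xi>)\<^sup>2 / 2) + 2 * (real s)\<^sup>2 * \<kappa>\<^sup>2 * rA \<xi>)"
      using b by (intro mult_left_mono) auto
    also have "\<dots> = \<kappa>\<^sup>2 * (?n * ((rh \<xi>)\<^sup>2 / 2)) + 2 * (real s)\<^sup>2 * (\<kappa> ^ 4 * rA \<xi>)"
      by (simp add: algebra_simps flip: power_add)
    finally show ?thesis by linarith
  qed
  have n: "\<kappa>\<^sup>2 * (rh \<xi>)\<^sup>2 / 2 \<le> \<kappa>\<^sup>2 * (?n * ((rh \<xi>)\<^sup>2 / 2))"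
  proof -
    have "1 \<le> ?n" by (simp add: Suc_leI)
    then have "1 * ((rh \<xi>)\<^sup>2 / 2) \<le> ?n * ((rh \<xi>)\<^sup>2 / 2)" by (intro mult_right_mono) auto
    then have "\<kappa>\<^sup>2 * (1 * ((rh \<xi>)\<^sup>2 / 2)) \<le> \<kappa>\<^sup>2 * (?n * ((rh \<xi>)\<^sup>2 / 2))" by (intro mult_left_mono) auto
    then show ?thesis by simp
  qed
  have 3: "\<kappa>\<^sup>2 * (?n * (rh \<xi>)\<^sup>2 - rA \<xi> * (rA \<xi> + rw \<xi>) + Re (c \<xi>) + x) = 2 * (\<kappa>\<^sup>2 * (?n * ((rh \<xi>)\<^sup>2 / 2))) - \<kappa>\<^sup>2 * (rA \<xi>)\<^sup>2 - \<kappa>\<^sup>2 * (rw \<xi> * rA \<xi>)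
     + \<kappa>\<^sup>2 * Re (c \<xi>) + \<kappa>\<^sup>2 * x" for x by (simp add: algebra_simps power2_eq_square)
  show ?thesis unfolding eq 3 using n b' c unfolding distrib_right by linarith
qed

text \<open>The divergence of \<open>a\<close> contains \<open>- nn * w\<close>, so the field
  \<open>w^2 * a\<close> yields \<open>- n * w^3\<close>, the power to be estimated;
  \<open>w^2 * A\<close> is what remains to be paid.\<close>

lemma weighted_div_w_upper:
  assumes \<beta>: "(\<Sum>\<alpha>\<in>UNIV. (cmod (\<beta> \<alpha>))\<^sup>2) \<le> 4 * \<kappa>\<^sup>2" and p: "p \<le> 0"
  shows "Re (weighted_div \<xi> s \<beta> (\<lambda>\<alpha> x. (w x)\<^sup>2 * a \<alpha> x))
    \<le> - real CARD('n) * (rw \<xi>) ^ 3 + (real CARD('n) + 2 + real s) * ((rw \<xi>)\<^sup>2 * rA \<xi>) + 2 * real s * (\<kappa>\<^sup>2 * (rw \<xi>)\<^sup>2)"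
proof -
  let ?n = "real CARD('n)"
  have X: "(\<Sum>\<alpha>\<in>UNIV. Zbar \<alpha> (\<lambda>x. (w x)\<^sup>2 * a \<alpha> x) \<xi>) = (w \<xi>)\<^sup>2 * (- nn * g \<xi>) + 2 * of_real (2 + p) * (w \<xi>)\<^sup>2 * A \<xi>"
  proof -
    have "Zbar \<alpha> (\<lambda>x. (w x)\<^sup>2) \<xi> = 2 * of_real (2 + p) * (w \<xi>)\<^sup>2 * ab \<alpha> \<xi>" for \<alpha>
      using differentiable_fields[OF xi] by (simp add: Z_power Zbar_w[OF xi]) (simp add: power2_eq_square)
    then have "(\<Sum>\<alpha>\<in>UNIV. Zbar \<alpha> (\<lambda>x. (w x)\<^sup>2) \<xi> * a \<alpha> \<xi>)
       = (\<Sum>\<alpha>\<in>UNIV. 2 * of_real (2 + p) * (w \<xi>)\<^sup>2 * (a \<alpha> \<xi> * ab \<alpha> \<xi>))"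
      by (simp add: mult_ac)
    then have "(\<Sum>\<alpha>\<in>UNIV. Zbar \<alpha> (\<lambda>x. (w x)\<^sup>2) \<xi> * a \<alpha> \<xi>) = 2 * of_real (2 + p) * (w \<xi>)\<^sup>2 * A \<xi>"
      unfolding sum_distrib_left[symmetric] by (simp add: A_def)
    then show ?thesis using differentiable_fields[OF xi] by (subst div_Zbar_mult) (simp_all add: div_a[OF xi])
  qed
  have Y: "(\<Sum>\<alpha>\<in>UNIV. ab \<alpha> \<xi> * ((w \<xi>)\<^sup>2 * a \<alpha> \<xi>)) = (w \<xi>)\<^sup>2 * A \<xi>"
    by (simp add: A_def sum_distrib_left mult_ac)
  have W: "(\<Sum>\<alpha>\<in>UNIV. \<beta> \<alpha> * ((w \<xi>)\<^sup>2 * a \<alpha> \<xi>)) = (w \<xi>)\<^sup>2 * (\<Sum>\<alpha>\<in>UNIV. \<beta> \<alpha> * a \<alpha> \<xi>)"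
    by (simp add: sum_distrib_left mult_ac)
  have w2: "(w \<xi>)\<^sup>2 = of_real ((rw \<xi>)\<^sup>2)" by (simp add: w_real[of \<xi>])
  have 2: "Re ((w \<xi>)\<^sup>2 * (- nn * g \<xi>)) = - ?n * (rw \<xi>) ^ 3 - ?n * ((rw \<xi>)\<^sup>2 * rA \<xi>)"
    "Re (2 * of_real (2 + p) * (w \<xi>)\<^sup>2 * A \<xi>) = 2 * (2 + p) * ((rw \<xi>)\<^sup>2 * rA \<xi>)"
    "Re (2 * (nn - 1) * ((w \<xi>)\<^sup>2 * A \<xi>)) = 2 * (?n - 1) * ((rw \<xi>)\<^sup>2 * rA \<xi>)"
    "Re (of_nat s * ((w \<xi>)\<^sup>2 * z)) = real s * ((rw \<xi>)\<^sup>2 * Re z)" for z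
    unfolding g_def A_real[OF xi] w_real h_real[OF xi] nn_def by (simp_all add: power2_eq_square power3_eq_cube algebra_simps)
  have eq: "Re (weighted_div \<xi> s \<beta> (\<lambda>\<alpha> x. (w x)\<^sup>2 * a \<alpha> x)) = - ?n * (rw \<xi>) ^ 3 - ?n * ((rw \<xi>)\<^sup>2 * rA \<xi>)
     + 2 * (2 + p) * ((rw \<xi>)\<^sup>2 * rA \<xi>) + 2 * (?n - 1) * ((rw \<xi>)\<^sup>2 * rA \<xi>) + real s * ((rw \<xi>)\<^sup>2 * Re (\<Sum>\<alpha>\<in>UNIV. \<beta> \<alpha> * a \<alpha> \<xi>))"
    unfolding weighted_div_def X Y W plus_complex.sel 2 ..
  have "Re (\<Sum>\<alpha>\<in>UNIV. \<beta> \<alpha> * a \<alpha> \<xi>) \<le> rA \<xi> + \<kappa>\<^sup>2"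
    using sum_sq_bound[OF xi \<beta>, of 1] by simp
  then have "real s * ((rw \<xi>)\<^sup>2 * Re (\<Sum>\<alpha>\<in>UNIV. \<beta> \<alpha> * a \<alpha> \<xi>)) \<le> real s * ((rw \<xi>)\<^sup>2 * (rA \<xi> + \<kappa>\<^sup>2))"
    by (intro mult_left_mono) auto
  also have "\<dots> = real s * ((rw \<xi>)\<^sup>2 * rA \<xi>) + real s * (\<kappa>\<^sup>2 * (rw \<xi>)\<^sup>2)" by (simp add: algebra_simps)
  finally have b: "real s * ((rw \<xi>)\<^sup>2 * Re (\<Sum>\<alpha>\<in>UNIV. \<beta> \<alpha> * a \<alpha> \<xi>)) \<le> real s * ((rw \<xi>)\<^sup>2 * rA \<xi>) + real s * (\<kappa>\<^sup>2 * (rw \<xi>)\<^sup>2)" .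
  have "p * ((rw \<xi>)\<^sup>2 * rA \<xi>) \<le> 0" using p rA_nonneg[OF xi] by (simp add: mult_nonpos_nonneg)
  moreover have "0 \<le> real s * (\<kappa>\<^sup>2 * (rw \<xi>)\<^sup>2)" by simp
  moreover have "2 * (2 + p) * y = 4 * y + 2 * (p * y)" "2 * (?n - 1) * y = 2 * (?n * y) - 2 * y"
    "(?n + 2 + real s) * y = ?n * y + 2 * y + real s * y" "2 * real s * y = 2 * (real s * y)" for y
    by (simp_all add: algebra_simps)
  ultimately show ?thesis unfolding eq using b by (simp only:)
qed

text \<open>With \<open>\<kappa> = 1 / (r * R)\<close> the gradient bound on \<open>eta\<close>
  becomes \<open>4 * \<kappa>^2\<close> for its logarithmic derivative. The second field has the
  cutoff power \<open>s - 2\<close> because \<open>r ^ (s - 2) / R^2 = r ^ s * \<kappa>^2\<close>,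
  the factor with which it enters \<open>absorbs\<close>.\<close>

lemma pointwise_estimate:
  fixes s :: nat and eta :: "'n heis \<Rightarrow> complex"
  assumes p: "p \<le> 0" and s: "s \<ge> 2" and eps: "0 < \<epsilon>" "\<epsilon> \<le> 1 / 16"
    and absorb: "absorbs (real CARD('n)) (real s) (\<epsilon> / 4)
      (- p * (2 * real CARD('n) - 1) - p\<^sup>2 / 2 - \<epsilon> * (real CARD('n) + 2)) (- p * (2 * real CARD('n) - 1))
      (28 * (real s)\<^sup>2) (1 / (4 * (1 / (800 * (real s)\<^sup>2))) + 2 * (real s)\<^sup>2) K1 K2 C"
    and eta: "eta differentiable (at \<xi>)" "eta \<xi> = of_real r" "r > 0"
    and grad: "(\<Sum>\<alpha>\<in>UNIV. (cmod (Zbar \<alpha> eta \<xi>))\<^sup>2) \<le> 4 / R\<^sup>2" and R: "R > 0"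
  shows "r ^ s * (Re (weight \<xi>) * (rw \<xi>) ^ 3) \<le>
      K1 * Re (\<Sum>\<alpha>\<in>UNIV. Zbar \<alpha> (\<lambda>x. eta x ^ s * (weight x * (V \<alpha> x + of_real \<epsilon> * ((A x)\<^sup>2 * a \<alpha> x)))) \<xi>)
      + K2 / R\<^sup>2 * Im (\<Sum>\<alpha>\<in>UNIV. Zbar \<alpha> (\<lambda>x. eta x ^ (s - 2) * (weight x * (h x * a \<alpha> x))) \<xi>)
      - 2 * Re (\<Sum>\<alpha>\<in>UNIV. Zbar \<alpha> (\<lambda>x. eta x ^ s * (weight x * ((w x)\<^sup>2 * a \<alpha> x))) \<xi>)
      + C * (1 / (r * R)) ^ 6 * (r ^ s * Re (weight \<xi>))"
proof -
  define \<kappa> where "\<kappa> = 1 / (r * R)"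
  define \<beta> where "\<beta> = (\<lambda>\<alpha>. Zbar \<alpha> eta \<xi> / eta \<xi>)"
  define rE where "rE = Re (weight \<xi>)"
  have weight: "weight \<xi> = of_real rE" "rE > 0"
  proof -
    have "weight \<xi> = of_real (exp (2 * (real CARD('n) - 1) * f \<xi>))"
      unfolding weight_def F_def nn_def by (simp flip: exp_of_real)
    then show "weight \<xi> = of_real rE" "rE > 0" by (auto simp: rE_def)
  qed
  have k: "\<kappa> \<ge> 0" "\<kappa>\<^sup>2 * r\<^sup>2 = 1 / R\<^sup>2" using eta R by (simp_all add: \<kappa>_def power_divide power_mult_distrib)
  have \<beta>: "(\<Sum>\<alpha>\<in>UNIV. (cmod (\<beta> \<alpha>))\<^sup>2) \<le> 4 * \<kappa>\<^sup>2"
  proof -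
    have "(\<Sum>\<alpha>\<in>UNIV. (cmod (\<beta> \<alpha>))\<^sup>2) = (\<Sum>\<alpha>\<in>UNIV. (cmod (Zbar \<alpha> eta \<xi>))\<^sup>2) / r\<^sup>2"
      using eta by (simp add: \<beta>_def norm_divide power_divide sum_divide_distrib)
    also have "\<dots> \<le> (4 / R\<^sup>2) / r\<^sup>2" using grad by (intro divide_right_mono) auto
    finally show ?thesis using eta R by (simp add: \<kappa>_def power_divide power_mult_distrib mult.commute)
  qed
  let ?Q1 = "Re (weighted_div \<xi> s \<beta> (\<lambda>\<alpha> x. V \<alpha> x + of_real \<epsilon> * ((A x)\<^sup>2 * a \<alpha> x)))"
  let ?Q2 = "Im (weighted_div \<xi> (s - 2) \<beta> (\<lambda>\<alpha> x. h x * a \<alpha> x))"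
  let ?Q3 = "Re (weighted_div \<xi> s \<beta> (\<lambda>\<alpha> x. (w x)\<^sup>2 * a \<alpha> x))"
  have nonneg: "SG \<xi> \<ge> 0" "SX \<xi> \<ge> 0" "SY \<xi> \<ge> 0"
    unfolding SG_def SX_def SY_def by (auto intro: sum_nonneg)
  have q1: "?Q1 \<ge> (SG \<xi> + SX \<xi> + SY \<xi>) / 2 + (- p * (2 * real CARD('n) - 1) - p\<^sup>2 / 2 - \<epsilon> * (real CARD('n) + 2)) * (rw \<xi> * (rA \<xi>)\<^sup>2)
      + (- p * (2 * real CARD('n) - 1)) * ((rw \<xi>)\<^sup>2 * rA \<xi>)
      + \<epsilon> / 4 * (rA \<xi>) ^ 3 - 28 * (real s)\<^sup>2 * (\<kappa>\<^sup>2 * (rA \<xi>)\<^sup>2) - 24 * (real s)\<^sup>2 * (\<kappa>\<^sup>2 * (rw \<xi>)\<^sup>2)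
      - 100 * (real s)\<^sup>2 * (\<kappa>\<^sup>2 * (rh \<xi>)\<^sup>2)"
  proof -
    \<comment> \<open>For \<open>p \<le> 0\<close> the term with \<open>w * h^2\<close> has the good
      sign and is dropped.\<close>
    have "3 * real CARD('n) * p * (rw \<xi> * (rh \<xi>)\<^sup>2) \<le> 0"
      using p rw_pos[of \<xi>] by (simp add: mult_nonpos_nonneg mult_nonneg_nonpos)
    moreover have "(- p * (2 * real CARD('n) - 1)) * ((rw \<xi>)\<^sup>2 * rA \<xi>) = - (p * (2 * real CARD('n) - 1) * ((rw \<xi>)\<^sup>2 * rA \<xi>))"
      by simp
    ultimately show ?thesis using s by (intro order_trans[OF _ weighted_div_V_lower[OF xi \<beta> _ eps]]) simp_all
  qed
  have q2: "\<kappa>\<^sup>2 * ?Q2 \<ge> \<kappa>\<^sup>2 * (rh \<xi>)\<^sup>2 / 2 - \<kappa>\<^sup>2 * (rA \<xi>)\<^sup>2 - \<kappa>\<^sup>2 * (rw \<xi> * rA \<xi>) - SG \<xi> / (800 * (real s)\<^sup>2)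
     - (1 / (4 * (1 / (800 * (real s)\<^sup>2))) + 2 * (real s)\<^sup>2) * (\<kappa> ^ 4 * rA \<xi>)"
  proof -
    have "(1 / (4 * (1 / (800 * (real s)\<^sup>2))) + 2 * (real (s - 2))\<^sup>2) * (\<kappa> ^ 4 * rA \<xi>) \<le> (1 / (4 * (1 / (800 * (real s)\<^sup>2))) + 2 * (real s)\<^sup>2) * (\<kappa> ^ 4 * rA \<xi>)"
      using rA_nonneg[OF xi] by (intro mult_right_mono add_left_mono mult_left_mono power_mono) auto
    moreover have "1 / (800 * (real s)\<^sup>2) * SG \<xi> = SG \<xi> / (800 * (real s)\<^sup>2)" by simp
    ultimately show ?thesis using weighted_div_h_lower[OF \<beta>, of "1 / (800 * (real s)\<^sup>2)" "s - 2"] s by simp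
  qed
  note q3 = weighted_div_w_upper[OF \<beta> p, of s]
  have main: "(rw \<xi>) ^ 3 \<le> K1 * ?Q1 + K2 * (\<kappa>\<^sup>2 * ?Q2) - 2 * ?Q3 + C * \<kappa> ^ 6"
    using absorb[unfolded absorbs_def, rule_format, OF nonneg rA_nonneg[OF xi] less_imp_le[OF rw_pos] k(1) q1 q2 q3] .
  have e0: "eta \<xi> \<noteq> 0" using eta by simp
  have dd: "(\<lambda>x. V \<alpha> x + of_real \<epsilon> * ((A x)\<^sup>2 * a \<alpha> x)) differentiable (at \<xi>)"
    "(\<lambda>x. h x * a \<alpha> x) differentiable (at \<xi>)" "(\<lambda>x. (w x)\<^sup>2 * a \<alpha> x) differentiable (at \<xi>)" for \<alpha>
    using differentiable_fields[OF xi] differentiable_V_weight[OF xi] by simp_all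
  have rs: "r ^ s = r ^ (s - 2) * r\<^sup>2" using s by (metis le_add_diff_inverse2 power_add)
  have T1: "Re (\<Sum>\<alpha>\<in>UNIV. Zbar \<alpha> (\<lambda>x. eta x ^ s * (weight x * (V \<alpha> x + of_real \<epsilon> * ((A x)\<^sup>2 * a \<alpha> x)))) \<xi>) = r ^ s * rE * ?Q1"
    unfolding div_weighted[OF xi eta(1) e0 dd(1)] eta(2) weight(1) \<beta>_def by (simp flip: of_real_power of_real_mult add: mult.assoc)
  have T3: "Re (\<Sum>\<alpha>\<in>UNIV. Zbar \<alpha> (\<lambda>x. eta x ^ s * (weight x * ((w x)\<^sup>2 * a \<alpha> x))) \<xi>) = r ^ s * rE * ?Q3"
    unfolding div_weighted[OF xi eta(1) e0 dd(3)] eta(2) weight(1) \<beta>_def by (simp flip: of_real_power of_real_mult add: mult.assoc)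
  have T2: "Im (\<Sum>\<alpha>\<in>UNIV. Zbar \<alpha> (\<lambda>x. eta x ^ (s - 2) * (weight x * (h x * a \<alpha> x))) \<xi>) = r ^ (s - 2) * rE * ?Q2"
    unfolding div_weighted[OF xi eta(1) e0 dd(2)] eta(2) weight(1) \<beta>_def by (simp flip: of_real_power of_real_mult add: mult.assoc)
  have T2': "K2 / R\<^sup>2 * (r ^ (s - 2) * rE * ?Q2) = r ^ s * rE * (K2 * (\<kappa>\<^sup>2 * ?Q2))"
  proof -
    have "K2 / R\<^sup>2 = K2 * (\<kappa>\<^sup>2 * r\<^sup>2)" using k(2) by simp
    then show ?thesis unfolding rs by simp
  qed
  have "r ^ s * rE * (rw \<xi>) ^ 3 \<le> r ^ s * rE * (K1 * ?Q1 + K2 * (\<kappa>\<^sup>2 * ?Q2) - 2 * ?Q3 + C * \<kappa> ^ 6)"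
    using main weight eta by (intro mult_left_mono) auto
  then show ?thesis unfolding T1 T2 T3 T2' rE_def[symmetric] \<kappa>_def[symmetric] by (simp add: algebra_simps)
qed

end

end

section \<open>Integration by parts on superlevel sets\<close>

text \<open>Difference quotients of \<open>H\<close> have integral zero by translation invariance.
  The mean value theorem turns them into values of the derivative at nearby points, which gives both
  their limit and a uniform bound, so dominated convergence applies.\<close>

lemma integral_ddir_eq_0:
  fixes H :: "'a::euclidean_space \<Rightarrow> real"
  assumes diff: "\<And>x. H differentiable (at x)" and cont: "continuous_on UNIV (ddir v H)"
    and supp: "\<And>x. norm x > B \<Longrightarrow> H x = 0"
  shows "has_bochner_integral lborel (ddir v H) 0"
proof -
  let ?g = "ddir v H"
  \<comment> \<open>The margin \<open>norm v\<close> makes \<open>K\<close> contain the supports of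
    all difference quotients with step at most 1.\<close>
  define K where "K = cball (0::'a) (B + norm v)"
  have gz: "?g x = 0" if "norm x > B" for x
  proof -
    have "ddir v H x = ddir v (\<lambda>x. 0) x"
    proof (rule ddir_cong[of "- cball 0 B"])
      show "open (- cball (0::'a) B)" by (simp add: open_Compl)
    qed (use that supp in auto)
    then show ?thesis by simp
  qed
  have "compact (?g ` K)" unfolding K_def
    by (intro compact_continuous_image continuous_on_subset[OF cont]) auto
  then have "bounded (?g ` K)" by (rule compact_imp_bounded)
  then obtain M0 where M0: "\<And>x. x \<in> K \<Longrightarrow> \<bar>?g x\<bar> \<le> M0"
    unfolding bounded_iff by auto
  define M where "M = max M0 0"
  have M: "\<bar>?g x\<bar> \<le> M" for x
  proof (cases "x \<in> K")
    case True then show ?thesis using M0 by (fastforce simp: M_def)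
  next
    case False
    then have "norm x > B + norm v" by (simp add: K_def)
    then have "norm x > B" using norm_ge_zero[of v] by linarith
    then show ?thesis by (simp add: gz M_def)
  qed
  have Hcont: "continuous_on UNIV H"
    using diff by (simp add: continuous_at_imp_continuous_on differentiable_imp_continuous_within)
  have Hint: "integrable lborel H"
  proof -
    have "integrable lborel (\<lambda>x. indicator K x *\<^sub>R H x)"
      unfolding K_def by (intro borel_integrable_compact continuous_on_subset[OF Hcont]) auto
    moreover have "(\<lambda>x. indicator K x *\<^sub>R H x) = H"
    proof
      fix x
      have "x \<in> K" if "\<not> norm x > B" unfolding K_def using norm_ge_zero[of v] that by (simp; linarith)
      then show "indicator K x *\<^sub>R H x = H x"
        using supp[of x] by (cases "norm x > B") auto
    qed
    ultimately show ?thesis by simp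
  qed
  have gint: "integrable lborel ?g"
  proof -
    have "integrable lborel (\<lambda>x. indicator K x *\<^sub>R ?g x)"
      unfolding K_def by (intro borel_integrable_compact continuous_on_subset[OF cont]) auto
    moreover have "(\<lambda>x. indicator K x *\<^sub>R ?g x) = ?g"
    proof
      fix x
      have "x \<in> K" if "\<not> norm x > B" unfolding K_def using norm_ge_zero[of v] that by (simp; linarith)
      then show "indicator K x *\<^sub>R ?g x = ?g x"
        using gz[of x] by (cases "norm x > B") auto
    qed
    ultimately show ?thesis by simp
  qed
  have Hm: "H \<in> borel_measurable borel" using Hcont borel_measurable_continuous_onI by blast
  have tr: "integrable lborel (\<lambda>x. H (y + x))" "integral\<^sup>L lborel (\<lambda>x. H (y + x)) = integral\<^sup>L lborel H" for y
  proof -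
    have "integrable (distr lborel borel ((+) y)) H" using Hint by (simp add: lborel_distr_plus)
    then show "integrable lborel (\<lambda>x. H (y + x))" by (subst (asm) integrable_distr_eq) (use Hm in auto)
    show "integral\<^sup>L lborel (\<lambda>x. H (y + x)) = integral\<^sup>L lborel H"
      using integral_distr[of "(+) y" lborel borel H] Hm by (simp add: lborel_distr_plus)
  qed
  define t where "t i = inverse (real (Suc i))" for i
  have t: "0 < t i" "t i \<le> 1" for i by (auto simp: t_def field_simps)
  have t0: "t \<longlonglongrightarrow> 0" unfolding t_def by (rule LIMSEQ_inverse_real_of_nat)
  define D where "D i x = inverse (t i) * (H (t i *\<^sub>R v + x) - H x)" for i x
  have Dmv: "\<exists>s. 0 < s \<and> s < t i \<and> D i x = ?g (x + s *\<^sub>R v)" for i x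
    using mvt_ddir[of "t i" H x v] t[of i] diff by (auto simp: D_def add.commute field_simps)
  have Dlim: "(\<lambda>i. D i x) \<longlonglongrightarrow> ?g x" for x
  proof -
    obtain s where s: "\<And>i. 0 < s i \<and> s i < t i \<and> D i x = ?g (x + s i *\<^sub>R v)"
      using Dmv[of _ x] by metis
    have "s \<longlonglongrightarrow> 0"
      by (rule tendsto_sandwich[OF _ _ tendsto_const t0]) (use s in \<open>auto intro!: always_eventually less_imp_le\<close>)
    then have "(\<lambda>i. x + s i *\<^sub>R v) \<longlonglongrightarrow> x + 0 *\<^sub>R v" by (intro tendsto_intros)
    then have "(\<lambda>i. x + s i *\<^sub>R v) \<longlonglongrightarrow> x" by simp
    moreover have "isCont ?g x" using cont by (simp add: continuous_on_eq_continuous_at)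
    ultimately have "(\<lambda>i. ?g (x + s i *\<^sub>R v)) \<longlonglongrightarrow> ?g x"
      by (rule isCont_tendsto_compose[rotated])
    then show ?thesis using s by simp
  qed
  have Dbound: "norm (D i x) \<le> indicator K x * M" for i x
  proof (cases "x \<in> K")
    case True
    then show ?thesis using Dmv[of i x] M by auto
  next
    case False
    have nx: "norm x > B + norm v" using False by (simp add: K_def)
    moreover have "norm (t i *\<^sub>R v + x) > B"
    proof -
      have "norm x \<le> norm (t i *\<^sub>R v + x) + norm (t i *\<^sub>R v)"
        using norm_triangle_ineq4[of "t i *\<^sub>R v + x" "t i *\<^sub>R v"] by simp
      moreover have "norm (t i *\<^sub>R v) \<le> norm v" using t[of i] by (simp add: mult_left_le_one_le)
      ultimately show ?thesis using nx by linarith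
    qed
    moreover have "norm x > B" using nx norm_ge_zero[of v] by linarith
    ultimately have "D i x = 0" using supp by (simp add: D_def)
    then show ?thesis using False by simp
  qed
  have Dint: "integrable lborel (D i)" "integral\<^sup>L lborel (D i) = 0" for i
    unfolding D_def[abs_def] using tr[of "t i *\<^sub>R v"] Hint by simp_all
  have "(\<lambda>i. integral\<^sup>L lborel (D i)) \<longlonglongrightarrow> integral\<^sup>L lborel ?g"
  proof (rule integral_dominated_convergence[where w="\<lambda>x. indicator K x * M"])
    show "integrable lborel (\<lambda>x. indicator K x * M)"
      using borel_integrable_compact[of K "\<lambda>_. M"] by (simp add: K_def)
  qed (use Dlim Dbound Dint gint in \<open>auto intro: borel_measurable_integrable\<close>)
  then have "integral\<^sup>L lborel ?g = 0" unfolding Dint(2) by (simp add: LIMSEQ_const_iff)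
  then show ?thesis using gint by (simp add: has_bochner_integral_iff)
qed

lemma has_derivative_zero_squeeze:
  fixes H G :: "'a::euclidean_space \<Rightarrow> real"
  assumes "(H has_derivative (\<lambda>_. 0)) (at x)" "H x = 0" "\<And>y. \<bar>G y\<bar> \<le> \<bar>H y\<bar>"
  shows "(G has_derivative (\<lambda>_. 0)) (at x)"
proof -
  have G0: "G x = 0" using assms(3)[of x] assms(2) by simp
  have "((\<lambda>y. norm (H y) / norm (y - x)) \<longlongrightarrow> 0) (at x)"
    using assms(1,2) by (simp add: has_derivative_iff_norm)
  then have "((\<lambda>y. norm (G y) / norm (y - x)) \<longlongrightarrow> 0) (at x)"
    by (rule Lim_null_comparison[rotated])
       (use assms(3) in \<open>auto intro!: always_eventually divide_right_mono\<close>)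
  then show ?thesis using G0 by (simp add: has_derivative_iff_norm)
qed

text \<open>
  Since \<open>H\<close> vanishes to second order on \<open>{k = 0}\<close>, its extension by zero is differentiable everywhere, so
  no regularity of the boundary of \<open>{k > 0}\<close> is needed.
\<close>

lemma integral_ddir_superlevel:
  fixes H k :: "'a::euclidean_space \<Rightarrow> real"
  assumes S: "open S" and diff: "\<And>x. x \<in> S \<Longrightarrow> H differentiable (at x)" and cont: "continuous_on S (ddir v H)"
    and k: "continuous_on UNIV k" and sub: "{x. k x \<ge> 0} \<subseteq> S" and bdd: "bounded {x. k x \<ge> 0}"
    and z: "\<And>x. k x = 0 \<Longrightarrow> H x = 0" "\<And>x w. k x = 0 \<Longrightarrow> ddir w H x = 0"
  shows "has_bochner_integral lborel (\<lambda>x. indicator {x. k x > 0} x *\<^sub>R ddir v H x) 0"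
proof -
  define G where "G x = (if k x > 0 then H x else 0)" for x
  have op: "open {x. k x > 0}" "open {x. k x < 0}"
    using k by (auto intro!: open_Collect_less continuous_intros)
  have G: "G differentiable (at x) \<and> ddir v G x = indicator {x. k x > 0} x *\<^sub>R ddir v H x" for x
  proof -
    consider "k x > 0" | "k x < 0" | "k x = 0" by linarith
    then show ?thesis
    proof cases
      case 1
      have "H differentiable (at x)" using 1 sub diff by (auto simp: subset_iff)
      then show ?thesis
        using differentiable_transform_open[of H x "{x. k x > 0}" G] ddir_transform[of H x "{x. k x > 0}" G] op 1
        by (auto simp: G_def)
    next
      case 2
      have c: "(\<lambda>_. 0::real) differentiable (at x)" by simp
      then show ?thesis
        using differentiable_transform_open[OF c, of "{x. k x < 0}" G] ddir_transform[OF c, of "{x. k x < 0}" G] op 2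
        by (auto simp: G_def)
    next
      case 3
      have "H differentiable (at x)" using 3 sub diff by (auto simp: subset_iff)
      from has_derivative_ddir[OF this] have "(H has_derivative (\<lambda>_. 0)) (at x)" using z(2)[OF 3] by simp
      from has_derivative_zero_squeeze[OF this z(1)[OF 3], of G] have "(G has_derivative (\<lambda>_. 0)) (at x)"
        by (auto simp: G_def)
      then show ?thesis using 3 ddir_eqI[of G "\<lambda>_. 0" x] by (auto simp: differentiable_def)
    qed
  qed
  have "continuous_on UNIV (\<lambda>x. if k x \<le> 0 then 0 else ddir v H x)"
    by (rule continuous_on_cases_le[OF _ _ k]) (use sub z in \<open>auto intro: continuous_on_subset[OF cont]\<close>)
  also have "(\<lambda>x. if k x \<le> 0 then 0 else ddir v H x) = ddir v G"
    using G by (auto simp: fun_eq_iff)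
  finally have c: "continuous_on UNIV (ddir v G)" .
  obtain B where B: "\<And>x. k x \<ge> 0 \<Longrightarrow> norm x \<le> B" using bdd unfolding bounded_iff by auto
  have "has_bochner_integral lborel (ddir v G) 0"
  proof (rule integral_ddir_eq_0[OF _ c, of B])
    show "G x = 0" if "norm x > B" for x using B[of x] that by (auto simp: G_def)
  qed (use G in simp)
  moreover have "ddir v G = (\<lambda>x. indicator {x. k x > 0} x *\<^sub>R ddir v H x)" using G by auto
  ultimately show ?thesis by simp
qed

lemma integral_ddir_superlevel_complex:
  fixes H :: "'a::euclidean_space \<Rightarrow> complex" and k :: "'a \<Rightarrow> real"
  assumes S: "open S" and H: "smooth_on H S"
    and k: "continuous_on UNIV k" and sub: "{x. k x \<ge> 0} \<subseteq> S" and bdd: "bounded {x. k x \<ge> 0}"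
    and z: "\<And>x. k x = 0 \<Longrightarrow> H x = 0" "\<And>x w. k x = 0 \<Longrightarrow> ddir w H x = 0"
  shows "has_bochner_integral lborel (\<lambda>x. indicator {x. k x > 0} x *\<^sub>R ddir v H x) 0"
proof -
  have *: "has_bochner_integral lborel (\<lambda>x. indicator {x. k x > 0} x *\<^sub>R L (ddir v H x)) 0"
    if L: "bounded_linear L" for L :: "complex \<Rightarrow> real"
  proof -
    have s: "smooth_on (\<lambda>x. L (H x)) S" by (rule smooth_on_bounded_linear[OF S L H])
    have d: "ddir w (\<lambda>x. L (H x)) x = L (ddir w H x)" if "x \<in> S" for x w
      by (rule ddir_bounded_linear[OF L smooth_on_differentiable[OF H that]])
    have L0: "L 0 = 0" using L by (simp add: linear_simps)
    have "has_bochner_integral lborel (\<lambda>x. indicator {x. k x > 0} x *\<^sub>R ddir v (\<lambda>x. L (H x)) x) 0"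
      by (rule integral_ddir_superlevel[OF S _ _ k sub bdd])
         (use s smooth_on_differentiable smooth_on_continuous[OF smooth_on_ddir[OF s]] z d sub L0 in \<open>auto simp: subset_iff\<close>)
    moreover have "indicator {x. k x > 0} x *\<^sub>R ddir v (\<lambda>x. L (H x)) x = indicator {x. k x > 0} x *\<^sub>R L (ddir v H x)" for x
      using d sub by (cases "k x > 0") (auto simp: subset_iff)
    ultimately show ?thesis by (simp only:)
  qed
  have r: "has_bochner_integral lborel (\<lambda>x. complex_of_real (indicator {x. k x > 0} x *\<^sub>R Re (ddir v H x))) (of_real 0)"
    "has_bochner_integral lborel (\<lambda>x. complex_of_real (indicator {x. k x > 0} x *\<^sub>R Im (ddir v H x))) (of_real 0)"
    by (rule has_bochner_integral_of_real[OF *[OF bounded_linear_Re]], rule has_bochner_integral_of_real[OF *[OF bounded_linear_Im]])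
  from has_bochner_integral_add[OF r(1) has_bochner_integral_mult_right[OF r(2), of \<i>]]
  have "has_bochner_integral lborel (\<lambda>x. complex_of_real (indicator {x. k x > 0} x *\<^sub>R Re (ddir v H x))
     + \<i> * complex_of_real (indicator {x. k x > 0} x *\<^sub>R Im (ddir v H x))) 0" by simp
  moreover have "complex_of_real (indicator {x. k x > 0} x *\<^sub>R Re (ddir v H x))
     + \<i> * complex_of_real (indicator {x. k x > 0} x *\<^sub>R Im (ddir v H x)) = indicator {x. k x > 0} x *\<^sub>R ddir v H x" for x
    by (auto simp: complex_eq_iff indicator_def)
  ultimately show ?thesis by simp
qed

text \<open>The coefficient of \<open>dt\<close> in these fields is independent of \<open>t\<close>,
  so it moves under the derivative and each term becomes a derivative in a fixed direction. The
  exponent \<open>m \<ge> 2\<close> provides the second-order vanishing on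
  \<open>{k = 0}\<close>.\<close>

lemma integral_Zbar_superlevel:
  fixes X :: "'n::finite heis \<Rightarrow> complex" and k :: "'n heis \<Rightarrow> real"
  assumes S: "open S" and X: "smooth_on X S" and k: "smooth_on k UNIV"
    and sub: "{x. k x \<ge> 0} \<subseteq> S" and bdd: "bounded {x. k x \<ge> 0}" and m: "m \<ge> 2"
  shows "has_bochner_integral lborel (\<lambda>x. indicator {x. k x > 0} x *\<^sub>R Zbar \<alpha> (\<lambda>x. complex_of_real (k x) ^ m * X x) x) 0" (is "?P (Zbar \<alpha> _)")
    and "has_bochner_integral lborel (\<lambda>x. indicator {x. k x > 0} x *\<^sub>R Z \<alpha> (\<lambda>x. complex_of_real (k x) ^ m * X x) x) 0"
proof -
  have *: "has_bochner_integral lborel (\<lambda>x. indicator {x. k x > 0} x *\<^sub>R ddir v (\<lambda>x. complex_of_real (k x) ^ m * Y x) x) 0"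
    if Y: "smooth_on Y S" for Y v
  proof (rule integral_ddir_superlevel_complex[OF S _ smooth_on_continuous[OF k] sub bdd])
    have kS: "smooth_on (\<lambda>x. complex_of_real (k x)) S"
      by (intro smooth_on_of_real S smooth_on_subset[OF k]) auto
    show "smooth_on (\<lambda>x. complex_of_real (k x) ^ m * Y x) S"
      by (intro smooth_intros S Y kS)
    show "complex_of_real (k x) ^ m * Y x = 0" if "k x = 0" for x using that m by simp
    show "ddir w (\<lambda>x. complex_of_real (k x) ^ m * Y x) x = 0" if "k x = 0" for x w
    proof -
      have xS: "x \<in> S" using sub that by auto
      have d: "(\<lambda>x. complex_of_real (k x)) differentiable (at x)" "Y differentiable (at x)"
        using smooth_on_differentiable[OF _ xS] kS Y by blast+
      have "((\<lambda>x. complex_of_real (k x) ^ m) has_derivative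
         (\<lambda>v. of_nat m * complex_of_real (k x) ^ (m - 1) * ddir v (\<lambda>x. complex_of_real (k x)) x)) (at x)"
        using has_derivative_power[OF has_derivative_ddir[OF d(1)], of m] by (simp add: mult_ac)
      from ddir_eqI[OF this] have "ddir w (\<lambda>x. complex_of_real (k x) ^ m) x = 0" using that m by simp
      then show ?thesis using that m d by (subst ddir_mult) auto
    qed
  qed
  let ?H = "\<lambda>x. complex_of_real (k x) ^ m * X x"
  have zX: "smooth_on (\<lambda>x. fst x $ \<alpha> * X x) S" "smooth_on (\<lambda>x. cnj (fst x $ \<alpha>) * X x) S"
    by (intro smooth_intros S X smooth_on_coord)+
  have t: "ddir (0, 1) (\<lambda>x. complex_of_real (k x) ^ m * (fst x $ \<alpha> * X x)) x = fst x $ \<alpha> * ddir (0, 1) ?H x"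
    "ddir (0, 1) (\<lambda>x. complex_of_real (k x) ^ m * (cnj (fst x $ \<alpha>) * X x)) x = cnj (fst x $ \<alpha>) * ddir (0, 1) ?H x"
    if "k x > 0" for x
  proof -
    have xS: "x \<in> S" using sub that by auto
    have kS: "smooth_on (\<lambda>x. complex_of_real (k x)) S"
      by (intro smooth_on_of_real S smooth_on_subset[OF k]) auto
    have d: "?H differentiable (at x)"
      by (rule smooth_on_differentiable[OF _ xS]) (intro smooth_intros S X kS)
    have c: "(\<lambda>x. fst x $ \<alpha>) differentiable (at x)" "(\<lambda>x. cnj (fst x $ \<alpha>)) differentiable (at x)"
      using bounded_linear_imp_differentiable[OF bounded_linear_coord]
        bounded_linear_imp_differentiable[OF bounded_linear_compose[OF bounded_linear_cnj bounded_linear_coord]] by (auto simp: comp_def)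
    have "ddir (0, 1) (\<lambda>x. fst x $ \<alpha> * ?H x) x = fst x $ \<alpha> * ddir (0, 1) ?H x"
      using ddir_mult[OF c(1) d] by (simp add: ddir_linear[OF bounded_linear_coord])
    moreover have "ddir (0, 1) (\<lambda>x. cnj (fst x $ \<alpha>) * ?H x) x = cnj (fst x $ \<alpha>) * ddir (0, 1) ?H x"
      using ddir_mult[OF c(2) d] by (simp add: ddir_bounded_linear[OF bounded_linear_cnj c(1)] ddir_linear[OF bounded_linear_coord])
    ultimately show "ddir (0, 1) (\<lambda>x. complex_of_real (k x) ^ m * (fst x $ \<alpha> * X x)) x = fst x $ \<alpha> * ddir (0, 1) ?H x"
     "ddir (0, 1) (\<lambda>x. complex_of_real (k x) ^ m * (cnj (fst x $ \<alpha>) * X x)) x = cnj (fst x $ \<alpha>) * ddir (0, 1) ?H x"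
      by (simp_all add: mult_ac)
  qed
  let ?T = "{x. k x > 0}"
  have "has_bochner_integral lborel (\<lambda>x. (1/2) * (indicator ?T x *\<^sub>R ddir (axis \<alpha> 1, 0) ?H x)
     + (\<i>/2) * (indicator ?T x *\<^sub>R ddir (axis \<alpha> \<i>, 0) ?H x)
     + (- \<i>) * (indicator ?T x *\<^sub>R ddir (0, 1) (\<lambda>x. complex_of_real (k x) ^ m * (fst x $ \<alpha> * X x)) x)) (1/2 * 0 + \<i>/2 * 0 + (-\<i>) * 0)"
    by (intro has_bochner_integral_add has_bochner_integral_mult_right * X zX)
  moreover have "(\<lambda>x. (1/2) * (indicator ?T x *\<^sub>R ddir (axis \<alpha> 1, 0) ?H x)
     + (\<i>/2) * (indicator ?T x *\<^sub>R ddir (axis \<alpha> \<i>, 0) ?H x)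
     + (- \<i>) * (indicator ?T x *\<^sub>R ddir (0, 1) (\<lambda>x. complex_of_real (k x) ^ m * (fst x $ \<alpha> * X x)) x))
     = (\<lambda>x. indicator ?T x *\<^sub>R Zbar \<alpha> ?H x)" (is "?L = _")
  proof
    fix x show "?L x = indicator ?T x *\<^sub>R Zbar \<alpha> ?H x"
      by (cases "k x > 0") (simp_all add: Zbar_ddir t add_divide_distrib diff_divide_distrib)
  qed
  ultimately show "has_bochner_integral lborel (\<lambda>x. indicator ?T x *\<^sub>R Zbar \<alpha> ?H x) 0" by simp
  have "has_bochner_integral lborel (\<lambda>x. (1/2) * (indicator ?T x *\<^sub>R ddir (axis \<alpha> 1, 0) ?H x)
     + (-\<i>/2) * (indicator ?T x *\<^sub>R ddir (axis \<alpha> \<i>, 0) ?H x)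
     + \<i> * (indicator ?T x *\<^sub>R ddir (0, 1) (\<lambda>x. complex_of_real (k x) ^ m * (cnj (fst x $ \<alpha>) * X x)) x)) (1/2 * 0 + (-\<i>/2) * 0 + \<i> * 0)"
    by (intro has_bochner_integral_add has_bochner_integral_mult_right * X zX)
  moreover have "(\<lambda>x. (1/2) * (indicator ?T x *\<^sub>R ddir (axis \<alpha> 1, 0) ?H x)
     + (-\<i>/2) * (indicator ?T x *\<^sub>R ddir (axis \<alpha> \<i>, 0) ?H x)
     + \<i> * (indicator ?T x *\<^sub>R ddir (0, 1) (\<lambda>x. complex_of_real (k x) ^ m * (cnj (fst x $ \<alpha>) * X x)) x))
     = (\<lambda>x. indicator ?T x *\<^sub>R Z \<alpha> ?H x)" (is "?L = _")
  proof
    fix x show "?L x = indicator ?T x *\<^sub>R Z \<alpha> ?H x"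
      by (cases "k x > 0") (simp_all add: Z_ddir t add_divide_distrib diff_divide_distrib)
  qed
  ultimately show "has_bochner_integral lborel (\<lambda>x. indicator ?T x *\<^sub>R Z \<alpha> ?H x) 0" by simp
qed

section \<open>The integral estimate\<close>

definition zsq :: "'n::finite heis \<Rightarrow> real" where
  "zsq \<xi> = (\<Sum>\<alpha>\<in>UNIV. (cmod (fst \<xi> $ \<alpha>))\<^sup>2)"

text \<open>For \<open>e = 0\<close> this is the fourth power of the homogeneous norm; \<open>e > 0\<close> regularises its negative powers.\<close>

definition hq :: "real \<Rightarrow> 'n::finite heis \<Rightarrow> real" where
  "hq e \<xi> = (zsq \<xi> + e)\<^sup>2 + (snd \<xi>)\<^sup>2"

lemma zsq_nonneg: "zsq \<xi> \<ge> 0"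
  unfolding zsq_def by (intro sum_nonneg) auto

lemma zsq_norm: "zsq \<xi> = (norm (fst \<xi>))\<^sup>2"
  by (simp add: zsq_def norm_vec_def L2_set_def sum_nonneg)

lemma zsq_complex: "complex_of_real (zsq \<xi>) = (\<Sum>\<alpha>\<in>UNIV. fst \<xi> $ \<alpha> * cnj (fst \<xi> $ \<alpha>))"
  unfolding zsq_def of_real_sum complex_norm_square ..

lemma heis_norm_hq: "heis_norm \<xi> = hq 0 \<xi> powr (1/4)"
  by (simp add: heis_norm_def hq_def zsq_def)

lemma hq_nonneg: "hq e \<xi> \<ge> 0"
  by (simp add: hq_def)

lemma smooth_on_zsq: "smooth_on (zsq :: 'n::finite heis \<Rightarrow> real) UNIV"
proof -
  have "smooth_on (\<lambda>\<xi>::'n heis. Re (\<Sum>\<alpha>\<in>UNIV. fst \<xi> $ \<alpha> * cnj (fst \<xi> $ \<alpha>))) UNIV"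
    by (intro smooth_on_bounded_linear[OF _ bounded_linear_Re] smooth_intros smooth_on_coord) auto
  then show ?thesis by (simp add: zsq_complex[symmetric] del: Re_sum)
qed

lemma smooth_on_hq: "smooth_on (hq e) UNIV"
  unfolding hq_def[abs_def] by (intro smooth_intros smooth_on_zsq smooth_on_coord) auto

lemma diff_zsq: "(\<lambda>\<xi>. complex_of_real (zsq \<xi>)) differentiable (at \<xi>)"
  and diff_snd: "(\<lambda>\<xi>. complex_of_real (snd \<xi>)) differentiable (at (\<xi>::'n::finite heis))"
  and diff_coord: "(\<lambda>\<xi>. fst \<xi> $ \<alpha>) differentiable (at (\<xi>::'n::finite heis))"
  by (rule smooth_on_differentiable[of _ UNIV], (intro smooth_intros smooth_on_zsq smooth_on_coord; simp), simp)+

lemma Z_zsq: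
  "Z \<alpha> (\<lambda>\<xi>. complex_of_real (zsq \<xi>)) \<xi> = cnj (fst \<xi> $ \<alpha>)"
  "Zbar \<alpha> (\<lambda>\<xi>. complex_of_real (zsq \<xi>)) \<xi> = fst \<xi> $ \<alpha>"
proof -
  have c: "(\<lambda>\<xi>::'n::finite heis. cnj (fst \<xi> $ \<beta>)) differentiable (at \<xi>)" for \<beta> and \<xi> :: "'n::finite heis"
    by (rule smooth_on_differentiable[of _ UNIV], (intro smooth_intros smooth_on_coord; simp), simp)
  have "Z \<alpha> (\<lambda>x. fst x $ \<beta> * cnj (fst x $ \<beta>)) \<xi> = (if \<alpha> = \<beta> then cnj (fst \<xi> $ \<beta>) else 0)"
    "Zbar \<alpha> (\<lambda>x. fst x $ \<beta> * cnj (fst x $ \<beta>)) \<xi> = (if \<alpha> = \<beta> then fst \<xi> $ \<beta> else 0)" for \<beta>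
    by (simp_all add: Z_mult diff_coord c Z_coord Z_cnj)
  then show "Z \<alpha> (\<lambda>\<xi>. complex_of_real (zsq \<xi>)) \<xi> = cnj (fst \<xi> $ \<alpha>)"
    "Zbar \<alpha> (\<lambda>\<xi>. complex_of_real (zsq \<xi>)) \<xi> = fst \<xi> $ \<alpha>"
    unfolding zsq_complex by (simp_all add: Z_sum diff_coord c)
qed

lemma Z_hq:
  "Z \<alpha> (\<lambda>\<xi>. complex_of_real (hq e \<xi>)) \<xi> = 2 * cnj (fst \<xi> $ \<alpha>) * (of_real (zsq \<xi> + e) + \<i> * of_real (snd \<xi>))"
  "Zbar \<alpha> (\<lambda>\<xi>. complex_of_real (hq e \<xi>)) \<xi> = 2 * fst \<xi> $ \<alpha> * (of_real (zsq \<xi> + e) - \<i> * of_real (snd \<xi>))"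
  unfolding hq_def
  by (simp_all add: Z_add Z_power Z_zsq Z_coord diff_zsq diff_snd algebra_simps)

text \<open>Each derivative is \<open>2 * z\<close> times \<open>zsq + e - \<i> * t\<close>, and the
  second factor has squared modulus \<open>hq e\<close>. For \<open>e = 0\<close> on a ball of
  radius \<open>R\<close> the right side is at most \<open>4 * R ^ 6\<close>, the size needed for
  the cutoff.\<close>

lemma sum_Zbar_hq: "(\<Sum>\<alpha>\<in>UNIV. (cmod (Zbar \<alpha> (\<lambda>\<xi>. complex_of_real (hq e \<xi>)) \<xi>))\<^sup>2) = 4 * zsq \<xi> * hq e \<xi>"
proof -
  have "cmod (of_real (zsq \<xi> + e) - \<i> * of_real (snd \<xi>)) ^ 2 = hq e \<xi>"
    unfolding cmod_power2 by (simp add: hq_def)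
  then have "(cmod (Zbar \<alpha> (\<lambda>\<xi>. complex_of_real (hq e \<xi>)) \<xi>))\<^sup>2 = 4 * (cmod (fst \<xi> $ \<alpha>))\<^sup>2 * hq e \<xi>" for \<alpha>
    unfolding Z_hq norm_mult power_mult_distrib by simp
  then show ?thesis by (simp add: zsq_def sum_distrib_left sum_distrib_right)
qed

lemma hq_bounds:
  assumes "hq e \<xi> \<le> R ^ 4" "e \<ge> 0" "R \<ge> 0"
  shows "zsq \<xi> + e \<le> R\<^sup>2" "\<bar>snd \<xi>\<bar> \<le> R\<^sup>2"
proof -
  have R: "R ^ 4 = (R\<^sup>2)\<^sup>2" by simp
  have "(zsq \<xi> + e)\<^sup>2 \<le> (R\<^sup>2)\<^sup>2" "(snd \<xi>)\<^sup>2 \<le> (R\<^sup>2)\<^sup>2" using assms(1) unfolding R hq_def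
    using zero_le_power2[of "snd \<xi>"] zero_le_power2[of "zsq \<xi> + e"] by linarith+
  then show "zsq \<xi> + e \<le> R\<^sup>2" "\<bar>snd \<xi>\<bar> \<le> R\<^sup>2"
    using power2_le_imp_le[of _ "R\<^sup>2"] abs_le_square_iff[of "snd \<xi>" "R\<^sup>2"] by auto
qed

text \<open>The \<open>t\<close> side scales like \<open>R^2\<close>, so the box has volume
  proportional to \<open>R ^ (2 * n + 2)\<close>; this is how the homogeneous dimension
  enters.\<close>

lemma hq_subset_box:
  assumes "R \<ge> 0" "e \<ge> 0"
  shows "{\<xi>::'n::finite heis. hq e \<xi> \<le> R ^ 4} \<subseteq> cbox (- (R *\<^sub>R One), - R\<^sup>2) (R *\<^sub>R One, R\<^sup>2)"
proof
  fix \<xi> :: "'n heis" assume "\<xi> \<in> {\<xi>. hq e \<xi> \<le> R ^ 4}"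
  then have h: "zsq \<xi> + e \<le> R\<^sup>2" "\<bar>snd \<xi>\<bar> \<le> R\<^sup>2" using hq_bounds assms by blast+
  have "(norm (fst \<xi>))\<^sup>2 \<le> R\<^sup>2" using h(1) assms(2) by (simp add: zsq_norm)
  then have nR: "norm (fst \<xi>) \<le> R" using power2_le_imp_le assms(1) by blast
  have "- R \<le> fst \<xi> \<bullet> b \<and> fst \<xi> \<bullet> b \<le> R" if "b \<in> Basis" for b
    using Basis_le_norm[OF that, of "fst \<xi>"] nR by linarith
  then have "fst \<xi> \<in> cbox (- (R *\<^sub>R One)) (R *\<^sub>R One)"
    by (simp add: mem_box)
  then show "\<xi> \<in> cbox (- (R *\<^sub>R One), - R\<^sup>2) (R *\<^sub>R One, R\<^sup>2)"
    using h(2) by (cases \<xi>) (auto simp: cbox_Pair_eq)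
qed

lemma bounded_hq: "e \<ge> 0 \<Longrightarrow> R \<ge> 0 \<Longrightarrow> bounded {\<xi>::'n::finite heis. hq e \<xi> \<le> R ^ 4}"
  using hq_subset_box bounded_subset bounded_cbox by metis

lemma continuous_on_hq: "continuous_on A (hq e)"
  using smooth_on_continuous[OF smooth_on_hq] continuous_on_subset by blast

lemma compact_hq:
  assumes "e \<ge> 0" "R \<ge> 0" shows "compact {\<xi>::'n::finite heis. hq e \<xi> \<le> R ^ 4}"
  unfolding compact_eq_bounded_closed
  using bounded_hq[OF assms] by (auto intro!: closed_Collect_le continuous_on_hq)

lemma measure_box:
  assumes "R \<ge> 0" "T \<ge> 0"
  shows "measure lborel (cbox (- (R *\<^sub>R One), - T) (R *\<^sub>R One, T) :: 'n::finite heis set) = (2 * R) ^ (2 * CARD('n)) * (2 * T)"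
proof -
  define b where "b = (R *\<^sub>R One :: complex ^ 'n)"
  have "(2 * R) *\<^sub>R One = b + b" unfolding b_def by (simp only: scaleR_2[symmetric] scaleR_scaleR)
  then have b: "- b + (2 * R) *\<^sub>R One = b" by simp
  have "measure lborel (cbox (- b) (- b + (2 * R) *\<^sub>R One)) = (2 * R) ^ DIM(complex ^ 'n)"
    using content_cbox_plus[of "- b" "2 * R"] assms by simp
  then have "measure lborel (cbox (- (R *\<^sub>R One)) (R *\<^sub>R One :: complex ^ 'n)) = (2 * R) ^ DIM(complex ^ 'n)"
    unfolding b by (simp only: b_def)
  moreover have "DIM(complex ^ 'n) = 2 * CARD('n)" by simp
  moreover have "measure lborel (cbox (- T) T) = 2 * T" using assms by simp
  ultimately show ?thesis by (simp only: content_Pair)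
qed

lemma integral_le_volume:
  assumes "R \<ge> 0" "c \<ge> 0"
    and f: "set_integrable lborel {\<xi>::'n::finite heis. hq 0 \<xi> < R ^ 4} f" "\<And>\<xi>. hq 0 \<xi> < R ^ 4 \<Longrightarrow> f \<xi> \<le> c"
  shows "(LINT \<xi>:{\<xi>::'n heis. hq 0 \<xi> < R ^ 4}|lborel. f \<xi>) \<le> c * ((2 * R) ^ (2 * CARD('n)) * (2 * R\<^sup>2))"
proof -
  let ?B = "cbox (- (R *\<^sub>R One), - R\<^sup>2) (R *\<^sub>R One, R\<^sup>2) :: 'n heis set"
  have "(LINT \<xi>:{\<xi>::'n heis. hq 0 \<xi> < R ^ 4}|lborel. f \<xi>) \<le> (LINT \<xi>|lborel. indicator ?B \<xi> * c)"
    unfolding set_lebesgue_integral_def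
  proof (rule integral_mono)
    show "integrable lborel (\<lambda>\<xi>. indicator {\<xi>::'n heis. hq 0 \<xi> < R ^ 4} \<xi> *\<^sub>R f \<xi>)"
      using f(1) by (simp add: set_integrable_def)
    show "integrable lborel (\<lambda>\<xi>. indicator ?B \<xi> * c)"
      using borel_integrable_compact[of ?B "\<lambda>_. c"] by simp
    fix \<xi> :: "'n heis"
    show "indicator {\<xi>. hq 0 \<xi> < R ^ 4} \<xi> *\<^sub>R f \<xi> \<le> indicator ?B \<xi> * c"
    proof (cases "hq 0 \<xi> < R ^ 4")
      case True
      then have "\<xi> \<in> ?B" using hq_subset_box[OF assms(1) order_refl] less_imp_le by blast
      then show ?thesis using True f(2) by simp
    qed (use assms(2) in simp)
  qed
  also have "\<dots> = c * measure lborel ?B" by simp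
  also have "measure lborel ?B = (2 * R) ^ (2 * CARD('n)) * (2 * R\<^sup>2)"
    by (rule measure_box) (use assms in auto)
  finally show ?thesis .
qed

text \<open>\<open>\<theta> = M / (6 + 3 * p)\<close> makes \<open>exp (M * f)\<close> the power
  \<open>\<theta>\<close> of \<open>exp (3 * (2 + p) * f)\<close>; for \<open>M = 2 * n - 2\<close>
  these are \<open>weight\<close> and \<open>w^3\<close>. Either \<open>C * \<kappa>^6\<close> is at
  most half of \<open>w^3\<close>, or the weight itself is bounded by a power of
  \<open>\<kappa>\<close>.\<close>

lemma young_exp:
  fixes f \<kappa> p M C :: real
  assumes "\<kappa> > 0" "C > 0" "p > -2" "M \<ge> 0"
  shows "C * \<kappa> ^ 6 * exp (M * f) \<le> exp (M * f) * exp (3 * (2 + p) * f) / 2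
    + C * (2 * C) powr (M / (6 + 3 * p)) * \<kappa> powr (6 + 6 * (M / (6 + 3 * p)))"
proof -
  define \<theta> where "\<theta> = M / (6 + 3 * p)"
  have th: "\<theta> \<ge> 0" using assms by (simp add: \<theta>_def)
  show ?thesis
  proof (cases "C * \<kappa> ^ 6 \<le> exp (3 * (2 + p) * f) / 2")
    case True
    then have "C * \<kappa> ^ 6 * exp (M * f) \<le> exp (3 * (2 + p) * f) / 2 * exp (M * f)" by (intro mult_right_mono) auto
    also have "\<dots> = exp (M * f) * exp (3 * (2 + p) * f) / 2" by simp
    finally have "C * \<kappa> ^ 6 * exp (M * f) \<le> exp (M * f) * exp (3 * (2 + p) * f) / 2" .
    moreover have "C * (2 * C) powr \<theta> * \<kappa> powr (6 + 6 * \<theta>) \<ge> 0" using assms by simp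
    ultimately show ?thesis unfolding \<theta>_def by linarith
  next
    case False
    have k6: "\<kappa> ^ 6 = \<kappa> powr 6" using powr_realpow[of \<kappa> 6] assms by simp
    have "exp (M * f) = exp (3 * (2 + p) * f) powr \<theta>"
      unfolding powr_def using assms by (simp add: \<theta>_def field_simps)
    also have "\<dots> \<le> (2 * C * \<kappa> ^ 6) powr \<theta>" using False th by (intro powr_mono2) auto
    also have "\<dots> = (2 * C) powr \<theta> * \<kappa> powr (6 * \<theta>)"
      unfolding k6 using assms by (simp add: powr_mult powr_powr del: powr_numeral)
    finally have "C * \<kappa> ^ 6 * exp (M * f) \<le> C * \<kappa> ^ 6 * ((2 * C) powr \<theta> * \<kappa> powr (6 * \<theta>))"
      using assms by (intro mult_left_mono) auto
    also have "\<dots> = C * (2 * C) powr \<theta> * \<kappa> powr (6 + 6 * \<theta>)"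
      unfolding powr_add k6 by (simp add: mult_ac del: powr_numeral)
    moreover have "exp (M * f) * exp (3 * (2 + p) * f) / 2 \<ge> 0" by simp
    ultimately show ?thesis unfolding \<theta>_def by linarith
  qed
qed

lemma has_bochner_integral_set_mono:
  assumes "has_bochner_integral M (\<lambda>x. indicator A x *\<^sub>R g x) (0::real)" "set_integrable M A f" "\<And>x. x \<in> A \<Longrightarrow> f x \<le> g x + h x"
    and "set_integrable M A h"
  shows "(LINT x:A|M. f x) \<le> (LINT x:A|M. h x)"
proof -
  have g: "set_integrable M A g" "(LINT x:A|M. g x) = 0"
    using assms(1) by (simp_all add: set_integrable_def set_lebesgue_integral_def has_bochner_integral_iff)
  have "(LINT x:A|M. f x) \<le> (LINT x:A|M. g x + h x)"
    by (rule set_integral_mono) (use assms g in auto)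
  then show ?thesis using g assms(4) by (simp add: set_integral_add)
qed

lemma has_bochner_integral_sum_zero:
  fixes f :: "'i \<Rightarrow> 'b \<Rightarrow> complex"
  assumes "\<And>i. i \<in> I \<Longrightarrow> has_bochner_integral M (\<lambda>x. indicator T x *\<^sub>R f i x) 0"
  shows "has_bochner_integral M (\<lambda>x. indicator T x *\<^sub>R (\<Sum>i\<in>I. f i x)) 0"
  using has_bochner_integral_sum[of I M "\<lambda>i x. indicator T x *\<^sub>R f i x" "\<lambda>_. 0"] assms
  unfolding scaleR_sum_right by (simp only: sum.neutral_const)

context log_solution begin

text \<open>The divergences in \<open>pointwise_estimate\<close> integrate to zero, and
  \<open>young_exp\<close> makes the remainder independent of \<open>f\<close>. The bound
  \<open>s \<ge> 4\<close> leaves the exponent \<open>s - 2\<close> large enough for the integration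
  by parts.\<close>

lemma integral_estimate:
  fixes s :: nat
  assumes p: "-2 < p" "p \<le> 0" and s: "s \<ge> 4" and eps: "0 < \<epsilon>" "\<epsilon> \<le> 1 / 16"
    and absorb: "absorbs (real CARD('n)) (real s) (\<epsilon> / 4)
      (- p * (2 * real CARD('n) - 1) - p\<^sup>2 / 2 - \<epsilon> * (real CARD('n) + 2)) (- p * (2 * real CARD('n) - 1))
      (28 * (real s)\<^sup>2) (1 / (4 * (1 / (800 * (real s)\<^sup>2))) + 2 * (real s)\<^sup>2) K1 K2 C"
    and C: "C > 0" and R: "R > 0" and sub: "{\<xi>. hq 0 \<xi> \<le> R ^ 4} \<subseteq> S"
    and \<theta>: "\<theta> = (2 * real CARD('n) - 2) / (6 + 3 * p)" and s': "real s \<ge> 6 + 6 * \<theta>"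
  shows "(LINT \<xi>:{\<xi>. hq 0 \<xi> < R ^ 4}|lborel. (1 - hq 0 \<xi> / R ^ 4) ^ s * exp ((2 * real CARD('n) + 4 + 3 * p) * f \<xi>))
    \<le> 2 * C * (2 * C) powr \<theta> * R powr (- (6 + 6 * \<theta>)) * ((2 * R) ^ (2 * CARD('n)) * (2 * R\<^sup>2))"
proof -
  let ?n = "real CARD('n)"
  define k where "k \<xi> = 1 - hq 0 \<xi> / R ^ 4" for \<xi> :: "'n heis"
  let ?e = "\<lambda>x. complex_of_real (k x)"
  have k_alt: "k = (\<lambda>\<xi>. 1 + (- 1 / R ^ 4) * hq 0 \<xi>)" by (auto simp: k_def)
  have ks: "smooth_on k UNIV" unfolding k_alt by (intro smooth_intros smooth_on_hq) auto
  have T: "{\<xi>. k \<xi> > 0} = {\<xi>. hq 0 \<xi> < R ^ 4}" "{\<xi>. k \<xi> \<ge> 0} = {\<xi>. hq 0 \<xi> \<le> R ^ 4}"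
    using R by (auto simp: k_def field_simps)
  have sub': "{\<xi>. k \<xi> \<ge> 0} \<subseteq> S" using sub T by simp
  have bdd: "bounded {\<xi>. k \<xi> \<ge> 0}" unfolding T using bounded_hq[of 0 R] R by simp
  have th: "\<theta> \<ge> 0"
  proof -
    have "1 \<le> ?n" by (simp add: Suc_leI)
    then show ?thesis using p unfolding \<theta> by simp
  qed
  define T1 where "T1 x = (\<Sum>\<alpha>\<in>UNIV. Zbar \<alpha> (\<lambda>x. ?e x ^ s * (weight x * (V \<alpha> x + of_real \<epsilon> * ((A x)\<^sup>2 * a \<alpha> x)))) x)" for x
  define T2 where "T2 x = (\<Sum>\<alpha>\<in>UNIV. Zbar \<alpha> (\<lambda>x. ?e x ^ (s - 2) * (weight x * (h x * a \<alpha> x))) x)" for x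
  define T3 where "T3 x = (\<Sum>\<alpha>\<in>UNIV. Zbar \<alpha> (\<lambda>x. ?e x ^ s * (weight x * ((w x)\<^sup>2 * a \<alpha> x))) x)" for x
  let ?T = "{\<xi>. k \<xi> > 0}"
  have "has_bochner_integral lborel (\<lambda>x. indicator ?T x *\<^sub>R Zbar \<alpha> (\<lambda>x. ?e x ^ s * (weight x * (V \<alpha> x + of_real \<epsilon> * ((A x)\<^sup>2 * a \<alpha> x)))) x) 0"
    "has_bochner_integral lborel (\<lambda>x. indicator ?T x *\<^sub>R Zbar \<alpha> (\<lambda>x. ?e x ^ (s - 2) * (weight x * (h x * a \<alpha> x))) x) 0"
    "has_bochner_integral lborel (\<lambda>x. indicator ?T x *\<^sub>R Zbar \<alpha> (\<lambda>x. ?e x ^ s * (weight x * ((w x)\<^sup>2 * a \<alpha> x))) x) 0" for \<alpha>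
    by (rule integral_Zbar_superlevel(1)[OF S_open _ ks sub' bdd], (intro smooth_intros S_open s_weight sV sA sa sh sw), use s in simp)+
  then have T0: "has_bochner_integral lborel (\<lambda>x. indicator ?T x *\<^sub>R T1 x) 0"
    "has_bochner_integral lborel (\<lambda>x. indicator ?T x *\<^sub>R T2 x) 0"
    "has_bochner_integral lborel (\<lambda>x. indicator ?T x *\<^sub>R T3 x) 0"
    unfolding T1_def T2_def T3_def by (intro has_bochner_integral_sum_zero; blast)+
  have "has_bochner_integral lborel (\<lambda>x. K1 * Re (indicator ?T x *\<^sub>R T1 x) + K2 / R\<^sup>2 * Im (indicator ?T x *\<^sub>R T2 x)
     + (- 2) * Re (indicator ?T x *\<^sub>R T3 x)) (K1 * Re 0 + K2 / R\<^sup>2 * Im 0 + (- 2) * Re 0)"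
    by (intro has_bochner_integral_add has_bochner_integral_mult_right has_bochner_integral_Re has_bochner_integral_Im T0)
  moreover have "(\<lambda>x. K1 * Re (indicator ?T x *\<^sub>R T1 x) + K2 / R\<^sup>2 * Im (indicator ?T x *\<^sub>R T2 x)
     + (- 2) * Re (indicator ?T x *\<^sub>R T3 x)) = (\<lambda>x. indicator ?T x *\<^sub>R (K1 * Re (T1 x) + K2 / R\<^sup>2 * Im (T2 x) - 2 * Re (T3 x)))"
    by (auto simp: algebra_simps)
  ultimately have D0: "has_bochner_integral lborel (\<lambda>x. indicator ?T x *\<^sub>R (K1 * Re (T1 x) + K2 / R\<^sup>2 * Im (T2 x) - 2 * Re (T3 x))) 0"
    by simp
  let ?F = "\<lambda>\<xi>. k \<xi> ^ s * exp ((2 * ?n + 4 + 3 * p) * f \<xi>)"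
  let ?c = "C * (2 * C) powr \<theta> * R powr (- (6 + 6 * \<theta>))"
  have pw: "1 / 2 * ?F \<xi> \<le> (K1 * Re (T1 \<xi>) + K2 / R\<^sup>2 * Im (T2 \<xi>) - 2 * Re (T3 \<xi>)) + ?c" if "\<xi> \<in> ?T" for \<xi>
  proof -
    have xi: "\<xi> \<in> S" using sub' that by auto
    define r where "r = k \<xi>"
    have r: "r > 0" "r \<le> 1" using that hq_nonneg[of 0 \<xi>] R by (auto simp: r_def k_def)
    have de: "?e differentiable (at \<xi>)"
      by (rule smooth_on_differentiable[OF smooth_on_of_real[OF _ ks]]) auto
    have hd: "(\<lambda>\<xi>. complex_of_real (hq 0 \<xi>)) differentiable (at \<xi>)"
      by (rule smooth_on_differentiable[OF smooth_on_of_real[OF _ smooth_on_hq]]) auto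
    have Zk: "Zbar \<alpha> ?e \<xi> = of_real (- 1 / R ^ 4) * Zbar \<alpha> (\<lambda>\<xi>. complex_of_real (hq 0 \<xi>)) \<xi>" for \<alpha>
    proof -
      have "?e = (\<lambda>\<xi>. 1 + of_real (- 1 / R ^ 4) * complex_of_real (hq 0 \<xi>))" by (auto simp: k_def)
      moreover have "Zbar \<alpha> (\<lambda>\<xi>. 1 + c * complex_of_real (hq 0 \<xi>)) \<xi> = c * Zbar \<alpha> (\<lambda>\<xi>. complex_of_real (hq 0 \<xi>)) \<xi>" for c
        using hd by (simp add: Z_add Z_cmult)
      ultimately show ?thesis by (simp only:)
    qed
    have "(\<Sum>\<alpha>\<in>UNIV. (cmod (Zbar \<alpha> ?e \<xi>))\<^sup>2) = (1 / R ^ 4)\<^sup>2 * (4 * zsq \<xi> * hq 0 \<xi>)"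
      unfolding sum_Zbar_hq[symmetric] sum_distrib_left Zk norm_mult power_mult_distrib norm_of_real by simp
    also have "\<dots> \<le> (1 / R ^ 4)\<^sup>2 * (4 * R\<^sup>2 * R ^ 4)"
    proof -
      have "hq 0 \<xi> \<le> R ^ 4" using that T by auto
      then show ?thesis using hq_bounds[of 0 \<xi> R] R zsq_nonneg[of \<xi>] hq_nonneg[of 0 \<xi>] by (intro mult_left_mono mult_mono) auto
    qed
    also have "\<dots> = 4 / R\<^sup>2" using R by (simp add: field_simps power2_eq_square eval_nat_numeral)
    finally have grad: "(\<Sum>\<alpha>\<in>UNIV. (cmod (Zbar \<alpha> ?e \<xi>))\<^sup>2) \<le> 4 / R\<^sup>2" .
    have EEr: "Re (weight \<xi>) = exp ((2 * ?n - 2) * f \<xi>)"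
    proof -
      have "weight \<xi> = of_real (exp ((2 * ?n - 2) * f \<xi>))"
        unfolding weight_def F_def nn_def by (simp add: algebra_simps flip: exp_of_real)
      then show ?thesis by simp
    qed
    have rw3: "rw \<xi> ^ 3 = exp (3 * (2 + p) * f \<xi>)"
    proof -
      have "w \<xi> = of_real (exp ((2 + p) * f \<xi>))" unfolding w_def F_def by (simp flip: exp_of_real)
      then have "rw \<xi> = exp ((2 + p) * f \<xi>)" by (simp add: rw_def)
      then show ?thesis by (simp add: mult.assoc flip: exp_of_nat_mult)
    qed
    have eqF: "Re (weight \<xi>) * rw \<xi> ^ 3 = exp ((2 * ?n + 4 + 3 * p) * f \<xi>)"
      unfolding EEr rw3 by (simp add: algebra_simps flip: exp_add)
    have "r ^ s * (Re (weight \<xi>) * (rw \<xi>) ^ 3) \<le> K1 * Re (T1 \<xi>) + K2 / R\<^sup>2 * Im (T2 \<xi>) - 2 * Re (T3 \<xi>)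
      + C * (1 / (r * R)) ^ 6 * (r ^ s * Re (weight \<xi>))"
      unfolding T1_def T2_def T3_def
      by (rule pointwise_estimate[OF xi p(2) _ eps absorb de _ r(1) grad R]) (use s in \<open>auto simp: r_def\<close>)
    also have "C * (1 / (r * R)) ^ 6 * (r ^ s * Re (weight \<xi>)) = r ^ s * (C * (1 / (r * R)) ^ 6 * Re (weight \<xi>))" by simp
    also have "\<dots> \<le> r ^ s * (Re (weight \<xi>) * rw \<xi> ^ 3 / 2 + C * (2 * C) powr \<theta> * (1 / (r * R)) powr (6 + 6 * \<theta>))"
      unfolding EEr rw3 \<theta>
      by (rule mult_left_mono, rule young_exp) (use r R C p in \<open>auto simp: Suc_leI\<close>)
    finally have "1 / 2 * (r ^ s * (Re (weight \<xi>) * (rw \<xi>) ^ 3)) \<le> K1 * Re (T1 \<xi>) + K2 / R\<^sup>2 * Im (T2 \<xi>) - 2 * Re (T3 \<xi>)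
      + r ^ s * (C * (2 * C) powr \<theta> * (1 / (r * R)) powr (6 + 6 * \<theta>))"
      by (simp add: algebra_simps)
    \<comment> \<open>\<open>s\<close> exceeds the power of \<open>1 / r\<close>, so the remainder
      stays bounded up to the boundary of the ball, where \<open>r\<close> tends to 0.\<close>
    moreover have "r ^ s * (C * (2 * C) powr \<theta> * (1 / (r * R)) powr (6 + 6 * \<theta>)) \<le> ?c"
    proof -
      have "r ^ s * (1 / (r * R)) powr (6 + 6 * \<theta>) = r powr (real s - (6 + 6 * \<theta>)) * R powr (- (6 + 6 * \<theta>))"
      proof -
        have "r ^ s * (1 / (r * R)) powr \<tau> = r powr (real s - \<tau>) * R powr (- \<tau>)" for \<tau>
          using r R by (simp add: powr_divide powr_mult powr_minus powr_diff powr_realpow field_simps)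
        then show ?thesis .
      qed
      also have "\<dots> \<le> 1 * R powr (- (6 + 6 * \<theta>))"
        using r s' by (intro mult_right_mono powr_le1) auto
      finally have "(C * (2 * C) powr \<theta>) * (r ^ s * (1 / (r * R)) powr (6 + 6 * \<theta>)) \<le> (C * (2 * C) powr \<theta>) * (1 * R powr (- (6 + 6 * \<theta>)))"
        using C by (intro mult_left_mono) auto
      then show ?thesis by (simp add: mult_ac)
    qed
    ultimately show ?thesis unfolding eqF r_def by linarith
  qed
  have comp: "compact {\<xi>. k \<xi> \<ge> 0}" unfolding T using compact_hq[of 0 R] R by simp
  have meas: "?T \<in> sets lborel"
    using smooth_on_continuous[OF ks] by (auto intro!: borel_open open_Collect_less continuous_intros)
  have int: "set_integrable lborel ?T G" if "continuous_on S G" for G :: "'n heis \<Rightarrow> real"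
  proof (rule set_integrable_subset[OF _ meas])
    show "set_integrable lborel {\<xi>. k \<xi> \<ge> 0} G"
      unfolding set_integrable_def using comp continuous_on_subset[OF that sub'] by (rule borel_integrable_compact)
  qed auto
  have cF: "continuous_on S ?F"
    using smooth_on_continuous[OF ks] continuous_on_subset smooth_on_continuous[OF f_smooth]
    by (intro continuous_intros) blast+
  have "(LINT \<xi>:?T|lborel. 1 / 2 * ?F \<xi>) \<le> (LINT \<xi>:?T|lborel. ?c)"
  proof (rule has_bochner_integral_set_mono[OF D0 _ pw])
    show "set_integrable lborel ?T (\<lambda>\<xi>. 1 / 2 * ?F \<xi>)" by (rule int) (intro continuous_intros cF)
    show "set_integrable lborel ?T (\<lambda>\<xi>. ?c)" by (rule int) simp
  qed
  also have "\<dots> \<le> ?c * ((2 * R) ^ (2 * CARD('n)) * (2 * R\<^sup>2))"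
    unfolding T by (rule integral_le_volume) (use R C int[of "\<lambda>_. ?c"] T in auto)
  finally show ?thesis unfolding T by (simp add: k_def)
qed

end

section \<open>A mean value inequality\<close>

definition lap :: "('n::finite heis \<Rightarrow> complex) \<Rightarrow> 'n heis \<Rightarrow> complex" where
  "lap F \<xi> = (\<Sum>\<alpha>\<in>UNIV. Zbar \<alpha> (Z \<alpha> F) \<xi> + Z \<alpha> (Zbar \<alpha> F) \<xi>)"

lemma heis_laplacian_lap: "heis_laplacian u = lap (\<lambda>\<eta>. complex_of_real (u \<eta>))"
  by (simp add: heis_laplacian_def lap_def fun_eq_iff)

lemma lap_cong:
  assumes "open S" "\<xi> \<in> S" "\<And>y. y \<in> S \<Longrightarrow> f y = g y"
  shows "lap f \<xi> = lap g \<xi>"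
proof -
  have "Zbar \<alpha> (Z \<alpha> f) \<xi> = Zbar \<alpha> (Z \<alpha> g) \<xi>" "Z \<alpha> (Zbar \<alpha> f) \<xi> = Z \<alpha> (Zbar \<alpha> g) \<xi>" for \<alpha>
    by (rule Z_cong[OF assms(1,2)], rule Z_cong[OF assms(1)], assumption, rule assms(3), assumption)+
  then show ?thesis by (simp add: lap_def)
qed

lemma lap_add:
  assumes "open S" "\<xi> \<in> S" "smooth_on f S" "smooth_on g S"
  shows "lap (\<lambda>x. f x + g x) \<xi> = lap f \<xi> + lap g \<xi>"
proof -
  have d: "f differentiable (at y)" "g differentiable (at y)" if "y \<in> S" for y
    using smooth_on_differentiable assms that by blast+
  have d2: "Z \<alpha> f differentiable (at \<xi>)" "Z \<alpha> g differentiable (at \<xi>)"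
    "Zbar \<alpha> f differentiable (at \<xi>)" "Zbar \<alpha> g differentiable (at \<xi>)" for \<alpha>
    using smooth_on_differentiable smooth_on_Z assms by blast+
  have "Zbar \<alpha> (Z \<alpha> (\<lambda>x. f x + g x)) \<xi> = Zbar \<alpha> (\<lambda>x. Z \<alpha> f x + Z \<alpha> g x) \<xi>"
    "Z \<alpha> (Zbar \<alpha> (\<lambda>x. f x + g x)) \<xi> = Z \<alpha> (\<lambda>x. Zbar \<alpha> f x + Zbar \<alpha> g x) \<xi>" for \<alpha>
    by (rule Z_cong[OF assms(1,2)], rule Z_add; rule d, assumption)+
  then show ?thesis using d2 by (simp add: lap_def Z_add sum.distrib)
qed

lemma lap_cmult:
  assumes "open S" "\<xi> \<in> S" "smooth_on f S"
  shows "lap (\<lambda>x. c * f x) \<xi> = c * lap f \<xi>"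
proof -
  have d: "f differentiable (at y)" if "y \<in> S" for y
    using smooth_on_differentiable assms that by blast+
  have d2: "Z \<alpha> f differentiable (at \<xi>)" "Zbar \<alpha> f differentiable (at \<xi>)" for \<alpha>
    using smooth_on_differentiable smooth_on_Z assms by blast+
  have "Zbar \<alpha> (Z \<alpha> (\<lambda>x. c * f x)) \<xi> = Zbar \<alpha> (\<lambda>x. c * Z \<alpha> f x) \<xi>"
    "Z \<alpha> (Zbar \<alpha> (\<lambda>x. c * f x)) \<xi> = Z \<alpha> (\<lambda>x. c * Zbar \<alpha> f x) \<xi>" for \<alpha>
    by (rule Z_cong[OF assms(1,2)], rule Z_cmult; rule d, assumption)+
  then show ?thesis using d2 by (simp add: lap_def Z_cmult sum_distrib_left distrib_left)
qed

lemma lap_zsq: "lap (\<lambda>\<xi>. complex_of_real (zsq \<xi>)) (\<xi>::'n::finite heis) = 2 * of_nat CARD('n)"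
proof -
  have "Z \<alpha> (\<lambda>\<xi>. complex_of_real (zsq \<xi>)) = (\<lambda>\<xi>. cnj (fst \<xi> $ \<alpha>))"
    "Zbar \<alpha> (\<lambda>\<xi>. complex_of_real (zsq \<xi>)) = (\<lambda>\<xi>. fst \<xi> $ \<alpha>)" for \<alpha> :: 'n
    by (auto simp: Z_zsq fun_eq_iff)
  then show ?thesis by (simp add: lap_def Z_cnj diff_coord Z_coord)
qed

section \<open>The regularised fundamental solution and Green's identity\<close>

lemma hq_pos: "e > 0 \<Longrightarrow> hq e \<xi> > 0"
  unfolding hq_def using zsq_nonneg[of \<xi>] by (simp add: add_nonneg_pos add_pos_nonneg)

definition hq_powr :: "real \<Rightarrow> real \<Rightarrow> 'n::finite heis \<Rightarrow> complex" where
  "hq_powr e a \<xi> = complex_of_real (hq e \<xi> powr a)"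

lemma hq_powr_mult: "hq_powr e a \<xi> * hq_powr e b \<xi> = hq_powr e (a + b) \<xi>"
  by (simp add: hq_powr_def powr_add)

lemma smooth_on_hq_powr_real:
  assumes "e > 0" shows "smooth_on (\<lambda>\<xi>::'n::finite heis. hq e \<xi> powr a) UNIV"
proof -
  have "smooth_on (\<lambda>\<xi>::'n heis. exp (a * ln (hq e \<xi>))) UNIV"
    by (intro smooth_intros smooth_on_ln smooth_on_hq hq_pos assms) auto
  moreover have "(\<lambda>\<xi>::'n heis. exp (a * ln (hq e \<xi>))) = (\<lambda>\<xi>. hq e \<xi> powr a)"
  proof
    fix \<xi> :: "'n heis" show "exp (a * ln (hq e \<xi>)) = hq e \<xi> powr a"
      using hq_pos[OF assms, of \<xi>] by (simp add: powr_def)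
  qed
  ultimately show ?thesis by simp
qed

lemma smooth_on_hq_powr: "e > 0 \<Longrightarrow> open S \<Longrightarrow> smooth_on (hq_powr e a) S"
  unfolding hq_powr_def[abs_def] by (intro smooth_on_of_real smooth_on_subset[OF smooth_on_hq_powr_real]) auto

lemma ddir_hq_powr:
  assumes "e > 0"
  shows "ddir v (hq_powr e a) \<xi> = of_real a * hq_powr e (a - 1) \<xi> * ddir v (\<lambda>\<xi>. complex_of_real (hq e \<xi>)) \<xi>"
proof -
  have d: "hq e differentiable (at \<xi>)" by (rule smooth_on_differentiable[OF smooth_on_hq UNIV_I])
  have "((\<lambda>x. x powr a) has_field_derivative a * hq e \<xi> powr (a - 1)) (at (hq e \<xi>))"
    by (rule has_real_derivative_powr) (rule hq_pos[OF assms])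
  then have "((\<lambda>x. x powr a) has_derivative (\<lambda>y. a * hq e \<xi> powr (a - 1) * y)) (at (hq e \<xi>))"
    by (simp add: has_field_derivative_def)
  from has_derivative_compose[OF has_derivative_ddir[OF d] this]
  have "((\<lambda>\<xi>. hq e \<xi> powr a) has_derivative (\<lambda>v. a * hq e \<xi> powr (a - 1) * ddir v (hq e) \<xi>)) (at \<xi>)" .
  then have "(hq_powr e a has_derivative (\<lambda>v. complex_of_real (a * hq e \<xi> powr (a - 1) * ddir v (hq e) \<xi>))) (at \<xi>)"
    unfolding hq_powr_def[abs_def] by (rule has_derivative_of_real)
  from ddir_eqI[OF this] show ?thesis
    by (simp add: hq_powr_def ddir_bounded_linear[OF bounded_linear_of_real d])
qed

lemma Z_hq_powr:
  assumes "e > 0"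
  shows "Z \<alpha> (hq_powr e a) \<xi> = of_real a * hq_powr e (a - 1) \<xi> * Z \<alpha> (\<lambda>\<xi>. complex_of_real (hq e \<xi>)) \<xi>"
    "Zbar \<alpha> (hq_powr e a) \<xi> = of_real a * hq_powr e (a - 1) \<xi> * Zbar \<alpha> (\<lambda>\<xi>. complex_of_real (hq e \<xi>)) \<xi>"
  by (simp_all add: Z_ddir Zbar_ddir ddir_hq_powr[OF assms] algebra_simps add_divide_distrib diff_divide_distrib)

text \<open>For \<open>a = - n / 2\<close> the last bracket reduces to \<open>4 * n * e\<close>, so
  the Laplacian has a sign and is concentrated near the origin for small \<open>e\<close>.\<close>

lemma lap_hq_powr:
  fixes \<xi> :: "'n::finite heis"
  assumes "e > 0"
  shows "lap (hq_powr e a) \<xi> = of_real (a * hq e \<xi> powr (a - 1) * (4 * real CARD('n) * (zsq \<xi> + e) + 8 * a * zsq \<xi>))"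
proof -
  let ?N = "\<lambda>\<xi>::'n heis. complex_of_real (hq e \<xi>)"
  have sN: "smooth_on ?N UNIV" by (intro smooth_on_of_real smooth_on_hq) auto
  have d: "hq_powr e (a - 1) differentiable (at \<xi>)" "Z \<alpha> ?N differentiable (at \<xi>)" "Zbar \<alpha> ?N differentiable (at \<xi>)" for \<alpha>
    by (rule smooth_on_differentiable[OF _ UNIV_I], intro smooth_on_hq_powr smooth_on_Z sN assms open_UNIV)+
  have ZN: "Z \<alpha> ?N = (\<lambda>\<xi>. 2 * cnj (fst \<xi> $ \<alpha>) * (of_real (zsq \<xi> + e) + \<i> * of_real (snd \<xi>)))"
    "Zbar \<alpha> ?N = (\<lambda>\<xi>. 2 * fst \<xi> $ \<alpha> * (of_real (zsq \<xi> + e) - \<i> * of_real (snd \<xi>)))" for \<alpha>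
    by (auto simp: fun_eq_iff Z_hq)
  have c: "(\<lambda>\<xi>::'n heis. cnj (fst \<xi> $ \<beta>)) differentiable (at \<xi>)" for \<beta>
    by (rule smooth_on_differentiable[of _ UNIV], (intro smooth_intros smooth_on_coord; simp), simp)
  have ZZN: "Zbar \<alpha> (Z \<alpha> ?N) \<xi> + Z \<alpha> (Zbar \<alpha> ?N) \<xi> = of_real (4 * (zsq \<xi> + e) + 8 * (cmod (fst \<xi> $ \<alpha>))\<^sup>2)" for \<alpha>
  proof -
    have 1: "Zbar \<alpha> (Z \<alpha> ?N) \<xi> = 2 * (of_real (zsq \<xi> + e) + \<i> * of_real (snd \<xi>)) + 4 * (fst \<xi> $ \<alpha> * cnj (fst \<xi> $ \<alpha>))"
      unfolding ZN by (simp add: Z_mult Z_add Z_cmult Z_cnj Z_coord Z_zsq diff_zsq diff_snd diff_coord c algebra_simps)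
    have 2: "Z \<alpha> (Zbar \<alpha> ?N) \<xi> = 2 * (of_real (zsq \<xi> + e) - \<i> * of_real (snd \<xi>)) + 4 * (fst \<xi> $ \<alpha> * cnj (fst \<xi> $ \<alpha>))"
      unfolding ZN by (simp add: Z_mult Z_add Z_diff Z_cmult Z_cnj Z_coord Z_zsq diff_zsq diff_snd diff_coord c algebra_simps)
    show ?thesis unfolding 1 2 of_real_add of_real_mult complex_norm_square by (simp add: algebra_simps)
  qed
  have grad: "Zbar \<alpha> ?N \<xi> * Z \<alpha> ?N \<xi> = of_real (4 * (cmod (fst \<xi> $ \<alpha>))\<^sup>2 * hq e \<xi>)" for \<alpha>
  proof -
    have "(of_real (zsq \<xi> + e) - \<i> * of_real (snd \<xi>)) * (of_real (zsq \<xi> + e) + \<i> * of_real (snd \<xi>)) = complex_of_real (hq e \<xi>)"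
      by (simp add: hq_def power2_eq_square algebra_simps)
    moreover have "(2 * z * P) * (2 * zc * M) = 4 * (z * zc) * (P * M)" for z zc P M :: complex by simp
    ultimately show ?thesis unfolding ZN of_real_mult complex_norm_square by simp
  qed
  have PZ: "Z \<alpha> (hq_powr e a) = (\<lambda>\<xi>. of_real a * hq_powr e (a - 1) \<xi> * Z \<alpha> ?N \<xi>)"
    "Zbar \<alpha> (hq_powr e a) = (\<lambda>\<xi>. of_real a * hq_powr e (a - 1) \<xi> * Zbar \<alpha> ?N \<xi>)" for \<alpha> :: 'n
    by (rule ext, rule Z_hq_powr[OF assms])+
  have "Zbar \<alpha> (Z \<alpha> (hq_powr e a)) \<xi> + Z \<alpha> (Zbar \<alpha> (hq_powr e a)) \<xi> =
      of_real a * hq_powr e (a - 1) \<xi> * (Zbar \<alpha> (Z \<alpha> ?N) \<xi> + Z \<alpha> (Zbar \<alpha> ?N) \<xi>)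
      + 2 * of_real a * of_real (a - 1) * hq_powr e (a - 2) \<xi> * (Zbar \<alpha> ?N \<xi> * Z \<alpha> ?N \<xi>)" for \<alpha>
    unfolding PZ using d by (simp add: Z_mult Z_cmult Z_hq_powr[OF assms] algebra_simps)
  also have "\<dots> \<alpha> = of_real (a * hq e \<xi> powr (a - 1) * (4 * (zsq \<xi> + e) + 8 * a * (cmod (fst \<xi> $ \<alpha>))\<^sup>2))" for \<alpha>
  proof -
    have eq: "hq e \<xi> powr (a - 1) = hq e \<xi> powr (a - 2) * hq e \<xi>"
      using powr_add[of "hq e \<xi>" "a - 2" 1] hq_pos[OF assms, of \<xi>] by (simp add: powr_one)
    show ?thesis unfolding ZZN grad hq_powr_def eq by (simp add: algebra_simps)
  qed
  finally have "lap (hq_powr e a) \<xi> = (\<Sum>\<alpha>\<in>(UNIV::'n set). of_real (a * hq e \<xi> powr (a - 1) * (4 * (zsq \<xi> + e) + 8 * a * (cmod (fst \<xi> $ \<alpha>))\<^sup>2)))"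
    by (simp only: lap_def)
  also have "\<dots> = of_real (a * hq e \<xi> powr (a - 1) * (\<Sum>\<alpha>\<in>(UNIV::'n set). 4 * (zsq \<xi> + e) + 8 * a * (cmod (fst \<xi> $ \<alpha>))\<^sup>2))"
    by (simp only: of_real_sum sum_distrib_left of_real_mult)
  also have "(\<Sum>\<alpha>\<in>(UNIV::'n set). 4 * (zsq \<xi> + e) + 8 * a * (cmod (fst \<xi> $ \<alpha>))\<^sup>2) = 4 * real CARD('n) * (zsq \<xi> + e) + 8 * a * zsq \<xi>"
    by (simp add: sum.distrib zsq_def sum_distrib_left)
  finally show ?thesis .
qed

text \<open>The cube in \<open>\<psi>\<close> leaves a factor \<open>k^2\<close> in both components
  of \<open>U * Z \<psi> - \<psi> * Z U\<close>, which is what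
  \<open>integral_Zbar_superlevel\<close> asks for; hence no boundary term appears.\<close>

lemma green_superlevel:
  fixes k :: "'n::finite heis \<Rightarrow> real" and U \<theta> :: "'n heis \<Rightarrow> complex"
  assumes S: "open S" and U: "smooth_on U S" and \<theta>: "smooth_on \<theta> S" and k: "smooth_on k UNIV"
    and sub: "{x. k x \<ge> 0} \<subseteq> S" and bdd: "bounded {x. k x \<ge> 0}"
  defines "\<psi> \<equiv> \<lambda>x. complex_of_real (k x) ^ 3 * \<theta> x"
  shows "has_bochner_integral lborel (\<lambda>x. indicator {x. k x > 0} x *\<^sub>R (U x * lap \<psi> x - \<psi> x * lap U x)) 0"
proof -
  let ?k = "\<lambda>x. complex_of_real (k x)"
  have sk: "smooth_on ?k S" by (intro smooth_on_of_real S smooth_on_subset[OF k]) auto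
  have s\<psi>: "smooth_on \<psi> S" unfolding \<psi>_def by (intro smooth_intros S sk \<theta>)
  have d: "?k differentiable (at x)" "\<theta> differentiable (at x)" "U differentiable (at x)" "\<psi> differentiable (at x)"
    "Z \<alpha> U differentiable (at x)" "Zbar \<alpha> U differentiable (at x)"
    "Z \<alpha> \<psi> differentiable (at x)" "Zbar \<alpha> \<psi> differentiable (at x)" if "x \<in> S" for x \<alpha>
    using smooth_on_differentiable that sk \<theta> U s\<psi> smooth_on_Z[OF S U] smooth_on_Z[OF S s\<psi>] by blast+
  define X where "X \<alpha> x = U x * (?k x * Z \<alpha> \<theta> x + 3 * \<theta> x * Z \<alpha> ?k x) - \<theta> x * ?k x * Z \<alpha> U x" for \<alpha> x
  define Y where "Y \<alpha> x = U x * (?k x * Zbar \<alpha> \<theta> x + 3 * \<theta> x * Zbar \<alpha> ?k x) - \<theta> x * ?k x * Zbar \<alpha> U x" for \<alpha> x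
  have sX: "smooth_on (X \<alpha>) S" "smooth_on (Y \<alpha>) S" for \<alpha>
    unfolding X_def[abs_def] Y_def[abs_def] by (intro smooth_intros smooth_on_Z S U sk \<theta>)+
  have Z\<psi>: "Z \<alpha> \<psi> x = ?k x ^ 2 * (?k x * Z \<alpha> \<theta> x + 3 * \<theta> x * Z \<alpha> ?k x)"
    "Zbar \<alpha> \<psi> x = ?k x ^ 2 * (?k x * Zbar \<alpha> \<theta> x + 3 * \<theta> x * Zbar \<alpha> ?k x)" if "x \<in> S" for \<alpha> x
    unfolding \<psi>_def using d[OF that] by (simp_all add: Z_mult Z_power power3_eq_cube power2_eq_square algebra_simps)
  have XY: "?k x ^ 2 * X \<alpha> x = U x * Z \<alpha> \<psi> x - \<psi> x * Z \<alpha> U x"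
    "?k x ^ 2 * Y \<alpha> x = U x * Zbar \<alpha> \<psi> x - \<psi> x * Zbar \<alpha> U x" if "x \<in> S" for \<alpha> x
    unfolding Z\<psi>[OF that] X_def Y_def by (simp_all add: \<psi>_def power3_eq_cube power2_eq_square algebra_simps)
  have div: "(\<Sum>\<alpha>\<in>UNIV. Zbar \<alpha> (\<lambda>x. ?k x ^ 2 * X \<alpha> x) x + Z \<alpha> (\<lambda>x. ?k x ^ 2 * Y \<alpha> x) x) = U x * lap \<psi> x - \<psi> x * lap U x"
    if "x \<in> S" for x
  proof -
    have "Zbar \<alpha> (\<lambda>x. ?k x ^ 2 * X \<alpha> x) x = Zbar \<alpha> (\<lambda>x. U x * Z \<alpha> \<psi> x - \<psi> x * Z \<alpha> U x) x"
      "Z \<alpha> (\<lambda>x. ?k x ^ 2 * Y \<alpha> x) x = Z \<alpha> (\<lambda>x. U x * Zbar \<alpha> \<psi> x - \<psi> x * Zbar \<alpha> U x) x" for \<alpha>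
      by (rule Z_cong[OF S that], rule XY, assumption)+
    then have t: "Zbar \<alpha> (\<lambda>x. ?k x ^ 2 * X \<alpha> x) x + Z \<alpha> (\<lambda>x. ?k x ^ 2 * Y \<alpha> x) x
      = U x * (Zbar \<alpha> (Z \<alpha> \<psi>) x + Z \<alpha> (Zbar \<alpha> \<psi>) x) - \<psi> x * (Zbar \<alpha> (Z \<alpha> U) x + Z \<alpha> (Zbar \<alpha> U) x)" for \<alpha>
      using d[OF that] by (simp only: Z_diff Z_mult differentiable_mult) (simp add: algebra_simps)
    show ?thesis unfolding t lap_def sum_distrib_left sum_subtractf ..
  qed
  have "has_bochner_integral lborel (\<lambda>x. indicator {x. k x > 0} x *\<^sub>R Zbar \<alpha> (\<lambda>x. ?k x ^ 2 * X \<alpha> x) x) 0"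
    "has_bochner_integral lborel (\<lambda>x. indicator {x. k x > 0} x *\<^sub>R Z \<alpha> (\<lambda>x. ?k x ^ 2 * Y \<alpha> x) x) 0" for \<alpha>
    using integral_Zbar_superlevel[OF S _ k sub bdd, of _ 2] sX by blast+
  then have "has_bochner_integral lborel (\<lambda>x. indicator {x. k x > 0} x *\<^sub>R (Zbar \<alpha> (\<lambda>x. ?k x ^ 2 * X \<alpha> x) x + Z \<alpha> (\<lambda>x. ?k x ^ 2 * Y \<alpha> x) x)) (0 + 0)" for \<alpha>
    unfolding scaleR_add_right by (intro has_bochner_integral_add)
  then have "has_bochner_integral lborel (\<lambda>x. indicator {x. k x > 0} x *\<^sub>R (\<Sum>\<alpha>\<in>UNIV. Zbar \<alpha> (\<lambda>x. ?k x ^ 2 * X \<alpha> x) x + Z \<alpha> (\<lambda>x. ?k x ^ 2 * Y \<alpha> x) x)) 0"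
    by (intro has_bochner_integral_sum_zero) simp
  moreover have "indicator {x. k x > 0} x *\<^sub>R (\<Sum>\<alpha>\<in>UNIV. Zbar \<alpha> (\<lambda>x. ?k x ^ 2 * X \<alpha> x) x + Z \<alpha> (\<lambda>x. ?k x ^ 2 * Y \<alpha> x) x)
    = indicator {x. k x > 0} x *\<^sub>R (U x * lap \<psi> x - \<psi> x * lap U x)" for x
  proof (cases "k x > 0")
    case True
    then have "x \<in> S" using sub by (auto simp: less_imp_le)
    then show ?thesis using div by simp
  qed simp
  ultimately show ?thesis by (simp only:)
qed

text \<open>The \<open>2 * n\<close> real coordinates of \<open>z\<close> are at most
  \<open>r / sqrt (2 * n)\<close> in modulus, so \<open>zsq \<le> r^2\<close>; the constant is
  \<open>5 = 2^2 + 1\<close>.\<close>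

lemma box_in_hq:
  fixes \<xi> :: "'n::finite heis"
  assumes "r > 0" "\<xi> \<in> cbox (- ((r / sqrt (2 * real CARD('n))) *\<^sub>R One), - r\<^sup>2) ((r / sqrt (2 * real CARD('n))) *\<^sub>R One, r\<^sup>2)"
  shows "hq (r\<^sup>2) \<xi> \<le> 5 * r ^ 4"
proof -
  let ?d = "r / sqrt (2 * real CARD('n))"
  have f: "fst \<xi> \<in> cbox (- (?d *\<^sub>R One)) (?d *\<^sub>R One)" "\<bar>snd \<xi>\<bar> \<le> r\<^sup>2"
    using assms(2) by (cases \<xi>, auto simp: cbox_Pair_eq)+
  have "zsq \<xi> = (\<Sum>b\<in>Basis. (fst \<xi> \<bullet> b)\<^sup>2)"
    unfolding zsq_norm by (simp add: norm_eq_sqrt_inner euclidean_inner[of "fst \<xi>" "fst \<xi>"] power2_eq_square sum_nonneg)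
  also have "\<dots> \<le> (\<Sum>b\<in>(Basis :: (complex ^ 'n) set). ?d\<^sup>2)"
  proof (rule sum_mono)
    fix b :: "complex ^ 'n" assume b: "b \<in> Basis"
    then have "\<bar>fst \<xi> \<bullet> b\<bar> \<le> ?d" using f(1) by (auto simp: mem_box abs_le_iff)
    then show "(fst \<xi> \<bullet> b)\<^sup>2 \<le> ?d\<^sup>2" using abs_le_square_iff[of "fst \<xi> \<bullet> b" ?d] assms(1) by auto
  qed
  also have "\<dots> = r\<^sup>2" by (simp add: power_divide)
  finally have "zsq \<xi> + r\<^sup>2 \<le> 2 * r\<^sup>2" by simp
  then have "(zsq \<xi> + r\<^sup>2)\<^sup>2 \<le> (2 * r\<^sup>2)\<^sup>2" using zsq_nonneg[of \<xi>] by (intro power_mono) auto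
  moreover have "(snd \<xi>)\<^sup>2 \<le> (r\<^sup>2)\<^sup>2" using f(2) abs_le_square_iff[of "snd \<xi>" "r\<^sup>2"] by simp
  ultimately show ?thesis unfolding hq_def by (simp add: power_mult_distrib flip: power_mult)
qed

lemma lap_hq_powr_bound:
  fixes \<xi> :: "'n::finite heis"
  assumes "e > 0" "a \<ge> 1" "hq e \<xi> \<le> 1"
  shows "0 \<le> Re (lap (hq_powr e a) \<xi>)" "Re (lap (hq_powr e a) \<xi>) \<le> a * (4 * real CARD('n) + 8 * a)"
proof -
  have z: "zsq \<xi> + e \<le> 1" using hq_bounds(1)[of e \<xi> 1] assms by simp
  have eq: "Re (lap (hq_powr e a) \<xi>) = a * (hq e \<xi> powr (a - 1) * (4 * real CARD('n) * (zsq \<xi> + e) + 8 * a * zsq \<xi>))"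
    unfolding lap_hq_powr[OF assms(1)] by simp
  have n: "0 \<le> 4 * real CARD('n) * (zsq \<xi> + e) + 8 * a * zsq \<xi>" using zsq_nonneg[of \<xi>] assms by simp
  show "0 \<le> Re (lap (hq_powr e a) \<xi>)" unfolding eq using n assms by simp
  have "hq e \<xi> powr (a - 1) * (4 * real CARD('n) * (zsq \<xi> + e) + 8 * a * zsq \<xi>) \<le> 1 * (4 * real CARD('n) * 1 + 8 * a * 1)"
    using n assms z zsq_nonneg[of \<xi>] hq_nonneg[of e \<xi>]
    by (intro mult_mono add_mono powr_le1 mult_left_mono) auto
  then show "Re (lap (hq_powr e a) \<xi>) \<le> a * (4 * real CARD('n) + 8 * a)" unfolding eq using assms by (intro mult_left_mono) auto
qed

text \<open>
  Green's identity is applied to \<open>\<psi> = k\<^sup>3 hq e powr (- n / 2)\<close> with \<open>k = 1 - hq e powr (n / 2 + 2)\<close>. The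
  second factor is a regularisation of Folland's fundamental solution: minus its Laplacian is the positive kernel
  \<open>2 n\<^sup>2 e * hq e powr (- n / 2 - 1)\<close>, which has a fixed mass near the origin however small \<open>e\<close> is. The
  exponent in \<open>k\<close> makes all other terms in the expansion of \<open>\<psi>\<close> powers of \<open>hq e\<close> of exponent at least
  \<open>2\<close>, with bounded Laplacian.
\<close>

lemma sub_mean_value:
  "\<exists>C>0. \<forall>S (v :: 'n::finite heis \<Rightarrow> real). open S \<longrightarrow> {\<xi>. hq 0 \<xi> \<le> 1} \<subseteq> S \<longrightarrow> smooth_on v S \<longrightarrow>
     (\<forall>\<xi>\<in>S. v \<xi> \<ge> 0) \<longrightarrow> (\<forall>\<xi>\<in>S. Re (lap (\<lambda>x. complex_of_real (v x)) \<xi>) \<ge> 0) \<longrightarrow>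
     v 0 \<le> C * (LINT \<xi>:{\<xi>. hq 0 \<xi> < 1}|lborel. v \<xi>)"
proof -
  define n where "n = real CARD('n)"
  have n: "n \<ge> 1" by (simp add: n_def Suc_leI)
  \<comment> \<open>By \<open>lap_hq_powr_bound\<close> this bounds the Laplacian of
    \<open>hq e powr a\<close> on \<open>hq e \<le> 1\<close>; the coefficients in \<open>M\<close>
    are those of a cube.\<close>
  define m where "m a = a * (4 * n + 8 * a)" for a :: real
  define M where "M = 3 * m 2 + 3 * m (n / 2 + 4) + m (n + 6)"
  have M: "M > 0" using n by (simp add: M_def m_def add_pos_pos)
  \<comment> \<open>A lower bound for the mass of the kernel on the box \<open>?K\<close> below.
    With \<open>e = r^2\<close> all powers of \<open>r\<close> cancel, so it is independent of
    \<open>r\<close>.\<close>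
  define c0 where "c0 = 2 * n\<^sup>2 * 5 powr (- n / 2 - 1) * ((2 / sqrt (2 * n)) ^ (2 * CARD('n)) * 2)"
  have c0: "c0 > 0" using n by (simp add: c0_def)
  show ?thesis
  proof (rule exI[of _ "2 * M / c0"], intro conjI allI impI)
    show "2 * M / c0 > 0" using M c0 by simp
    fix S :: "'n heis set" and v
    assume S: "open S" and sub: "{\<xi>. hq 0 \<xi> \<le> 1} \<subseteq> S" and v: "smooth_on v S"
      and v0: "\<forall>\<xi>\<in>S. v \<xi> \<ge> 0" and lv: "\<forall>\<xi>\<in>S. Re (lap (\<lambda>x. complex_of_real (v x)) \<xi>) \<ge> 0"
    let ?U = "\<lambda>x. complex_of_real (v x)"
    let ?B = "{\<xi>::'n heis. hq 0 \<xi> < 1}"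
    have cont: "continuous_on S v" by (rule smooth_on_continuous[OF v])
    have intv: "set_integrable lborel ?B v"
    proof (rule set_integrable_subset)
      show "set_integrable lborel {\<xi>. hq 0 \<xi> \<le> 1} v" unfolding set_integrable_def
        using compact_hq[of 0 1] by (intro borel_integrable_compact continuous_on_subset[OF cont sub]) simp
      show "?B \<in> sets lborel" by (auto intro!: borel_open open_Collect_less continuous_on_hq continuous_intros)
    qed auto
    have z0: "hq 0 (0::'n heis) = 0" by (simp add: hq_def zsq_def)
    have oS: "0 \<in> S" using sub z0 by auto
    have vint0: "(LINT \<xi>:?B|lborel. v \<xi>) \<ge> 0"
      unfolding set_lebesgue_integral_def
      by (intro Bochner_Integration.integral_nonneg) (use v0 sub in \<open>auto simp: indicator_def subset_iff less_imp_le\<close>)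
    show "v 0 \<le> 2 * M / c0 * (LINT \<xi>:?B|lborel. v \<xi>)"
    proof (cases "v 0 > 0")
      case False
      then show ?thesis using vint0 M c0 by (smt (verit) divide_nonneg_pos mult_nonneg_nonneg)
    next
      case True
      have "isCont v 0" using cont S oS continuous_on_eq_continuous_at by blast
      then obtain d where d: "d > 0" "\<And>y. dist y 0 < d \<Longrightarrow> dist (v y) (v 0) < v 0 / 2"
        unfolding continuous_at_eps_delta using True by (meson half_gt_zero)
      \<comment> \<open>\<open>r \<le> 1 / 2\<close> keeps the box inside \<open>hq e < 1\<close>,
        and \<open>r \<le> d / 4\<close> keeps it within distance \<open>3 * r < d\<close> of the
        origin, where \<open>v\<close> is at least half of \<open>v 0\<close>.\<close>
      define r where "r = min (1/2) (d / 4)"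
      have r: "r > 0" "r \<le> 1 / 2" "r \<le> d / 4" using d by (auto simp: r_def)
      define e where "e = r\<^sup>2"
      have e: "e > 0" using r by (simp add: e_def)
      let ?d = "r / sqrt (2 * real CARD('n))"
      let ?K = "cbox (- (?d *\<^sub>R One), - r\<^sup>2) (?d *\<^sub>R One, r\<^sup>2) :: 'n heis set"
      define j where "j = n / 2 + 2"
      define k where "k \<xi> = 1 - hq e \<xi> powr j" for \<xi> :: "'n heis"
      define b where "b = - n / 2"
      define \<psi> where "\<psi> = (\<lambda>x::'n heis. complex_of_real (k x) ^ 3 * hq_powr e b x)"
      have ks: "smooth_on k UNIV" unfolding k_def[abs_def] by (intro smooth_intros smooth_on_hq_powr_real e) auto
      have jp: "j > 0" using n by (simp add: j_def)
      have k_iff: "k x > 0 \<longleftrightarrow> hq e x < 1" "k x \<ge> 0 \<longleftrightarrow> hq e x \<le> 1" for x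
      proof -
        consider "hq e x < 1" | "hq e x = 1" | "hq e x > 1" by linarith
        then have "(k x > 0 \<longleftrightarrow> hq e x < 1) \<and> (k x \<ge> 0 \<longleftrightarrow> hq e x \<le> 1)"
          by cases (use powr_less_mono2[OF jp, of "hq e x" 1] powr_less_mono2[OF jp, of 1 "hq e x"] hq_nonneg[of e x]
            in \<open>auto simp: k_def\<close>)
        then show "k x > 0 \<longleftrightarrow> hq e x < 1" "k x \<ge> 0 \<longleftrightarrow> hq e x \<le> 1" by auto
      qed
      have hq_le: "hq 0 x \<le> hq e x" for x :: "'n heis"
        unfolding hq_def using zsq_nonneg[of x] e by (intro add_right_mono power_mono) auto
      have sub2: "{x. k x \<ge> 0} \<subseteq> S" unfolding k_iff using sub hq_le by (auto intro: order_trans)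
      have bdd: "bounded {x. k x \<ge> 0}" unfolding k_iff using bounded_hq[of e 1] e by simp
      have sU: "smooth_on ?U S" by (intro smooth_on_of_real S v)
      have green: "has_bochner_integral lborel (\<lambda>x. indicator {x. k x > 0} x *\<^sub>R (?U x * lap \<psi> x - \<psi> x * lap ?U x)) 0"
        unfolding \<psi>_def by (rule green_superlevel[OF S sU smooth_on_hq_powr[OF e S] ks sub2 bdd])
      have "has_bochner_integral lborel (\<lambda>x. Re (indicator {x. k x > 0} x *\<^sub>R (?U x * lap \<psi> x - \<psi> x * lap ?U x))) (Re 0)"
        by (rule has_bochner_integral_Re[OF green])
      then have green': "has_bochner_integral lborel (\<lambda>x. indicator {x. k x > 0} x *\<^sub>R Re (?U x * lap \<psi> x - \<psi> x * lap ?U x)) 0"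
        by simp
      have lap\<psi>: "Re (lap \<psi> x) \<le> M - 2 * n\<^sup>2 * e * hq e x powr (b - 1)" if "k x > 0" for x
      proof -
        have h1: "hq e x \<le> 1" using that k_iff by auto
        have eq: "\<psi> = (\<lambda>x. (hq_powr e b x + (- 3) * hq_powr e 2 x) + (3 * hq_powr e (n / 2 + 4) x + (- 1) * hq_powr e (n + 6) x))"
        proof
          fix x
          have k': "complex_of_real (k x) = 1 - hq_powr e j x" by (simp add: k_def hq_powr_def)
          have "\<psi> x = hq_powr e b x - 3 * (hq_powr e j x * hq_powr e b x) + 3 * (hq_powr e j x * (hq_powr e j x * hq_powr e b x)) - hq_powr e j x * (hq_powr e j x * (hq_powr e j x * hq_powr e b x))"
            unfolding \<psi>_def k' by (simp add: power3_eq_cube algebra_simps)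
          then show "\<psi> x = (hq_powr e b x + (- 3) * hq_powr e 2 x) + (3 * hq_powr e (n / 2 + 4) x + (- 1) * hq_powr e (n + 6) x)"
            unfolding hq_powr_mult by (simp add: j_def b_def algebra_simps)
        qed
        have sP: "smooth_on (hq_powr e a) UNIV" "smooth_on (\<lambda>x. c * hq_powr e a x) UNIV" for a c
          by (intro smooth_intros smooth_on_hq_powr e; simp)+
        have "lap \<psi> x = (lap (hq_powr e b) x + (- 3) * lap (hq_powr e 2) x) + (3 * lap (hq_powr e (n / 2 + 4)) x + (- 1) * lap (hq_powr e (n + 6)) x)"
          unfolding eq by (subst lap_add[of UNIV] | subst lap_cmult[of UNIV] | intro smooth_on_add sP open_UNIV UNIV_I)+ (rule refl)
        then have "Re (lap \<psi> x) = Re (lap (hq_powr e b) x) - 3 * Re (lap (hq_powr e 2) x) + 3 * Re (lap (hq_powr e (n / 2 + 4)) x) - Re (lap (hq_powr e (n + 6)) x)"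
          by simp
        moreover have "Re (lap (hq_powr e b) x) = - 2 * n\<^sup>2 * e * hq e x powr (b - 1)"
        proof -
          have "b * (4 * n * (zsq x + e) + 8 * b * zsq x) = - 2 * n\<^sup>2 * e" by (simp add: b_def power2_eq_square algebra_simps)
          then have "hq e x powr (b - 1) * (b * (4 * n * (zsq x + e) + 8 * b * zsq x)) = hq e x powr (b - 1) * (- 2 * n\<^sup>2 * e)" by simp
          then show ?thesis unfolding lap_hq_powr[OF e] Re_complex_of_real n_def[symmetric] by (simp add: mult_ac)
        qed
        moreover have "Re (lap (hq_powr e (n / 2 + 4)) x) \<le> m (n / 2 + 4)" "0 \<le> Re (lap (hq_powr e 2) x)" "0 \<le> Re (lap (hq_powr e (n + 6)) x)"
          using lap_hq_powr_bound(2)[OF e _ h1, of "n / 2 + 4"] lap_hq_powr_bound(1)[OF e _ h1, of 2] lap_hq_powr_bound(1)[OF e _ h1, of "n + 6"] n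
          by (simp_all add: m_def n_def)
        moreover have "m 2 \<ge> 0" "m (n + 6) \<ge> 0" using n by (simp_all add: m_def)
        ultimately show ?thesis unfolding M_def by linarith
      qed
      have \<psi>0: "\<psi> x = of_real ((k x) ^ 3 * hq e x powr b)" for x by (simp add: \<psi>_def hq_powr_def)
      have measT: "{x. k x > 0} \<in> sets lborel"
        using smooth_on_continuous[OF ks] by (auto intro!: borel_open open_Collect_less continuous_intros)
      have TB: "{x. k x > 0} \<subseteq> ?B" unfolding k_iff using hq_le by (auto intro: le_less_trans)
      have intvT: "set_integrable lborel {x. k x > 0} v" by (rule set_integrable_subset[OF intv measT TB])
      define q where "q x = 2 * n\<^sup>2 * e * hq e x powr (b - 1) * v x" for x
      have qcont: "continuous_on S q"
      proof -
        have "continuous_on S (\<lambda>x. hq e x powr (b - 1))"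
          by (rule continuous_on_subset[OF smooth_on_continuous[OF smooth_on_hq_powr_real[OF e]]]) auto
        then show ?thesis unfolding q_def by (intro continuous_on_mult continuous_on_const cont)
      qed
      have compT: "compact {x. k x \<ge> 0}" unfolding k_iff using compact_hq[of e 1] e by simp
      have intq: "set_integrable lborel {x. k x > 0} q"
      proof (rule set_integrable_subset[OF _ measT])
        show "set_integrable lborel {x. k x \<ge> 0} q" unfolding set_integrable_def
          by (intro borel_integrable_compact compT continuous_on_subset[OF qcont sub2])
      qed auto
      have "(LINT x:{x. k x > 0}|lborel. q x) \<le> (LINT x:{x. k x > 0}|lborel. M * v x)"
      proof (rule has_bochner_integral_set_mono)
        show "has_bochner_integral lborel (\<lambda>x. indicator {x. k x > 0} x *\<^sub>R (- Re (?U x * lap \<psi> x - \<psi> x * lap ?U x))) 0"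
          using has_bochner_integral_minus[OF green'] by (simp only: scaleR_minus_right minus_zero)
        show "set_integrable lborel {x. k x > 0} (\<lambda>x. M * v x)" using intvT by simp
        fix x assume x: "x \<in> {x. k x > 0}"
        then have xS: "x \<in> S" using sub2 by (auto simp: less_imp_le)
        have "Re (?U x * lap \<psi> x) = v x * Re (lap \<psi> x)" by simp
        also have "\<dots> \<le> v x * (M - 2 * n\<^sup>2 * e * hq e x powr (b - 1))"
          using lap\<psi> x v0 xS by (intro mult_left_mono) auto
        also have "\<dots> = M * v x - q x" by (simp add: q_def algebra_simps)
        finally have "Re (?U x * lap \<psi> x) \<le> M * v x - q x" .
        moreover have "Re (\<psi> x * lap ?U x) = (k x) ^ 3 * hq e x powr b * Re (lap ?U x)" by (simp add: \<psi>0)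
        moreover have "(k x) ^ 3 * hq e x powr b * Re (lap ?U x) \<ge> 0" using x lv xS by simp
        ultimately show "q x \<le> - Re (?U x * lap \<psi> x - \<psi> x * lap ?U x) + M * v x" by simp
      qed (rule intq)
      also have "\<dots> = M * (LINT x:{x. k x > 0}|lborel. v x)" by simp
      also have "\<dots> \<le> M * (LINT x:?B|lborel. v x)"
      proof (rule mult_left_mono)
        show "(LINT x:{x. k x > 0}|lborel. v x) \<le> (LINT x:?B|lborel. v x)"
          unfolding set_lebesgue_integral_def
          by (rule integral_mono) (use intvT intv TB v0 sub in \<open>auto simp: set_integrable_def indicator_def subset_iff less_imp_le\<close>)
      qed (use M in simp)
      finally have upper: "(LINT x:{x. k x > 0}|lborel. q x) \<le> M * (LINT x:?B|lborel. v x)" .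
      have K: "hq e x \<le> 5 * r ^ 4" "hq e x < 1" "v x \<ge> v 0 / 2" if "x \<in> ?K" for x
      proof -
        show 1: "hq e x \<le> 5 * r ^ 4" unfolding e_def by (rule box_in_hq[OF r(1) that])
        have r4: "r ^ 4 \<le> (1 / 2) ^ 4" using r by (intro power_mono) auto
        then show "hq e x < 1" using 1 by (simp add: eval_nat_numeral)
        have "r ^ 4 \<ge> 0" using r by simp
        then have "hq 0 x \<le> 16 * r ^ 4" using 1 hq_le[of x] by linarith
        then have "hq 0 x \<le> (2 * r) ^ 4" by (simp add: power_mult_distrib)
        then have z: "zsq x \<le> (2 * r)\<^sup>2" and t: "\<bar>snd x\<bar> \<le> r\<^sup>2"
          using hq_bounds(1)[of 0 x "2 * r"] r that by (auto, cases x, auto simp: cbox_Pair_eq)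
        have "norm (fst x) \<le> 2 * r" by (rule power2_le_imp_le) (use z r in \<open>simp_all add: zsq_norm\<close>)
        moreover have "norm (snd x) \<le> r"
        proof -
          have "r\<^sup>2 \<le> r" using r by (simp add: power2_eq_square mult_left_le)
          then show ?thesis using t by simp
        qed
        ultimately have "norm x \<le> 3 * r" using norm_Pair_le[of "fst x" "snd x"] by simp
        then have "dist x 0 < d" using r d by simp
        then show "v x \<ge> v 0 / 2" using d(2)[of x] by (simp add: dist_real_def abs_if split: if_splits)
      qed
      define q0 where "q0 = 2 * n\<^sup>2 * e * (5 * r ^ 4) powr (b - 1) * (v 0 / 2)"
      have "(LINT x|lborel. indicator ?K x * q0) \<le> (LINT x:{x. k x > 0}|lborel. q x)"
        unfolding set_lebesgue_integral_def
      proof (rule integral_mono)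
        show "integrable lborel (\<lambda>x. indicator ?K x * q0)" using borel_integrable_compact[of ?K "\<lambda>_. q0"] by simp
        show "integrable lborel (\<lambda>x. indicator {x. k x > 0} x *\<^sub>R q x)" using intq by (simp add: set_integrable_def)
        fix x :: "'n heis"
        show "indicator ?K x * q0 \<le> indicator {x. k x > 0} x *\<^sub>R q x"
        proof (cases "x \<in> ?K")
          case True
          have "(5 * r ^ 4) powr (b - 1) \<le> hq e x powr (b - 1)"
            using K(1)[OF True] hq_pos[OF e, of x] n by (intro powr_mono2') (auto simp: b_def)
          then have "q0 \<le> q x" unfolding q0_def q_def using K(3)[OF True] e \<open>v 0 > 0\<close> by (intro mult_mono mult_left_mono) auto
          then show ?thesis using True K(2)[OF True] k_iff by simp
        next
          case False
          have "q x \<ge> 0" if "k x > 0"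
          proof -
            have "x \<in> S" using sub2 that by (auto simp: less_imp_le)
            then show ?thesis using v0 e unfolding q_def by simp
          qed
          then show ?thesis using False by (simp add: indicator_def)
        qed
      qed
      then have lower: "q0 * measure lborel ?K \<le> (LINT x:{x. k x > 0}|lborel. q x)" by (simp add: mult.commute)
      have "q0 * measure lborel ?K = c0 * (v 0 / 2)"
      proof -
        have mK: "measure lborel ?K = (2 * ?d) ^ (2 * CARD('n)) * (2 * r\<^sup>2)"
          by (rule measure_box) (use r in auto)
        have "(2 * ?d) ^ (2 * CARD('n)) = (2 / sqrt (2 * n)) ^ (2 * CARD('n)) * r powr (2 * n)"
        proof -
          have "2 * ?d = (2 / sqrt (2 * n)) * r" by (simp add: n_def)
          moreover have "r ^ (2 * CARD('n)) = r powr (2 * n)" using r powr_realpow[of r "2 * CARD('n)"] by (simp add: n_def)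
          ultimately show ?thesis by (simp only: power_mult_distrib)
        qed
        moreover have "(5 * r ^ 4) powr (b - 1) = 5 powr (- n / 2 - 1) * r powr (- 2 * n - 4)"
        proof -
          have "r ^ 4 = r powr 4" using powr_realpow[of r 4] r by simp
          then show ?thesis using r by (simp add: powr_mult powr_powr b_def algebra_simps del: powr_numeral)
        qed
        moreover have "e * r powr (- 2 * n - 4) * (r powr (2 * n) * r\<^sup>2) = 1"
        proof -
          have "r\<^sup>2 = r powr 2" using powr_realpow[of r 2] r by simp
          then have "e * r powr (- 2 * n - 4) * (r powr (2 * n) * r\<^sup>2) = r powr (2 + (- 2 * n - 4) + (2 * n + 2))"
            unfolding e_def powr_add by (simp only: mult.assoc)
          then show ?thesis using r by simp
        qed
        ultimately show ?thesis unfolding q0_def mK c0_def by (simp add: mult_ac)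
      qed
      then have "c0 * (v 0 / 2) \<le> M * (LINT x:?B|lborel. v x)" using lower upper by simp
      then show ?thesis using c0 by (simp add: field_simps)
    qed
  qed
qed

section \<open>Solutions and their rescaling\<close>

text \<open>With \<open>u = exp (n * F)\<close> the two orders of differentiation in
  \<open>lap\<close> differ by \<open>2 * \<i> * dt F\<close>, which becomes the imaginary part of
  \<open>g\<close>; the splitting \<open>q * ln u = n * F + (2 + p) * F\<close> accounts for
  \<open>w\<close>.\<close>

lemma log_solution_pde:
  fixes u :: "'n::finite heis \<Rightarrow> real"
  assumes S: "open S" and u: "smooth_on u S" and pos: "\<And>\<xi>. \<xi> \<in> S \<Longrightarrow> u \<xi> > 0"
    and eq: "\<And>\<xi>. \<xi> \<in> S \<Longrightarrow> lap (\<lambda>\<eta>. complex_of_real (u \<eta>)) \<xi> = - complex_of_real (2 * (real CARD('n))\<^sup>2 * u \<xi> powr q)"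
    and p: "p = real CARD('n) * (q - 1) - 2"
  defines "F \<equiv> \<lambda>\<xi>. complex_of_real (ln (u \<xi>) / real CARD('n))"
  assumes xi: "\<xi> \<in> S"
  shows "(\<Sum>\<alpha>\<in>UNIV. Zbar \<alpha> (Z \<alpha> F) \<xi>) = - of_nat CARD('n) *
    ((\<Sum>\<alpha>\<in>UNIV. Z \<alpha> F \<xi> * Zbar \<alpha> F \<xi>) + exp ((2 + complex_of_real p) * F \<xi>) - \<i> * dt F \<xi>)"
proof -
  define N where "N = complex_of_real (real CARD('n))"
  have N: "N \<noteq> 0" by (simp add: N_def)
  let ?U = "\<lambda>\<eta>. complex_of_real (u \<eta>)"
  have sF: "smooth_on F S"
  proof -
    have "F = (\<lambda>\<xi>. (1 / N) * complex_of_real (ln (u \<xi>)))" by (simp add: F_def N_def)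
    moreover have "smooth_on (\<lambda>\<xi>. (1 / N) * complex_of_real (ln (u \<xi>))) S"
      by (intro smooth_intros smooth_on_ln S u pos)
    ultimately show ?thesis by simp
  qed
  have U: "?U x = exp (N * F x)" if "x \<in> S" for x
  proof -
    have "N * F x = complex_of_real (ln (u x))" by (simp add: N_def F_def)
    then show ?thesis using pos[OF that] by (simp add: exp_of_real)
  qed
  have dF: "F differentiable (at x)" if "x \<in> S" for x
    by (rule smooth_on_differentiable[OF sF that])
  have dNF: "(\<lambda>x. N * F x) differentiable (at x)" if "x \<in> S" for x
    using dF[OF that] by simp
  have dU: "(\<lambda>x. exp (N * F x)) differentiable (at x)" if "x \<in> S" for x
    by (rule differentiableI[OF has_derivative_exp_comp[OF dNF[OF that]]])
  have d2: "Z \<alpha> F differentiable (at \<xi>)" "Zbar \<alpha> F differentiable (at \<xi>)" for \<alpha>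
    using smooth_on_differentiable[OF smooth_on_Z(1)[OF S sF] xi] smooth_on_differentiable[OF smooth_on_Z(2)[OF S sF] xi] by auto
  have ZU: "Z \<alpha> (\<lambda>x. exp (N * F x)) x = N * (exp (N * F x) * Z \<alpha> F x)"
    "Zbar \<alpha> (\<lambda>x. exp (N * F x)) x = N * (exp (N * F x) * Zbar \<alpha> F x)" if "x \<in> S" for x \<alpha>
    using dF[OF that] dNF[OF that] by (simp_all add: Z_exp Z_cmult)
  have ZZU: "Zbar \<alpha> (Z \<alpha> (\<lambda>x. exp (N * F x))) \<xi> + Z \<alpha> (Zbar \<alpha> (\<lambda>x. exp (N * F x))) \<xi>
     = N * exp (N * F \<xi>) * (2 * Zbar \<alpha> (Z \<alpha> F) \<xi> - 2 * \<i> * dt F \<xi> + 2 * N * (Z \<alpha> F \<xi> * Zbar \<alpha> F \<xi>))" for \<alpha>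
  proof -
    have "Zbar \<alpha> (Z \<alpha> (\<lambda>x. exp (N * F x))) \<xi> = Zbar \<alpha> (\<lambda>x. N * (exp (N * F x) * Z \<alpha> F x)) \<xi>"
      "Z \<alpha> (Zbar \<alpha> (\<lambda>x. exp (N * F x))) \<xi> = Z \<alpha> (\<lambda>x. N * (exp (N * F x) * Zbar \<alpha> F x)) \<xi>"
      by (rule Z_cong[OF S xi], rule ZU, assumption)+
    then have 1: "Zbar \<alpha> (Z \<alpha> (\<lambda>x. exp (N * F x))) \<xi> = N * (exp (N * F \<xi>) * Zbar \<alpha> (Z \<alpha> F) \<xi> + N * (exp (N * F \<xi>) * Zbar \<alpha> F \<xi>) * Z \<alpha> F \<xi>)"
      "Z \<alpha> (Zbar \<alpha> (\<lambda>x. exp (N * F x))) \<xi> = N * (exp (N * F \<xi>) * Z \<alpha> (Zbar \<alpha> F) \<xi> + N * (exp (N * F \<xi>) * Z \<alpha> F \<xi>) * Zbar \<alpha> F \<xi>)"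
      using d2 dU[OF xi] by (simp_all add: Z_cmult Z_mult ZU[OF xi])
    have 2: "Z \<alpha> (Zbar \<alpha> F) \<xi> = Zbar \<alpha> (Z \<alpha> F) \<xi> - 2 * \<i> * dt F \<xi>"
      using Z_commute(3)[OF S sF xi, of \<alpha> \<alpha>] by simp
    show ?thesis unfolding 1 2 by (simp add: algebra_simps)
  qed
  have "lap ?U \<xi> = lap (\<lambda>x. exp (N * F x)) \<xi>" by (rule lap_cong[OF S xi U])
  also have "\<dots> = N * exp (N * F \<xi>) * (2 * (\<Sum>\<alpha>\<in>UNIV. Zbar \<alpha> (Z \<alpha> F) \<xi>) - 2 * \<i> * N * dt F \<xi> + 2 * N * (\<Sum>\<alpha>\<in>UNIV. Z \<alpha> F \<xi> * Zbar \<alpha> F \<xi>))"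
    unfolding lap_def ZZU sum_distrib_left[symmetric] sum.distrib sum_subtractf by (simp add: N_def)
  finally have l: "lap ?U \<xi> = \<dots>" .
  have w: "complex_of_real (u \<xi> powr q) = exp (N * F \<xi>) * exp ((2 + complex_of_real p) * F \<xi>)"
  proof -
    have "u \<xi> powr q = exp (q * ln (u \<xi>))" using pos[OF xi] by (simp add: powr_def)
    also have "q * ln (u \<xi>) = real CARD('n) * (ln (u \<xi>) / real CARD('n)) + (2 + p) * (ln (u \<xi>) / real CARD('n))"
      by (simp add: p field_simps)
    finally show ?thesis unfolding F_def N_def by (simp add: exp_add flip: exp_of_real)
  qed
  have "N * exp (N * F \<xi>) * (2 * (\<Sum>\<alpha>\<in>UNIV. Zbar \<alpha> (Z \<alpha> F) \<xi>) - 2 * \<i> * N * dt F \<xi> + 2 * N * (\<Sum>\<alpha>\<in>UNIV. Z \<alpha> F \<xi> * Zbar \<alpha> F \<xi>))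
    = - (2 * N\<^sup>2 * complex_of_real (u \<xi> powr q))"
    using eq[OF xi] unfolding l by (simp add: N_def)
  also have "\<dots> = N * exp (N * F \<xi>) * (- 2 * N * exp ((2 + complex_of_real p) * F \<xi>))"
    unfolding w by (simp add: power2_eq_square)
  finally have "2 * (\<Sum>\<alpha>\<in>UNIV. Zbar \<alpha> (Z \<alpha> F) \<xi>) - 2 * \<i> * N * dt F \<xi> + 2 * N * (\<Sum>\<alpha>\<in>UNIV. Z \<alpha> F \<xi> * Zbar \<alpha> F \<xi>)
     = - 2 * N * exp ((2 + complex_of_real p) * F \<xi>)"
    using N by (simp only: mult_cancel_left) simp
  then have "2 * (\<Sum>\<alpha>\<in>UNIV. Zbar \<alpha> (Z \<alpha> F) \<xi>) = 2 * (- N * ((\<Sum>\<alpha>\<in>UNIV. Z \<alpha> F \<xi> * Zbar \<alpha> F \<xi>) + exp ((2 + complex_of_real p) * F \<xi>) - \<i> * dt F \<xi>))"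
    by (simp add: algebra_simps)
  then have "(\<Sum>\<alpha>\<in>UNIV. Zbar \<alpha> (Z \<alpha> F) \<xi>) = - N * ((\<Sum>\<alpha>\<in>UNIV. Z \<alpha> F \<xi> * Zbar \<alpha> F \<xi>) + exp ((2 + complex_of_real p) * F \<xi>) - \<i> * dt F \<xi>)"
    by (simp only: mult_cancel_left) simp
  then show ?thesis by (simp add: N_def)
qed

definition solution :: "real \<Rightarrow> 'n::finite heis set \<Rightarrow> ('n heis \<Rightarrow> real) \<Rightarrow> bool" where
  "solution q S u \<longleftrightarrow> open S \<and> smooth_on u S \<and> (\<forall>\<xi>\<in>S. u \<xi> > 0) \<and>
     (\<forall>\<xi>\<in>S. lap (\<lambda>\<eta>. complex_of_real (u \<eta>)) \<xi> = - complex_of_real (2 * (real CARD('n))\<^sup>2 * u \<xi> powr q))"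

lemma solution_integral_estimate:
  fixes q :: real
  assumes q: "1 < q" "q < 1 + 2 / real CARD('n::finite)"
  shows "\<exists>\<tau> s C. C > 0 \<and> \<tau> > 2 * real CARD('n) + 2 \<and> (\<forall>S (u :: 'n heis \<Rightarrow> real) R. solution q S u \<longrightarrow> R > 0 \<longrightarrow> {\<xi>. hq 0 \<xi> \<le> R ^ 4} \<subseteq> S \<longrightarrow>
     (LINT \<xi>:{\<xi>. hq 0 \<xi> < R ^ 4}|lborel. (1 - hq 0 \<xi> / R ^ 4) ^ s * u \<xi> powr (3 * q - 1 - 2 / real CARD('n)))
       \<le> C * R powr (2 * real CARD('n) + 2 - \<tau>))"
proof -
  define n where "n = real CARD('n)"
  have n: "n \<ge> 1" by (simp add: n_def Suc_leI)
  define p where "p = n * (q - 1) - 2"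
  have p: "-2 < p" "p < 0"
  proof -
    have "n * (q - 1) > 0" using n q by simp
    then show "-2 < p" by (simp add: p_def)
    have "n * (q - 1) < n * (2 / n)" using n q(2) by (intro mult_strict_left_mono) (auto simp: n_def)
    then show "p < 0" using n by (simp add: p_def)
  qed
  \<comment> \<open>Equal to \<open>- p * ((2 * n - 1) + p / 2)\<close>, hence positive for
    \<open>-2 < p < 0\<close>; the positivity leaves room for the loss
    \<open>\<epsilon> * (n + 2)\<close> caused by the field \<open>A^2 * a\<close>.\<close>
  define c1 where "c1 = - p * (2 * n - 1) - p\<^sup>2 / 2"
  have c1: "c1 > 0"
  proof -
    have "c1 = - p * ((2 * n - 1) + p / 2)" by (simp add: c1_def power2_eq_square algebra_simps)
    then show ?thesis using p n by (simp add: mult_neg_pos)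
  qed
  define \<epsilon> where "\<epsilon> = min (1 / 16) (c1 / (n + 2))"
  have eps: "0 < \<epsilon>" "\<epsilon> \<le> 1 / 16" unfolding \<epsilon>_def using c1 n by (simp, intro min.cobounded1)
  have "\<epsilon> * (n + 2) \<le> c1 / (n + 2) * (n + 2)" using n by (intro mult_right_mono) (auto simp: \<epsilon>_def)
  then have eps2: "c1 - \<epsilon> * (n + 2) \<ge> 0" using n by simp
  define \<theta> where "\<theta> = (2 * n - 2) / (6 + 3 * p)"
  \<comment> \<open>This is \<open>2 / (q - 1)\<close> times the exponent
    \<open>3 * q - 1 - 2 / n\<close>, so the estimate is invariant under the rescaling of
    solutions.\<close>
  define \<tau> where "\<tau> = 6 + 6 * \<theta>"
  \<comment> \<open>After multiplication by \<open>2 + p\<close> the two sides differ by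
    \<open>4 + 2 * (2 - n) * p\<close>. For \<open>n \<ge> 2\<close> this is positive because
    \<open>p < 0\<close>, for \<open>n = 1\<close> because \<open>p > -2\<close>.\<close>
  have tau: "\<tau> > 2 * n + 2"
  proof -
    have "\<tau> * (2 + p) = 2 * (2 * n + 4 + 3 * p)"
    proof -
      have "\<theta> * (3 * (2 + p)) = 2 * n - 2" using p by (simp add: \<theta>_def)
      then show ?thesis by (simp add: \<tau>_def algebra_simps)
    qed
    moreover have "2 * (2 * n + 4 + 3 * p) > (2 * n + 2) * (2 + p)"
    proof (cases "n \<ge> 2")
      case True
      then have "(2 - n) * p \<ge> 0" using p by (simp add: mult_nonpos_nonpos)
      then show ?thesis by (simp add: algebra_simps)
    next
      case False
      then have "CARD('n) < 2" by (simp add: n_def)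
      moreover have "CARD('n) > 0" by simp
      ultimately have "CARD('n) = 1" by linarith
      then have "n = 1" by (simp add: n_def)
      then show ?thesis using p by (simp add: algebra_simps)
    qed
    ultimately have "(2 * n + 2) * (2 + p) < \<tau> * (2 + p)" by simp
    then show ?thesis using p by (simp add: mult_less_cancel_right)
  qed
  define s where "s = nat \<lceil>max 4 \<tau>\<rceil>"
  have s: "s \<ge> 4" "real s \<ge> \<tau>" unfolding s_def by (auto simp: le_nat_iff) linarith+
  have c2: "- p * (2 * n - 1) > 0" using p n by (simp add: mult_neg_pos)
  obtain K1 K2 C where C: "C > 0" and abs: "absorbs n (real s) (\<epsilon> / 4) (c1 - \<epsilon> * (n + 2)) (- p * (2 * n - 1))
      (28 * (real s)\<^sup>2) (1 / (4 * (1 / (800 * (real s)\<^sup>2))) + 2 * (real s)\<^sup>2) K1 K2 C"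
    using absorption[of n "real s" "\<epsilon> / 4" "c1 - \<epsilon> * (n + 2)" "- p * (2 * n - 1)" "28 * (real s)\<^sup>2"
      "1 / (4 * (1 / (800 * (real s)\<^sup>2))) + 2 * (real s)\<^sup>2"] n s(1) eps eps2 c2 by auto
  define C' where "C' = 2 * C * (2 * C) powr \<theta> * (2 ^ (2 * CARD('n)) * 2)"
  show ?thesis
  proof (rule exI[of _ \<tau>], rule exI[of _ s], rule exI[of _ C'], intro conjI allI impI)
    show "C' > 0" using C by (simp add: C'_def)
    show "2 * real CARD('n) + 2 < \<tau>" using tau by (simp add: n_def)
    fix S and u :: "'n heis \<Rightarrow> real" and R :: real
    assume sol: "solution q S u" and R: "R > 0" and sub: "{\<xi>. hq 0 \<xi> \<le> R ^ 4} \<subseteq> S"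
    define f where "f \<xi> = ln (u \<xi>) / n" for \<xi>
    have pos: "u \<xi> > 0" if "\<xi> \<in> S" for \<xi> using sol that by (simp add: solution_def)
    have L: "log_solution S f p"
    proof (rule log_solution.intro)
      show "open S" using sol by (simp add: solution_def)
      have f_alt: "f = (\<lambda>\<xi>. (1 / n) * ln (u \<xi>))" by (simp add: f_def fun_eq_iff)
      show "smooth_on f S" unfolding f_alt
        using sol by (intro smooth_intros smooth_on_ln) (auto simp: solution_def)
      fix \<xi> assume xi: "\<xi> \<in> S"
      show "(\<Sum>\<alpha>\<in>UNIV. Zbar \<alpha> (Z \<alpha> (\<lambda>\<xi>. complex_of_real (f \<xi>))) \<xi>) = - of_nat CARD('n) *
        ((\<Sum>\<alpha>\<in>UNIV. Z \<alpha> (\<lambda>\<xi>. complex_of_real (f \<xi>)) \<xi> * Zbar \<alpha> (\<lambda>\<xi>. complex_of_real (f \<xi>)) \<xi>)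
          + exp ((2 + complex_of_real p) * complex_of_real (f \<xi>)) - \<i> * dt (\<lambda>\<xi>. complex_of_real (f \<xi>)) \<xi>)"
        unfolding f_def n_def
        by (rule log_solution_pde[where S = S and q = q]) (use sol xi p_def n_def in \<open>auto simp: solution_def\<close>)
    qed
    have "(LINT \<xi>:{\<xi>. hq 0 \<xi> < R ^ 4}|lborel. (1 - hq 0 \<xi> / R ^ 4) ^ s * exp ((2 * real CARD('n) + 4 + 3 * p) * f \<xi>))
      \<le> 2 * C * (2 * C) powr \<theta> * R powr (- (6 + 6 * \<theta>)) * ((2 * R) ^ (2 * CARD('n)) * (2 * R\<^sup>2))"
      by (rule log_solution.integral_estimate[OF L p(1) less_imp_le[OF p(2)] s(1) eps _ C R sub])
         (use abs s(2) in \<open>auto simp: \<theta>_def \<tau>_def c1_def n_def\<close>)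
    also have "(LINT \<xi>:{\<xi>. hq 0 \<xi> < R ^ 4}|lborel. (1 - hq 0 \<xi> / R ^ 4) ^ s * exp ((2 * real CARD('n) + 4 + 3 * p) * f \<xi>))
       = (LINT \<xi>:{\<xi>. hq 0 \<xi> < R ^ 4}|lborel. (1 - hq 0 \<xi> / R ^ 4) ^ s * u \<xi> powr (3 * q - 1 - 2 / real CARD('n)))"
    proof (rule set_lebesgue_integral_cong)
      show "{\<xi>. hq 0 \<xi> < R ^ 4} \<in> sets lborel" by (auto intro!: borel_open open_Collect_less continuous_on_hq continuous_intros)
      show "\<forall>\<xi>. \<xi> \<in> {\<xi>::'n heis. hq 0 \<xi> < R ^ 4} \<longrightarrow> (1 - hq 0 \<xi> / R ^ 4) ^ s * exp ((2 * real CARD('n) + 4 + 3 * p) * f \<xi>)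
         = (1 - hq 0 \<xi> / R ^ 4) ^ s * u \<xi> powr (3 * q - 1 - 2 / real CARD('n))"
      proof (intro allI impI)
        fix \<xi> :: "'n heis" assume "\<xi> \<in> {\<xi>. hq 0 \<xi> < R ^ 4}"
        then have "\<xi> \<in> S" using sub by (auto simp: less_imp_le)
        then have "u \<xi> > 0" by (rule pos)
        moreover have "(2 * n + 4 + 3 * p) * f \<xi> = (3 * q - 1 - 2 / n) * ln (u \<xi>)"
          using n by (simp add: f_def p_def field_simps)
        ultimately show "(1 - hq 0 \<xi> / R ^ 4) ^ s * exp ((2 * real CARD('n) + 4 + 3 * p) * f \<xi>)
         = (1 - hq 0 \<xi> / R ^ 4) ^ s * u \<xi> powr (3 * q - 1 - 2 / real CARD('n))"
          by (simp add: powr_def n_def)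
      qed
    qed
    also have "2 * C * (2 * C) powr \<theta> * R powr (- (6 + 6 * \<theta>)) * ((2 * R) ^ (2 * CARD('n)) * (2 * R\<^sup>2))
       = C' * R powr (2 * real CARD('n) + 2 - \<tau>)"
    proof -
      have "R ^ (2 * CARD('n)) * R\<^sup>2 = R powr (2 * real CARD('n) + 2)"
        using R powr_realpow[of R "2 * CARD('n) + 2"] by (simp add: power_add power2_eq_square add.commute)
      then have "R powr (- \<tau>) * (R ^ (2 * CARD('n)) * R\<^sup>2) = R powr (2 * real CARD('n) + 2 - \<tau>)"
        using powr_add[of R "- \<tau>" "2 * real CARD('n) + 2"] by (simp add: algebra_simps)
      then show ?thesis by (simp add: C'_def \<tau>_def power_mult_distrib mult_ac)
    qed
    finally show "(LINT \<xi>:{\<xi>. hq 0 \<xi> < R ^ 4}|lborel. (1 - hq 0 \<xi> / R ^ 4) ^ s * u \<xi> powr (3 * q - 1 - 2 / real CARD('n)))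
       \<le> C' * R powr (2 * real CARD('n) + 2 - \<tau>)" .
  qed
qed

section \<open>Group law, dilations and the homogeneous norm\<close>

definition hmul :: "'n::finite heis \<Rightarrow> 'n heis \<Rightarrow> 'n heis" where
  "hmul \<xi> \<eta> = (fst \<xi> + fst \<eta>, snd \<xi> + snd \<eta> + 2 * Im (\<Sum>\<alpha>\<in>UNIV. fst \<xi> $ \<alpha> * cnj (fst \<eta> $ \<alpha>)))"

definition hdil :: "real \<Rightarrow> 'n::finite heis \<Rightarrow> 'n heis" where
  "hdil l \<eta> = (l *\<^sub>R fst \<eta>, l\<^sup>2 * snd \<eta>)"

lemma hmul_assoc: "hmul \<xi> (hmul \<eta> \<zeta>) = hmul (hmul \<xi> \<eta>) \<zeta>"
  by (simp add: hmul_def sum.distrib algebra_simps)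

lemma hmul_0 [simp]: "hmul \<xi> 0 = \<xi>"
  by (simp add: hmul_def)

lemma hmul_inverse: "hmul (hmul \<xi> \<eta>) (- \<eta>) = \<xi>"
proof -
  have "Im (\<Sum>\<alpha>\<in>UNIV. fst \<eta> $ \<alpha> * cnj (fst \<eta> $ \<alpha>)) = 0"
    unfolding zsq_complex[symmetric] by simp
  then show ?thesis by (simp add: hmul_def prod_eq_iff algebra_simps sum.distrib sum_negf sum_subtractf)
qed

lemma hdil_0 [simp]: "hdil l 0 = 0"
  by (simp add: hdil_def zero_prod_def)

lemma heis_norm_nonneg: "heis_norm \<xi> \<ge> 0"
  by (simp add: heis_norm_hq)

lemma heis_norm_pow4: "heis_norm \<xi> ^ 4 = hq 0 \<xi>"
proof -
  have "heis_norm \<xi> ^ 4 = heis_norm \<xi> powr 4"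
    by (cases "heis_norm \<xi> = 0") (use heis_norm_nonneg[of \<xi>] powr_realpow[of "heis_norm \<xi>" 4] in auto)
  then show ?thesis using hq_nonneg[of 0 \<xi>] by (simp add: heis_norm_hq powr_powr)
qed

lemma heis_norm_less_iff: "R \<ge> 0 \<Longrightarrow> heis_norm \<xi> < R \<longleftrightarrow> hq 0 \<xi> < R ^ 4"
  and heis_norm_le_iff: "R \<ge> 0 \<Longrightarrow> heis_norm \<xi> \<le> R \<longleftrightarrow> hq 0 \<xi> \<le> R ^ 4"
  unfolding heis_norm_pow4[symmetric] using heis_norm_nonneg[of \<xi>]
  by (simp_all add: power_mono_iff not_le[symmetric])

lemma heis_norm_sq: "(heis_norm \<xi>)\<^sup>2 = cmod (of_real (zsq \<xi>) + \<i> * of_real (snd \<xi>))"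
proof -
  have "((heis_norm \<xi>)\<^sup>2)\<^sup>2 = (cmod (of_real (zsq \<xi>) + \<i> * of_real (snd \<xi>)))\<^sup>2"
    using heis_norm_pow4[of \<xi>] by (simp add: cmod_power2 hq_def flip: power_mult)
  then show ?thesis by (rule power2_eq_imp_eq) (auto simp: heis_norm_nonneg)
qed

lemma heis_norm_0 [simp]: "heis_norm 0 = 0"
  by (simp add: heis_norm_hq hq_def zsq_def)

lemma heis_norm_minus: "heis_norm (- \<xi>) = heis_norm \<xi>"
  by (simp add: heis_norm_hq hq_def zsq_def)

lemma heis_norm_dil: "l \<ge> 0 \<Longrightarrow> heis_norm (hdil l \<xi>) = l * heis_norm \<xi>"
proof -
  assume l: "l \<ge> 0"
  have "heis_norm (hdil l \<xi>) ^ 4 = (l * heis_norm \<xi>) ^ 4"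
    unfolding heis_norm_pow4 power_mult_distrib
    by (simp add: hq_def hdil_def zsq_norm power_mult_distrib algebra_simps flip: power_mult)
  then show ?thesis using heis_norm_nonneg l by (metis mult_nonneg_nonneg power_eq_iff_eq_base zero_less_numeral)
qed

text \<open>For a product, the complex number \<open>zsq + \<i> * t\<close> is the sum of those of
  the factors plus \<open>2 * P\<close>, with \<open>P\<close> the Hermitian product of the
  \<open>z\<close> components. Its modulus is the squared norm, so Cauchy-Schwarz for
  \<open>P\<close> yields the square of the sum.\<close>

lemma heis_norm_triangle: "heis_norm (hmul \<xi> \<eta>) \<le> heis_norm \<xi> + heis_norm \<eta>"
proof -
  define P where "P = (\<Sum>\<alpha>\<in>UNIV. fst \<xi> $ \<alpha> * cnj (fst \<eta> $ \<alpha>))"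
  have "zsq (hmul \<xi> \<eta>) = zsq \<xi> + zsq \<eta> + 2 * Re P"
  proof -
    have "(cmod (x + y))\<^sup>2 = (cmod x)\<^sup>2 + (cmod y)\<^sup>2 + 2 * Re (x * cnj y)" for x y
      unfolding cmod_power2 by (simp add: power2_eq_square algebra_simps)
    then show ?thesis
      unfolding zsq_def hmul_def P_def fst_conv vector_add_component Re_sum sum_distrib_left by (simp only: sum.distrib)
  qed
  then have "of_real (zsq (hmul \<xi> \<eta>)) + \<i> * of_real (snd (hmul \<xi> \<eta>))
     = (of_real (zsq \<xi>) + \<i> * of_real (snd \<xi>)) + (of_real (zsq \<eta>) + \<i> * of_real (snd \<eta>)) + 2 * P"
    by (simp add: hmul_def P_def[symmetric] complex_eq_iff)
  then have "(heis_norm (hmul \<xi> \<eta>))\<^sup>2 \<le> (heis_norm \<xi>)\<^sup>2 + (heis_norm \<eta>)\<^sup>2 + cmod (2 * P)"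
    unfolding heis_norm_sq by (metis norm_triangle_ineq norm_triangle_mono order_refl)
  also have "cmod (2 * P) \<le> 2 * (heis_norm \<xi> * heis_norm \<eta>)"
  proof -
    have "cmod P \<le> (\<Sum>\<alpha>\<in>UNIV. \<bar>cmod (fst \<xi> $ \<alpha>)\<bar> * \<bar>cmod (fst \<eta> $ \<alpha>)\<bar>)"
      unfolding P_def by (rule order_trans[OF norm_sum]) (simp add: norm_mult)
    also have "\<dots> \<le> norm (fst \<xi>) * norm (fst \<eta>)"
      unfolding norm_vec_def by (rule L2_set_mult_ineq)
    also have "\<dots> \<le> heis_norm \<xi> * heis_norm \<eta>"
    proof -
      have n: "norm (fst \<zeta>) \<le> heis_norm \<zeta>" for \<zeta> :: "'a heis"
      proof (rule power2_le_imp_le)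
        show "(norm (fst \<zeta>))\<^sup>2 \<le> (heis_norm \<zeta>)\<^sup>2"
          unfolding heis_norm_sq zsq_norm[symmetric]
          using abs_Re_le_cmod[of "of_real (zsq \<zeta>) + \<i> * of_real (snd \<zeta>)"] by simp
      qed (rule heis_norm_nonneg)
      show ?thesis by (intro mult_mono n heis_norm_nonneg) auto
    qed
    finally show ?thesis by (simp add: norm_mult)
  qed
  finally have "(heis_norm (hmul \<xi> \<eta>))\<^sup>2 \<le> (heis_norm \<xi> + heis_norm \<eta>)\<^sup>2"
    by (simp add: power2_sum)
  then show ?thesis using heis_norm_nonneg by (meson add_nonneg_nonneg power2_le_imp_le)
qed

lemma heis_norm_reverse_triangle: "heis_norm \<xi> - heis_norm \<eta> \<le> heis_norm (hmul \<xi> \<eta>)"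
  using heis_norm_triangle[of "hmul \<xi> \<eta>" "- \<eta>"] by (simp add: hmul_inverse heis_norm_minus)

lemma continuous_on_heis_norm: "continuous_on A heis_norm"
  unfolding heis_norm_hq[abs_def] by (intro continuous_on_powr' continuous_on_hq continuous_on_const) (auto simp: hq_nonneg)

text \<open>The linear part of a dilation followed by a left translation. That composite is affine
  in the coordinates, which brings the chain rule for affine maps into play.\<close>

definition hlin :: "'n::finite heis \<Rightarrow> real \<Rightarrow> 'n heis \<Rightarrow> 'n heis" where
  "hlin \<xi> l \<zeta> = (l *\<^sub>R fst \<zeta>, l\<^sup>2 * snd \<zeta> + 2 * l * Im (\<Sum>\<alpha>\<in>UNIV. fst \<xi> $ \<alpha> * cnj (fst \<zeta> $ \<alpha>)))"

lemma hmul_hdil: "hmul \<xi> (hdil l \<zeta>) = \<xi> + hlin \<xi> l \<zeta>"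
  by (simp add: hmul_def hdil_def hlin_def prod_eq_iff algebra_simps sum_distrib_left)

lemma bounded_linear_hlin: "bounded_linear (hlin \<xi> l)"
proof -
  have "linear (hlin \<xi> l)"
    by (rule linearI) (simp_all add: hlin_def algebra_simps sum.distrib sum_distrib_left)
  then show ?thesis by (simp add: linear_conv_bounded_linear)
qed

text \<open>Left invariance and homogeneity of degree one: the shear of \<open>hlin\<close> in the
  \<open>t\<close> direction matches the change of the coefficient of \<open>dt\<close> between the
  two points.\<close>

lemma Z_compose_hlin:
  assumes "F differentiable (at (\<xi> + hlin \<xi> l \<zeta>))"
  shows "Z \<alpha> (\<lambda>\<zeta>. F (\<xi> + hlin \<xi> l \<zeta>)) \<zeta> = of_real l * Z \<alpha> F (\<xi> + hlin \<xi> l \<zeta>)"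
    "Zbar \<alpha> (\<lambda>\<zeta>. F (\<xi> + hlin \<xi> l \<zeta>)) \<zeta> = of_real l * Zbar \<alpha> F (\<xi> + hlin \<xi> l \<zeta>)"
proof -
  let ?\<eta> = "\<xi> + hlin \<xi> l \<zeta>"
  note c = ddir_compose_affine(2)[OF bounded_linear_hlin assms]
  have lin: "linear (\<lambda>v. ddir v F ?\<eta>)" unfolding ddir_def using linear_frechet_derivative[OF assms] .
  have comb: "ddir (r *\<^sub>R v + t *\<^sub>R x) F ?\<eta> = r *\<^sub>R ddir v F ?\<eta> + t *\<^sub>R ddir x F ?\<eta>" for r t v x
    using linear_add[OF lin] linear_cmul[OF lin] by simp
  have s: "(\<Sum>\<beta>\<in>UNIV. fst \<xi> $ \<beta> * cnj (axis \<alpha> z $ \<beta>)) = fst \<xi> $ \<alpha> * cnj z" for z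
  proof -
    have "fst \<xi> $ \<beta> * cnj (axis \<alpha> z $ \<beta>) = (if \<beta> = \<alpha> then fst \<xi> $ \<alpha> * cnj z else 0)" for \<beta>
      by (auto simp: axis_def)
    then show ?thesis by simp
  qed
  have L: "hlin \<xi> l (axis \<alpha> 1, 0) = l *\<^sub>R (axis \<alpha> 1, 0) + (2 * l * Im (fst \<xi> $ \<alpha>)) *\<^sub>R (0, 1)"
    "hlin \<xi> l (axis \<alpha> \<i>, 0) = l *\<^sub>R (axis \<alpha> \<i>, 0) + (- 2 * l * Re (fst \<xi> $ \<alpha>)) *\<^sub>R (0, 1)"
    "hlin \<xi> l (0, 1) = l\<^sup>2 *\<^sub>R (0, 1) + 0 *\<^sub>R (0, 1)"
    unfolding hlin_def fst_conv snd_conv s by (simp_all add: prod_eq_iff)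
  have f: "fst ?\<eta> $ \<alpha> = fst \<xi> $ \<alpha> + of_real l * fst \<zeta> $ \<alpha>" by (simp add: hlin_def) (simp add: scaleR_conv_of_real)
  have z: "fst \<xi> $ \<alpha> = of_real (Re (fst \<xi> $ \<alpha>)) + \<i> * of_real (Im (fst \<xi> $ \<alpha>))" by (simp add: complex_eq_iff)
  show "Z \<alpha> (\<lambda>\<zeta>. F (\<xi> + hlin \<xi> l \<zeta>)) \<zeta> = of_real l * Z \<alpha> F ?\<eta>"
    unfolding Z_ddir c L comb f scaleR_conv_of_real
    by (subst (3) z) (simp add: field_simps power2_eq_square)
  show "Zbar \<alpha> (\<lambda>\<zeta>. F (\<xi> + hlin \<xi> l \<zeta>)) \<zeta> = of_real l * Zbar \<alpha> F ?\<eta>"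
    unfolding Zbar_ddir c L comb f scaleR_conv_of_real
    by (subst (3) z) (simp add: field_simps power2_eq_square)
qed

lemma lap_compose_hlin:
  assumes S: "open S" and T: "smooth_on F T" and sub: "\<And>\<zeta>. \<zeta> \<in> S \<Longrightarrow> \<xi> + hlin \<xi> l \<zeta> \<in> T" and T': "open T" and z: "\<zeta> \<in> S"
  shows "lap (\<lambda>\<zeta>. F (\<xi> + hlin \<xi> l \<zeta>)) \<zeta> = of_real (l\<^sup>2) * lap F (\<xi> + hlin \<xi> l \<zeta>)"
proof -
  have d: "F differentiable (at (\<xi> + hlin \<xi> l x))" if "x \<in> S" for x
    by (rule smooth_on_differentiable[OF T sub[OF that]])
  have d2: "Z \<alpha> F differentiable (at (\<xi> + hlin \<xi> l \<zeta>))" "Zbar \<alpha> F differentiable (at (\<xi> + hlin \<xi> l \<zeta>))" for \<alpha>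
    using smooth_on_differentiable[OF _ sub[OF z]] smooth_on_Z[OF T' T] by blast+
  have d3: "(\<lambda>\<zeta>. Z \<alpha> F (\<xi> + hlin \<xi> l \<zeta>)) differentiable (at \<zeta>)" "(\<lambda>\<zeta>. Zbar \<alpha> F (\<xi> + hlin \<xi> l \<zeta>)) differentiable (at \<zeta>)" for \<alpha>
    using ddir_compose_affine(1)[OF bounded_linear_hlin d2(1)] ddir_compose_affine(1)[OF bounded_linear_hlin d2(2)] by auto
  have "Zbar \<alpha> (Z \<alpha> (\<lambda>\<zeta>. F (\<xi> + hlin \<xi> l \<zeta>))) \<zeta> = Zbar \<alpha> (\<lambda>\<zeta>. of_real l * Z \<alpha> F (\<xi> + hlin \<xi> l \<zeta>)) \<zeta>"
    "Z \<alpha> (Zbar \<alpha> (\<lambda>\<zeta>. F (\<xi> + hlin \<xi> l \<zeta>))) \<zeta> = Z \<alpha> (\<lambda>\<zeta>. of_real l * Zbar \<alpha> F (\<xi> + hlin \<xi> l \<zeta>)) \<zeta>" for \<alpha>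
    by (rule Z_cong[OF S z], rule Z_compose_hlin, rule d, assumption)+
  then have "Zbar \<alpha> (Z \<alpha> (\<lambda>\<zeta>. F (\<xi> + hlin \<xi> l \<zeta>))) \<zeta> = of_real l * (of_real l * Zbar \<alpha> (Z \<alpha> F) (\<xi> + hlin \<xi> l \<zeta>))"
    "Z \<alpha> (Zbar \<alpha> (\<lambda>\<zeta>. F (\<xi> + hlin \<xi> l \<zeta>))) \<zeta> = of_real l * (of_real l * Z \<alpha> (Zbar \<alpha> F) (\<xi> + hlin \<xi> l \<zeta>))" for \<alpha>
    using d2 d3 by (simp_all add: Z_cmult Z_compose_hlin)
  then show ?thesis by (simp add: lap_def sum_distrib_left power2_eq_square algebra_simps)
qed

text \<open>\<open>b = 2 / (q - 1)\<close> is the exponent with \<open>b + 2 = b * q\<close>, so the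
  factor \<open>l^2\<close> produced by two derivatives fits the nonlinearity.\<close>

lemma solution_rescale:
  fixes u :: "'n::finite heis \<Rightarrow> real"
  assumes sol: "solution q T u" and q: "q > 1" and l: "l > 0" and S: "open S"
    and sub: "\<And>\<zeta>. \<zeta> \<in> S \<Longrightarrow> hmul \<xi> (hdil l \<zeta>) \<in> T"
  shows "solution q S (\<lambda>\<zeta>. l powr (2 / (q - 1)) * u (hmul \<xi> (hdil l \<zeta>)))"
proof -
  define b where "b = 2 / (q - 1)"
  have T: "open T" "smooth_on u T" "\<And>\<xi>. \<xi> \<in> T \<Longrightarrow> u \<xi> > 0"
    "\<And>\<xi>. \<xi> \<in> T \<Longrightarrow> lap (\<lambda>\<eta>. complex_of_real (u \<eta>)) \<xi> = - complex_of_real (2 * (real CARD('n))\<^sup>2 * u \<xi> powr q)"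
    using sol by (auto simp: solution_def)
  have sub': "\<xi> + hlin \<xi> l \<zeta> \<in> T" if "\<zeta> \<in> S" for \<zeta> using sub[OF that] by (simp add: hmul_hdil)
  have sU: "smooth_on (\<lambda>\<eta>. complex_of_real (u \<eta>)) T" by (intro smooth_on_of_real T)
  have su: "smooth_on (\<lambda>\<zeta>. u (\<xi> + hlin \<xi> l \<zeta>)) S"
    by (rule smooth_on_compose_affine[OF S bounded_linear_hlin sub' T(2)])
  show ?thesis unfolding solution_def hmul_hdil b_def[symmetric]
  proof (intro conjI ballI)
    show "smooth_on (\<lambda>\<zeta>. l powr b * u (\<xi> + hlin \<xi> l \<zeta>)) S" by (intro smooth_intros S su)
    show "l powr b * u (\<xi> + hlin \<xi> l \<zeta>) > 0" if "\<zeta> \<in> S" for \<zeta> using l T(3)[OF sub'[OF that]] by simp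
    fix \<zeta> assume z: "\<zeta> \<in> S"
    let ?u = "u (\<xi> + hlin \<xi> l \<zeta>)"
    have "lap (\<lambda>\<eta>. complex_of_real (l powr b * u (\<xi> + hlin \<xi> l \<eta>))) \<zeta>
       = of_real (l powr b) * lap (\<lambda>\<eta>. complex_of_real (u (\<xi> + hlin \<xi> l \<eta>))) \<zeta>"
      using lap_cmult[OF S z smooth_on_of_real[OF S su], of "of_real (l powr b)"] by simp
    also have "lap (\<lambda>\<eta>. complex_of_real (u (\<xi> + hlin \<xi> l \<eta>))) \<zeta> = of_real (l\<^sup>2) * lap (\<lambda>\<eta>. complex_of_real (u \<eta>)) (\<xi> + hlin \<xi> l \<zeta>)"
      by (rule lap_compose_hlin[OF S sU sub' T(1) z])
    also have "lap (\<lambda>\<eta>. complex_of_real (u \<eta>)) (\<xi> + hlin \<xi> l \<zeta>) = - complex_of_real (2 * (real CARD('n))\<^sup>2 * ?u powr q)"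
      by (rule T(4)[OF sub'[OF z]])
    also have "of_real (l powr b) * (of_real (l\<^sup>2) * - complex_of_real (2 * (real CARD('n))\<^sup>2 * ?u powr q))
       = - complex_of_real (2 * (real CARD('n))\<^sup>2 * (l powr b * l\<^sup>2 * ?u powr q))" by simp
    also have "l powr b * l\<^sup>2 * ?u powr q = (l powr b * ?u) powr q"
    proof -
      have "l\<^sup>2 = l powr 2" using powr_realpow[of l 2] l by simp
      moreover have "b + 2 = b * q" using q by (simp add: b_def field_simps)
      ultimately show ?thesis using l T(3)[OF sub'[OF z]] by (simp add: powr_mult powr_powr powr_add[symmetric] del: powr_numeral)
    qed
    finally show "lap (\<lambda>\<eta>. complex_of_real (l powr b * u (\<xi> + hlin \<xi> l \<eta>))) \<zeta>
       = - complex_of_real (2 * (real CARD('n))\<^sup>2 * (l powr b * ?u) powr q)" .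
  qed (rule S)
qed

section \<open>Blow-up\<close>

text \<open>
  \<open>v + \<kappa> |z|\<^sup>2\<close> is subharmonic for a \<open>\<kappa>\<close> of the order of \<open>m powr q\<close>; since \<open>q > 1\<close>, the correction contributes
  at most \<open>m / 4\<close> to the mean value inequality when \<open>m\<close> is small.
\<close>

lemma no_blowup_profile:
  fixes q :: real
  assumes q: "1 < q" "q < 1 + 2 / real CARD('n::finite)"
  shows "\<exists>R\<ge>4. \<exists>m>0. \<forall>S (v :: 'n heis \<Rightarrow> real). solution q S v \<longrightarrow> {\<xi>. hq 0 \<xi> \<le> R ^ 4} \<subseteq> S \<longrightarrow>
     (\<forall>\<xi>. hq 0 \<xi> < 16 \<longrightarrow> v \<xi> \<le> 2 powr (2 / (q - 1)) * m) \<longrightarrow> v 0 \<noteq> m"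
proof -
  define n where "n = real CARD('n)"
  have n: "n \<ge> 1" by (simp add: n_def Suc_leI)
  define b where "b = 2 / (q - 1)"
  define \<mu> where "\<mu> = 3 * q - 1 - 2 / n"
  have mu: "\<mu> > 0"
  proof -
    have "2 / n \<le> 2" using n by (simp add: field_simps)
    moreover have "2 / n > q - 1" using q(2) by (simp add: n_def)
    moreover have "3 * q - 1 - 2 / n > 0 \<longleftrightarrow> 2 / n < 3 * q - 1" by linarith
    ultimately show ?thesis unfolding \<mu>_def using q by linarith
  qed
  obtain \<tau> s C where C: "C > 0" and tau: "\<tau> > 2 * n + 2" and est: "\<And>S (u :: 'n heis \<Rightarrow> real) R. solution q S u \<Longrightarrow> R > 0 \<Longrightarrow> {\<xi>. hq 0 \<xi> \<le> R ^ 4} \<subseteq> S \<Longrightarrow>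
     (LINT \<xi>:{\<xi>. hq 0 \<xi> < R ^ 4}|lborel. (1 - hq 0 \<xi> / R ^ 4) ^ s * u \<xi> powr \<mu>) \<le> C * R powr (2 * n + 2 - \<tau>)"
    using solution_integral_estimate[OF q] unfolding n_def \<mu>_def by blast
  obtain CM where CM: "CM > 0" and mv: "\<And>S (v :: 'n heis \<Rightarrow> real). open S \<Longrightarrow> {\<xi>. hq 0 \<xi> \<le> 1} \<subseteq> S \<Longrightarrow> smooth_on v S \<Longrightarrow>
     \<forall>\<xi>\<in>S. v \<xi> \<ge> 0 \<Longrightarrow> \<forall>\<xi>\<in>S. Re (lap (\<lambda>x. complex_of_real (v x)) \<xi>) \<ge> 0 \<Longrightarrow>
     v 0 \<le> CM * (LINT \<xi>:{\<xi>. hq 0 \<xi> < 1}|lborel. v \<xi>)"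
    using sub_mean_value[where 'n='n] by metis
  define vB :: real where "vB = 2 ^ (2 * CARD('n)) * 2"
  have vB: "vB > 0" by (simp add: vB_def)
  \<comment> \<open>The solution of
    \<open>CM * (n * (2 powr b * m) powr q) * vB = m / 4\<close>.\<close>
  define m where "m = (1 / (4 * n * 2 powr (b * q) * CM * vB)) powr (1 / (q - 1))"
  have m: "m > 0" using n CM vB by (simp add: m_def)
  define K where "K = 2 powr b * m"
  have K: "K > 0" using m by (simp add: K_def)
  define \<kappa> where "\<kappa> = n * K powr q"
  have kap: "\<kappa> > 0" using n K by (simp add: \<kappa>_def)
  have small: "CM * (\<kappa> * vB) = m / 4"
  proof -
    have "m powr (q - 1) = 1 / (4 * n * 2 powr (b * q) * CM * vB)"
      using q n CM vB by (simp add: m_def powr_powr)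
    moreover have "m powr q = m * m powr (q - 1)" using m powr_add[of m 1 "q - 1"] by simp
    ultimately have "m powr q = m / (4 * n * 2 powr (b * q) * CM * vB)" by simp
    moreover have "K powr q = 2 powr (b * q) * m powr q" using m by (simp add: K_def powr_mult powr_powr)
    ultimately show ?thesis using n CM vB by (simp add: \<kappa>_def)
  qed
  \<comment> \<open>Values of \<open>v\<close> up to \<open>\<delta>\<close> contribute at most
    \<open>m / 4\<close> to the mean value inequality, so together with the correction by
    \<open>\<kappa>\<close> half of \<open>m\<close> is left over.\<close>
  define \<delta> where "\<delta> = m / (4 * CM * vB)"
  have del: "\<delta> > 0" using m CM vB by (simp add: \<delta>_def)
  \<comment> \<open>The lower bound that this remaining half forces on the integral of
    \<open>v powr \<mu>\<close> over the unit ball.\<close>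
  define c4 where "c4 = m / (2 * CM * (K * \<delta> powr (- \<mu>)))"
  have c4: "c4 > 0" using m CM K del by (simp add: c4_def)
  \<comment> \<open>\<open>\<tau>\<close> exceeds the homogeneous dimension, so the integral
    estimate decays in \<open>R\<close>; the factor \<open>2 ^ s\<close> allows for the cutoff on
    the unit ball.\<close>
  have "((\<lambda>R. 2 ^ s * (C * R powr (2 * n + 2 - \<tau>))) \<longlongrightarrow> 2 ^ s * (C * 0)) at_top"
    by (intro tendsto_mult tendsto_const tendsto_neg_powr filterlim_ident) (use tau in auto)
  then have "\<forall>\<^sub>F R in at_top. 2 ^ s * (C * R powr (2 * n + 2 - \<tau>)) < c4"
    using c4 by (intro order_tendstoD(2)[of _ 0]) auto
  then obtain R where R: "R \<ge> 4" "2 ^ s * (C * R powr (2 * n + 2 - \<tau>)) < c4"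
    using eventually_happens'[OF _ eventually_conj[OF eventually_ge_at_top[of 4]]] by (metis (no_types, lifting) trivial_limit_at_top_linorder)
  show ?thesis
  proof (rule exI[of _ R], intro conjI, rule R(1), rule exI[of _ m], intro conjI allI impI notI, rule m)
    fix S and v :: "'n heis \<Rightarrow> real"
    assume sol: "solution q S v" and sub: "{\<xi>. hq 0 \<xi> \<le> R ^ 4} \<subseteq> S"
      and bd: "\<forall>\<xi>. hq 0 \<xi> < 16 \<longrightarrow> v \<xi> \<le> 2 powr (2 / (q - 1)) * m" and v0: "v 0 = m"
    have R4: "R ^ 4 \<ge> 16"
    proof -
      have "(4::real) ^ 4 \<le> R ^ 4" using R(1) by (intro power_mono) auto
      then show ?thesis by simp
    qed
    have vS: "open S" "smooth_on v S" "\<And>\<xi>. \<xi> \<in> S \<Longrightarrow> v \<xi> > 0"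
      "\<And>\<xi>. \<xi> \<in> S \<Longrightarrow> lap (\<lambda>\<eta>. complex_of_real (v \<eta>)) \<xi> = - complex_of_real (2 * n\<^sup>2 * v \<xi> powr q)"
      using sol by (auto simp: solution_def n_def)
    have vK: "v \<xi> \<le> K" if "hq 0 \<xi> < 16" for \<xi> using bd[rule_format, OF that] by (simp add: K_def b_def)
    define S' where "S' = S \<inter> {\<xi>. hq 0 \<xi> < 16}"
    have S': "open S'" unfolding S'_def
      by (intro open_Int vS(1) open_Collect_less continuous_on_hq continuous_on_const)
    have B1: "{\<xi>::'n heis. hq 0 \<xi> \<le> 1} \<subseteq> S'" using sub R4 by (auto simp: S'_def)
    let ?B = "{\<xi>::'n heis. hq 0 \<xi> < 1}"
    have BS: "?B \<subseteq> S'" using B1 by (auto simp: less_imp_le)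
    define w where "w \<xi> = v \<xi> + \<kappa> * zsq \<xi>" for \<xi>
    have sv': "smooth_on v S'" by (rule smooth_on_subset[OF vS(2)]) (simp add: S'_def)
    have sz': "smooth_on zsq S'" by (rule smooth_on_subset[OF smooth_on_zsq]) simp
    have sw: "smooth_on w S'" unfolding w_def[abs_def] by (intro smooth_intros S' sv' sz')
    have measB: "?B \<in> sets lborel" by (auto intro!: borel_open open_Collect_less continuous_on_hq continuous_intros)
    have int: "set_integrable lborel ?B f" if "continuous_on S' f" for f :: "'n heis \<Rightarrow> real"
    proof (rule set_integrable_subset[OF _ measB])
      show "set_integrable lborel {\<xi>. hq 0 \<xi> \<le> 1} f" unfolding set_integrable_def
        using compact_hq[of 0 1] by (intro borel_integrable_compact continuous_on_subset[OF that B1]) simp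
    qed auto
    have volB: "(LINT \<xi>:?B|lborel. f \<xi>) \<le> x * vB" if "continuous_on S' f" "x \<ge> 0" "\<And>\<xi>. hq 0 \<xi> < 1 \<Longrightarrow> f \<xi> \<le> x" for f x
      using integral_le_volume[of 1 x f] int[OF that(1)] that(2,3) by (simp add: vB_def)
    have "w 0 \<le> CM * (LINT \<xi>:?B|lborel. w \<xi>)"
    proof (rule mv[OF S' B1 sw])
      show "\<forall>\<xi>\<in>S'. 0 \<le> w \<xi>"
      proof
        fix \<xi> assume "\<xi> \<in> S'"
        then have "v \<xi> > 0" using vS(3) by (simp add: S'_def)
        then show "0 \<le> w \<xi>" unfolding w_def using kap zsq_nonneg[of \<xi>] by (intro add_nonneg_nonneg mult_nonneg_nonneg) simp_all
      qed
      show "\<forall>\<xi>\<in>S'. 0 \<le> Re (lap (\<lambda>x. complex_of_real (w x)) \<xi>)"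
      proof
        fix \<xi> assume xi: "\<xi> \<in> S'"
        have "lap (\<lambda>x. complex_of_real (w x)) \<xi> = lap (\<lambda>x. complex_of_real (v x) + of_real \<kappa> * complex_of_real (zsq x)) \<xi>"
          by (simp add: w_def)
        also have "\<dots> = lap (\<lambda>x. complex_of_real (v x)) \<xi> + of_real \<kappa> * lap (\<lambda>x. complex_of_real (zsq x)) \<xi>"
          by (subst lap_add[OF S' xi], (intro smooth_intros S' sv' sz')+, subst lap_cmult[OF S' xi], intro smooth_intros S' sz', rule refl)
        finally have "Re (lap (\<lambda>x. complex_of_real (w x)) \<xi>) = 2 * n * \<kappa> - 2 * n\<^sup>2 * v \<xi> powr q"
          using vS(4) xi by (simp add: lap_zsq S'_def n_def)
        moreover have "v \<xi> powr q \<le> K powr q"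
          using xi vK vS(3) q by (intro powr_mono2) (auto simp: S'_def less_imp_le)
        then have "2 * n\<^sup>2 * v \<xi> powr q \<le> 2 * n\<^sup>2 * K powr q" by (intro mult_left_mono) auto
        moreover have "2 * n\<^sup>2 * K powr q = 2 * n * \<kappa>" by (simp add: \<kappa>_def power2_eq_square)
        ultimately show "0 \<le> Re (lap (\<lambda>x. complex_of_real (w x)) \<xi>)" by linarith
      qed
    qed
    moreover have "w 0 = m" by (simp add: w_def v0 zsq_def)
    ultimately have m_le: "m \<le> CM * (LINT \<xi>:?B|lborel. w \<xi>)" by simp
    have cv: "continuous_on S' v" "continuous_on S' zsq" using sv' sz' smooth_on_continuous by blast+
    have cvm: "continuous_on S' (\<lambda>\<xi>. v \<xi> powr \<mu>)"
      by (intro continuous_on_powr' cv continuous_on_const) (use vS(3) mu in \<open>auto simp: S'_def less_imp_le\<close>)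
    \<comment> \<open>Where \<open>v\<close> exceeds \<open>\<delta>\<close>, use
      \<open>v \<le> K\<close> and \<open>(v / \<delta>) powr \<mu> \<ge> 1\<close>.\<close>
    have w_split: "w \<xi> \<le> \<delta> + K * \<delta> powr (- \<mu>) * v \<xi> powr \<mu> + \<kappa>" if "\<xi> \<in> ?B" for \<xi>
    proof -
      have "zsq \<xi> \<le> 1" using hq_bounds(1)[of 0 \<xi> 1] that by simp
      then have "\<kappa> * zsq \<xi> \<le> \<kappa> * 1" using kap by (intro mult_left_mono) auto
      moreover have "v \<xi> \<le> \<delta> + K * \<delta> powr (- \<mu>) * v \<xi> powr \<mu>"
      proof (cases "v \<xi> \<le> \<delta>")
        case True
        moreover have "K * \<delta> powr (- \<mu>) * v \<xi> powr \<mu> \<ge> 0" using K by simp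
        ultimately show ?thesis by linarith
      next
        case False
        have "\<delta> powr \<mu> \<le> v \<xi> powr \<mu>" using False del mu by (intro powr_mono2) auto
        then have "K * \<delta> powr (- \<mu>) * \<delta> powr \<mu> \<le> K * \<delta> powr (- \<mu>) * v \<xi> powr \<mu>" using K by (intro mult_left_mono) auto
        moreover have "K * \<delta> powr (- \<mu>) * \<delta> powr \<mu> = K" using del by (simp add: powr_minus)
        moreover have "v \<xi> \<le> K" using vK that by auto
        ultimately show ?thesis using del by linarith
      qed
      ultimately show ?thesis unfolding w_def by linarith
    qed
    have "(LINT \<xi>:?B|lborel. w \<xi>) \<le> (LINT \<xi>:?B|lborel. (\<delta> + \<kappa>) + K * \<delta> powr (- \<mu>) * v \<xi> powr \<mu>)"
    proof (rule set_integral_mono)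
      show "set_integrable lborel ?B w" by (rule int[OF smooth_on_continuous[OF sw]])
      show "set_integrable lborel ?B (\<lambda>\<xi>. (\<delta> + \<kappa>) + K * \<delta> powr (- \<mu>) * v \<xi> powr \<mu>)"
        by (rule int) (intro continuous_intros cvm)
    qed (use w_split in force)
    also have "\<dots> = (LINT \<xi>:?B|lborel. (\<delta> + \<kappa>)) + K * \<delta> powr (- \<mu>) * (LINT \<xi>:?B|lborel. v \<xi> powr \<mu>)"
    proof -
      have i1: "set_integrable lborel ?B (\<lambda>\<xi>. \<delta> + \<kappa>)" by (rule int) simp
      have i2: "set_integrable lborel ?B (\<lambda>\<xi>. K * \<delta> powr (- \<mu>) * v \<xi> powr \<mu>)" by (rule int) (intro continuous_intros cvm)
      show ?thesis unfolding set_integral_add(2)[OF i1 i2] by simp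
    qed
    also have "(LINT \<xi>:?B|lborel. (\<delta> + \<kappa>)) \<le> (\<delta> + \<kappa>) * vB"
      by (rule volB) (use del kap in auto)
    finally have "(LINT \<xi>:?B|lborel. w \<xi>) \<le> (\<delta> + \<kappa>) * vB + K * \<delta> powr (- \<mu>) * (LINT \<xi>:?B|lborel. v \<xi> powr \<mu>)"
      by simp
    then have "CM * (LINT \<xi>:?B|lborel. w \<xi>) \<le> CM * ((\<delta> + \<kappa>) * vB + K * \<delta> powr (- \<mu>) * (LINT \<xi>:?B|lborel. v \<xi> powr \<mu>))"
      using CM by (intro mult_left_mono) auto
    also have "\<dots> = CM * (\<delta> * vB) + CM * (\<kappa> * vB) + CM * (K * \<delta> powr (- \<mu>)) * (LINT \<xi>:?B|lborel. v \<xi> powr \<mu>)"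
      by (simp add: algebra_simps)
    also have "CM * (\<delta> * vB) = m / 4" using CM vB by (simp add: \<delta>_def)
    finally have "m / 2 \<le> CM * (K * \<delta> powr (- \<mu>)) * (LINT \<xi>:?B|lborel. v \<xi> powr \<mu>)"
      using m_le small by simp
    then have c4_le: "c4 \<le> (LINT \<xi>:?B|lborel. v \<xi> powr \<mu>)"
      using CM K del by (simp add: c4_def field_simps)
    let ?T = "{\<xi>::'n heis. hq 0 \<xi> < R ^ 4}"
    let ?g = "\<lambda>\<xi>. (1 - hq 0 \<xi> / R ^ 4) ^ s * v \<xi> powr \<mu>"
    have cg: "continuous_on S ?g"
    proof -
      have "continuous_on S (\<lambda>\<xi>. v \<xi> powr \<mu>)"
        by (intro continuous_on_powr' smooth_on_continuous[OF vS(2)] continuous_on_const) (use vS(3) mu in \<open>auto simp: less_imp_le\<close>)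
      then show ?thesis
        by (intro continuous_on_mult continuous_on_power continuous_on_diff continuous_on_divide continuous_on_const continuous_on_hq)
           (use R in auto)
    qed
    have intT: "set_integrable lborel ?T ?g"
    proof (rule set_integrable_subset)
      show "set_integrable lborel {\<xi>. hq 0 \<xi> \<le> R ^ 4} ?g" unfolding set_integrable_def
        using compact_hq[of 0 R] R by (intro borel_integrable_compact continuous_on_subset[OF cg sub]) auto
      show "?T \<in> sets lborel" by (auto intro!: borel_open open_Collect_less continuous_on_hq continuous_intros)
    qed auto
    have "(LINT \<xi>:?B|lborel. v \<xi> powr \<mu>) \<le> (LINT \<xi>:?T|lborel. 2 ^ s * ?g \<xi>)"
      unfolding set_lebesgue_integral_def
    proof (rule integral_mono)
      show "integrable lborel (\<lambda>\<xi>. indicator ?B \<xi> *\<^sub>R v \<xi> powr \<mu>)" using int[OF cvm] by (simp add: set_integrable_def)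
      have "set_integrable lborel ?T (\<lambda>\<xi>. 2 ^ s * ?g \<xi>)" using intT by (intro set_integrable_mult_right) auto
      then show "integrable lborel (\<lambda>\<xi>. indicator ?T \<xi> *\<^sub>R (2 ^ s * ?g \<xi>))" by (simp add: set_integrable_def)
      fix \<xi> :: "'n heis"
      show "indicator ?B \<xi> *\<^sub>R v \<xi> powr \<mu> \<le> indicator ?T \<xi> *\<^sub>R (2 ^ s * ?g \<xi>)"
      proof (cases "hq 0 \<xi> < 1")
        case True
        \<comment> \<open>Since \<open>R \<ge> 4\<close>, the cutoff is at least
          \<open>15 / 16\<close> on the unit ball, in particular at least one half.\<close>
        then have "hq 0 \<xi> / R ^ 4 \<le> 1 / 16" using R4 hq_nonneg[of 0 \<xi>] by (intro frac_le) auto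
        moreover have "x \<le> 1 / 16 \<Longrightarrow> 1 \<le> 2 * (1 - x)" for x :: real by simp
        ultimately have "1 \<le> 2 * (1 - hq 0 \<xi> / R ^ 4)" by blast
        then have "1 \<le> (2 * (1 - hq 0 \<xi> / R ^ 4)) ^ s" by (rule one_le_power)
        then have "1 * v \<xi> powr \<mu> \<le> (2 * (1 - hq 0 \<xi> / R ^ 4)) ^ s * v \<xi> powr \<mu>" by (intro mult_right_mono) auto
        then show ?thesis using True R4 unfolding power_mult_distrib by (simp add: mult.assoc)
      next
        case False
        have "0 \<le> ?g \<xi>" if "hq 0 \<xi> < R ^ 4"
        proof -
          have "hq 0 \<xi> / R ^ 4 \<le> 1" using that R by (simp add: field_simps)
          then show ?thesis by simp
        qed
        then show ?thesis using False by (simp add: indicator_def)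
      qed
    qed
    also have "\<dots> = 2 ^ s * (LINT \<xi>:?T|lborel. ?g \<xi>)" by simp
    also have "\<dots> \<le> 2 ^ s * (C * R powr (2 * n + 2 - \<tau>))"
      using est[OF sol _ sub] R(1) by (intro mult_left_mono) auto
    also have "\<dots> < c4" by (rule R(2))
    finally show False using c4_le by simp
  qed
qed

section \<open>Choice of the blow-up point\<close>

theorem theorem1p2:
  fixes n :: nat and Q qstar q :: real
  assumes "n = CARD('n::finite)"
    and "Q = 2 * real n + 2"
    and "qstar = (Q + 2) / (Q - 2)"
    and "1 < q" and "q < qstar"
  shows "\<exists>C>0. \<forall>u :: 'n heis \<Rightarrow> real.
           smooth_on u (heis_unit_ball - {0}) \<longrightarrow>
           (\<forall>\<xi> \<in> heis_unit_ball - {0}. u \<xi> > 0) \<longrightarrow>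
           (\<forall>\<xi> \<in> heis_unit_ball - {0}.
              - heis_laplacian u \<xi> = complex_of_real (2 * (real n)\<^sup>2 * u \<xi> powr q)) \<longrightarrow>
           (\<forall>\<^sub>F \<xi> in at 0. u \<xi> \<le> C * heis_norm \<xi> powr (- 2 / (q - 1)))"
proof -
  have n1: "real CARD('n) \<ge> 1" by (simp add: Suc_leI)
  have "qstar = 1 + 2 / real CARD('n)" unfolding assms(1-3) using n1 by (simp add: field_simps)
  then have q2: "q < 1 + 2 / real CARD('n)" using assms(5) by simp
  define b where "b = 2 / (q - 1)"
  have b: "b > 0" using assms(4) by (simp add: b_def)
  obtain R m where R: "R \<ge> 4" and m: "m > 0" and profile: "\<And>S (v :: 'n heis \<Rightarrow> real). solution q S v \<Longrightarrow>
     {\<xi>. hq 0 \<xi> \<le> R ^ 4} \<subseteq> S \<Longrightarrow> \<forall>\<xi>. hq 0 \<xi> < 16 \<longrightarrow> v \<xi> \<le> 2 powr b * m \<Longrightarrow> v 0 \<noteq> m"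
    using no_blowup_profile[OF assms(4) q2] unfolding b_def by blast
  \<comment> \<open>The factor \<open>2 powr b\<close> compensates
    \<open>\<rho> = |\<xi>| / 2\<close>, so a violation of the bound at \<open>\<xi>\<close> means
    \<open>\<rho> powr b * u \<xi> > m * R powr b\<close>.\<close>
  define C where "C = 2 powr b * (m * R powr b)"
  have C: "C > 0" using m R by (simp add: C_def)
  let ?T = "heis_unit_ball - {0} :: 'n heis set"
  have main: "u \<xi> \<le> C * heis_norm \<xi> powr (- b)"
    if sol: "solution q ?T u" and xi: "\<xi> \<noteq> 0" "heis_norm \<xi> < 1 / 2" for u :: "'n heis \<Rightarrow> real" and \<xi>
  proof (rule ccontr)
    assume contra: "\<not> u \<xi> \<le> C * heis_norm \<xi> powr (- b)"
    \<comment> \<open>Points within \<open>\<rho>\<close> of \<open>\<xi>\<close> have norm at least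
      \<open>\<rho> > 0\<close> and at most \<open>3 * \<rho> < 1\<close>, so the whole ball lies in
      the punctured unit ball.\<close>
    define \<rho> where "\<rho> = heis_norm \<xi> / 2"
    have rho: "\<rho> > 0"
    proof -
      have "heis_norm \<xi> \<noteq> 0"
      proof
        assume "heis_norm \<xi> = 0"
        then have "hq 0 \<xi> \<le> 0 ^ 4" using heis_norm_pow4[of \<xi>] by simp
        then have "zsq \<xi> + 0 \<le> 0\<^sup>2" "\<bar>snd \<xi>\<bar> \<le> 0\<^sup>2" using hq_bounds[of 0 \<xi> 0] by auto
        then have "fst \<xi> = 0" "snd \<xi> = 0" by (auto simp: zsq_norm)
        then show False using xi(1) by (simp add: prod_eq_iff)
      qed
      then show ?thesis using heis_norm_nonneg[of \<xi>] by (simp add: \<rho>_def)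
    qed
    have inT: "hmul \<xi> \<eta> \<in> ?T" if "heis_norm \<eta> \<le> \<rho>" for \<eta>
    proof -
      have "heis_norm (hmul \<xi> \<eta>) > 0"
        using heis_norm_reverse_triangle[of \<xi> \<eta>] that rho by (simp add: \<rho>_def)
      then have "hmul \<xi> \<eta> \<noteq> 0" by auto
      moreover have "heis_norm (hmul \<xi> \<eta>) < 1"
        using heis_norm_triangle[of \<xi> \<eta>] that xi(2) by (simp add: \<rho>_def)
      ultimately show ?thesis by (simp add: heis_unit_ball_def)
    qed
    have solT: "open ?T" "smooth_on u ?T" "\<And>\<eta>. \<eta> \<in> ?T \<Longrightarrow> u \<eta> > 0" using sol by (auto simp: solution_def)
    \<comment> \<open>The first factor vanishes on the boundary sphere. A maximum therefore has room
      \<open>d\<close> around it, and within \<open>d / 2\<close> of it \<open>u\<close> exceeds its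
      value there by a factor of at most \<open>2 powr b\<close>.\<close>
    define F where "F \<eta> = (\<rho> - heis_norm \<eta>) powr b * u (hmul \<xi> \<eta>)" for \<eta>
    define D where "D = {\<eta>::'n heis. hq 0 \<eta> \<le> \<rho> ^ 4}"
    have D: "\<eta> \<in> D \<longleftrightarrow> heis_norm \<eta> \<le> \<rho>" for \<eta> using heis_norm_le_iff[of \<rho> \<eta>] rho by (simp add: D_def)
    have "compact D" unfolding D_def using compact_hq[of 0 \<rho>] rho by simp
    moreover have "0 \<in> D" using D rho by simp
    moreover have "continuous_on D F"
    proof -
      have cm: "continuous_on D (hmul \<xi>)"
      proof -
        have "hmul \<xi> = (\<lambda>\<eta>. \<xi> + hlin \<xi> 1 \<eta>)"
          by (rule ext) (simp add: hmul_def hlin_def prod_eq_iff)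
        then show ?thesis by (simp add: continuous_on_add linear_continuous_on[OF bounded_linear_hlin])
      qed
      have "continuous_on D (\<lambda>\<eta>. u (hmul \<xi> \<eta>))"
        by (rule continuous_on_compose2[OF smooth_on_continuous[OF solT(2)] cm]) (rule image_subsetI, rule inT, simp add: D)
      moreover have "continuous_on D (\<lambda>\<eta>. (\<rho> - heis_norm \<eta>) powr b)"
        by (rule continuous_on_powr'[OF continuous_on_diff[OF continuous_on_const continuous_on_heis_norm] continuous_on_const])
           (simp add: D b)
      ultimately show ?thesis unfolding F_def by (intro continuous_on_mult)
    qed
    ultimately obtain \<eta>1 where \<eta>1: "\<eta>1 \<in> D" "\<And>\<eta>. \<eta> \<in> D \<Longrightarrow> F \<eta> \<le> F \<eta>1"
      using continuous_attains_sup[of D F] by blast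
    define \<xi>1 where "\<xi>1 = hmul \<xi> \<eta>1"
    define d where "d = \<rho> - heis_norm \<eta>1"
    define M where "M = u \<xi>1"
    have M: "M > 0" unfolding M_def \<xi>1_def using solT(3) inT \<eta>1(1) D by blast
    have big: "m * R powr b < d powr b * M"
    proof -
      have h: "heis_norm \<xi> > 0" using rho by (simp add: \<rho>_def)
      have "C * heis_norm \<xi> powr (- b) < u \<xi>" using contra by simp
      then have "\<rho> powr b * (C * heis_norm \<xi> powr (- b)) < \<rho> powr b * u \<xi>" using rho by simp
      moreover have "\<rho> powr b * (C * heis_norm \<xi> powr (- b)) = m * R powr b"
        using h by (simp add: \<rho>_def C_def powr_divide powr_minus field_simps)
      moreover have "\<rho> powr b * u \<xi> = F 0" by (simp add: F_def)
      moreover have "F 0 \<le> F \<eta>1" using \<eta>1(2) \<open>0 \<in> D\<close> by blast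
      moreover have "F \<eta>1 = d powr b * M" by (simp add: F_def d_def M_def \<xi>1_def)
      ultimately show ?thesis by simp
    qed
    have d: "d > 0"
    proof -
      have "d \<noteq> 0"
      proof
        assume "d = 0"
        moreover have "m * R powr b \<ge> 0" using m by simp
        ultimately show False using big by simp
      qed
      moreover have "d \<ge> 0" using \<eta>1(1) D by (simp add: d_def)
      ultimately show ?thesis by simp
    qed
    \<comment> \<open>The scale at which the rescaled solution takes the value \<open>m\<close> at
      the origin; \<open>big\<close> then says that \<open>l * R < d\<close>.\<close>
    define l where "l = (m / M) powr (1 / b)"
    have l: "l > 0" using m M by (simp add: l_def)
    have lb: "l powr b * M = m" using m M b by (simp add: l_def powr_powr)
    have lR: "l * R < d"
    proof -
      have "(l * R) powr b * M = m * R powr b" using l R lb by (simp add: powr_mult mult_ac)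
      then have "(l * R) powr b < d powr b" using big M by (simp add: mult_less_cancel_right_disj flip: \<open>(l * R) powr b * M = m * R powr b\<close>)
      then show ?thesis using b d l R by (meson less_imp_le mult_nonneg_nonneg not_le order_trans powr_mono2 zero_le_numeral)
    qed
    define S where "S = {\<zeta>::'n heis. l * heis_norm \<zeta> < d}"
    have S: "open S" unfolding S_def
      by (intro open_Collect_less continuous_on_mult continuous_on_const continuous_on_heis_norm)
    define v where "v \<zeta> = l powr b * u (hmul \<xi>1 (hdil l \<zeta>))" for \<zeta>
    have near: "heis_norm (hmul \<eta>1 (hdil l \<zeta>)) \<le> heis_norm \<eta>1 + l * heis_norm \<zeta>" for \<zeta>
      using heis_norm_triangle[of \<eta>1 "hdil l \<zeta>"] l by (simp add: heis_norm_dil)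
    have as: "hmul \<xi>1 (hdil l \<zeta>) = hmul \<xi> (hmul \<eta>1 (hdil l \<zeta>))" for \<zeta> by (simp add: \<xi>1_def hmul_assoc)
    have "solution q S v" unfolding v_def[abs_def] b_def
    proof (rule solution_rescale[OF sol assms(4) l S])
      fix \<zeta> assume "\<zeta> \<in> S"
      then show "hmul \<xi>1 (hdil l \<zeta>) \<in> ?T" unfolding as using near[of \<zeta>] by (intro inT) (simp add: S_def d_def)
    qed
    moreover have "{\<zeta>. hq 0 \<zeta> \<le> R ^ 4} \<subseteq> S"
    proof
      fix \<zeta> :: "'n heis" assume "\<zeta> \<in> {\<zeta>. hq 0 \<zeta> \<le> R ^ 4}"
      then have "heis_norm \<zeta> \<le> R" using heis_norm_le_iff[of R \<zeta>] R by simp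
      then have "l * heis_norm \<zeta> \<le> l * R" using l by simp
      then show "\<zeta> \<in> S" using lR by (simp add: S_def)
    qed
    moreover have "\<forall>\<zeta>. hq 0 \<zeta> < 16 \<longrightarrow> v \<zeta> \<le> 2 powr b * m"
    proof (intro allI impI)
      fix \<zeta> :: "'n heis" assume "hq 0 \<zeta> < 16"
      then have z2: "heis_norm \<zeta> < 2" using heis_norm_less_iff[of 2 \<zeta>] by simp
      let ?\<eta> = "hmul \<eta>1 (hdil l \<zeta>)"
      have "l * heis_norm \<zeta> \<le> l * 2" using z2 l by simp
      moreover have "l * 4 \<le> l * R" using R l by simp
      \<comment> \<open>Here \<open>R \<ge> 4\<close> is used: a point \<open>\<zeta>\<close> of
        norm below 2 is moved by at most \<open>d / 2\<close>, so the maximality of \<open>F\<close>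
        applies with weight at least \<open>d / 2\<close>.\<close>
      ultimately have le: "l * heis_norm \<zeta> \<le> d / 2" using lR by linarith
      then have dist: "\<rho> - heis_norm ?\<eta> \<ge> d / 2" using near[of \<zeta>] by (simp add: d_def)
      then have "?\<eta> \<in> D" using D d by simp
      then have "F ?\<eta> \<le> F \<eta>1" by (rule \<eta>1(2))
      moreover have "(d / 2) powr b * u (hmul \<xi> ?\<eta>) \<le> F ?\<eta>"
        unfolding F_def using dist d b solT(3)[OF inT[OF D[THEN iffD1, OF \<open>?\<eta> \<in> D\<close>]]]
        by (intro mult_right_mono powr_mono2) simp_all
      moreover have "F \<eta>1 = d powr b * M" by (simp add: F_def d_def M_def \<xi>1_def)
      ultimately have "(d / 2) powr b * u (hmul \<xi> ?\<eta>) \<le> d powr b * M" by linarith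
      then have "u (hmul \<xi> ?\<eta>) \<le> 2 powr b * M" using d by (simp add: powr_divide field_simps)
      then have "l powr b * u (hmul \<xi> ?\<eta>) \<le> l powr b * (2 powr b * M)" by (intro mult_left_mono) auto
      also have "\<dots> = 2 powr b * m" using lb by (simp add: mult_ac)
      finally show "v \<zeta> \<le> 2 powr b * m" by (simp add: v_def as)
    qed
    moreover have "v 0 = m" using lb by (simp add: v_def M_def)
    ultimately show False using profile by blast
  qed
  show ?thesis
  proof (rule exI[of _ C], intro conjI allI impI, rule C)
    fix u :: "'n heis \<Rightarrow> real"
    assume sm: "smooth_on u ?T" and pos: "\<forall>\<xi>\<in>?T. 0 < u \<xi>"
      and eq: "\<forall>\<xi>\<in>?T. - heis_laplacian u \<xi> = complex_of_real (2 * (real n)\<^sup>2 * u \<xi> powr q)"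
    have ob: "open {\<xi>::'n heis. heis_norm \<xi> < x}" for x
      by (intro open_Collect_less continuous_on_const continuous_on_heis_norm)
    have "open ?T" unfolding heis_unit_ball_def using ob by (intro open_Diff) auto
    moreover have "lap (\<lambda>\<eta>. complex_of_real (u \<eta>)) \<xi> = - complex_of_real (2 * (real CARD('n))\<^sup>2 * u \<xi> powr q)" if "\<xi> \<in> ?T" for \<xi>
    proof -
      have "- lap (\<lambda>\<eta>. complex_of_real (u \<eta>)) \<xi> = complex_of_real (2 * (real CARD('n))\<^sup>2 * u \<xi> powr q)"
        using eq that unfolding heis_laplacian_lap assms(1) by blast
      then show ?thesis by (metis minus_minus)
    qed
    ultimately have sol: "solution q ?T u" using sm pos by (simp add: solution_def)
    have "\<forall>\<^sub>F \<xi> in at (0::'n heis). heis_norm \<xi> < 1 / 2"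
      using ob[of "1/2"] by (auto simp: eventually_at_topological intro!: exI[of _ "{\<xi>. heis_norm \<xi> < 1 / 2}"])
    moreover have "\<forall>\<^sub>F \<xi> in at (0::'n heis). \<xi> \<noteq> 0" by (simp add: eventually_at_filter)
    ultimately have "\<forall>\<^sub>F \<xi> in at 0. u \<xi> \<le> C * heis_norm \<xi> powr (- b)"
      by eventually_elim (rule main[OF sol])
    then show "\<forall>\<^sub>F \<xi> in at 0. u \<xi> \<le> C * heis_norm \<xi> powr (- 2 / (q - 1))" by (simp add: b_def)
  qed
qed

end
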